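(* Let $\mathfrak{D}=\mathfrak{D}(\{a^{(j)}_{m_1\dots m_k}\}_{j,m})$ be the classical discriminant polynomial of complete intersections of multidegree $(p_1,\dots,p_r)$ in $\mathbb{P}^{k-1}$, with multi-weighted degrees $deg_1,\dots,deg_r$ and $deg_{var}$ (defined in the context). Then: 1. for $j=1,\dots,r$, $$deg_j=\frac{\prod_{i=1}^rp_i}{p_j}\sum_{i=1}^r\frac{(p_j-1)^k-(p_i-1)^k}{p_j-p_i}\cdot\frac{1}{\prod_{l\neq i}(p_i-p_l)};$$ 2. $$deg_{var}=\frac1k\sum_{j=1}^rp_j\,deg_j=\Big(\prod_{j=1}^rp_j\Big)\sum_{j=1}^r\frac{(p_j-1)^{k-1}}{\prod_{l\neq j}(p_j-p_l)}.$$ Here for $i=j$ the expression $\frac{(p_j-1)^k-(p_i-1)^k}{p_j-p_i}$ is taken to be $k(p_j-1)^{k-1}$, and the poles that seemingly occur when some $p_i=p_j$ cancel after grouping terms (the right-hand sides are read as the polynomials in $p_1,\dots,p_r$ they equal).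
   Context: The base field $\mathbb{K}$ is algebraically closed of characteristic zero. Consider $r$-tuples ($r<k$) of homogeneous forms in $k$ variables $F_j(x)=\sum_{m_1+\dots+m_k=p_j}a^{(j)}_{m_1\dots m_k}x_1^{m_1}\cdots x_k^{m_k}$, $j=1,\dots,r$. The classical discriminant is the hypersurface $\Delta\subset\prod_{j=1}^r|\mathcal{O}_{\mathbb{P}^{k-1}}(p_j)|$ of those tuples for which $\bigcap_jF_j^{-1}(0)\subset\mathbb{P}^{k-1}$ is not a smooth complete intersection of the expected dimension $k-1-r$; $\mathfrak{D}$ is its defining polynomial in the coefficients $a^{(j)}_{m_1\dots m_k}$. The polynomial $\mathfrak{D}$ is multi-weighted-homogeneous: the numbers $deg_j$ and $deg_{var}$ are defined by the identities $$\mathfrak{D}\big(\{\lambda_ja^{(j)}_{m_1\dots m_k}\}\big)=\Big(\prod_{j=1}^r\lambda_j^{deg_j}\Big)\mathfrak{D}\big(\{a^{(j)}_{m_1\dots m_k}\}\big),\qquad \lambda_j\in\mathbb{K}^*,$$ $$\mathfrak{D}\big(\{\lambda_1^{m_1}\cdots\lambda_k^{m_k}a^{(j)}_{m_1\dots m_k}\}\big)=\Big(\prod_{i=1}^k\lambda_i\Big)^{deg_{var}}\mathfrak{D}\big(\{a^{(j)}_{m_1\dots m_k}\}\big),\qquad \lambda_i\in\mathbb{K}^*.$$ So $deg_j$ is the degree of $\mathfrak{D}$ in the coefficients of $F_j$, and $deg_{var}$ is the common weight with respect to scaling each variable $x_i$. *)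

theory Defs
  imports
    Complex_Main
    "HOL-Library.Poly_Mapping"
    "HOL-Computational_Algebra.Polynomial"
    "HOL-Computational_Algebra.Squarefree"
    "Jordan_Normal_Form.DL_Rank"
begin

section \<open>Multivariate polynomials\<close>

type_synonym ('v, 'a) mvpoly = "('v \<Rightarrow>\<^sub>0 nat) \<Rightarrow>\<^sub>0 'a"

definition mv_eval :: "('v \<Rightarrow> 'a) \<Rightarrow> ('v, 'a) mvpoly \<Rightarrow> 'a::comm_semiring_1" where
  "mv_eval x P =
    (\<Sum>t\<in>Poly_Mapping.keys P. Poly_Mapping.lookup P t *
      (\<Prod>v\<in>Poly_Mapping.keys t. x v ^ Poly_Mapping.lookup t v))"

definition mv_in :: "'v set \<Rightarrow> ('v, 'a::zero) mvpoly \<Rightarrow> bool" where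
  "mv_in V P \<longleftrightarrow> (\<forall>t\<in>Poly_Mapping.keys P. Poly_Mapping.keys t \<subseteq> V)"

section \<open>Forms in k variables\<close>

text \<open>Variables and forms are numbered from 0. A multi-index \<open>(m\<^sub>1, \<dots>, m\<^sub>k)\<close> is a list of
  length \<open>k\<close>.\<close>

definition multi_indices :: "nat \<Rightarrow> nat \<Rightarrow> nat list set" where
  "multi_indices k d = {m. length m = k \<and> sum_list m = d}"

definition form :: "nat \<Rightarrow> nat \<Rightarrow> (nat list \<Rightarrow> 'a) \<Rightarrow> 'a::field vec \<Rightarrow> 'a" where
  "form k d c x = (\<Sum>m\<in>multi_indices k d. c m * (\<Prod>i<k. (x $ i) ^ (m ! i)))"

text \<open>The formal derivative with respect to the variable \<open>i\<close>; the factor \<open>m ! i\<close> removes the terms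
  in which the subtraction is truncated.\<close>

definition form_pderiv ::
    "nat \<Rightarrow> nat \<Rightarrow> (nat list \<Rightarrow> 'a) \<Rightarrow> nat \<Rightarrow> 'a::field vec \<Rightarrow> 'a" where
  "form_pderiv k d c i x =
    (\<Sum>m\<in>multi_indices k d. c m * of_nat (m ! i) *
      (\<Prod>l<k. (x $ l) ^ (if l = i then m ! l - 1 else m ! l)))"

section \<open>Zariski topology and dimension in projective space\<close>

text \<open>A subset of \<open>\<bbbP>\<^bsup>k-1\<^esup>\<close> is represented by the set of all nonzero vectors representing its points.\<close>

definition proj_zeros :: "nat \<Rightarrow> (nat \<times> (nat list \<Rightarrow> 'a)) set \<Rightarrow> 'a::field vec set" where
  "proj_zeros k S = {x \<in> carrier_vec k. x \<noteq> 0\<^sub>v k \<and> (\<forall>(d, c)\<in>S. form k d c x = 0)}"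

definition proj_closed :: "nat \<Rightarrow> 'a::field vec set \<Rightarrow> bool" where
  "proj_closed k Z \<longleftrightarrow> (\<exists>S. Z = proj_zeros k S)"

definition proj_irreducible :: "nat \<Rightarrow> 'a::field vec set \<Rightarrow> bool" where
  "proj_irreducible k Z \<longleftrightarrow> proj_closed k Z \<and> Z \<noteq> {} \<and>
    (\<forall>A B. proj_closed k A \<and> proj_closed k B \<and> Z \<subseteq> A \<union> B \<longrightarrow> Z \<subseteq> A \<or> Z \<subseteq> B)"

definition irreducible_chain :: "nat \<Rightarrow> 'a::field vec set \<Rightarrow> nat \<Rightarrow> bool" where
  "irreducible_chain k X n \<longleftrightarrow>
    (\<exists>Z. (\<forall>i\<le>n. proj_irreducible k (Z i) \<and> Z i \<subseteq> X) \<and> (\<forall>i<n. Z i \<subset> Z (Suc i)))"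

text \<open>Krull dimension; the empty set has no dimension in this sense.\<close>

definition has_proj_dim :: "nat \<Rightarrow> 'a::field vec set \<Rightarrow> nat \<Rightarrow> bool" where
  "has_proj_dim k X d \<longleftrightarrow> irreducible_chain k X d \<and> \<not> irreducible_chain k X (Suc d)"

section \<open>The classical discriminant\<close>

text \<open>A tuple of forms of degrees \<open>p 0, \<dots>, p (r - 1)\<close> is given by its coefficients \<open>a (j, m)\<close>;
  only the pairs in \<open>coeff_vars k r p\<close> matter.\<close>

definition coeff_vars :: "nat \<Rightarrow> nat \<Rightarrow> (nat \<Rightarrow> nat) \<Rightarrow> (nat \<times> nat list) set" where
  "coeff_vars k r p = {(j, m). j < r \<and> m \<in> multi_indices k (p j)}"

definition common_zeros ::
    "nat \<Rightarrow> nat \<Rightarrow> (nat \<Rightarrow> nat) \<Rightarrow> (nat \<times> nat list \<Rightarrow> 'a) \<Rightarrow> 'a::field vec set" where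
  "common_zeros k r p a = proj_zeros k {(p j, \<lambda>m. a (j, m)) | j. j < r}"

definition jacobian ::
    "nat \<Rightarrow> nat \<Rightarrow> (nat \<Rightarrow> nat) \<Rightarrow> (nat \<times> nat list \<Rightarrow> 'a) \<Rightarrow> 'a::field vec \<Rightarrow> 'a mat" where
  "jacobian k r p a x = mat r k (\<lambda>(j, i). form_pderiv k (p j) (\<lambda>m. a (j, m)) i x)"

text \<open>Smoothness is that of the subscheme of \<open>\<bbbP>\<^bsup>k-1\<^esup>\<close> cut out by the given equations (so
  non-reduced intersections are excluded): at each point the Jacobian matrix has rank equal to the
  codimension \<open>r\<close>.\<close>

definition smooth_complete_intersection ::
    "nat \<Rightarrow> nat \<Rightarrow> (nat \<Rightarrow> nat) \<Rightarrow> (nat \<times> nat list \<Rightarrow> 'a::field) \<Rightarrow> bool" where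
  "smooth_complete_intersection k r p a \<longleftrightarrow>
    has_proj_dim k (common_zeros k r p a) (k - 1 - r) \<and>
    (\<forall>x\<in>common_zeros k r p a. vec_space.rank r (jacobian k r p a x) = r)"

text \<open>Coefficient tuples representing a point of the product of the projective spaces
  \<open>|\<O>(p\<^sub>j)|\<close>, i.e. no form is zero.\<close>

definition nonzero_forms ::
    "nat \<Rightarrow> nat \<Rightarrow> (nat \<Rightarrow> nat) \<Rightarrow> (nat \<times> nat list \<Rightarrow> 'a::zero) \<Rightarrow> bool" where
  "nonzero_forms k r p a \<longleftrightarrow> (\<forall>j<r. \<exists>m\<in>multi_indices k (p j). a (j, m) \<noteq> 0)"

definition discriminant_locus ::
    "nat \<Rightarrow> nat \<Rightarrow> (nat \<Rightarrow> nat) \<Rightarrow> (nat \<times> nat list \<Rightarrow> 'a::field) set" where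
  "discriminant_locus k r p =
    {a. nonzero_forms k r p a \<and> \<not> smooth_complete_intersection k r p a}"

text \<open>The defining polynomial is the reduced equation of the discriminant, which determines it up to
  a nonzero constant. Note that \<open>squarefree\<close> implies \<open>D \<noteq> 0\<close>.\<close>

definition is_discriminant ::
    "nat \<Rightarrow> nat \<Rightarrow> (nat \<Rightarrow> nat) \<Rightarrow> (nat \<times> nat list, 'a::field) mvpoly \<Rightarrow> bool" where
  "is_discriminant k r p D \<longleftrightarrow>
    mv_in (coeff_vars k r p) D \<and> squarefree D \<and>
    (\<forall>a. nonzero_forms k r p a \<longrightarrow> (mv_eval a D = 0 \<longleftrightarrow> a \<in> discriminant_locus k r p))"

definition has_form_degrees ::
    "nat \<Rightarrow> (nat \<times> nat list, 'a::field) mvpoly \<Rightarrow> (nat \<Rightarrow> nat) \<Rightarrow> bool" where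
  "has_form_degrees r D deg \<longleftrightarrow>
    (\<forall>\<mu> a. (\<forall>j<r. \<mu> j \<noteq> 0) \<longrightarrow>
      mv_eval (\<lambda>(j, m). \<mu> j * a (j, m)) D = (\<Prod>j<r. \<mu> j ^ deg j) * mv_eval a D)"

definition has_variable_degree ::
    "nat \<Rightarrow> (nat \<times> nat list, 'a::field) mvpoly \<Rightarrow> nat \<Rightarrow> bool" where
  "has_variable_degree k D degvar \<longleftrightarrow>
    (\<forall>\<mu> a. (\<forall>i<k. \<mu> i \<noteq> 0) \<longrightarrow>
      mv_eval (\<lambda>(j, m). (\<Prod>i<k. \<mu> i ^ (m ! i)) * a (j, m)) D
        = (\<Prod>i<k. \<mu> i) ^ degvar * mv_eval a D)"

section \<open>The degree formulas\<close>

definition form_degree_formula :: "nat \<Rightarrow> nat \<Rightarrow> nat \<Rightarrow> (nat \<Rightarrow> rat) \<Rightarrow> rat" where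
  "form_degree_formula k r j q =
    (\<Prod>i<r. q i) / q j *
    (\<Sum>i<r.
      (if i = j then of_nat k * (q j - 1) ^ (k - 1)
       else ((q j - 1) ^ k - (q i - 1) ^ k) / (q j - q i))
      * (1 / (\<Prod>l\<in>{..<r} - {i}. q i - q l)))"

definition variable_degree_formula :: "nat \<Rightarrow> nat \<Rightarrow> (nat \<Rightarrow> rat) \<Rightarrow> rat" where
  "variable_degree_formula k r q =
    (\<Prod>j<r. q j) * (\<Sum>j<r. (q j - 1) ^ (k - 1) / (\<Prod>l\<in>{..<r} - {j}. q j - q l))"

text \<open>\<open>polynomial_value r R q v\<close>: the rational expression \<open>R\<close> in \<open>r\<close> variables is a polynomial
  wherever none of its denominators vanishes, and the value of this polynomial at \<open>q\<close> is \<open>v\<close>. The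
  polynomial is unique because it is prescribed on a Zariski-dense subset of \<open>\<rat>\<^sup>r\<close>.\<close>

definition polynomial_value ::
    "nat \<Rightarrow> ((nat \<Rightarrow> rat) \<Rightarrow> rat) \<Rightarrow> (nat \<Rightarrow> rat) \<Rightarrow> rat \<Rightarrow> bool" where
  "polynomial_value r R q v \<longleftrightarrow>
    (\<exists>E. mv_in {..<r} E \<and>
      (\<forall>s. inj_on s {..<r} \<and> (\<forall>j<r. s j \<noteq> 0) \<longrightarrow> mv_eval s E = R s) \<and>
      mv_eval q E = v)"

end

theory Submission
  imports Defs "HOL-Library.Product_Lexorder" "HOL-Library.List_Lexorder" "HOL-Library.FuncSet"
    "HOL-Library.Function_Algebras" "HOL-Computational_Algebra.Polynomial_Factorial"
    "HOL-Computational_Algebra.Formal_Power_Series" "Jordan_Normal_Form.Char_Poly"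
begin

text \<open>Let \<open>N\<^sub>j\<close> and \<open>V\<close> be the values of the two formulas. The degrees satisfy
 \<open>\<Sum> p\<^sub>j deg\<^sub>j = k deg\<^sub>v\<^sub>a\<^sub>r\<close> by homogeneity, and \<open>\<Sum> p\<^sub>j N\<^sub>j = k V\<close>, so it is enough to show
 \<open>deg\<^sub>j \<le> N\<^sub>j\<close> and \<open>deg\<^sub>v\<^sub>a\<^sub>r \<ge> V\<close>.

 A singular point with its multipliers is a functional that kills the columns of the Jacobian matrix
 and the multiples of the equations. If \<open>F\<^sub>j\<close> moves in a generic pencil, adding both members of the
 pencil to these vectors leaves codimension at most \<open>N\<^sub>j\<close> in high degrees. So some minor has degree
 at most \<open>N\<^sub>j\<close> along the pencil, and it is divisible by the reduced equation of the discriminant.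

 Adding one variable at a time, one constructs forms such that \<open>F\<^sub>1\<close> has \<open>V / p\<^sub>1\<close> nondegenerate
 critical points with different values on the affine part of \<open>F\<^sub>2 = \<dots> = F\<^sub>r = 0\<close>. Each of them is a
 root of the discriminant on the line \<open>F\<^sub>1 + t x\<^sub>1 ^ p\<^sub>1\<close>, where its degree is at most \<open>deg\<^sub>v\<^sub>a\<^sub>r / p\<^sub>1\<close>.\<close>

text \<open>The discriminant is defined through smoothness and Krull dimension, whereas a minor only
  sees points where the Jacobian matrix drops rank. So the tuples whose common zeros may have the
  wrong dimension must be shown to contain no component of the discriminant. They miss a whole plane
  of binomial tuples outside the origin, which no hypersurface cone can do. This needs the exact
  dimension of a projective set with a system of parameters; it is obtained by counting monomials. A
  codimension bound is an open condition, so one special tuple per step of an induction on the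
  number of variables proves it for almost all tuples. For the lower bound there is no analysis over
  an arbitrary field: nondegenerate zeros are followed to a nonzero parameter by approximate
  polynomial curves together with the Nullstellensatz. Both counts satisfy the recursion of the
  complete symmetric polynomials in the p_i - 1. This is the origin of the values N_j and V, and
  these polynomials also give the formulas a meaning when some degrees coincide.\<close>

abbreviation "keys \<equiv> Poly_Mapping.keys"
abbreviation "multi \<equiv> multi_indices"
lemmas mi_def = multi_indices_def
type_synonym 'a fn = "(nat \<Rightarrow> 'a) \<Rightarrow> 'a"
type_synonym cvar = "nat \<times> nat list"
abbreviation (input) "frac_at T c s \<equiv> case_option (inverse (poly T s)) (\<lambda>i. poly (c i) s)"
abbreviation "lookup \<equiv> Poly_Mapping.lookup"

section \<open>Polynomial functions\<close>

text \<open>Substitution combined with a change of coefficients, so that evaluation, restriction to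
  a line and translation by a multiple of a vector are instances of one ring homomorphism.\<close>

definition mv_subst::"('a => 'b) => ('v => 'b) => ('v,'a::zero) mvpoly => 'b::comm_semiring_1" where "mv_subst h x P = (SUM t:keys P. h (lookup P t) *
   (PROD v:keys t. x v^lookup t v))"

lemma mv_eval_eq_subst: "mv_eval x P = mv_subst (%c. c) x P" by (simp add: mv_eval_def mv_subst_def)

definition mmon::"('v => 'b) => ('v \<Rightarrow>\<^sub>0 nat) => 'b::comm_semiring_1" where "mmon x t = (PROD v:keys t. x v^lookup t v)"

lemma mmon_superset:
 assumes "finite A" "keys t <= A"
 shows "mmon x t = (PROD v:A. x v^lookup t v)" unfolding mmon_def using assms by (intro prod.mono_neutral_left) (auto simp: in_keys_iff)

lemma mmon_add: "mmon x (s+t) = mmon x s*mmon x t"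
proof -
 let ?A = "keys s Un keys t"
 have "mmon x (s+t) = (PROD v:?A. x v^lookup (s+t) v)" using keys_add[of s t] by (intro mmon_superset) auto
 also have "... = (PROD v:?A. x v^lookup s v)*(PROD v:?A. x v^lookup t v)" by (simp add: lookup_add power_add prod.distrib)
 also have "... = mmon x s*mmon x t" by (simp add: mmon_superset[of ?A])
 finally show ?thesis .
qed

lemma mmon_0 [simp]: "mmon x 0 = 1" by (simp add: mmon_def)
lemma mv_subst_monom: "mv_subst h x P = (SUM t:keys P. h (lookup P t)*mmon x t)" by (simp add: mv_subst_def mmon_def)

lemma mv_subst_superset:
 assumes "finite A" "keys P <= A" "h 0 = 0"
 shows "mv_subst h x P = (SUM t:A. h (lookup P t)*mmon x t)" unfolding mv_subst_monom using assms by (intro sum.mono_neutral_left) (auto simp: in_keys_iff)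

context comm_ring_hom
begin

lemma mv_subst_0 [simp]: "mv_subst hom x 0 = 0" by (simp add: mv_subst_def)

lemma mv_subst_add: "mv_subst hom x (P+Q) = mv_subst hom x P + mv_subst hom x Q"
proof -
 let ?A = "keys P Un keys Q"
 have "mv_subst hom x (P+Q) = (SUM t:?A. hom (lookup (P+Q) t)*mmon x t)" using keys_add[of P Q] by (intro mv_subst_superset) auto
 also have "... = (SUM t:?A. hom (lookup P t)*mmon x t)+(SUM t:?A. hom (lookup Q t)*mmon x t)" by (simp add: lookup_add hom_distribs algebra_simps sum.distrib)
 finally show ?thesis by (simp add: mv_subst_superset[of ?A])
qed

lemma mv_subst_single: "mv_subst hom x (Poly_Mapping.single t c) = hom c*mmon x t" by (cases "c = 0") (auto simp: mv_subst_monom)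
lemma mv_subst_sum: "mv_subst hom x (sum f A) = (SUM i:A. mv_subst hom x (f i))" by (induction A rule: infinite_finite_induct) (auto simp: mv_subst_add)

lemma poly_mapping_sum_singles: "P = (SUM t:keys P. Poly_Mapping.single t (lookup P t))"
 by (rule poly_mapping_eqI) (auto simp: lookup_sum lookup_single when_def in_keys_iff)

lemma mv_subst_mult: "mv_subst hom x (P*Q) = mv_subst hom x P*mv_subst hom x Q"
proof -
 have "P*Q = (SUM s:keys P. SUM t:keys Q. Poly_Mapping.single (s+t) (lookup P s*lookup Q t))"
  by (subst poly_mapping_sum_singles[of P], subst poly_mapping_sum_singles[of Q]) (simp add: sum_product mult_single)
 hence "mv_subst hom x (P*Q) = (SUM s:keys P. SUM t:keys Q. (hom (lookup P s)*mmon x s)*(hom (lookup Q t)*mmon x t))"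
  by (simp add: mv_subst_sum mv_subst_single mmon_add hom_distribs algebra_simps)
 thus ?thesis by (simp add: mv_subst_monom sum_product)
qed

lemma mv_subst_1 [simp]: "mv_subst hom x 1 = 1" using mv_subst_single[of x 0 1] by simp
lemma mv_subst_hom: "comm_ring_hom (mv_subst hom x)" by unfold_locales (auto simp: mv_subst_add mv_subst_mult)
lemma hom_mmon: "hom (mmon x t) = mmon (%v. hom (x v)) t" by (simp add: mmon_def hom_distribs)
lemma hom_mv_subst: "hom (mv_subst h x P) = mv_subst (%c. hom (h c)) (%v. hom (x v)) P" by (simp add: mv_subst_monom hom_distribs hom_mmon)

end

lemma comm_ring_hom_ident: "comm_ring_hom (%c::'a::comm_ring_1. c)" by unfold_locales auto

lemma comm_ring_hom_mv_eval: "comm_ring_hom (mv_eval x::_ => 'a::comm_ring_1)"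
 unfolding mv_eval_eq_subst[abs_def] by (rule comm_ring_hom.mv_subst_hom[OF comm_ring_hom_ident])

lemma mv_eval_simps [simp]:
 fixes x::"'v => 'a::comm_ring_1"
 shows "mv_eval x 0 = 0" "mv_eval x 1 = 1" "mv_eval x (P+Q) = mv_eval x P + mv_eval x Q" "mv_eval x (P*Q) = mv_eval x P*mv_eval x Q"
  "mv_eval x (P-Q) = mv_eval x P - mv_eval x Q" "mv_eval x (- P) = - mv_eval x P" "mv_eval x (P^n) = mv_eval x P^n"
  "mv_eval x (sum f A) = (SUM i:A. mv_eval x (f i))" "mv_eval x (prod f A) = (PROD i:A. mv_eval x (f i))"
proof -
 interpret comm_ring_hom "mv_eval x" by (rule comm_ring_hom_mv_eval)
 show "mv_eval x 0 = 0" "mv_eval x 1 = 1" "mv_eval x (P+Q) = mv_eval x P + mv_eval x Q" "mv_eval x (P*Q) = mv_eval x P*mv_eval x Q"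
  "mv_eval x (P-Q) = mv_eval x P - mv_eval x Q" "mv_eval x (- P) = - mv_eval x P" "mv_eval x (P^n) = mv_eval x P^n"
  "mv_eval x (sum f A) = (SUM i:A. mv_eval x (f i))" "mv_eval x (prod f A) = (PROD i:A. mv_eval x (f i))" by (simp_all add: hom_distribs)
qed

definition mv_var::"'v => ('v,'a::comm_ring_1) mvpoly" where "mv_var v = Poly_Mapping.single (Poly_Mapping.single v 1) 1"

definition mv_const::"'a => ('v,'a::comm_ring_1) mvpoly" where "mv_const c = Poly_Mapping.single 0 c"

lemma mv_eval_var [simp]: "mv_eval x (mv_var v) = (x v::'a::comm_ring_1)" by (simp add: mv_eval_def mv_var_def)
lemma mv_eval_const [simp]: "mv_eval x (mv_const c) = (c::'a::comm_ring_1)" by (cases "c = 0") (simp_all add: mv_eval_def mv_const_def)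

lemma comm_ring_hom_mv_const: "comm_ring_hom (mv_const::_ => ('v,'a::comm_ring_1) mvpoly)"
proof
 fix x y::'a
 show "(mv_const (x+y)::('v,'a) mvpoly) = mv_const x + mv_const y" unfolding mv_const_def by (rule single_add)
 show "(mv_const (x*y)::('v,'a) mvpoly) = mv_const x*mv_const y" unfolding mv_const_def mult_single by simp
qed (simp_all add: mv_const_def)

lemma (in comm_ring_hom) mv_subst_const [simp]: "mv_subst hom x (mv_const c) = hom c" by (simp add: mv_const_def mv_subst_single)

lemma mv_in_add: "mv_in V P ==> mv_in V Q ==> mv_in V (P+Q)"
 for P Q::"('v,'a::comm_ring_1) mvpoly" using keys_add[of P Q] by (auto simp: mv_in_def)

lemma mv_in_mult: "mv_in V P ==> mv_in V Q ==> mv_in V (P*Q)"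
 for P Q::"('v,'a::comm_ring_1) mvpoly" unfolding mv_in_def
proof
 fix t assume PQ: "ALL t:keys P. keys t <= V" "ALL t:keys Q. keys t <= V"
  and "t : keys (P*Q)"
 then obtain a b where "t = a + b" "a : keys P" "b : keys Q" using keys_mult[of P Q] by blast
 with PQ show "keys t <= V" using keys_add[of a b] by (meson Un_least order_trans)
qed

lemma mv_in_var: "v : V ==> mv_in V (mv_var v)" by (auto simp: mv_in_def mv_var_def)
lemma mv_in_const: "mv_in V (mv_const v)" by (cases "v = 0") (auto simp: mv_in_def mv_const_def)

text \<open>Over an infinite domain a polynomial is determined by its function. Most of the proof
  therefore works with functions and these closure rules, and passes to \<open>mvpoly\<close> only
  where divisibility matters. The set \<open>V\<close> may be infinite.\<close>

inductive pfun::"'v set => (('v => 'a::comm_ring_1) => 'a) => bool" for V where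
 const: "pfun V (%_. c)"
| var: "v : V ==> pfun V (%a. a v)"
| add: "pfun V f ==> pfun V g ==> pfun V (%a. f a + g a)"
| mult: "pfun V f ==> pfun V g ==> pfun V (%a. f a*g a)"

lemma pfun_uminus: "pfun V f ==> pfun V (%a. - f a)" using pfun.mult[OF pfun.const[of V "-1"], of f] by simp
lemma pfun_diff: "pfun V f ==> pfun V g ==> pfun V (%a. f a - g a)" using pfun.add[OF _ pfun_uminus, of V f g] by simp
lemma pfun_sum: "(!!i. i : A ==> pfun V (f i)) ==> pfun V (%a. SUM i:A. f i a)" by (induction A rule: infinite_finite_induct) (auto intro: pfun.intros)
lemma pfun_prod: "(!!i. i : A ==> pfun V (f i)) ==> pfun V (%a. PROD i:A. f i a)" by (induction A rule: infinite_finite_induct) (auto intro: pfun.intros)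
lemma pfun_power: "pfun V f ==> pfun V (%a. f a^n)" by (induction n) (auto intro: pfun.intros)

lemmas pfunI = pfun.intros pfun_uminus pfun_diff pfun_sum pfun_prod pfun_power

lemma pfun_mono: "pfun V f ==> V <= W ==> pfun W f" by (induction rule: pfun.induct) (auto intro: pfun.intros)

lemma pfun_compose:
 assumes "pfun V f" "!!v. v : V ==> pfun W (g v)"
 shows "pfun W (%a. f (%v. g v a))" using assms by (induction rule: pfun.induct) (auto intro: pfun.intros)

lemma pfun_cong_on:
 assumes "pfun V f" "!!v. v : V ==> a v = b v"
 shows "f a = f b" using assms by (induction rule: pfun.induct) auto

lemma pfun_imp_mvpoly: "pfun V f ==> EX P. mv_in V P & (ALL a. mv_eval a P = f a)"
proof (induction rule: pfun.induct)
 case (const c)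
 show ?case by (rule exI[of _ "mv_const c"]) (auto simp: mv_in_const)
next
 case (var v)
 thus ?case by (intro exI[of _ "mv_var v"]) (auto simp: mv_in_var)
next
 case (add f g)
 then obtain P Q where "mv_in V P & (ALL a. mv_eval a P = f a)" "mv_in V Q & (ALL a. mv_eval a Q = g a)" by blast
 thus ?case by (intro exI[of _ "P+Q"]) (auto simp: mv_in_add)
next
 case (mult f g)
 then obtain P Q where "mv_in V P & (ALL a. mv_eval a P = f a)" "mv_in V Q & (ALL a. mv_eval a Q = g a)" by blast
 thus ?case by (intro exI[of _ "P*Q"]) (auto simp: mv_in_mult)
qed

lemma pfun_mv_eval: "mv_in V P ==> pfun V (%a. mv_eval a P)" unfolding mv_eval_def mv_in_def by (intro pfunI) blast
lemma pfun_mv_UNIV: "pfun UNIV (%a. mv_eval a P)" by (rule pfun_mv_eval) (simp add: mv_in_def)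

lemma pfun_det:
 assumes "!!i j. i < n ==> j < n ==> pfun V (%a. f a i j)"
 shows "pfun V (%a. det (mat n n (%(i,j). f a i j)))"
proof -
 have "det (mat n n (%(i,j). f a i j)) = (SUM q | q permutes {0..<n}. signof q*(PROD i = 0..<n. f a i (q i)))" for a
  unfolding det_def by (auto intro!: sum.cong prod.cong arg_cong[of _ _ "(*) _"])
 thus ?thesis using permutes_in_image[of _ "{0..<n}"] by (auto intro!: pfunI assms)
qed

lemma pfun_curve:
 assumes "pfun V f"
 shows "EX P. ALL s. f (%v. poly (c v) s) = poly P s" using assms
proof (induction rule: pfun.induct)
 case (const b)
 show ?case by (rule exI[of _ "[:b:]"]) simp
next
 case (var v)
 show ?case by (rule exI[of _ "c v"]) simp
next
 case (add f g)
 then obtain P Q where "ALL s. f (%v. poly (c v) s) = poly P s" "ALL s. g (%v. poly (c v) s) = poly Q s" by blast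
 thus ?case by (intro exI[of _ "P+Q"]) simp
next
 case (mult f g)
 then obtain P Q where "ALL s. f (%v. poly (c v) s) = poly P s" "ALL s. g (%v. poly (c v) s) = poly Q s" by blast
 thus ?case by (intro exI[of _ "P*Q"]) simp
qed

lemma pfun_line:
 assumes "pfun V f"
 shows "EX P. ALL s. f (%v. a v + s*b v) = poly P s" using pfun_curve[OF assms, of "%v. [:a v,b v:]"] by (simp add: algebra_simps)

lemma poly_eq_0_infinite:
 fixes P::"'a::idom poly"
 assumes "infinite S" "!!s. s : S ==> poly P s = 0"
 shows "P = 0" using poly_roots_finite[of P] assms by (metis (mono_tags, lifting) finite_subset mem_Collect_eq subsetI)

text \<open>On the line joining a point where \<open>f\<close> is nonzero to a point where
  \<open>g\<close> is nonzero, both functions become nonzero univariate polynomials, and so does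
  their product.\<close>

lemma pfun_mult_eq_0:
 fixes f g::"('v => 'a::{idom,ring_char_0}) => 'a"
 assumes "pfun V f" "pfun W g" "!!a. f a*g a = 0"
 shows "(ALL a. f a = 0) | (ALL a. g a = 0)"
proof (rule ccontr)
 assume "~ ?thesis"
 then obtain a b where ab: "f a ~= 0" "g b ~= 0" by blast
 obtain P where P: "ALL s. f (%v. a v + s*(b v - a v)) = poly P s" using pfun_line[OF assms(1), of a "%v. b v - a v"] by blast
 obtain Q where Q: "ALL s. g (%v. a v + s*(b v - a v)) = poly Q s" using pfun_line[OF assms(2), of a "%v. b v - a v"] by blast
 have "poly (P*Q) s = 0" for s using P Q assms(3) by (metis poly_mult)
 hence "P*Q = 0" by (metis poly_eq_0_infinite[OF infinite_UNIV_char_0] )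
 hence "P = 0 | Q = 0" by simp
 moreover have "poly P 0 ~= 0" using P[rule_format, of 0] ab by simp
 moreover have "poly Q 1 ~= 0" using Q[rule_format, of 1] ab by simp
 ultimately show False by auto
qed

text \<open>Induction on the variables: with the others fixed, the sum is a polynomial in
  \<open>a v\<close> with infinitely many zeros. Its coefficient of degree \<open>e\<close> is a sum
  of the same kind over the monomials with exponent \<open>e\<close> at \<open>v\<close>.\<close>

lemma mv_sum_zero_imp_coeffs_zero:
 fixes c::"('v \<Rightarrow>\<^sub>0 nat) => 'a::{idom,ring_char_0}"
 assumes "finite V" "finite T" "!!t. t : T ==> keys t <= V"
  and "!!a. (SUM t:T. c t*mmon a t) = 0" "t : T"
 shows "c t = 0" using assms
proof (induction V arbitrary: T c t rule: finite_induct)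
 case empty
 hence "T = {0}" by auto
 with empty show ?case by simp
next
 case (insert v V)
 define del where "del = (%t. Poly_Mapping.update v 0 t::'v \<Rightarrow>\<^sub>0 nat)"
 have lookup_del: "lookup (del t) w = (if w = v then 0 else lookup t w)" for t w by (simp add: del_def lookup_update)
 have keys_del: "keys (del t) = keys t - {v}" for t by (auto simp: in_keys_iff lookup_del split: if_splits)
 have mon: "mmon a t = a v^lookup t v*mmon a (del t)" for a::"'v => 'a" and t
 proof -
  have "mmon a t = (PROD w:insert v (keys t). a w^lookup t w)" by (intro mmon_superset) auto
  also have "... = a v^lookup t v*(PROD w:keys t - {v}. a w^lookup t w)" by (subst prod.insert_remove) auto
  also have "(PROD w:keys t - {v}. a w^lookup t w) = mmon a (del t)" unfolding mmon_def keys_del by (intro prod.cong) (auto simp: lookup_del)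
  finally show ?thesis .
 qed
 define e where "e = lookup t v"
 define Te where "Te = {t : T. lookup t v = e}"
 have inj: "inj_on del Te"
 proof (rule inj_onI, rule poly_mapping_eqI)
  fix s t w assume "s : Te" "t : Te" "del s = del t"
  thus "lookup s w = lookup t w" using lookup_del[of s w] lookup_del[of t w] by (cases "w = v") (auto simp: Te_def)
 qed
 have "(SUM t:Te. c t*mmon a (del t)) = 0" for a
 proof -
  define P where "P = (SUM t:T. monom (c t*mmon a (del t)) (lookup t v))"
  have "poly P z = 0" for z
  proof -
   have "mmon (a(v := z)) (del t) = mmon a (del t)" for t unfolding mmon_def keys_del by (intro prod.cong) auto
   hence "poly P z = (SUM t:T. c t*mmon (a(v := z)) t)" unfolding P_def by (subst (2) mon) (simp add: poly_sum poly_monom algebra_simps)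
   with insert show ?thesis by simp
  qed
  hence "P = 0" by (metis poly_eq_0_infinite[OF infinite_UNIV_char_0])
  hence "coeff P e = 0" by simp
  thus ?thesis unfolding P_def Te_def using insert.prems(1) by (simp add: coeff_sum sum.inter_filter if_distrib cong: if_cong)
 qed
 hence "(SUM u:del ` Te. c (inv_into Te del u)*mmon a u) = 0" for a by (subst sum.reindex[OF inj]) (simp add: inv_into_f_f[OF inj])
 moreover have "keys u <= V" if "u : del ` Te" for u using that insert.prems(2) keys_del by (auto simp: Te_def)
 moreover have "finite (del ` Te)" using insert.prems(1) by (simp add: Te_def)
 moreover have "del t : del ` Te" using insert.prems by (auto simp: Te_def e_def)
 ultimately have "c (inv_into Te del (del t)) = 0" using insert.IH[of "del ` Te" "%u. c (inv_into Te del u)" "del t"] by blast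
 moreover have "t : Te" using insert.prems by (simp add: Te_def e_def)
 ultimately show ?case by (simp add: inv_into_f_f[OF inj])
qed

lemma mv_eval_zero_imp_zero:
 fixes P::"('v,'a::{idom,ring_char_0}) mvpoly"
 assumes "!!a. mv_eval a P = 0"
 shows "P = 0"
proof (rule poly_mapping_eqI)
 fix t
 show "lookup P t = lookup 0 t"
 proof (cases "t : keys P")
  case True
  have "lookup P t = 0" by (rule mv_sum_zero_imp_coeffs_zero[of "\<Union>t\<in>keys P. keys t" "keys P" _ t])
    (use assms True in "auto simp: mv_eval_def mmon_def")
  thus ?thesis by simp
 qed (simp add: in_keys_iff)
qed

lemma mv_eval_eqI:
 fixes P Q::"('v,'a::{idom,ring_char_0}) mvpoly"
 assumes "!!a. mv_eval a P = mv_eval a Q"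
 shows "P = Q" using mv_eval_zero_imp_zero[of "P-Q"] assms by simp

section \<open>Polynomials vanishing on a squarefree hypersurface\<close>

text \<open>An element of least degree in the ideal generated by \<open>p\<close> and
  \<open>f\<close> divides both, by division with remainder.\<close>

lemma poly_bezout:
 fixes p f::"'f::field poly"
 assumes "p ~= 0"
 obtains g al be where "g dvd p" "g dvd f" "g = al*p + be*f" "lead_coeff g = 1"
proof -
 define I where "I = {g. EX al be. g = al*p + be*f}"
 have lin: "a*x + b*y : I" if "x : I" "y : I" for a b x y
 proof -
  from that obtain al be al' be' where "x = al*p + be*f" "y = al'*p + be'*f" by (auto simp: I_def)
  hence "a*x + b*y = (a*al + b*al')*p + (a*be + b*be')*f" by (simp add: algebra_simps)
  thus ?thesis unfolding I_def by blast
 qed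
 have pI: "p : I" and fI: "f : I" unfolding I_def using mult_1[of p] mult_1[of f] mult_zero_left[of p] mult_zero_left[of f] add_0 add.right_neutral
  by (metis (mono_tags, lifting) mem_Collect_eq)+
 define g where "g = arg_min degree (%g. g : I & g ~= 0)"
 have g: "g : I" "g ~= 0" and gmin: "!!x. x : I ==> x ~= 0 ==> degree g <= degree x"
  unfolding g_def using arg_min_nat_lemma[of "%g. g : I & g ~= 0" p degree] pI assms by auto
 have dvd: "g dvd x" if "x : I" for x
 proof (rule ccontr)
  assume "~ g dvd x"
  hence "x mod g ~= 0" by (simp add: dvd_eq_mod_eq_0)
  moreover have "x mod g : I" using lin[OF that g(1), of 1 "- (x div g)"] by (simp add: minus_div_mult_eq_mod[symmetric])
  ultimately have "degree g <= degree (x mod g)" by (intro gmin)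
  with `x mod g ~= 0` degree_mod_less[of g x] g show False by auto
 qed
 define c where "c = inverse (lead_coeff g)"
 have c: "c ~= 0" using g by (simp add: c_def)
 obtain al be where ab: "g = al*p + be*f" using g by (auto simp: I_def)
 show thesis
 proof (rule that[of "smult c g" "smult c al" "smult c be"])
  show "smult c g dvd p" "smult c g dvd f" using dvd pI fI c by (auto simp: smult_dvd_iff)
  show "smult c g = smult c al*p + smult c be*f" by (subst ab) (simp add: smult_add_right)
  show "lead_coeff (smult c g) = 1" using g by (simp add: c_def)
 qed
qed

lemma monic_dvd_imp_degree_0_or_eq:
 fixes g p::"'f::field poly"
 assumes "g dvd p" "lead_coeff g = 1" "lead_coeff p = 1" "degree g = degree p"
 shows "g = p"
proof -
 obtain h where h: "p = g*h" using assms by blast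
 with assms have "g ~= 0" "h ~= 0" by auto
 with h have "degree p = degree g + degree h" using degree_mult_eq[of g h] by simp
 with assms(4) have "degree h = 0" by simp
 then obtain c where c: "h = [:c:]" by (rule degree_eq_zeroE)
 from h have "lead_coeff p = lead_coeff g*lead_coeff h" by (simp only: lead_coeff_mult)
 with assms c have "c = 1" by simp
 with c h show ?thesis by simp
qed

text \<open>A nonconstant monic divisor of least degree is irreducible. The last conclusion is the
  form in which this is used: the monic gcd of \<open>pp\<close> and \<open>f\<close> is 1 or, by
  minimality, \<open>pp\<close> itself.\<close>

lemma exists_minimal_monic_divisor:
 fixes h::"'f::field poly"
 assumes "degree h > 0"
 obtains pp where "pp dvd h" "lead_coeff pp = 1" "degree pp > 0" "!!f. pp dvd f | (EX al be. al*pp + be*f = 1)"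
proof -
 let ?Q = "%pp. pp dvd h & lead_coeff pp = 1 & degree pp > 0"
 define h' where "h' = smult (inverse (lead_coeff h)) h"
 have "?Q h'" using assms by (auto simp: h'_def smult_dvd_iff)
 define pp where "pp = arg_min degree ?Q"
 have pp: "?Q pp" and min: "!!x. ?Q x ==> degree pp <= degree x" unfolding pp_def using arg_min_nat_lemma[of ?Q h' degree] `?Q h'` by auto
 have "pp dvd f | (EX al be. al*pp + be*f = 1)" for f
 proof -
  have "pp ~= 0" using pp by auto
  then obtain g al be where g: "g dvd pp" "g dvd f" "g = al*pp + be*f" "lead_coeff g = 1" by (rule poly_bezout[of pp f])
  show ?thesis
  proof (cases "degree g = 0")
   case True
   then obtain c where "g = [:c:]" by (rule degree_eq_zeroE)
   with g(4) have "g = 1" by (simp add: one_pCons)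
   with g show ?thesis by metis
  next
   case False
   hence "degree pp <= degree g" using min[of g] g pp by (meson dvd_trans neq0_conv)
   moreover have "degree g <= degree pp" using g `pp ~= 0` by (intro dvd_imp_degree_le)
   ultimately have "g = pp" using g pp by (intro monic_dvd_imp_degree_0_or_eq) auto
   with g(2) show ?thesis by simp
  qed
 qed
 with pp that show thesis by blast
qed

section \<open>Polynomials over a fraction field and Gauss lemmas\<close>

interpretation to_fract_hom: inj_idom_hom "to_fract::'a::idom => _" by unfold_locales auto

abbreviation frp::"'a::idom poly => 'a fract poly" where "frp == map_poly to_fract"

interpretation fp: map_poly_inj_idom_hom "to_fract::'a::idom => _" ..

lemma frp_eq_iff: "frp P = frp Q \<longleftrightarrow> P = Q" by (auto simp: poly_eq_iff)

lemma coeff_mult_degree_bounds: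
 assumes "degree p <= m" "degree q <= n"
 shows "coeff (p*q) (m+n) = coeff p m*coeff q n"
proof (cases "degree p = m & degree q = n")
 case True
 thus ?thesis by (auto simp: coeff_mult_degree_sum)
next
 case False
 hence "degree (p*q) < m + n" using assms degree_mult_le[of p q] by linarith
 moreover have "coeff p m = 0 | coeff q n = 0" using False assms by (auto simp: coeff_eq_0)
 ultimately show ?thesis by (auto simp: coeff_eq_0)
qed

lemma degree_map_poly_lead_coeff: "f 0 = 0 ==> f (lead_coeff p) ~= 0 ==> degree (map_poly f p) = degree p"
 by (metis coeff_map_poly degree_map_poly_le le_antisym le_degree)

lemma clear_denominators:
 fixes A::"'a::idom fract poly"
 obtains w A1 where "w ~= 0" "smult (to_fract w) A = frp A1"
proof -
 have "EX w A1. w ~= 0 & smult (to_fract w) A = frp A1"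
 proof (induction A)
  case 0
  thus ?case by (intro exI[of _ 1] exI[of _ 0]) auto
 next
  case (pCons x A)
  then obtain w A1 where w: "w ~= 0" "smult (to_fract w) A = frp A1" by blast
  obtain u v where uv: "x = Fract u v" "v ~= 0" by (cases x) auto
  have "to_fract v*x = to_fract u" using uv by (simp add: to_fract_def eq_fract)
  hence "smult (to_fract (w*v)) (pCons x A) = frp (pCons (w*u) (smult v A1))"
   using w(2) by (simp add: hom_distribs mult.assoc smult_smult[symmetric] mult.commute[of _ "to_fract v"] del: smult_smult)
  with w uv show ?case by (intro exI[of _ "w*v"] exI) auto
 qed
 with that show thesis by blast
qed

text \<open>Pseudo-division by a monic polynomial is true division. The remainder is divisible by
  \<open>B\<close> over the fraction field and has smaller degree, so it is 0.\<close>

lemma monic_dvd_fract_poly: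
 fixes A B::"'a::idom poly"
 assumes "lead_coeff B = 1" "frp B dvd frp A"
 shows "B dvd A"
proof -
 have "B ~= 0" using assms(1) by auto
 obtain q r where qr: "pseudo_divmod A B = (q,r)" by force
 from pseudo_divmod[OF `B ~= 0` qr] assms(1) have *: "A = B*q + r" "r = 0 | degree r < degree B" by auto
 have "frp A = frp B*frp q + frp r" by (subst *(1)) (simp add: hom_distribs)
 with assms(2) have "frp B dvd frp r" by (metis dvd_add_times_triv_left_iff mult.commute add.commute)
 hence "r = 0" using *(2) dvd_imp_degree_le[of "frp B" "frp r"] by fastforce
 with * show ?thesis by simp
qed

lemma smult_cancel_left_idom:
 fixes p q::"'a::idom poly"
 shows "smult c p = smult c q ==> c ~= 0 ==> p = q" by (metis mult_cancel_left coeff_smult poly_eqI)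

text \<open>A Gauss lemma over the ring \<open>K[s]\<close>, obtained by cancelling one root at a time.\<close>

lemma lead_coeff_divides_factor:
 fixes A B C::"'a::alg_closed_field poly poly"
 assumes "A*B = smult (lead_coeff A*lead_coeff B) C" "A ~= 0" "B ~= 0"
 shows "EX A'. A = smult (lead_coeff A) A'" using assms
proof (induction "degree (lead_coeff A) + degree (lead_coeff B)" arbitrary: A B rule: less_induct)
 case less
 show ?case
 proof (cases "degree (lead_coeff A) = 0")
  case True
  then obtain c where c: "lead_coeff A = [:c:]" by (rule degree_eq_zeroE)
  hence "c ~= 0" using less.prems by auto
  hence "A = smult (lead_coeff A) (smult [:inverse c:] A)" by (simp add: c one_pCons[symmetric])
  thus ?thesis by blast
 next
  case False
  then obtain al where al: "poly (lead_coeff A) al = 0" using alg_closed_imp_poly_has_root by blast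
  interpret ev: map_poly_comm_ring_hom "%p::'a poly. poly p al" by unfold_locales auto
  let ?l = "[:-al,1:]"
  have split: "EX P'. P = smult ?l P'" if "map_poly (%p. poly p al) P = 0" for P::"'a poly poly"
  proof -
   have "[:?l:] dvd P" unfolding const_poly_dvd_iff
   proof
    fix n show "?l dvd coeff P n" using arg_cong[OF that, of "%p. coeff p n"] by (simp add: poly_eq_0_iff_dvd coeff_map_poly)
   qed
   thus ?thesis by (auto elim!: dvdE)
  qed
  \<comment> \<open>At a root of the leading coefficient of \<open>A\<close> the right-hand side
    vanishes, hence one of the two factors does. Cancelling \<open>?l\<close> from it lowers the sum
    of the degrees of the leading coefficients.\<close>
  have "map_poly (%p. poly p al) A*map_poly (%p. poly p al) B = 0" using arg_cong[OF less.prems(1), of "map_poly (%p. poly p al)"] al by (simp add: hom_distribs)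
  then consider "map_poly (%p. poly p al) A = 0" | "map_poly (%p. poly p al) B = 0" by auto
  thus ?thesis
  proof cases
   case 1
   then obtain A2 where A2: "A = smult ?l A2" using split by blast
   have lA: "lead_coeff A = ?l*lead_coeff A2" using lead_coeff_smult[of ?l A2] A2 by metis
   have "A2 ~= 0" using A2 less.prems by auto
   have "smult ?l (A2*B) = smult ?l (smult (lead_coeff A2*lead_coeff B) C)"
    using less.prems(1) unfolding lA by (subst (asm) A2) (simp add: mult.assoc del: mult_pCons_left)
   hence "A2*B = smult (lead_coeff A2*lead_coeff B) C" by (rule smult_cancel_left_idom) simp
   moreover have "degree (lead_coeff A2) < degree (lead_coeff A)" unfolding lA using `A2 ~= 0` by (subst degree_mult_eq) auto
   ultimately obtain A' where "A2 = smult (lead_coeff A2) A'" using less.hyps[of A2 B] `A2 ~= 0` less.prems by auto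
   hence "A = smult (lead_coeff A) A'" unfolding lA by (subst A2) (metis smult_smult)
   thus ?thesis by blast
  next
   case 2
   then obtain B2 where B2: "B = smult ?l B2" using split by blast
   have lB: "lead_coeff B = ?l*lead_coeff B2" using lead_coeff_smult[of ?l B2] B2 by metis
   have "B2 ~= 0" using B2 less.prems by auto
   have "smult ?l (A*B2) = smult ?l (smult (lead_coeff A*lead_coeff B2) C)"
    using less.prems(1) unfolding lB by (subst (asm) B2) (simp add: mult.assoc mult.left_commute del: mult_pCons_left)
   hence "A*B2 = smult (lead_coeff A*lead_coeff B2) C" by (rule smult_cancel_left_idom) simp
   moreover have "degree (lead_coeff B2) < degree (lead_coeff B)" unfolding lB using `B2 ~= 0` by (subst degree_mult_eq) auto
   ultimately show ?thesis using less.hyps[of A B2] `B2 ~= 0` less.prems by auto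
  qed
 qed
qed

definition line::"('v => 'a) => ('v => 'a) => ('v,'a::comm_ring_1) mvpoly => 'a poly" where "line a v f = mv_subst (%c. [:c:]) (%i. [:a i,v i:]) f"

text \<open>The polynomial f(x + t b) in t over the polynomial ring. For homogeneous
  \<open>f\<close> with f(b) nonzero it is monic up to a constant, so that divisibility by
  \<open>f\<close> becomes a univariate question over the fraction field.\<close>

definition shift::"('v => 'a) => ('v,'a::comm_ring_1) mvpoly => ('v,'a) mvpoly poly" where
 "shift b f = mv_subst (%c. [:mv_const c:]) (%i. [:mv_var i,mv_const (b i):]) f"

text \<open>The polynomial f(a + t x) in t: the Taylor expansion at \<open>a\<close>, graded by the
  power of t.\<close>

definition generic_line::"('v => 'a) => ('v,'a::comm_ring_1) mvpoly => ('v,'a) mvpoly poly" where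
 "generic_line a f = mv_subst (%c. [:mv_const c:]) (%i. [:mv_const (a i),mv_var i:]) f"

lemma comm_ring_hom_const_poly: "comm_ring_hom (%c::'a::comm_ring_1. [:c:])" by unfold_locales (auto simp: one_pCons)

lemma comm_ring_hom_const_poly_mv: "comm_ring_hom (%c::'a::comm_ring_1. [:mv_const c::('v,'a) mvpoly:])"
proof -
 interpret c: comm_ring_hom "mv_const::'a => ('v,'a) mvpoly" by (rule comm_ring_hom_mv_const)
 show ?thesis by unfold_locales (auto simp: hom_distribs one_pCons)
qed

lemma comm_ring_hom_line: "comm_ring_hom (line a v)" unfolding line_def[abs_def] by (rule comm_ring_hom.mv_subst_hom[OF comm_ring_hom_const_poly])
lemma comm_ring_hom_shift: "comm_ring_hom (shift b)" unfolding shift_def[abs_def] by (rule comm_ring_hom.mv_subst_hom[OF comm_ring_hom_const_poly_mv])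

lemma poly_line: "poly (line a v f) s = mv_eval (%i. a i + s*v i) f"
proof -
 have p: "comm_ring_hom (%P::'a poly. poly P s)" by unfold_locales auto
 show ?thesis unfolding line_def comm_ring_hom.hom_mv_subst[OF p] by (simp add: mv_eval_eq_subst)
qed

definition ev::"('v => 'a) => 'a => ('v,'a::comm_ring_1) mvpoly poly => 'a" where "ev a t P = poly (map_poly (mv_eval a) P) t"

lemma map_poly_mv_eval_hom: "map_poly_comm_ring_hom (mv_eval x::_ => 'a::comm_ring_1)" unfolding map_poly_comm_ring_hom_def by (rule comm_ring_hom_mv_eval)

lemma comm_ring_hom_ev: "comm_ring_hom (ev a t)"
proof -
 interpret map_poly_comm_ring_hom "mv_eval a" by (rule map_poly_mv_eval_hom)
 show ?thesis unfolding ev_def by unfold_locales (auto simp: hom_distribs)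
qed

lemma ev_pCons [simp]: "ev a t (pCons c P) = mv_eval a c + t*ev a t P"
proof -
 interpret map_poly_comm_ring_hom "mv_eval a" by (rule map_poly_mv_eval_hom)
 show ?thesis by (simp add: ev_def hom_distribs)
qed

lemma ev_0 [simp]: "ev a t 0 = 0" by (simp add: ev_def)

lemma ev_shift: "ev a t (shift b f) = mv_eval (%i. a i + t*b i) f"
proof -
 show ?thesis unfolding shift_def comm_ring_hom.hom_mv_subst[OF comm_ring_hom_ev] by (simp add: mv_eval_eq_subst[symmetric])
qed

lemma ev_generic_line: "ev a t (generic_line b f) = mv_eval (%i. b i + t*a i) f"
proof -
 show ?thesis unfolding generic_line_def comm_ring_hom.hom_mv_subst[OF comm_ring_hom_ev] by (simp add: mv_eval_eq_subst[symmetric])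
qed

lemma map_poly_mv_eval_eqI:
 fixes p q::"'a::{idom,ring_char_0} poly"
 shows "(!!t. poly p t = poly q t) ==> p = q" by (simp add: poly_eq_poly_eq_iff[symmetric] fun_eq_iff)

lemma ev_eqI:
 fixes P Q::"('v,'a::{idom,ring_char_0}) mvpoly poly"
 assumes "!!a t. ev a t P = ev a t Q"
 shows "P = Q"
proof (rule poly_eqI, rule mv_eval_eqI)
 fix n a
 have "map_poly (mv_eval a) P = map_poly (mv_eval a) Q" by (rule map_poly_mv_eval_eqI) (use assms in "simp add: ev_def")
 thus "mv_eval a (coeff P n) = mv_eval a (coeff Q n)" by (metis coeff_map_poly mv_eval_simps(1))
qed

text \<open>Division by ascending powers: the constant coefficient of \<open>W\<close> is a unit, so
  U / W is a power series, and \<open>Q\<close> is its truncation after degree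
  \<open>n\<close>.\<close>

lemma ascending_division:
 fixes U W::"('v,'a::field) mvpoly poly"
 assumes "coeff W 0 = mv_const c" "c ~= 0"
 shows "EX Q Z. U = W*Q + monom 1 (Suc n)*Z & degree Q <= n"
proof -
 have const: "mv_const c*(mv_const (inverse c)*q) = (q::('v,'a) mvpoly)" for q
  using assms(2) by (simp add: mult.assoc[symmetric] mv_const_def mult_single single_one)
 have step: "EX q Z'. Z = W*[:q:] + monom 1 1*Z'" for Z
 proof -
  define q where "q = mv_const (inverse c)*coeff Z 0"
  have "coeff (Z - W*[:q:]) 0 = 0" using const[of "coeff Z 0"] by (simp add: coeff_mult assms(1) q_def mult.commute mult.left_commute)
  then obtain Z' where "Z - W*[:q:] = pCons 0 Z'" by (metis coeff_pCons_0 pCons_cases)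
  hence "Z = W*[:q:] + monom 1 1*Z'" by (simp add: monom_altdef algebra_simps)
  thus ?thesis by blast
 qed
 show ?thesis
 proof (induction n)
  case 0
  obtain q Z where "U = W*[:q:] + monom 1 1*Z" using step by blast
  thus ?case by (intro exI[of _ "[:q:]"] exI[of _ Z]) auto
 next
  case (Suc n)
  then obtain Q Z where Q: "U = W*Q + monom 1 (Suc n)*Z" "degree Q <= n" by blast
  obtain q Z' where Z: "Z = W*[:q:] + monom 1 1*Z'" using step by blast
  have "U = W*(Q + monom q (Suc n)) + monom 1 (Suc (Suc n))*Z'"
  proof -
   have "monom 1 (Suc n)*[:q:] = monom q (Suc n)" "monom 1 (Suc n)*monom 1 1 = monom (1::('v,'a) mvpoly) (Suc (Suc n))"
    by (simp_all add: mult_monom monom_0[symmetric] del: monom_0)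
   moreover have "U = W*Q + monom 1 (Suc n)*(W*[:q:]) + monom 1 (Suc n)*(monom 1 1*Z')" unfolding Q(1) Z by (simp only: distrib_left add.assoc)
   moreover have "monom 1 (Suc n)*(W*[:q:]) = W*(monom 1 (Suc n)*[:q:])" by (rule mult.left_commute)
   ultimately show ?thesis by (simp only: distrib_left mult.assoc[symmetric])
  qed
  moreover have "degree (Q + monom q (Suc n)) <= Suc n" using Q(2) by (intro degree_add_le) (auto simp: degree_monom_le)
  ultimately show ?case by blast
 qed
qed

text \<open>If \<open>w\<close> divides \<open>u\<close> along every line through a point where \<open>w\<close> does not vanish, then the power
 series \<open>u / w\<close> at this point is a polynomial.\<close>

lemma dvd_if_dvd_on_lines:
 fixes u w::"('v,'a::field_char_0) mvpoly"
 assumes w: "mv_eval a w ~= 0" and dvd: "!!v. line a v w dvd line a v u"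
 shows "w dvd u"
proof -
 let ?U = "generic_line a u" and ?W = "generic_line a w"
 have line: "map_poly (mv_eval v) (generic_line a f) = line a v f" for v::"'v => 'a" and f
  by (rule map_poly_mv_eval_eqI) (simp add: ev_def[symmetric] ev_generic_line poly_line)
 have W0: "coeff ?W 0 = mv_const (mv_eval a w)"
 proof (rule mv_eval_eqI)
  fix v::"'v => 'a"
  have "mv_eval v (coeff ?W 0) = coeff (line a v w) 0" by (simp add: line[symmetric] coeff_map_poly)
  also have "... = mv_eval a w" using poly_line[of a v w 0] by (simp add: poly_0_coeff_0)
  finally show "mv_eval v (coeff ?W 0) = mv_eval v (mv_const (mv_eval a w))" by simp
 qed
 define n where "n = degree ?U"
 obtain Q Z where QZ: "?U = ?W*Q + monom 1 (Suc n)*Z" "degree Q <= n" using ascending_division[OF W0 w] by blast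
 \<comment> \<open>On each line the quotient is a polynomial of degree at most \<open>n\<close> by
   hypothesis, so it agrees with the truncated series and nothing remains.\<close>
 have "Z = 0"
 proof (rule ev_eqI)
  fix v::"'v => 'a" and t
  interpret m: map_poly_comm_ring_hom "mv_eval v::('v,'a) mvpoly => 'a" by (rule map_poly_mv_eval_hom)
  let ?m = "map_poly (mv_eval v)::('v,'a) mvpoly poly => 'a poly"
  let ?w = "line a v w" and ?u = "line a v u"
  have eq: "?u = ?w*?m Q + monom 1 (Suc n)*?m Z" using arg_cong[OF QZ(1), of ?m] by (simp add: line hom_distribs)
  have w0: "poly ?w 0 ~= 0" using w by (simp add: poly_line)
  obtain q where q: "?u = ?w*q" using dvd by blast
  have "?w ~= 0" using w0 by auto
  have du: "degree ?u <= n" unfolding n_def line[symmetric] by (rule degree_map_poly_le)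
  have dq: "degree q <= n"
  proof (cases "q = 0")
   case False
   with `?w ~= 0` du show ?thesis unfolding q by (simp add: degree_mult_eq)
  qed simp
  have dQ: "degree (?m Q) <= n" using QZ(2) degree_map_poly_le[of "mv_eval v" Q] by simp
  have *: "?w*(q - ?m Q) = monom 1 (Suc n)*?m Z" using eq q by (simp add: algebra_simps)
  have "monom 1 (Suc n) dvd q - ?m Q"
  proof (rule ccontr)
   assume n: "~ ?thesis"
   hence "q - ?m Q ~= 0" by auto
   with n have "order 0 (q - ?m Q) < Suc n" by (simp add: monom_1_dvd_iff)
   moreover have "order 0 ?w = 0" using w0 by (rule order_0I)
   ultimately have "order 0 (?w*(q - ?m Q)) < Suc n" using `?w ~= 0` `q - ?m Q ~= 0` by (subst order_mult) auto
   moreover have "?w*(q - ?m Q) ~= 0" using `?w ~= 0` `q - ?m Q ~= 0` by simp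
   ultimately have "~ monom 1 (Suc n) dvd ?w*(q - ?m Q)" by (simp add: monom_1_dvd_iff del: dvd_diff_commute)
   with * show False by simp
  qed
  hence "q - ?m Q = 0 | degree (monom (1::'a) (Suc n)) <= degree (q - ?m Q)" using dvd_imp_degree_le by blast
  hence "q - ?m Q = 0" using degree_diff_le[OF dq dQ] by (auto simp: degree_monom_eq)
  with * have "?m Z = 0" by simp
  thus "ev v t Z = ev v t 0" by (simp add: ev_def)
 qed
 \<comment> \<open>Translation by \<open>- a\<close>: the identity on the generic line at t = 1,
   with x - a in place of x, is a factorization of \<open>u\<close>.\<close>
 define ta where "ta = mv_subst mv_const (%i. mv_var i - mv_const (a i)::('v,'a) mvpoly)"
 have ev: "mv_eval v (ta f) = mv_eval (%i. v i - a i) f" for v f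
  unfolding ta_def comm_ring_hom.hom_mv_subst[OF comm_ring_hom_mv_eval] by (simp add: mv_eval_eq_subst[symmetric])
 have "u = w*ta (poly Q 1)"
 proof (rule mv_eval_eqI)
  fix v::"'v => 'a"
  let ?v = "%i. v i - a i"
  interpret e: comm_ring_hom "ev ?v 1" by (rule comm_ring_hom_ev)
  have 1: "mv_eval b (poly P 1) = ev b 1 P" for b::"'v => 'a" and P by (induction P) simp_all
  have "ev ?v 1 ?U = ev ?v 1 ?W*ev ?v 1 Q" using QZ(1) `Z = 0` by (simp add: hom_distribs)
  thus "mv_eval v u = mv_eval v (w*ta (poly Q 1))" by (simp add: ev_generic_line ev 1)
 qed
 thus ?thesis by simp
qed

text \<open>After clearing denominators, the claim is that the leading coefficient \<open>w1\<close>
  divides every coefficient of \<open>A1\<close>. By \<open>dvd_if_dvd_on_lines\<close> this may be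
  checked on lines through a point where \<open>w1*w2\<close> is nonzero; there the coefficients lie
  in K[s].\<close>

lemma monic_factor_integral:
 fixes A B::"('v::linorder,'a::{alg_closed_field,field_char_0}) mvpoly fract poly"
 assumes AB: "A*B = frp C" and monic: "lead_coeff A = 1" "lead_coeff B = 1"
 shows "EX A'. A = frp A' & lead_coeff A' = 1"
proof -
 obtain w1 A1 where A1: "w1 ~= 0" "smult (to_fract w1) A = frp A1" by (rule clear_denominators)
 obtain w2 B1 where B1: "w2 ~= 0" "smult (to_fract w2) B = frp B1" by (rule clear_denominators)
 have lA: "lead_coeff A1 = w1" and lB: "lead_coeff B1 = w2" using arg_cong[OF A1(2), of lead_coeff] arg_cong[OF B1(2), of lead_coeff] monic A1(1) B1(1) by simp_all
 have "frp (A1*B1) = frp (smult (w1*w2) C)" by (simp add: hom_distribs A1(2)[symmetric] B1(2)[symmetric] AB mult.commute)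
 hence eq: "A1*B1 = smult (w1*w2) C" by (simp only: frp_eq_iff)
 have "w1 ~= 0" using A1 by simp
 have dvd: "w1 dvd coeff A1 n" for n
 proof -
  have "w1*w2 ~= 0" using A1 B1 by simp
  then obtain a where a: "mv_eval a (w1*w2) ~= 0" using mv_eval_zero_imp_zero by blast
  show ?thesis
  proof (rule dvd_if_dvd_on_lines)
   show "mv_eval a w1 ~= 0" using a by simp
   fix v
   interpret l: comm_ring_hom "line a v" by (rule comm_ring_hom_line)
   interpret m: map_poly_comm_ring_hom "line a v" ..
   have nz: "line a v w1 ~= 0" "line a v w2 ~= 0" using a poly_line[of a v w1 0] poly_line[of a v w2 0] by auto
   let ?m = "map_poly (line a v)"
   have deg: "lead_coeff (?m A1) = line a v w1" "lead_coeff (?m B1) = line a v w2" using nz lA lB degree_map_poly_lead_coeff[of "line a v"]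
    by (simp_all add: coeff_map_poly)
   have "?m A1*?m B1 = smult (lead_coeff (?m A1)*lead_coeff (?m B1)) (?m C)" unfolding deg using arg_cong[OF eq, of ?m] by (simp add: hom_distribs)
   moreover have "?m A1 ~= 0" "?m B1 ~= 0" using deg nz by (metis leading_coeff_0_iff)+
   ultimately obtain A' where "?m A1 = smult (line a v w1) A'" using lead_coeff_divides_factor[of "?m A1" "?m B1" "?m C"] deg by auto
   hence "coeff (?m A1) n = line a v w1*coeff A' n" by simp
   thus "line a v w1 dvd line a v (coeff A1 n)" by (simp add: coeff_map_poly)
  qed
 qed
 hence "[:w1:] dvd A1" by (simp add: const_poly_dvd_iff)
 then obtain A' where A': "A1 = smult w1 A'" by (auto elim!: dvdE)
 have "smult (to_fract w1) A = smult (to_fract w1) (frp A')" unfolding A1(2) A' by (simp add: hom_distribs)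
 hence "A = frp A'" by (rule smult_cancel_left_idom) (use `w1 ~= 0` in simp)
 with monic show ?thesis by (intro exI[of _ A']) (auto simp: to_fract_1[symmetric] simp del: to_fract_1)
qed


section \<open>Divisibility by a squarefree homogeneous polynomial\<close>

definition unshift::"('v => 'a) => ('v,'a::comm_ring_1) mvpoly poly => ('v,'a) mvpoly poly" where "unshift b P = poly (map_poly (shift (%i. - b i)) P) [:0,1:]"

lemma comm_ring_hom_unshift: "comm_ring_hom (unshift b)"
proof -
 interpret map_poly_comm_ring_hom "shift (%i. - b i)" unfolding map_poly_comm_ring_hom_def by (rule comm_ring_hom_shift)
 show ?thesis unfolding unshift_def by unfold_locales (auto simp: hom_distribs)
qed

lemma ev_unshift: "ev a t (unshift b P) = ev (%i. a i - t*b i) t P"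
proof (induction P)
 case 0
 interpret comm_ring_hom "unshift b" by (rule comm_ring_hom_unshift)
 show ?case by simp
next
 case (pCons c P)
 interpret m: map_poly_comm_ring_hom "shift (%i. - b i)" unfolding map_poly_comm_ring_hom_def by (rule comm_ring_hom_shift)
 interpret e: comm_ring_hom "ev a t" by (rule comm_ring_hom_ev)
 have "unshift b (pCons c P) = shift (%i. - b i) c + [:0,1:]*unshift b P" by (simp add: unshift_def hom_distribs)
 thus ?case using pCons by (simp add: hom_distribs ev_shift)
qed

lemma unshift_shift: "unshift b (shift b f) = [:f:]"
 for f::"('v,'a::{idom,ring_char_0}) mvpoly" by (rule ev_eqI) (simp add: ev_unshift ev_shift)

text \<open>The inverse substitution \<open>unshift\<close> turns \<open>shift b D\<close> into
  \<open>D\<close>, constant in t. Both factors then have degree 0 in t, so each comes from a factor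
  of \<open>D\<close>.\<close>

lemma factor_of_shift:
 fixes D::"('v::linorder,'a::{alg_closed_field,field_char_0}) mvpoly"
 assumes "P*Q = shift b D" "D ~= 0"
 shows "EX f g. P = shift b f & D = f*g"
proof -
 interpret s: comm_ring_hom "shift b" by (rule comm_ring_hom_shift)
 interpret u: comm_ring_hom "unshift b" by (rule comm_ring_hom_unshift)
 have "unshift b P*unshift b Q = [:D:]" using arg_cong[OF assms(1), of "unshift b"] by (simp add: hom_distribs unshift_shift)
 moreover from this have "unshift b P ~= 0" "unshift b Q ~= 0" using assms(2) by auto
 ultimately have "degree (unshift b P) + degree (unshift b Q) = 0" by (metis degree_mult_eq degree_pCons_0)
 then obtain f g where fg: "unshift b P = [:f:]" "unshift b Q = [:g:]" by (metis add_is_0 degree_eq_zeroE)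
 have "P = shift b f"
 proof (rule ev_eqI)
  fix a t
  have "ev a t P = ev (%i. a i + t*b i) t (unshift b P)" by (simp add: ev_unshift)
  thus "ev a t P = ev a t (shift b f)" by (simp add: fg ev_shift)
 qed
 moreover have "[:D:] = [:f*g:]" using `unshift b P * unshift b Q = [:D:]` fg by (simp add: mult.commute)
 ultimately show ?thesis by auto
qed

definition mv_homogeneous::"nat => ('v,'a::zero) mvpoly => bool" where "mv_homogeneous d P \<longleftrightarrow> (ALL t:keys P. (SUM v:keys t. lookup t v) = d)"

lemma lead_coeff_shift:
 fixes P::"('v,'a::{idom,ring_char_0}) mvpoly"
 assumes "mv_homogeneous d P" "mv_eval b P ~= 0"
 shows "lead_coeff (shift b P) = mv_const (mv_eval b P)"
proof -
 let ?x = "%i. [:mv_var i,mv_const (b i)::('v,'a) mvpoly:]"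
 interpret c: comm_ring_hom "mv_const::'a => ('v,'a) mvpoly" by (rule comm_ring_hom_mv_const)
 have mon: "degree (mmon ?x t) <= (SUM v:keys t. lookup t v) & coeff (mmon ?x t) (SUM v:keys t. lookup t v) = mv_const (mmon b t)" for t
 proof -
  have "degree (PROD v:A. ?x v^e v) <= (SUM v:A. e v) & coeff (PROD v:A. ?x v^e v) (SUM v:A. e v) = mv_const (PROD v:A. b v^e v)" for A e
  proof (induction A rule: infinite_finite_induct)
   case (insert v A)
   have *: "degree (?x v^n) <= n & coeff (?x v^n) n = mv_const (b v^n)" for n
   proof (induction n)
    case (Suc n)
    have "degree (?x v*?x v^n) <= 1 + n" using Suc degree_pCons_le[of "mv_var v" "[:mv_const (b v):]"] by (intro order.trans[OF degree_mult_le] add_mono) auto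
    moreover have "coeff (?x v*?x v^n) (1+n) = coeff (?x v) 1*coeff (?x v^n) n" using Suc by (intro coeff_mult_degree_bounds) auto
    ultimately show ?case using Suc by (simp add: c.hom_mult)
   qed simp
   have "degree (?x v^e v*(PROD v:A. ?x v^e v)) <= e v + (SUM v:A. e v)" using insert *[of "e v"] by (intro order.trans[OF degree_mult_le] add_mono) auto
   moreover have "coeff (?x v^e v*(PROD v:A. ?x v^e v)) (e v + (SUM v:A. e v)) = coeff (?x v^e v) (e v)*coeff (PROD v:A. ?x v^e v) (SUM v:A. e v)"
    using insert *[of "e v"] by (intro coeff_mult_degree_bounds) auto
   ultimately show ?case using insert * by (simp add: c.hom_mult)
  qed auto
  thus ?thesis unfolding mmon_def .
 qed
 have eq: "shift b P = (SUM t:keys P. smult (mv_const (lookup P t)) (mmon ?x t))" by (simp add: shift_def mv_subst_monom)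
 have deg: "degree (shift b P) <= d" unfolding eq using mon assms(1) by (intro degree_sum_le) (auto simp: mv_homogeneous_def intro!: order.trans[OF degree_smult_le])
 have cf: "coeff (shift b P) d = mv_const (mv_eval b P)"
 proof -
  have "coeff (shift b P) d = (SUM t:keys P. mv_const (lookup P t*mmon b t))" unfolding eq coeff_sum using mon assms(1)
   by (intro sum.cong) (auto simp: mv_homogeneous_def c.hom_mult)
  thus ?thesis by (simp add: mv_eval_eq_subst mv_subst_monom c.hom_sum)
 qed
 have "mv_const (mv_eval b P) ~= (0::('v,'a) mvpoly)" using assms(2) mv_eval_const[of b "mv_eval b P"] mv_eval_simps(1)[of b] by metis
 with deg cf have "degree (shift b P) = d" by (metis le_antisym le_degree)
 with cf show ?thesis by simp
qed

lemma monic_factor_of_shift: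
 fixes D::"('v::linorder,'a::{alg_closed_field,field_char_0}) mvpoly"
 assumes "lead_coeff (shift b D) = 1" "pp dvd frp (shift b D)" "lead_coeff pp = 1"
 shows "EX f. pp = frp (shift b f) & f dvd D & lead_coeff (shift b f) = 1"
proof -
 obtain ka where ka: "frp (shift b D) = pp*ka" using assms(2) by blast
 have "lead_coeff pp*lead_coeff ka = 1" using arg_cong[OF ka, of lead_coeff] assms(1) by (simp add: lead_coeff_mult)
 with assms have lka: "lead_coeff ka = 1" by simp
 obtain P where P: "pp = frp P" "lead_coeff P = 1" using monic_factor_integral[OF ka[symmetric] assms(3) lka] by blast
 obtain Q where Q: "ka = frp Q" using monic_factor_integral[of ka pp "shift b D"] ka assms(3) lka by (metis mult.commute)
 have "frp (P*Q) = frp (shift b D)" using ka P Q by (simp add: hom_distribs)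
 hence "P*Q = shift b D" by (simp only: frp_eq_iff)
 moreover have "D ~= 0"
 proof
  interpret comm_ring_hom "shift b" by (rule comm_ring_hom_shift)
  assume "D = 0" with assms(1) show False by simp
 qed
 ultimately obtain f g where "P = shift b f" "D = f*g" using factor_of_shift by blast
 with P show ?thesis by auto
qed

text \<open>Nothing is known about \<open>E\<close> on the common zeros of \<open>U\<close>; the
  hypothesis \<open>coprime\<close> says that they contain no component of D = 0. If
  \<open>D\<close> does not divide \<open>E\<close>, some irreducible factor \<open>f\<close> of
  \<open>D\<close> does not. If \<open>f\<close> also fails to divide some \<open>u\<close> in
  \<open>U\<close>, Bezout relations give, after clearing denominators, a combination of
  \<open>f\<close> and \<open>E*u\<close> that is nonzero and free of t. Over a point where it does
  not vanish, a root t of \<open>f\<close> is a zero of \<open>D\<close>, hence of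
  \<open>E*u\<close>, which is a contradiction. So \<open>f\<close> divides all of \<open>U\<close>
  and is a unit.\<close>

theorem squarefree_dvd_if_vanishing_aux:
 fixes D E::"('v::linorder,'a::{alg_closed_field,field_char_0}) mvpoly"
 assumes sqf: "squarefree D" and lead: "lead_coeff (shift b D) = 1"
  and zeros: "!!u a. u : U ==> mv_eval a D = 0 ==> mv_eval a u ~= 0 ==> mv_eval a E = 0"
  and coprime: "!!f. f dvd D ==> (!!u. u : U ==> f dvd u) ==> f dvd 1"
 shows "D dvd E"
proof -
 interpret s: comm_ring_hom "shift b" by (rule comm_ring_hom_shift)
 interpret u: comm_ring_hom "unshift b" by (rule comm_ring_hom_unshift)
 let ?D = "frp (shift b D)" and ?E = "frp (shift b E)"
 have dvd_back: "f dvd g" if "lead_coeff (shift b f) = 1" "frp (shift b f) dvd frp (shift b g)"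
  for f g::"('v,'a) mvpoly"
 proof -
  have "shift b f dvd shift b g" using that by (rule monic_dvd_fract_poly)
  hence "unshift b (shift b f) dvd unshift b (shift b g)" by (rule u.hom_dvd)
  thus ?thesis by (simp add: unshift_shift)
 qed
 have unit: "degree (shift b f) = 0" if "f dvd 1" for f
 proof -
  have "shift b f dvd 1" using s.hom_dvd[OF that] by simp
  thus ?thesis by (auto simp: is_unit_poly_iff)
 qed
 have "?D dvd ?E"
 proof (rule ccontr)
  assume nd: "~ ?D dvd ?E"
  have "?D ~= 0" using lead by auto
  then obtain g al be where g: "g dvd ?D" "g dvd ?E" "g = al*?D + be*?E" "lead_coeff g = 1" by (rule poly_bezout[of ?D ?E])
  obtain h where h: "?D = g*h" using g(1) by blast
  have "degree h > 0"
  proof (rule ccontr)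
   assume "~ degree h > 0"
   then obtain c where "h = [:c:]" using degree_eq_zeroE by blast
   with h have "?D = smult c g" by simp
   with `?D ~= 0` g(2) have "?D dvd ?E" by (auto simp: smult_dvd_iff)
   with nd show False by simp
  qed
  then obtain pp where pp: "pp dvd h" "lead_coeff pp = 1" "degree pp > 0"
   and prime: "!!f. pp dvd f | (EX al be. al*pp + be*f = 1)" by (rule exists_minimal_monic_divisor) blast
  have "pp dvd ?D" using pp(1) h by simp
  then obtain f where f: "pp = frp (shift b f)" "f dvd D" "lead_coeff (shift b f) = 1" using monic_factor_of_shift[OF lead _ pp(2)] by blast
  \<comment> \<open>Otherwise \<open>pp\<close> divides the gcd \<open>g\<close> as well as the
    cofactor \<open>h\<close>, and its square divides \<open>?D\<close>; descending to
    \<open>f\<close>, this contradicts squarefreeness.\<close>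
  have nE: "~ pp dvd ?E"
  proof
   assume "pp dvd ?E"
   hence "pp dvd g" unfolding g(3) using `pp dvd ?D` by simp
   hence "pp*pp dvd ?D" unfolding h using pp(1) by (rule mult_dvd_mono)
   hence "frp (shift b (f*f)) dvd ?D" unfolding f(1) by (simp add: hom_distribs)
   moreover have "lead_coeff (shift b (f*f)) = 1" using f(3) by (simp add: hom_distribs lead_coeff_mult)
   ultimately have "f*f dvd D" by (intro dvd_back)
   hence "f dvd 1" using squarefreeD[OF sqf, of f] unfolding power2_eq_square by blast
   with unit have "degree (shift b f) = 0" .
   with pp(3) f(1) show False by simp
  qed
  have "f dvd u" if u: "u : U" for u
  proof (rule ccontr)
   assume "~ f dvd u"
   hence nu: "~ pp dvd frp (shift b u)" using dvd_back f by blast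
   obtain al1 be1 where 1: "al1*pp + be1*?E = 1" using prime[of ?E] nE by blast
   obtain al2 be2 where 2: "al2*pp + be2*frp (shift b u) = 1" using prime[of "frp (shift b u)"] nu by blast
   define ga where "ga = al1*(al2*pp + be2*frp (shift b u)) + be1*?E*al2"
   define de where "de = be1*be2"
   have 3: "ga*pp + de*frp (shift b (E*u)) = 1"
   proof -
    have "(al1*pp + be1*?E)*(al2*pp + be2*frp (shift b u)) = 1" unfolding 1 2 by simp
    thus ?thesis unfolding ga_def de_def by (simp add: hom_distribs algebra_simps)
   qed
   obtain w1 G where G: "w1 ~= 0" "smult (to_fract w1) ga = frp G" by (rule clear_denominators)
   obtain w2 H where H: "w2 ~= 0" "smult (to_fract w2) de = frp H" by (rule clear_denominators)
   have "frp (smult w2 G*shift b f + smult w1 H*shift b (E*u)) = frp [:w1*w2:]"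
   proof -
    have "smult (to_fract (w1*w2)) (ga*pp + de*frp (shift b (E*u))) = smult (to_fract (w1*w2)) 1" unfolding 3 by simp
    thus ?thesis by (simp add: hom_distribs G(2)[symmetric] H(2)[symmetric] f(1) smult_add_right mult.commute)
   qed
   hence eq: "smult w2 G*shift b f + smult w1 H*shift b (E*u) = [:w1*w2:]" by (simp only: frp_eq_iff)
   have "w1*w2 ~= 0" using G H by simp
   then obtain a where a: "mv_eval a (w1*w2) ~= 0" using mv_eval_zero_imp_zero by blast
   interpret m: map_poly_comm_ring_hom "mv_eval a::('v,'a) mvpoly => 'a" by (rule map_poly_mv_eval_hom)
   have "degree (shift b f) > 0" using pp(3) f(1) by simp
   hence "degree (map_poly (mv_eval a) (shift b f)) > 0" using f(3) by (subst degree_map_poly_lead_coeff) auto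
   then obtain t where "poly (map_poly (mv_eval a) (shift b f)) t = 0" using alg_closed_imp_poly_has_root by blast
   hence f0: "ev a t (shift b f) = 0" by (simp add: ev_def)
   hence "mv_eval (%i. a i + t*b i) f = 0" by (simp add: ev_shift)
   hence "mv_eval (%i. a i + t*b i) D = 0" using f(2) by (auto elim!: dvdE)
   hence "mv_eval (%i. a i + t*b i) (E*u) = 0" using zeros[OF u] by auto
   hence Eu: "ev a t (shift b (E*u)) = 0" by (simp add: ev_shift)
   interpret e: comm_ring_hom "ev a t" by (rule comm_ring_hom_ev)
   have "ev a t (smult w2 G*shift b f + smult w1 H*shift b (E*u)) = 0" using f0 Eu by (simp add: hom_distribs del: mult_smult_left)
   with eq a show False by simp
  qed
  hence "f dvd 1" using f(2) coprime by blast
  with unit have "degree (shift b f) = 0" .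
  with pp(3) f(1) show False by simp
 qed
 with lead show ?thesis by (rule dvd_back)
qed

theorem squarefree_dvd_if_vanishing:
 fixes D E::"('v::linorder,'a::{alg_closed_field,field_char_0}) mvpoly"
 assumes sqf: "squarefree D" and hom: "mv_homogeneous d D"
  and zeros: "!!u a. u : U ==> mv_eval a D = 0 ==> mv_eval a u ~= 0 ==> mv_eval a E = 0"
  and coprime: "!!f. f dvd D ==> (!!u. u : U ==> f dvd u) ==> f dvd 1"
 shows "D dvd E"
proof -
 have "D ~= 0" using sqf by auto
 then obtain b where b: "mv_eval b D ~= 0" using mv_eval_zero_imp_zero by blast
 define c where "c = (mv_const (inverse (mv_eval b D))::('v,'a) mvpoly)"
 have c: "c*mv_const (mv_eval b D) = 1" by (rule mv_eval_eqI) (use b in "simp add: c_def")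
 have D: "D = mv_const (mv_eval b D)*(c*D)" using c by (metis mult.assoc mult.commute mult_1)
 interpret s: comm_ring_hom "shift b" by (rule comm_ring_hom_shift)
 have "c*D dvd E"
 proof (rule squarefree_dvd_if_vanishing_aux[where U = U])
  have "D dvd c*D" by simp
  thus "squarefree (c*D)" using sqf D unfolding squarefree_def by (metis dvd_mult)
  have "shift b c = [:c:]" by (simp add: shift_def c_def comm_ring_hom.mv_subst_const[OF comm_ring_hom_const_poly_mv])
  thus "lead_coeff (shift b (c*D)) = 1" using lead_coeff_shift[OF hom b] c by (auto simp: hom_distribs lead_coeff_mult)
  show "mv_eval a E = 0" if "u : U" "mv_eval a (c*D) = 0" "mv_eval a u ~= 0" for u a using zeros[OF that(1) _ that(3)] that(2) b by (simp add: c_def)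
  show "f dvd 1" if "f dvd c*D" "!!u. u : U ==> f dvd u" for f using coprime[OF _ that(2)] that(1) D by (metis dvd_mult)
 qed
 thus ?thesis by (rule dvd_trans[rotated]) simp
qed

section \<open>Hilbert's Nullstellensatz\<close>

lemma coeff_mult_top:
 fixes p q::"'a::idom poly"
 assumes "degree p <= n" "degree q <= m"
 shows "coeff (p*q) (n+m) = coeff p n*coeff q m"
proof (cases "degree p = n & degree q = m")
 case True
 thus ?thesis using coeff_mult_degree_sum[of p q] by auto
next
 case False
 hence "coeff p n*coeff q m = 0" using assms by (auto intro: coeff_eq_0)
 moreover have "degree (p*q) < n + m" using False assms degree_mult_le[of p q] by linarith
 ultimately show ?thesis by (simp add: coeff_eq_0)
qed

definition polyideal::"'v set => (('v => 'a::comm_ring_1) => 'a) set => bool" where "polyideal V I \<longleftrightarrow> (ALL f:I. pfun V f) & (%_. 0) : I &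
  (ALL f:I. ALL g:I. (%x. f x + g x) : I) & (ALL f:I. ALL h. pfun V h --> (%x. h x*f x) : I)"

lemma pfun_if: "(b ==> pfun V f) ==> (~ b ==> pfun V g) ==> pfun V (%a. if b then f a else g a)" by (cases b) auto

text \<open>\<open>pol_in v V n c F\<close>: as a polynomial in the variable \<open>v\<close> with coefficients depending on \<open>V\<close>, the
 function \<open>F\<close> has degree at most \<open>n\<close> and the constant \<open>c\<close> as coefficient of degree \<open>n\<close>.\<close>

definition pol_in::"'v => 'v set => nat => 'a => (('v => 'a) => 'a::idom) => bool" where
 "pol_in v V n c F \<longleftrightarrow> (EX G. (ALL e. pfun V (%x. coeff (G x) e)) & (ALL x. degree (G x) <= n & coeff (G x) n = c & F x = poly (G x) (x v)))"

lemma pfun_coeff_mult: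
 assumes "!!e. pfun V (%x. coeff (G x) e)" "!!e. pfun V (%x. coeff (H x) e)"
 shows "pfun V (%x. coeff (G x*H x) e)" unfolding coeff_mult using assms by (intro pfunI)

lemma pol_in_mult: "pol_in v V n c F ==> pol_in v V n' c' F' ==> pol_in v V (n + n') (c*c') (%x. F x*F' x)"
proof -
 assume "pol_in v V n c F" "pol_in v V n' c' F'"
 then obtain G G' where *: "!!e. pfun V (%x. coeff (G x) e)" "!!e. pfun V (%x. coeff (G' x) e)"
  "!!x. degree (G x) <= n & coeff (G x) n = c & F x = poly (G x) (x v)"
  "!!x. degree (G' x) <= n' & coeff (G' x) n' = c' & F' x = poly (G' x) (x v)" by (auto simp: pol_in_def)
 thus ?thesis unfolding pol_in_def
  by (intro exI[of _ "%x. G x*G' x"]) (auto intro!: pfun_coeff_mult coeff_mult_top[THEN trans] degree_mult_le[THEN order_trans] add_mono)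
qed

lemma pol_in_const: "pol_in v V 0 c (%_. c)" unfolding pol_in_def by (intro exI[of _ "%_. [:c:]"]) (auto simp: coeff_pCons split: nat.split intro!: pfunI)
lemma pol_in_power: "pol_in v V n c F ==> pol_in v V (n*e) (c^e) (%x. F x^e)" by (induction e) (auto intro: pol_in_const dest: pol_in_mult)

lemma pol_in_prod: "(!!i. i : A ==> pol_in v V (n i) (c i) (F i)) ==> pol_in v V (SUM i:A. n i) (PROD i:A. c i) (%x. PROD i:A. F i x)"
 by (induction A rule: infinite_finite_induct) (auto intro: pol_in_const pol_in_mult)

lemma pol_in_add: "pol_in v V n c F ==> pol_in v V n c' F' ==> pol_in v V n (c + c') (%x. F x + F' x)"
proof -
 assume "pol_in v V n c F" "pol_in v V n c' F'"
 then obtain G G' where *: "!!e. pfun V (%x. coeff (G x) e)" "!!e. pfun V (%x. coeff (G' x) e)"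
  "!!x. degree (G x) <= n & coeff (G x) n = c & F x = poly (G x) (x v)"
  "!!x. degree (G' x) <= n & coeff (G' x) n = c' & F' x = poly (G' x) (x v)" by (auto simp: pol_in_def)
 thus ?thesis unfolding pol_in_def by (intro exI[of _ "%x. G x + G' x"]) (auto intro!: pfunI degree_add_le)
qed

lemma pol_in_sum: "(!!i. i : A ==> pol_in v V n (c i) (F i)) ==> pol_in v V n (SUM i:A. c i) (%x. SUM i:A. F i x)"
proof (induction A rule: infinite_finite_induct)
 case empty
 show ?case unfolding pol_in_def by (auto intro!: exI[of _ "%_. 0"] pfunI)
next
 case (infinite A)
 thus ?case unfolding pol_in_def by (auto intro!: exI[of _ "%_. 0"] pfunI)
qed (auto intro: pol_in_add)

lemma pol_in_less: "pol_in v V m c F ==> m < n ==> pol_in v V n 0 F" unfolding pol_in_def by (metis coeff_eq_0 le_less_trans less_imp_le)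

definition shear::"'v => ('v => 'a) => ('v => 'a) => 'v => 'a::comm_ring_1" where "shear v a x w = (if w = v then 0 else x w) + a w*x v"

text \<open>In the new coordinate \<open>x v\<close>, which moves along the vector \<open>a\<close>,
  the coefficient of degree \<open>d\<close> is the value at \<open>a\<close> of the homogeneous
  part of top degree of \<open>f\<close>. The vector is chosen where this part is nonzero;
  \<open>a v\<close> nonzero makes the change of coordinates invertible.\<close>

lemma pol_in_shear:
 fixes f::"('v => 'a::field_char_0) => 'a"
 assumes V: "finite V" "v : V" and f: "pfun V f" "f x0 ~= 0"
 shows "EX a d c. a v ~= 0 & c ~= 0 & pol_in v (V - {v}) d c (%x. f (shear v a x))"
proof -
 obtain P where P: "mv_in V P" "!!x. mv_eval x P = f x" using pfun_imp_mvpoly[OF f(1)] by blast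
 let ?K = "keys P"
 define tdeg where "tdeg = (%t::'v \<Rightarrow>\<^sub>0 nat. SUM w:keys t. lookup t w)"
 define d where "d = Max (tdeg ` ?K)"
 have "P ~= 0" using P(2)[of x0] f(2) by auto
 hence "tdeg ` ?K ~= {}" by (simp add: keys_eq_empty)
 hence "d : tdeg ` ?K" unfolding d_def by (intro Max_in) auto
 then obtain t0 where t0: "t0 : ?K" "tdeg t0 = d" by blast
 define T where "T = {t : ?K. tdeg t = d}"
 define top where "top = (%a. SUM t:T. lookup P t*mmon a t)"
 have keys: "keys t <= V" if "t : ?K" for t using P(1) that by (auto simp: mv_in_def)
 have "EX a. top a ~= 0"
 proof (rule ccontr)
  assume "\<nexists>a. top a ~= 0"
  hence "lookup P t0 = 0" using t0 keys V(1) by (intro mv_sum_zero_imp_coeffs_zero[of V T "lookup P" t0]) (auto simp: top_def T_def)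
  with t0 show False by (simp add: in_keys_iff)
 qed
 moreover have "pfun V top" unfolding top_def mmon_def using keys by (intro pfunI) (auto simp: T_def)
 moreover have "~ (ALL a. a v = (0::'a))" by (auto intro: exI[of _ "%_. 1"])
 ultimately have "EX a. top a*a v ~= 0" using pfun_mult_eq_0[of V top V "%a. a v"] pfun.var[OF V(2)] by blast
 then obtain a where a: "top a ~= 0" "a v ~= 0" by auto
 have lin: "pol_in v (V - {v}) 1 (a w) (%x. shear v a x w)" if "w : V" for w
 proof -
  have "coeff [:s,t:] e = (if e = 0 then s else if e = 1 then t else 0)" for s t::'a and e by (auto simp: coeff_pCons split: nat.split)
  thus ?thesis unfolding pol_in_def shear_def using that by (intro exI[of _ "%x. [:if w = v then 0 else x w,a w:]"]) (auto simp: mult.commute intro!: pfunI pfun_if)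
 qed
 have mon: "pol_in v (V - {v}) (tdeg t) (mmon a t) (%x. mmon (shear v a x) t)" if "t : ?K" for t
 proof -
  have "pol_in v (V - {v}) (SUM w:keys t. 1*lookup t w) (mmon a t) (%x. mmon (shear v a x) t)"
   unfolding mmon_def using keys[OF that] by (intro pol_in_prod pol_in_power lin) auto
  thus ?thesis by (simp add: tdeg_def)
 qed
 have "pol_in v (V - {v}) d (SUM t:?K. if t : T then lookup P t*mmon a t else 0) (%x. SUM t:?K. lookup P t*mmon (shear v a x) t)"
 proof (rule pol_in_sum)
  fix t assume t: "t : ?K"
  have "pol_in v (V - {v}) (0 + tdeg t) (lookup P t*mmon a t) (%x. lookup P t*mmon (shear v a x) t)" by (intro pol_in_mult pol_in_const mon t)
  moreover have "tdeg t <= d" unfolding d_def using t by (intro Max_ge) auto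
  ultimately show "pol_in v (V - {v}) d (if t : T then lookup P t*mmon a t else 0) (%x. lookup P t*mmon (shear v a x) t)"
   using t pol_in_less[of v "V - {v}" "tdeg t" _ _ d] by (auto simp: T_def le_less)
 qed
 moreover have "(SUM t:?K. if t : T then lookup P t*mmon a t else 0) = top a" unfolding top_def T_def by (simp add: sum.inter_filter[symmetric])
 moreover have "(SUM t:?K. lookup P t*mmon (shear v a x) t) = f (shear v a x)" for x by (simp add: P(2)[symmetric] mv_eval_eq_subst mv_subst_monom)
 ultimately show ?thesis using a by auto
qed

text \<open>The functions with such a representation contain 1 and are stable under multiplication
  by coordinates, because multiplying the remainder by \<open>x v\<close> overflows by a multiple of
  the monic \<open>G\<close> only.\<close>

lemma monic_division:
 fixes G::"('v => 'a::field) => 'a poly"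
 assumes v: "v : V" and G: "!!e. pfun (V - {v}) (%x. coeff (G x) e)" "!!x. degree (G x) <= d" "!!x. coeff (G x) d = 1"
  and d: "0 < d" and f: "pfun V f"
 shows "EX R Q. (ALL e. pfun (V - {v}) (%x. coeff (R x) e)) & (ALL x. degree (R x) < d) & pfun V Q & (ALL x. f x = poly (R x) (x v) + poly (G x) (x v)*Q x)"
proof -
 define S where "S = {f. EX R Q. (ALL e. pfun (V - {v}) (%x. coeff (R x) e)) & (ALL x. degree (R x) < d) & pfun V Q &
  (ALL x. f x = poly (R x) (x v) + poly (G x) (x v)*Q x)}"
 have SI: "f : S" if "!!e. pfun (V - {v}) (%x. coeff (R x) e)" "!!x. degree (R x) < d" "pfun V Q" "!!x. f x = poly (R x) (x v) + poly (G x) (x v)*Q x" for f R Q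
  unfolding S_def using that by (intro CollectI exI[of _ R] exI[of _ Q]) auto
 have up: "pfun (V - {v}) h ==> pfun V h" for h using pfun_mono by blast
 have "(%x. h x*f x) : S" if "pfun V h" "f : S" for h f using that
 proof (induction arbitrary: f rule: pfun.induct)
  case (const c)
  then obtain R Q where *: "!!e. pfun (V - {v}) (%x. coeff (R x) e)" "!!x. degree (R x) < d" "pfun V Q"
   "!!x. f x = poly (R x) (x v) + poly (G x) (x v)*Q x" by (auto simp: S_def)
  show ?case by (rule SI[of "%x. smult c (R x)" "%x. c*Q x"]) (use * d in "auto intro!: pfunI simp: algebra_simps")
 next
  case (var w)
  then obtain R Q where *: "!!e. pfun (V - {v}) (%x. coeff (R x) e)" "!!x. degree (R x) < d" "pfun V Q"
   "!!x. f x = poly (R x) (x v) + poly (G x) (x v)*Q x" by (auto simp: S_def)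
  show ?case
  proof (cases "w = v")
   case False
   thus ?thesis using var(1) by (intro SI[of "%x. smult (x w) (R x)" "%x. x w*Q x"]) (use * d in "auto intro!: pfunI simp: algebra_simps")
  next
   case True
   define R' where "R' = (%x. pCons 0 (R x) - smult (coeff (R x) (d-1)) (G x))"
   have "degree (R' x) < d" for x
   proof -
    have "coeff (R' x) e = 0" if e: "e > d-1" for e
    proof (cases "e = d")
     case True
     thus ?thesis using d G(3) by (cases d) (auto simp: R'_def)
    next
     case False
     hence "e > d" using e d by linarith
     hence "coeff (G x) e = 0" "coeff (R x) (e-1) = 0" using G(2)[of x] *(2)[of x] by (auto intro!: coeff_eq_0)
     thus ?thesis using `e > d` by (cases e) (auto simp: R'_def)
    qed
    thus ?thesis using degree_le[of "d-1" "R' x"] d by fastforce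
   qed
   moreover have "pfun (V - {v}) (%x. coeff (R' x) e)" for e unfolding R'_def using * G by (cases e) (auto intro!: pfunI)
   moreover have "pfun V (%x. x v*Q x + coeff (R x) (d-1))" by (rule pfun.add[OF pfun.mult[OF pfun.var[OF v] *(3)] up[OF *(1)]])
   ultimately show ?thesis unfolding True by (intro SI[of R' "%x. x v*Q x + coeff (R x) (d-1)"]) (auto simp: R'_def *(4) algebra_simps)
  qed
 next
  case (add g h)
  from add.IH(1)[OF add.prems] obtain R Q where *: "!!e. pfun (V - {v}) (%x. coeff (R x) e)" "!!x. degree (R x) < d"
   "pfun V Q" "!!x. g x*f x = poly (R x) (x v) + poly (G x) (x v)*Q x" by (auto simp: S_def)
  from add.IH(2)[OF add.prems] obtain R' Q' where **: "!!e. pfun (V - {v}) (%x. coeff (R' x) e)" "!!x. degree (R' x) < d"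
   "pfun V Q'" "!!x. h x*f x = poly (R' x) (x v) + poly (G x) (x v)*Q' x" by (auto simp: S_def)
  show ?case by (rule SI[of "%x. R x + R' x" "%x. Q x + Q' x"]) (use * ** in "auto intro!: pfunI degree_add_less simp: distrib_right distrib_left")
 next
  case (mult g h)
  thus ?case by (simp add: mult.assoc)
 qed
 moreover have "(%_. 1) : S" using d by (intro SI[of "%_. 1" "%_. 0"]) (auto intro!: pfunI)
 ultimately have "f : S" using f by fastforce
 thus ?thesis by (simp add: S_def)
qed

lemma polyideal_mult: "polyideal V I ==> f : I ==> pfun V h ==> (%x. h x*f x) : I" unfolding polyideal_def by blast

text \<open>Arrondo's proof: after a linear change of coordinates the ideal contains a polynomial that is
 monic in one variable, and a zero of the elimination ideal extends to a zero of the ideal.\<close>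

theorem nullstellensatz:
 fixes I::"(('v => 'a::{alg_closed_field,field_char_0}) => 'a) set"
 assumes "finite V" "polyideal V I" "(%_. 1) ~: I"
 shows "EX c. ALL f:I. f c = 0" using assms
proof (induction V arbitrary: I rule: finite_induct)
 case empty
 have "f c = 0" if "f : I" for f c
 proof (rule ccontr)
  assume "f c ~= 0"
  have "inverse (f c)*f x = 1" for x using pfun_cong_on[of "{}" f x c] that empty(1) `f c ~= 0` by (auto simp: polyideal_def)
  moreover have "(%x. inverse (f c)*f x) : I" by (rule polyideal_mult[OF empty(1) that pfun.const])
  ultimately show False using empty(2) by simp
 qed
 thus ?case by blast
next
 case (insert v V')
 let ?V = "insert v V'"
 have V': "?V - {v} = V'" using insert(2) by auto
 show ?case
 proof (cases "ALL f:I. ALL x. f x = 0")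
  case False
  then obtain f0 x0 where f0: "f0 : I" "f0 x0 ~= 0" by blast
  hence "pfun ?V f0" using insert.prems by (auto simp: polyideal_def)
  then obtain a d c where a: "a v ~= 0" "c ~= 0" "pol_in v V' d c (%x. f0 (shear v a x))" using pol_in_shear[of ?V v f0 x0] insert(1) f0(2) V' by auto
  define unshear where "unshear = (%x w. if w = v then x v / a v else x w - a w*(x v / a v))"
  have un: "shear v a (unshear x) = x" "unshear (shear v a x) = x" for x using a(1) by (auto simp: shear_def unshear_def fun_eq_iff)
  have pf_sh: "pfun ?V (%x. shear v a x w)" "pfun ?V (%x. unshear x w)" if "w : ?V" for w
   unfolding shear_def unshear_def divide_inverse using that by (auto intro!: pfunI pfun_if)
  define K where "K = {f. pfun ?V f & (%x. f (unshear x)) : I}"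
  have cmp: "pfun ?V (%x. h (unshear x))" "pfun ?V (%x. h (shear v a x))" if "pfun ?V h" for h
   using pfun_compose[OF that, of ?V "%w x. unshear x w"] pfun_compose[OF that, of ?V "%w x. shear v a x w"] pf_sh by auto
  have K: "polyideal ?V K" unfolding polyideal_def K_def using insert.prems(1) polyideal_mult[OF insert.prems(1) _ cmp(1)] by (auto simp: polyideal_def intro!: pfunI)
  have K1: "(%_. 1) ~: K" using insert.prems(2) by (simp add: K_def)
  have K_add: "(%x. f x + g x) : K" if "f : K" "g : K" for f g using that K by (auto simp: polyideal_def)
  have K_mult: "(%x. h x*f x) : K" if "f : K" "pfun ?V h" for f h using that K by (auto simp: polyideal_def)
  have K_sum: "(%x. SUM i:A. f i x) : K" if "!!i. i : A ==> f i : K" for A and f::"nat => _"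
   using that K by (induction A rule: infinite_finite_induct) (auto simp: polyideal_def)
  have "(%x. f0 (shear v a x)) : K" using cmp(2)[OF `pfun ?V f0`] f0(1) by (simp add: K_def un)
  hence gK: "(%x. inverse c*f0 (shear v a x)) : K" by (intro K_mult pfunI)
  have "pol_in v V' (0+d) (inverse c*c) (%x. inverse c*f0 (shear v a x))" by (intro pol_in_mult pol_in_const a)
  then obtain G where G: "!!e. pfun V' (%x. coeff (G x) e)" "!!x. degree (G x) <= d" "!!x. coeff (G x) d = 1"
   "!!x. inverse c*f0 (shear v a x) = poly (G x) (x v)" using a(2) by (auto simp: pol_in_def)
  have "d ~= 0"
  proof
   assume "d = 0"
   hence "G x = 1" for x using G(2,3)[of x] by (metis degree_0_id le_zero_eq one_pCons)
   thus False using gK K1 unfolding G(4) by simp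
  qed
  hence d: "0 < d" by simp
  have gK: "(%x. poly (G x) (x v)) : K" using gK by (simp add: G(4))
  have "polyideal V' {f : K. pfun V' f}" unfolding polyideal_def using K_add K_mult[OF _ pfun_mono[of V' _ ?V]] K by (auto simp: polyideal_def intro: pfunI)
  from insert.IH[OF this] K1 obtain b where b: "!!f. f : K ==> pfun V' f ==> f b = 0" by auto
  have G_b: "G (b(v := s)) = G b" for s by (rule poly_eqI, rule pfun_cong_on[OF G(1)]) (use insert(2) in auto)
  have line: "EX q. ALL s. h (b(v := s)) = poly q s" if "pfun ?V h" for h
  proof -
   have "(%w. poly (if w = v then [:0,1:] else [:b w:]) s) = b(v := s)" for s by auto
   thus ?thesis using pfun_curve[OF that, of "%w. if w = v then [:0,1:] else [:b w:]"] by simp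
  qed
  define J where "J = {q. EX f:K. ALL s. f (b(v := s)) = poly q s}"
  have J_poly: "EX q:J. ALL s. f (b(v := s)) = poly q s" if f: "f : K" for f
  proof -
   have "pfun ?V f" using f K by (auto simp: polyideal_def)
   then obtain q where "!!s. f (b(v := s)) = poly q s" using line by blast
   thus ?thesis unfolding J_def using f by blast
  qed
  \<comment> \<open>The determinant of multiplication by \<open>f\<close> modulo the monic
    \<open>G\<close> lies in \<open>K\<close> and does not involve \<open>x v\<close>, so it
    vanishes at \<open>b\<close>. If \<open>f\<close> is constantly \<open>u\<close> on the line
    over \<open>b\<close>, this determinant is u^d at \<open>b\<close>.\<close>
  have not1: "[:u:] ~: J" if "u ~= 0" for u
  proof
   assume "[:u:] : J"
   then obtain f where f: "f : K" "!!s. f (b(v := s)) = u" by (auto simp: J_def)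
   hence fV: "pfun ?V f" using K by (auto simp: polyideal_def)
   have "ALL e. EX R Q. (ALL e. pfun V' (%x. coeff (R x) e)) & (ALL x. degree (R x) < d) & pfun ?V Q &
     (ALL x. x v^e*f x = poly (R x) (x v) + poly (G x) (x v)*Q x)"
   proof
    fix e
    have "pfun ?V (%x. x v^e*f x)" using fV by (intro pfunI) auto
    from monic_division[of v ?V G d, unfolded V', OF _ G(1-3) d this]
    show "EX R Q. (ALL e. pfun V' (%x. coeff (R x) e)) & (ALL x. degree (R x) < d) & pfun ?V Q &
     (ALL x. x v^e*f x = poly (R x) (x v) + poly (G x) (x v)*Q x)" by simp
   qed
   then obtain R Q where R: "!!e e'. pfun V' (%x. coeff (R e x) e')" "!!e x. degree (R e x) < d" "!!e. pfun ?V (Q e)"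
    "!!e x. x v^e*f x = poly (R e x) (x v) + poly (G x) (x v)*Q e x" by metis
   define m where "m = (%x. mat d d (%(e,e'). coeff (R e x) e'))"
   have mc: "m x : carrier_mat d d" for x by (simp add: m_def)
   have pfdet: "pfun V' (%x. det (m x))" unfolding m_def by (intro pfun_det R)
   have pfcof: "pfun ?V (%x. cofactor (m x) e 0)" if "e < d" for e
   proof -
    have "mat_delete (m x) e 0 = mat (d-1) (d-1) (%(i,j). coeff (R (if i < e then i else Suc i) x) (Suc j))" for x
     unfolding mat_delete_def m_def using that by (intro eq_matI) auto
    thus ?thesis unfolding cofactor_def using pfun_det[of "d-1" V' "%x i j. coeff (R (if i < e then i else Suc i) x) (Suc j)"] R(1)
     by (auto intro!: pfunI pfun_mono[of V' _ ?V])
   qed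
   \<comment> \<open>Cramer's rule: the cofactors of the first column eliminate all powers of
     \<open>x v\<close> except the zeroth, which exhibits the determinant as an element of
     \<open>K\<close>.\<close>
   have "det (m x) = (SUM e<d. cofactor (m x) e 0*(x v^e*f x + (- Q e x)*poly (G x) (x v)))" for x
   proof -
    have adj: "(SUM e<d. cofactor (m x) e 0*coeff (R e x) e') = (if e' = 0 then det (m x) else 0)" if e': "e' < d" for e'
    proof -
     have "(adj_mat (m x)*m x) $$ (0,e') = (det (m x) \<cdot>\<^sub>m 1\<^sub>m d) $$ (0,e')" using adj_mat(3)[OF mc] by simp
     moreover have "(adj_mat (m x)*m x) $$ (0,e') = (SUM e<d. cofactor (m x) e 0*coeff (R e x) e')"
      using d e' mc[of x] by (simp add: scalar_prod_def adj_mat_def atLeast0LessThan) (simp add: m_def)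
     ultimately show ?thesis using d e' by simp
    qed
    have "(SUM e<d. cofactor (m x) e 0*(x v^e*f x + (- Q e x)*poly (G x) (x v))) = (SUM e<d. cofactor (m x) e 0*poly (R e x) (x v))"
     by (intro sum.cong refl) (simp add: R(4))
    also have "... = (SUM e<d. cofactor (m x) e 0*(SUM e'<d. coeff (R e x) e'*x v^e'))"
    proof (intro sum.cong refl arg_cong2[of _ _ _ _ "(*)"])
     fix e show "poly (R e x) (x v) = (SUM e'<d. coeff (R e x) e'*x v^e')"
      unfolding poly_altdef using R(2)[of e x] by (intro sum.mono_neutral_left) (auto simp: coeff_eq_0)
    qed
    also have "... = (SUM e'<d. (SUM e<d. cofactor (m x) e 0*coeff (R e x) e')*x v^e')"
     unfolding sum_distrib_left sum_distrib_right by (subst sum.swap) (simp add: mult.assoc)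
    also have "... = (SUM e'<d. if e' = 0 then det (m x) else 0)" by (intro sum.cong) (auto simp: adj)
    finally show ?thesis using d by simp
   qed
   moreover have "(%x. SUM e<d. cofactor (m x) e 0*(x v^e*f x + (- Q e x)*poly (G x) (x v))) : K"
    using R(3) by (intro K_sum K_mult K_add f(1) gK pfcof pfunI) auto
   ultimately have "(%x. det (m x)) : K" by simp
   hence "det (m b) = 0" using b pfdet by blast
   moreover have "R e b = monom u e" if e: "e < d" for e
   proof -
    have RB: "R e (b(v := s)) = R e b" for s by (rule poly_eqI, rule pfun_cong_on[OF R(1)]) (use insert(2) in auto)
    obtain q where q: "!!s. Q e (b(v := s)) = poly q s" using line[OF R(3)] by blast
    have "poly (monom u e) s = poly (R e b + G b*q) s" for s using R(4)[where e = e and x = "b(v := s)"] unfolding RB G_b by (simp add: q f(2) poly_monom mult.commute)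
    hence eq: "monom u e = R e b + G b*q" by (intro poly_ext) simp
    have "q = 0"
    proof (rule ccontr)
     assume "q ~= 0"
     have "degree (G b) = d" using G(2,3)[of b] by (metis le_degree le_antisym zero_neq_one)
     hence "degree (G b*q) >= d" using `q ~= 0` d by (subst degree_mult_eq) auto
     moreover have "G b*q = monom u e - R e b" using eq by simp
     hence "degree (G b*q) < d" using degree_diff_less[of "monom u e" d "R e b"] degree_monom_le[of u e] e R(2)[of e b] by auto
     ultimately show False by simp
    qed
    with eq show ?thesis by simp
   qed
   hence "m b = u \<cdot>\<^sub>m 1\<^sub>m d" unfolding m_def by (intro eq_matI) auto
   ultimately show False using `u ~= 0` by simp
  qed
  have "EX q:J. q ~= 0"
  proof -
   obtain q where q: "q : J" "!!s. poly (G (b(v := s))) s = poly q s" using J_poly[OF gK] by auto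
   hence "q = G b" by (intro poly_ext) (simp add: G_b)
   thus ?thesis using q(1) G(3)[of b] by (metis coeff_0 zero_neq_one)
  qed
  then obtain q1 where q1: "q1 : J & q1 ~= 0" by blast
  define q where "q = arg_min degree (%q. q : J & q ~= 0)"
  have q: "q : J" "q ~= 0" and min: "!!x. x : J ==> x ~= 0 ==> degree q <= degree x"
   using arg_min_nat_lemma[of "%q. q : J & q ~= 0", OF q1, of degree] unfolding q_def by auto
  have "degree q ~= 0" using not1 q by (metis degree_eq_zeroE pCons_0_0)
  then obtain s where s: "poly q s = 0" using alg_closed_imp_poly_has_root by blast
  have "f (b(v := s)) = 0" if fK: "f : K" for f
  proof -
   obtain h where h: "h : J" "!!s. f (b(v := s)) = poly h s" using J_poly[OF fK] by blast
   obtain fq where fq: "fq : K" "!!s. fq (b(v := s)) = poly q s" using q(1) by (auto simp: J_def)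
   have "pfun ?V (%x. poly (- (h div q)) (x v))" unfolding poly_altdef by (intro pfunI) auto
   hence "(%x. poly (- (h div q)) (x v)*fq x + f x) : K" by (intro K_add K_mult fq fK)
   moreover have "poly h t = poly (h div q) t*poly q t + poly (h mod q) t" for t by (metis div_mult_mod_eq poly_add poly_mult)
   ultimately have "h mod q : J" unfolding J_def using fq(2) h(2) by (intro CollectI bexI[of _ "%x. poly (- (h div q)) (x v)*fq x + f x"]) auto
   hence "h mod q = 0" using min[of "h mod q"] degree_mod_less[OF q(2), of h] by linarith
   hence "poly h s = 0" using s by (metis dvdE mod_0_imp_dvd mult_zero_left poly_mult)
   thus ?thesis by (simp add: h(2))
  qed
  moreover have "(%x. f (shear v a x)) : K" if "f : I" for f using that insert.prems(1) cmp(2)[of f] by (simp add: K_def un polyideal_def)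
  ultimately have "f (shear v a (b(v := s))) = 0" if "f : I" for f using that by blast
  thus ?thesis by blast
 qed auto
qed

section \<open>Finite extensions of polynomial rings\<close>

lemma homogeneous_system:
 fixes C::"'e => 'b => 'a::field"
 assumes "finite B" "finite E" "card B < card E"
 shows "EX d. (EX e:E. d e ~= 0) & (ALL al:B. (SUM e:E. d e*C e al) = 0)" using assms
proof (induction B arbitrary: E C rule: finite_induct)
 case empty
 then obtain e where "e : E" by (metis card.empty ex_in_conv less_irrefl)
 thus ?case by (intro exI[of _ "%_. 1"]) auto
next
 case (insert al0 B)
 show ?case
 proof (cases "ALL e:E. C e al0 = 0")
  case True
  then obtain d where "EX e:E. d e ~= 0" "ALL al:B. (SUM e:E. d e*C e al) = 0" using insert.IH[of E C] insert.prems insert.hyps by auto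
  with True show ?thesis by (intro exI[of _ d]) auto
 next
  case False
  then obtain e0 where e0: "e0 : E" "C e0 al0 ~= 0" by blast
  let ?E = "E - {e0}"
  define C' where "C' = (%e al. C e al - C e al0 / C e0 al0*C e0 al)"
  have "card B < card ?E" using insert e0 by simp
  then obtain d where d: "EX e:?E. d e ~= 0" "ALL al:B. (SUM e:?E. d e*C' e al) = 0" using insert.IH[of ?E C'] insert.prems by auto
  define D where "D = (%e. if e = e0 then - (SUM e:?E. d e*(C e al0 / C e0 al0)) else d e)"
  have sum: "(SUM e:E. D e*C e al) = (SUM e:?E. d e*C' e al)" for al
  proof -
   have "(SUM e:E. D e*C e al) = D e0*C e0 al + (SUM e:?E. d e*C e al)" using e0 insert.prems by (subst sum.remove[of _ e0]) (auto simp: D_def intro!: sum.cong)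
   also have "D e0*C e0 al = - (SUM e:?E. d e*(C e al0 / C e0 al0*C e0 al))" by (simp add: D_def sum_distrib_right mult.assoc)
   finally show ?thesis by (simp add: C'_def algebra_simps sum_subtractf)
  qed
  have "(SUM e:E. D e*C e al0) = 0" unfolding sum C'_def using e0 by simp
  moreover have "EX e:E. D e ~= 0" using d(1) by (auto simp: D_def)
  ultimately show ?thesis using d(2) sum by (intro exI[of _ D]) auto
 qed
qed

lemma pfun_taylor:
 assumes "finite J" "pfun J h"
 shows "EX G. (ALL j. pfun J (G j)) & (ALL z. h z = h l + (SUM j:J. (z j - l j)*G j z))" using assms(2)
proof (induction rule: pfun.induct)
 case (const c)
 show ?case by (intro exI[of _ "%_ _. 0"]) (auto intro: pfunI)
next
 case (var v)
 thus ?case using assms(1) by (intro exI[of _ "%j _. if j = v then 1 else 0"]) (auto intro: pfunI simp: if_distrib cong: if_cong)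
next
 case (add f g)
 then obtain F G where *: "ALL j. pfun J (F j)" "!!z. f z = f l + (SUM j:J. (z j - l j)*F j z)"
  "ALL j. pfun J (G j)" "!!z. g z = g l + (SUM j:J. (z j - l j)*G j z)" by blast
 have "f z + g z = f l + g l + (SUM j:J. (z j - l j)*(F j z + G j z))" for z using *(2)[of z] *(4)[of z] by (simp add: distrib_left sum.distrib)
 moreover have "pfun J (%z. F j z + G j z)" for j using * by (intro pfunI) auto
 ultimately show ?case by (intro exI[of _ "%j z. F j z + G j z"]) blast
next
 case (mult f g)
 then obtain F G where *: "ALL j. pfun J (F j)" "!!z. f z = f l + (SUM j:J. (z j - l j)*F j z)"
  "ALL j. pfun J (G j)" "!!z. g z = g l + (SUM j:J. (z j - l j)*G j z)" by blast
 have "f z*g z = f l*g l + (SUM j:J. (z j - l j)*(F j z*g z + f l*G j z))" for z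
 proof -
  have "(SUM j:J. (z j - l j)*(F j z*g z + f l*G j z)) = (SUM j:J. (z j - l j)*F j z)*g z + f l*(SUM j:J. (z j - l j)*G j z)"
   unfolding sum_distrib_left sum_distrib_right sum.distrib[symmetric] by (intro sum.cong) (simp_all add: algebra_simps)
  also have "... = (f z - f l)*g z + f l*(g z - g l)" using *(2)[of z] *(4)[of z] by simp
  finally show ?thesis by (simp add: algebra_simps)
 qed
 moreover have "pfun J (%z. F j z*g z + f l*G j z)" for j using *(1,3) mult.hyps by (intro pfunI) auto
 ultimately show ?case by (intro exI[of _ "%j z. F j z*g z + f l*G j z"]) blast
qed

section \<open>Monomials in part of the variables and integral dependence\<close>

definition pmon::"nat set => (nat => nat) => (nat => 'a) => 'a::comm_semiring_1" where "pmon P al x = (PROD i:P. x i^al i)"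

text \<open>Exponents are forced to be 0 outside \<open>P\<close>, so that each monomial has one
  representative and the set is finite.\<close>

definition Box::"nat set => nat => (nat => nat) set" where "Box P M = {al. (ALL i. i ~: P --> al i = 0) & sum al P < M}"

lemma finite_Box: "finite P ==> finite (Box P M)"
proof -
 assume P: "finite P"
 have "Box P M <= {al. ALL i. (i : P --> al i : {..<M}) & (i ~: P --> al i = 0)}"
 proof
  fix al assume a: "al : Box P M"
  have "al i < M" if "i : P" for i using member_le_sum[of i P al] that P a by (auto simp: Box_def)
  with a show "al : {al. ALL i. (i : P --> al i : {..<M}) & (i ~: P --> al i = 0)}" by (auto simp: Box_def)
 qed
 moreover have "finite {al. ALL i. (i : P --> al i : {..<M}) & (i ~: P --> al i = (0::nat))}" using P by (intro finite_set_of_finite_funs) auto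
 ultimately show ?thesis by (rule finite_subset)
qed

lemma pmon_Suc:
 assumes "finite P" "i : P"
 shows "pmon P (al(i := Suc (al i))) x = x i*pmon P al x"
proof -
 have "pmon P (al(i := Suc (al i))) x = x i^Suc (al i)*(PROD j:P - {i}. x j^al j)"
  unfolding pmon_def using assms by (subst prod.remove[of _ i]) (auto intro!: prod.cong)
 also have "... = x i*pmon P al x" unfolding pmon_def using assms by (subst (2) prod.remove[of _ i]) (auto simp: mult.assoc)
 finally show ?thesis .
qed

lemma sum_fun_upd_Suc:
 assumes "finite P" "i : P"
 shows "sum (al(i := Suc (al i))) P = Suc (sum al P)" using assms by (subst (1 2) sum.remove[of _ i]) (auto intro!: sum.cong)

text \<open>\<open>reprs Y P M J Z\<close>: functions which on \<open>Y\<close> are combinations of the monomials in \<open>Box P M\<close> with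
 coefficients that are polynomials in the functions \<open>Z j\<close>.\<close>

definition reprs::"(nat => 'a) set => nat set => nat => nat set => (nat => 'a fn) => ((nat => 'a) => 'a::comm_ring_1) set" where
 "reprs Y P M J Z = {h. EX c. (ALL al. pfun J (c al)) & (ALL y:Y. h y = (SUM al:Box P M. c al (%j. Z j y)*pmon P al y))}"

text \<open>An integral extension in terms of functions on \<open>Y\<close>: the coordinates outside
  \<open>P\<close> are among the \<open>Z j\<close>, and it is enough to rewrite the monomials in
  \<open>P\<close> of degree exactly \<open>M\<close>, since multiplication by a coordinate raises
  the degree by one.\<close>

locale finite_reduction =
 fixes V P J::"nat set" and Y::"(nat => 'a::{alg_closed_field,field_char_0}) set"
  and Z::"nat => 'a fn" and M::nat
 assumes fin: "finite V" "P <= V" "finite J" and M: "M > 0"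
  and Z: "!!j. j : J ==> pfun V (Z j)"
  and vars: "!!v. v : V ==> v ~: P ==> EX j:J. ALL x. Z j x = x v"
  and red: "!!be. sum be P = M ==> pmon P be : reprs Y P M J Z"
begin

abbreviation "R == reprs Y P M J Z"

lemma finP: "finite P" using fin finite_subset by blast
lemma repr_cong: "f : R ==> (!!y. y : Y ==> f y = g y) ==> g : R" unfolding reprs_def by auto

lemma repr_add: "f : R ==> g : R ==> (%y. f y + g y) : R"
proof -
 assume "f : R" "g : R"
 then obtain c d where "ALL al. pfun J (c al)" "ALL y:Y. f y = (SUM al:Box P M. c al (%j. Z j y)*pmon P al y)"
  "ALL al. pfun J (d al)" "ALL y:Y. g y = (SUM al:Box P M. d al (%j. Z j y)*pmon P al y)" by (auto simp: reprs_def)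
 thus ?thesis unfolding reprs_def by (intro CollectI exI[of _ "%al z. c al z + d al z"]) (auto intro: pfunI simp: algebra_simps sum.distrib)
qed

lemma repr_scale: "f : R ==> pfun J h ==> (%y. h (%j. Z j y)*f y) : R"
proof -
 assume "f : R" "pfun J h"
 then obtain c where "ALL al. pfun J (c al)" "ALL y:Y. f y = (SUM al:Box P M. c al (%j. Z j y)*pmon P al y)" by (auto simp: reprs_def)
 with `pfun J h` show ?thesis unfolding reprs_def
  by (intro CollectI exI[of _ "%al z. h z*c al z"]) (auto intro: pfunI simp: sum_distrib_left mult.assoc)
qed

lemma repr_zero: "(%y. 0) : R" unfolding reprs_def by (intro CollectI exI[of _ "%_ _. 0"]) (auto intro: pfunI)
lemma repr_sum: "(!!i. i : A ==> f i : R) ==> (%y. SUM i:A. f i y) : R" by (induction A rule: infinite_finite_induct) (auto intro: repr_add repr_zero)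

lemma repr_pmon: "al : Box P M ==> pmon P al : R" unfolding reprs_def using finite_Box[OF finP, of M] by (intro CollectI exI[of _ "%be _. if be = al then 1 else 0"])
  (auto intro: pfunI simp: if_distrib[of "%x. x*_"] cong: if_cong)

lemma repr_var: assumes "f : R" "v : V" shows "(%y. y v*f y) : R"
proof (cases "v : P")
 case False
 then obtain j where "j : J" "ALL x. Z j x = x v" using vars assms by blast
 thus ?thesis using repr_scale[OF assms(1) pfun.var[of j J]] by simp
next
 case True
 obtain c where c: "ALL al. pfun J (c al)" "ALL y:Y. f y = (SUM al:Box P M. c al (%j. Z j y)*pmon P al y)" using assms(1) by (auto simp: reprs_def)
 have "(%y. SUM al:Box P M. c al (%j. Z j y)*pmon P (al(v := Suc (al v))) y) : R"
 proof (intro repr_sum repr_scale)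
  fix al assume al: "al : Box P M"
  show "pfun J (c al)" using c by simp
  have s: "sum (al(v := Suc (al v))) P = Suc (sum al P)" by (rule sum_fun_upd_Suc[OF finP True])
  show "pmon P (al(v := Suc (al v))) : R"
  proof (cases "Suc (sum al P) < M")
   case True
   thus ?thesis using al s `v : P` by (intro repr_pmon) (auto simp: Box_def)
  next
   case False
   thus ?thesis using al s by (intro red) (auto simp: Box_def)
  qed
 qed
 thus ?thesis by (rule repr_cong) (auto simp: c(2) pmon_Suc[OF finP True] sum_distrib_left mult.left_commute)
qed

lemma repr_one: "(%_. 1) : R" using repr_pmon[of "%_. 0"] M by (simp add: Box_def pmon_def[abs_def])

lemma repr_pfun_mult: "pfun V h ==> f : R ==> (%y. h y*f y) : R"
proof (induction arbitrary: f rule: pfun.induct)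
 case (const c)
 thus ?case using repr_scale[of f "%_. c"] by (auto intro: pfunI)
next
 case (var v)
 thus ?case by (rule repr_var[rotated])
next
 case (add g h)
 hence "(%y. g y*f y + h y*f y) : R" by (intro repr_add) auto
 thus ?case by (simp add: algebra_simps)
next
 case (mult g h)
 thus ?case by (simp add: mult.assoc)
qed

lemma repr_pfun: "pfun V h ==> h : R" using repr_pfun_mult[OF _ repr_one, of h] by simp

text \<open>The ideal of the fibre over \<open>l\<close>. Requiring the identity on \<open>Y\<close>
  only puts the functions vanishing on \<open>Y\<close> into it.\<close>

definition ideal_at::"(nat => 'a) => ('a fn) set" where
 "ideal_at l = {f. pfun V f & (EX G. (ALL j. pfun V (G j)) & (ALL y:Y. f y = (SUM j:J. (Z j y - l j)*G j y)))}"

lemma polyideal_ideal_at: "polyideal V (ideal_at l)" unfolding polyideal_def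
proof (intro conjI ballI allI impI)
 fix f assume "f : ideal_at l" thus "pfun V f" by (simp add: ideal_at_def)
next
 show "(%_. 0) : ideal_at l" unfolding ideal_at_def by (intro CollectI conjI exI[of _ "%_ _. 0"]) (auto intro: pfunI)
next
 fix f g assume "f : ideal_at l" "g : ideal_at l"
 then obtain F G where "pfun V f" "ALL j. pfun V (F j)" "ALL y:Y. f y = (SUM j:J. (Z j y - l j)*F j y)"
  "pfun V g" "ALL j. pfun V (G j)" "ALL y:Y. g y = (SUM j:J. (Z j y - l j)*G j y)" by (auto simp: ideal_at_def)
 thus "(%x. f x + g x) : ideal_at l" unfolding ideal_at_def by (intro CollectI conjI exI[of _ "%j y. F j y + G j y"]) (auto intro: pfunI simp: distrib_left sum.distrib)
next
 fix f h::"'a fn" assume "f : ideal_at l" and h: "pfun V h"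
 then obtain F where "pfun V f" "ALL j. pfun V (F j)" "ALL y:Y. f y = (SUM j:J. (Z j y - l j)*F j y)" by (auto simp: ideal_at_def)
 with h show "(%x. h x*f x) : ideal_at l" unfolding ideal_at_def by (intro CollectI conjI exI[of _ "%j y. h y*F j y"])
   (auto intro: pfunI simp: sum_distrib_left mult.left_commute)
qed

lemma coefficients_vanish_imp_ideal_at:
 assumes "pfun V f" "!!al. pfun J (c al)" "!!al. al : Box P M ==> c al l = 0"
  and "!!y. y : Y ==> f y = (SUM al:Box P M. c al (%j. Z j y)*pmon P al y)"
 shows "f : ideal_at l"
proof -
 obtain G where G: "!!al j. pfun J (G al j)" "!!al z. c al z = c al l + (SUM j:J. (z j - l j)*G al j z)" using pfun_taylor[OF fin(3) assms(2), of _ l] by metis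
 have GV: "pfun V (%y. G al j (%j. Z j y))" for al j using pfun_compose[OF G(1) Z] .
 have pm: "pfun V (pmon P al)" for al using fin(2) unfolding pmon_def[abs_def] by (intro pfunI) auto
 have "f y = (SUM j:J. (Z j y - l j)*(SUM al:Box P M. G al j (%j. Z j y)*pmon P al y))" if "y : Y" for y
 proof -
  have "f y = (SUM al:Box P M. (SUM j:J. (Z j y - l j)*G al j (%j. Z j y))*pmon P al y)" unfolding assms(4)[OF that]
  proof (rule sum.cong[OF refl])
   fix al assume "al : Box P M"
   thus "c al (%j. Z j y)*pmon P al y = (SUM j:J. (Z j y - l j)*G al j (%j. Z j y))*pmon P al y" using G(2)[of al "%j. Z j y"] assms(3) by simp
  qed
  also have "... = (SUM j:J. (Z j y - l j)*(SUM al:Box P M. G al j (%j. Z j y)*pmon P al y))"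
   unfolding sum_distrib_left sum_distrib_right by (subst sum.swap) (simp add: mult.assoc)
  finally show ?thesis .
 qed
 thus ?thesis unfolding ideal_at_def using assms(1) by (intro CollectI conjI exI[of _ "%j y. SUM al:Box P M. G al j (%j. Z j y)*pmon P al y"])
   (auto intro!: pfunI GV pm)
qed

text \<open>The powers of a coordinate up to exponent \<open>card ?B\<close> have one coefficient
  vector each, one more than the number of entries. A linear relation between these vectors at
  \<open>l\<close> is the polynomial \<open>q\<close>. Hence the fibres are finite.\<close>

lemma coordinate_algebraic:
 assumes "v : V"
 shows "EX q. q ~= 0 & (%x. poly q (x v)) : ideal_at l"
proof -
 let ?B = "Box P M"
 have "ALL e. EX c. (ALL al. pfun J (c al)) & (ALL y:Y. y v^e = (SUM al:?B. c al (%j. Z j y)*pmon P al y))"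
 proof
  fix e have "(%y. y v^e) : R" using assms by (intro repr_pfun pfunI)
  thus "EX c. (ALL al. pfun J (c al)) & (ALL y:Y. y v^e = (SUM al:?B. c al (%j. Z j y)*pmon P al y))" by (auto simp: reprs_def)
 qed
 then obtain c where c: "!!e al. pfun J (c e al)" "!!e y. y : Y ==> y v^e = (SUM al:?B. c e al (%j. Z j y)*pmon P al y)" by metis
 obtain d where d: "EX e:{..card ?B}. d e ~= 0" "ALL al:?B. (SUM e<=card ?B. d e*c e al l) = 0"
  using homogeneous_system[of ?B "{..card ?B}" "%e al. c e al l"] finite_Box[OF finP] by auto
 define q where "q = (SUM e<=card ?B. monom (d e) e)"
 have "coeff q e = d e" if "e <= card ?B" for e using that by (simp add: q_def coeff_sum)
 hence "q ~= 0" using d(1) by fastforce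
 have q: "poly q t = (SUM e<=card ?B. d e*t^e)" for t by (simp add: q_def poly_sum poly_monom)
 have "(%x. poly q (x v)) : ideal_at l"
 proof (rule coefficients_vanish_imp_ideal_at)
  show "pfun V (%x. poly q (x v))" unfolding q using assms by (intro pfunI)
  show "pfun J (%z. SUM e<=card ?B. d e*c e al z)" for al by (intro pfunI c)
  show "(SUM e<=card ?B. d e*c e al l) = 0" if "al : ?B" for al using d that by blast
  fix y assume y: "y : Y"
  have "poly q (y v) = (SUM e<=card ?B. SUM al:?B. d e*c e al (%j. Z j y)*pmon P al y)" unfolding q by (simp add: c(2)[OF y] sum_distrib_left mult.assoc)
  also have "... = (SUM al:?B. (SUM e<=card ?B. d e*c e al (%j. Z j y))*pmon P al y)" by (subst sum.swap) (simp add: sum_distrib_right)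
  finally show "poly q (y v) = (SUM al:?B. (SUM e<=card ?B. d e*c e al (%j. Z j y))*pmon P al y)" .
 qed
 with `q ~= 0` show ?thesis by blast
qed

text \<open>Lying over: the second alternative comes from the determinant trick.\<close>

theorem point_or_relation: "(EX c. (ALL f. pfun V f --> (ALL y:Y. f y = 0) --> f c = 0) & (ALL j:J. Z j c = l j)) |
  (EX g. pfun J g & g l ~= 0 & (ALL y:Y. g (%j. Z j y) = 0))"
proof (cases "(%_. 1) : ideal_at l")
 case False
 then obtain c where c: "ALL f:ideal_at l. f c = 0" using nullstellensatz[OF fin(1) polyideal_ideal_at] by blast
 have 1: "f : ideal_at l" if "pfun V f" "ALL y:Y. f y = 0" for f unfolding ideal_at_def using that by (intro CollectI conjI exI[of _ "%_ _. 0"]) (auto intro: pfunI)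
 have 2: "(%x. Z j x - l j) : ideal_at l" if "j : J" for j unfolding ideal_at_def using that fin(3) Z[OF that]
  by (intro CollectI conjI exI[of _ "%i _. if i = j then 1 else 0"]) (auto intro!: pfunI simp: if_distrib cong: if_cong)
 have "f c = 0" if "pfun V f" "ALL y:Y. f y = 0" for f using c 1[OF that] by blast
 moreover have "Z j c = l j" if "j : J" for j using bspec[OF c 2[OF that]] by simp
 ultimately show ?thesis by blast
next
 case True
 then obtain G where G: "!!j. pfun V (G j)" "!!y. y : Y ==> 1 = (SUM j:J. (Z j y - l j)*G j y)" by (auto simp: ideal_at_def)
 let ?B = "Box P M"
 have "ALL j al. EX c. (ALL be. pfun J (c be)) & (ALL y:Y. G j y*pmon P al y = (SUM be:?B. c be (%j. Z j y)*pmon P be y))"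
 proof (intro allI)
  fix j al
  have "pfun V (pmon P al)" using fin(2) unfolding pmon_def[abs_def] by (intro pfunI) auto
  hence "(%y. G j y*pmon P al y) : R" by (intro repr_pfun pfunI G)
  thus "EX c. (ALL be. pfun J (c be)) & (ALL y:Y. G j y*pmon P al y = (SUM be:?B. c be (%j. Z j y)*pmon P be y))" by (auto simp: reprs_def)
 qed
 then obtain c where c: "!!j al be. pfun J (c j al be)" "!!j al y. y : Y ==> G j y*pmon P al y = (SUM be:?B. c j al be (%j. Z j y)*pmon P be y)" by metis
 obtain bs where bs: "set bs = ?B" "distinct bs" using finite_distinct_list[OF finite_Box[OF finP]] by blast
 define n where "n = length bs"
 define N where "N = (%al be z. SUM j:J. (z j - l j)*c j al be z)"
 \<comment> \<open>Multiplication by 1, written as an element of the ideal, has the matrix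
   \<open>N\<close>, so the vector of monomials lies in the kernel of \<open>A\<close>. One of its
   entries is the monomial 1, which makes the determinant vanish on \<open>Y\<close>; at
   \<open>l\<close> the matrix \<open>N\<close> is 0 and \<open>A\<close> is the identity.\<close>
 define A where "A = (%z. mat n n (%(a,b). (if a = b then 1 else 0) - N (bs ! a) (bs ! b) z))"
 define g where "g = (%z. det (A z))"
 have "pfun J g" unfolding g_def A_def N_def by (intro pfun_det pfunI c)
 moreover have "g l = 1"
 proof -
  have "A l = 1\<^sub>m n" unfolding A_def N_def by (intro eq_matI) auto
  thus ?thesis by (simp add: g_def)
 qed
 moreover have "g (%j. Z j y) = 0" if y: "y : Y" for y
 proof -
  let ?z = "%j. Z j y"
  define v where "v = vec n (%b. pmon P (bs ! b) y)"
  have "(%_. 0) : ?B" using M by (simp add: Box_def)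
  then obtain b0 where b0: "b0 < n" "bs ! b0 = (%_. 0)" using bs by (metis in_set_conv_nth n_def)
  have "v $ b0 ~= 0" using b0 by (simp add: v_def pmon_def)
  hence "v ~= 0\<^sub>v n" using b0 by auto
  moreover have "A ?z *\<^sub>v v = 0\<^sub>v n"
  proof (rule eq_vecI)
   fix a assume "a < dim_vec (0\<^sub>v n::'a vec)"
   hence a: "a < n" by simp
   have eq: "pmon P (bs ! a) y = (SUM b<n. N (bs ! a) (bs ! b) ?z*pmon P (bs ! b) y)"
   proof -
    have "pmon P (bs ! a) y = (SUM j:J. (Z j y - l j)*G j y)*pmon P (bs ! a) y" using G(2)[OF y] by simp
    also have "... = (SUM j:J. (Z j y - l j)*(SUM be:?B. c j (bs ! a) be ?z*pmon P be y))"
     unfolding sum_distrib_right by (intro sum.cong) (auto simp: mult.assoc c(2)[OF y])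
    also have "... = (SUM be:?B. N (bs ! a) be ?z*pmon P be y)" unfolding N_def sum_distrib_left sum_distrib_right by (subst sum.swap) (simp add: mult.assoc)
    also have "... = (SUM b<n. N (bs ! a) (bs ! b) ?z*pmon P (bs ! b) y)"
     by (rule sum.reindex_bij_betw[symmetric]) (use bs in "simp add: n_def bij_betw_nth")
    finally show ?thesis .
   qed
   have "(A ?z *\<^sub>v v) $ a = (SUM b<n. ((if a = b then 1 else 0) - N (bs ! a) (bs ! b) ?z)*pmon P (bs ! b) y)"
    using a by (simp add: A_def v_def scalar_prod_def atLeast0LessThan)
   also have "... = (SUM b<n. if a = b then pmon P (bs ! b) y else 0)-(SUM b<n. N (bs ! a) (bs ! b) ?z*pmon P (bs ! b) y)"
    unfolding sum_subtractf[symmetric] by (intro sum.cong) (auto simp: algebra_simps)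
   also have "... = 0" using a eq by simp
   finally show "(A ?z *\<^sub>v v) $ a = 0\<^sub>v n $ a" using a by simp
  qed (simp add: A_def)
  ultimately show ?thesis unfolding g_def using det_0_iff_vec_prod_zero[of "A ?z" n] unfolding A_def v_def by (metis (no_types, lifting) mat_carrier vec_carrier)
 qed
 ultimately show ?thesis by (intro disjI2 exI[of _ g]) auto
qed

end

section \<open>Spaces of functions\<close>

interpretation fs: vector_space "%(c::'a::field) (f::'p => 'a) x. c*f x" by unfold_locales (auto simp: fun_eq_iff algebra_simps)

lemma fs_span_mult:
 assumes "f : fs.span S" "!!g. g : S ==> (%x. u x*g x) : fs.span T"
 shows "(%x. u x*f x) : fs.span T"
proof -
 show ?thesis
 proof (rule fs.span_induct[where P = "%f. (%x. u x*f x) : fs.span T", OF assms(1)])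
  show "fs.subspace {f. (%x. u x*f x) : fs.span T}"
  proof (rule fs.subspaceI)
   show "0 : {f. (%x. u x*f x) : fs.span T}" using fs.span_zero[of T] by (simp add: zero_fun_def)
  next
   fix f g assume "f : {f. (%x. u x*f x) : fs.span T}" "g : {f. (%x. u x*f x) : fs.span T}"
   hence "(%x. u x*f x)+(%x. u x*g x) : fs.span T" by (intro fs.span_add) auto
   thus "f + g : {f. (%x. u x*f x) : fs.span T}" by (simp add: plus_fun_def distrib_left)
  next
   fix c f assume "f : {f. (%x. u x*f x) : fs.span T}"
   hence "(%x. c*(u x*f x)) : fs.span T" by (intro fs.span_scale) auto
   thus "(%x. c*f x) : {f. (%x. u x*f x) : fs.span T}" by (simp add: mult.left_commute)
  qed
 qed (use assms(2) in auto)
qed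

lemma fs_span_add: "f : fs.span S ==> g : fs.span S ==> (%x. f x + g x) : fs.span S" using fs.span_add[of f S g] by (simp add: plus_fun_def)
lemma fs_span_zero: "(%x. 0) : fs.span S" using fs.span_zero[of S] by (simp add: zero_fun_def)

lemma fs_span_sum: "(!!i. i : A ==> f i : fs.span S) ==> (%x. SUM i:A. f i x) : fs.span S"
 by (induction A rule: infinite_finite_induct) (auto intro: fs_span_add fs_span_zero)

definition span_on::"'p set => ('p => 'a::field) set => ('p => 'a) set" where "span_on Y S = {h. EX g:fs.span S. ALL y:Y. h y = g y}"

lemma span_on_base: "f : S ==> f : span_on Y S" unfolding span_on_def using fs.span_base by blast
lemma span_on_cong: "f : span_on Y S ==> (!!y. y : Y ==> f y = g y) ==> g : span_on Y S" unfolding span_on_def by auto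
lemma span_on_zero: "(%_. 0) : span_on Y S" unfolding span_on_def using fs_span_zero by fastforce
lemma span_on_add: "f : span_on Y S ==> g : span_on Y S ==> (%x. f x + g x) : span_on Y S" unfolding span_on_def using fs_span_add by fastforce
lemma span_on_scale: "f : span_on Y S ==> (%x. c*f x) : span_on Y S" unfolding span_on_def using fs.span_scale by fastforce

lemma span_on_sum: "(!!i. i : A ==> f i : span_on Y S) ==> (%x. SUM i:A. f i x) : span_on Y S"
 by (induction A rule: infinite_finite_induct) (auto intro: span_on_add span_on_zero)

lemma span_on_mult:
 assumes "f : span_on Y S" "!!g. g : S ==> (%x. u x*g x) : span_on Y T"
 shows "(%x. u x*f x) : span_on Y T"
proof -
 obtain g where g: "g : fs.span S" "ALL y:Y. f y = g y" using assms(1) by (auto simp: span_on_def)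
 have "(%x. u x*g x) : span_on Y T"
 proof (rule fs.span_induct[where P = "%g. (%x. u x*g x) : span_on Y T", OF g(1)])
  show "fs.subspace {g. (%x. u x*g x) : span_on Y T}"
  proof (rule fs.subspaceI)
   show "0 : {g. (%x. u x*g x) : span_on Y T}" using span_on_zero by (simp add: zero_fun_def)
   show "f + g : {g. (%x. u x*g x) : span_on Y T}"
    if "f : {g. (%x. u x*g x) : span_on Y T}" "g : {g. (%x. u x*g x) : span_on Y T}" for f g using span_on_add[of _ Y T] that by (simp add: plus_fun_def distrib_left)
   show "(%x. c*f x) : {g. (%x. u x*g x) : span_on Y T}"
    if "f : {g. (%x. u x*g x) : span_on Y T}" for c f using span_on_scale[of _ Y T c] that by (simp add: mult.left_commute)
  qed
 qed (use assms(2) in auto)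
 thus ?thesis using g(2) by (auto intro: span_on_cong)
qed

lemma span_on_trans:
 assumes "f : span_on Y S" "!!g. g : S ==> g : span_on Y T"
 shows "f : span_on Y T" using span_on_mult[OF assms(1), of "%_. 1" T] assms(2) by simp

lemma span_on_mono: "S <= T ==> span_on Y S <= span_on Y T" using span_on_trans span_on_base by blast
lemma sum_fun_apply: "(SUM s:S. f s) y = (SUM s:S. f s y)" by (induction S rule: infinite_finite_induct) auto

lemma card_le_if_independent_on:
 fixes f::"'i => 'p => 'a::field"
 assumes "finite I" "finite S" "!!i. i : I ==> f i : span_on Y S"
  and indep: "!!d. (!!y. y : Y ==> (SUM i:I. d i*f i y) = 0) ==> ALL i:I. d i = 0"
 shows "card I <= card S"
proof (rule ccontr)
 assume less: "~ ?thesis"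
 have "ALL i:I. EX C. ALL y:Y. f i y = (SUM s:S. C s*s y)"
 proof
  fix i assume "i : I"
  then obtain g where "g : fs.span S" "ALL y:Y. f i y = g y" using assms(3) by (auto simp: span_on_def)
  then obtain C where "g = (SUM s:S. (%x. C s*s x))" using fs.span_finite[OF assms(2)] by auto
  hence "g y = (SUM s:S. C s*s y)" for y by (simp add: sum_fun_apply)
  with `ALL y:Y. f i y = g y` show "EX C. ALL y:Y. f i y = (SUM s:S. C s*s y)" by auto
 qed
 then obtain C where C: "!!i y. i : I ==> y : Y ==> f i y = (SUM s:S. C i s*s y)" by metis
 obtain d where d: "EX i:I. d i ~= 0" "ALL s:S. (SUM i:I. d i*C i s) = 0" using homogeneous_system[of S I C] assms(1,2) less by auto
 have "(SUM i:I. d i*f i y) = 0" if "y : Y" for y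
 proof -
  have "(SUM i:I. d i*f i y) = (SUM i:I. SUM s:S. d i*C i s*s y)" using C that by (simp add: sum_distrib_left mult.assoc)
  also have "... = (SUM s:S. (SUM i:I. d i*C i s)*s y)" by (subst sum.swap) (simp add: sum_distrib_right)
  finally show ?thesis using d by simp
 qed
 thus False using indep d by blast
qed

text \<open>Refutes polynomial growth of order q + 1 under a bound of order q; both uses compare
  numbers of independent functions with numbers of monomials.\<close>

lemma power_growth_contradiction:
 fixes C c q::nat
 assumes "!!s. (s+1)^Suc q <= C*(c*s + 1)^q"
 shows False
proof -
 define c' where "c' = max c 1"
 define s where "s = C*c'^q"
 have "(c*s + 1) <= c'*(s+1)" unfolding c'_def by (auto simp: max_def algebra_simps)
 hence "C*(c*s + 1)^q <= C*(c'*(s+1))^q" by (intro mult_left_mono power_mono) auto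
 with assms[of s] have "(s+1)*(s+1)^q <= (C*c'^q)*(s+1)^q" unfolding power_mult_distrib by (simp only: power_Suc mult.assoc)
 hence "s + 1 <= C*c'^q" unfolding mult_le_cancel2 by simp
 thus False by (simp add: s_def)
qed

section \<open>Degree bounds for finite extensions\<close>

definition expo::"nat set => (nat => nat) set" where "expo J = {ga. ALL i. i ~: J --> ga i = 0}"

text \<open>The relation \<open>w\<close> is equality in the graded situation. It is
  \<open><=\<close> where a \<open>Z j\<close> that may have higher degree is counted with degree
  1.\<close>

definition red_mons::"(nat => nat => bool) => nat set => nat => nat set => (nat => 'a fn) => nat => ((nat => 'a) => 'a::comm_semiring_1) set" where
 "red_mons w P M J Z s = {%y. pmon P al y*pmon J ga (%j. Z j y) | al ga. al : Box P M & ga : expo J & w (sum al P + sum ga J) s}"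

lemma pmon_pred:
 assumes "finite P" "i : P" "be i > 0"
 shows "pmon P be x = x i*pmon P (be(i := be i-1)) x" "sum be P = Suc (sum (be(i := be i-1)) P)"
proof -
 have "be = (be(i := be i-1))(i := Suc ((be(i := be i-1)) i))" using assms(3) by auto
 thus "pmon P be x = x i*pmon P (be(i := be i-1)) x" "sum be P = Suc (sum (be(i := be i-1)) P)"
  using pmon_Suc[OF assms(1,2), of "be(i := be i-1)"] sum_fun_upd_Suc[OF assms(1,2), of "be(i := be i-1)"] by metis+
qed

text \<open>A monomial is built up one coordinate at a time. Whenever the degree in \<open>P\<close>
  reaches \<open>M\<close> the rule \<open>red\<close> is applied, and compatibility of
  \<open>w\<close> with addition controls the total weight.\<close>

lemma span_red_mons:
 fixes Y::"(nat => 'a::field) set"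
 assumes fin: "finite P" "finite J" and M: "M > 0"
  and w: "!!a. w a a" "!!a b c. w a b ==> w (a+c) (b+c)" "!!a b c. w a b ==> w b c ==> w a c"
  and red: "!!be. sum be P = M ==> pmon P be : span_on Y (red_mons w P M J Z M)"
 shows "(%y. pmon P be y*pmon J ga (%j. Z j y)) : span_on Y (red_mons w P M J Z (sum be P + sum ga J))"
proof -
 let ?S = "%s. red_mons w P M J Z s"
 have mono: "?S s <= ?S t" if "w s t" for s t unfolding red_mons_def using w(3) that by blast
 have Zm: "(%y. Z j y*h y) : span_on Y (?S (Suc s))" if "h : span_on Y (?S s)" "j : J" for h j s
 proof (rule span_on_mult[OF that(1)])
  fix g assume "g : ?S s"
  then obtain al ga where g: "g = (%y. pmon P al y*pmon J ga (%j. Z j y))" "al : Box P M" "ga : expo J" "w (sum al P + sum ga J) s" by (auto simp: red_mons_def)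
  let ?ga = "ga(j := Suc (ga j))"
  have "w (sum al P + sum ?ga J) (Suc s)" using w(2)[OF g(4), of 1] sum_fun_upd_Suc[OF fin(2) that(2)] by simp
  moreover have "?ga : expo J" using g that(2) by (auto simp: expo_def)
  ultimately have "(%y. pmon P al y*pmon J ?ga (%j. Z j y)) : ?S (Suc s)" unfolding red_mons_def using g(2) by blast
  thus "(%y. Z j y*g y) : span_on Y (?S (Suc s))" by (intro span_on_base) (simp add: g pmon_Suc[OF fin(2) that(2)] mult.left_commute)
 qed
 have Zp: "(%y. pmon J ga (%j. Z j y)*h y) : span_on Y (?S (s + sum ga J))"
  if "h : span_on Y (?S s)" for h ga s using that
 proof (induction "sum ga J" arbitrary: ga h s)
  case 0
  hence "pmon J ga x = 1" for x::"nat => 'a" using fin by (simp add: pmon_def)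
  thus ?case using 0 by simp
 next
  case (Suc n)
  then obtain j where j: "j : J" "ga j > 0" by (metis gr0I not_gr_zero sum.neutral zero_less_Suc)
  note pr = pmon_pred[OF fin(2) j(1), of ga]
  have "(%y. pmon J (ga(j := ga j-1)) (%j. Z j y)*h y) : span_on Y (?S (s + sum (ga(j := ga j-1)) J))" using Suc pr(2) j by (intro Suc.hyps) auto
  from Zm[OF this j(1)] show ?case using pr(2)[OF j(2)] by (simp add: mult.assoc pr(1)[OF j(2)])
 qed
 have Xm: "(%y. y i*h y) : span_on Y (?S (Suc s))" if "h : span_on Y (?S s)" "i : P" for h i s
 proof (rule span_on_mult[OF that(1)])
  fix g assume "g : ?S s"
  then obtain al ga where g: "g = (%y. pmon P al y*pmon J ga (%j. Z j y))" "al : Box P M" "ga : expo J" "w (sum al P + sum ga J) s" by (auto simp: red_mons_def)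
  let ?al = "al(i := Suc (al i))"
  note sal = sum_fun_upd_Suc[OF fin(1) that(2), of al]
  have ws: "w (sum ?al P + sum ga J) (Suc s)" using w(2)[OF g(4), of 1] sal by simp
  have eq: "(%y. y i*g y) = (%y. pmon J ga (%j. Z j y)*pmon P ?al y)" by (simp add: g pmon_Suc[OF fin(1) that(2)] mult_ac)
  show "(%y. y i*g y) : span_on Y (?S (Suc s))"
  proof (cases "sum ?al P < M")
   case True
   hence "?al : Box P M" using g that(2) by (auto simp: Box_def)
   hence "(%y. pmon P ?al y*pmon J ga (%j. Z j y)) : ?S (Suc s)" unfolding red_mons_def using g(3) ws by blast
   thus ?thesis unfolding eq by (intro span_on_base) (simp add: mult.commute)
  next
   case False
   hence "sum ?al P = M" using g(2) sal by (auto simp: Box_def)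
   hence "(%y. pmon J ga (%j. Z j y)*pmon P ?al y) : span_on Y (?S (M + sum ga J))" by (intro Zp red)
   moreover have "?S (M + sum ga J) <= ?S (Suc s)" using ws `sum ?al P = M` by (intro mono) simp
   ultimately show ?thesis unfolding eq using span_on_mono by blast
  qed
 qed
 have one: "(%_. 1) : span_on Y (?S 0)"
 proof (rule span_on_base)
  have "w (sum (%_. 0) P + sum (%_. 0) J) 0" using w(1) by simp
  thus "(%_. 1) : ?S 0" unfolding red_mons_def using M by (intro CollectI exI[of _ "%_. 0"]) (auto simp: Box_def expo_def pmon_def)
 qed
 have "pmon P be : span_on Y (?S (sum be P))"
 proof (induction "sum be P" arbitrary: be)
  case 0
  hence "pmon P be = (%_. 1::'a)" using fin by (auto simp: pmon_def fun_eq_iff)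
  thus ?case using one 0 by simp
 next
  case (Suc n)
  then obtain i where i: "i : P" "be i > 0" by (metis gr0I not_gr_zero sum.neutral zero_less_Suc)
  note pr = pmon_pred[OF fin(1) i(1), of be]
  have "pmon P (be(i := be i-1)) : span_on Y (?S (sum (be(i := be i-1)) P))" using Suc pr(2) i by (intro Suc.hyps) auto
  from Xm[OF this i(1)] have "(%y. y i*pmon P (be(i := be i-1)) y) : span_on Y (?S (sum be P))" using pr(2)[OF i(2)] by simp
  moreover have "pmon P be = (%y. y i*pmon P (be(i := be i-1)) y::'a)" by (rule ext) (rule pr(1)[OF i(2)])
  ultimately show ?case by simp
 qed
 from Zp[OF this, of ga] show ?thesis by (simp add: mult.commute)
qed

lemma card_expo_le:
 assumes "finite J"
 shows "finite {ga : expo J. ALL j:J. ga j <= t}" "card {ga : expo J. ALL j:J. ga j <= t} = (t+1)^card J"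
proof -
 have bij: "bij_betw (%ga. restrict ga J) {ga : expo J. ALL j:J. ga j <= t} (J \<rightarrow>\<^sub>E {..t})"
  by (rule bij_betwI[where g = "%ga j. if j : J then ga j else 0"]) (auto simp: expo_def fun_eq_iff PiE_def extensional_def Pi_def)
 show "finite {ga : expo J. ALL j:J. ga j <= t}" using bij_betw_finite[OF bij] assms by (simp add: finite_PiE)
 show "card {ga : expo J. ALL j:J. ga j <= t} = (t+1)^card J" using bij_betw_same_card[OF bij] assms by (simp add: card_PiE)
qed

lemma card_expo_sum_eq:
 assumes "finite J" "j0 : J"
 shows "finite {ga : expo J. sum ga J = t}" "card {ga : expo J. sum ga J = t} <= (t+1)^(card J-1)"
proof -
 let ?A = "{ga : expo J. sum ga J = t}" and ?B = "{ga : expo (J - {j0}). ALL j:J - {j0}. ga j <= t}"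
 have fB: "finite ?B" "card ?B = (t+1)^card (J - {j0})" using card_expo_le[of "J - {j0}" t] assms by auto
 have le: "ga j <= t" if "ga : ?A" "j : J" for ga j using member_le_sum[of j J ga] that assms by auto
 have inj: "inj_on (%ga. ga(j0 := 0)) ?A"
 proof (rule inj_onI)
  fix ga de assume a: "ga : ?A" "de : ?A" "ga(j0 := 0) = de(j0 := 0)"
  have eq: "ga j = de j" if "j ~= j0" for j using fun_cong[OF a(3), of j] that by simp
  have "sum ga J = ga j0 + sum ga (J - {j0})" "sum de J = de j0 + sum de (J - {j0})" using assms by (auto intro: sum.remove)
  moreover have "sum ga (J - {j0}) = sum de (J - {j0})" using eq by (intro sum.cong) auto
  ultimately have "ga j0 = de j0" using a by simp
  with eq show "ga = de" by (intro ext) metis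
 qed
 have sub: "(%ga. ga(j0 := 0)) ` ?A <= ?B"
 proof (intro image_subsetI)
  fix ga assume "ga : ?A"
  thus "ga(j0 := 0) : ?B" using le[of ga] by (simp add: expo_def)
 qed
 show "finite ?A" using finite_imageD[OF finite_subset[OF sub fB(1)] inj] .
 show "card ?A <= (t+1)^(card J-1)" using card_inj_on_le[OF inj sub fB(1)] fB(2) assms by simp
qed

text \<open>A bound for the Hilbert function: for a fixed exponent in \<open>Box P M\<close> the
  remaining degree is prescribed, so one exponent in \<open>J\<close> is determined by the others.
  Hence the growth of order \<open>card J - 1\<close>.\<close>

lemma card_red_mons_eq:
 assumes "finite P" "finite J" "J ~= {}"
 shows "finite (red_mons (=) P M J Z s)" "card (red_mons (=) P M J Z s) <= card (Box P M)*(s+1)^(card J-1)"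
proof -
 obtain j0 where j0: "j0 : J" using assms by blast
 let ?A = "%al. {ga : expo J. sum ga J = s - sum al P}"
 let ?S = "Sigma (Box P M) ?A"
 have fin: "finite ?S" using finite_Box[OF assms(1)] card_expo_sum_eq(1)[OF assms(2) j0] by blast
 have sub: "red_mons (=) P M J Z s <= (%(al,ga) y. pmon P al y*pmon J ga (%j. Z j y)) ` ?S" unfolding red_mons_def by force
 show "finite (red_mons (=) P M J Z s)" using finite_subset[OF sub finite_imageI[OF fin]] .
 have "card (red_mons (=) P M J Z s) <= card ?S" using card_mono[OF finite_imageI[OF fin] sub] card_image_le[OF fin] by (rule order_trans)
 also have "... = (SUM al:Box P M. card (?A al))" using finite_Box[OF assms(1)] card_expo_sum_eq(1)[OF assms(2) j0] by (subst card_SigmaI) auto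
 also have "... <= (SUM al:Box P M. (s+1)^(card J-1))"
 proof (rule sum_mono)
  fix al::"nat => nat"
  have "(s - sum al P + 1)^(card J-1) <= (s+1)^(card J-1)" by (intro power_mono) auto
  thus "card (?A al) <= (s+1)^(card J-1)" using card_expo_sum_eq(2)[OF assms(2) j0, of "s - sum al P"] by linarith
 qed
 finally show "card (red_mons (=) P M J Z s) <= card (Box P M)*(s+1)^(card J-1)" by simp
qed

lemma span_red_mons_subset_reprs:
 assumes "finite P" "finite J" "h : span_on Y (red_mons w P M J Z s)"
 shows "h : reprs Y P M J Z"
proof -
 let ?R = "reprs UNIV P M J Z"
 obtain g where g: "g : fs.span (red_mons w P M J Z s)" "ALL y:Y. h y = g y" using assms(3) by (auto simp: span_on_def)
 have "g : ?R"
 proof (rule fs.span_induct[where P = "%g. g : ?R", OF g(1)])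
  show "fs.subspace {x. x : ?R}"
  proof (rule fs.subspaceI)
   show "0 : {x. x : ?R}" unfolding reprs_def by (intro CollectI exI[of _ "%_ _. 0"]) (auto intro: pfunI)
  next
   fix f f' assume "f : {x. x : ?R}" "f' : {x. x : ?R}"
   then obtain c d where "ALL al. pfun J (c al)" "ALL y. f y = (SUM al:Box P M. c al (%j. Z j y)*pmon P al y)"
    "ALL al. pfun J (d al)" "ALL y. f' y = (SUM al:Box P M. d al (%j. Z j y)*pmon P al y)" by (auto simp: reprs_def)
   thus "f + f' : {x. x : ?R}" unfolding reprs_def by (intro CollectI exI[of _ "%al z. c al z + d al z"]) (auto intro: pfunI simp: distrib_right sum.distrib)
  next
   fix b f assume "f : {x. x : ?R}"
   then obtain c where "ALL al. pfun J (c al)" "ALL y. f y = (SUM al:Box P M. c al (%j. Z j y)*pmon P al y)" by (auto simp: reprs_def)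
   thus "(%x. b*f x) : {x. x : ?R}" unfolding reprs_def by (intro CollectI exI[of _ "%al z. b*c al z"]) (auto intro: pfunI simp: sum_distrib_left mult.assoc)
  qed
 next
  fix f assume "f : red_mons w P M J Z s"
  then obtain al ga where f: "f = (%y. pmon P al y*pmon J ga (%j. Z j y))" "al : Box P M" by (auto simp: red_mons_def)
  have "pfun J (pmon J ga)" unfolding pmon_def[abs_def] by (intro pfunI)
  moreover have "f y = (SUM be:Box P M. (if be = al then pmon J ga else (%_. 0)) (%j. Z j y)*pmon P be y)" for y
  proof -
   have "(SUM be:Box P M. (if be = al then pmon J ga else (%_. 0)) (%j. Z j y)*pmon P be y) = (SUM be:Box P M. if be = al then f y else 0)"
    by (intro sum.cong) (auto simp: f(1) mult.commute)
   thus ?thesis using f(2) finite_Box[OF assms(1), of M] by simp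
  qed
  ultimately show "f : ?R" unfolding reprs_def by (intro CollectI exI[of _ "%be. if be = al then pmon J ga else (%_. 0)"]) (auto intro: pfunI)
 qed
 with g(2) show ?thesis unfolding reprs_def by fastforce
qed

lemma pmon_lookup: "finite J ==> keys t <= J ==> pmon J (lookup t) z = mmon z t" by (simp add: pmon_def mmon_superset)

lemma pmon_eq_mmon:
 assumes "finite J" "ga : expo J"
 shows "EX t. keys t <= J & lookup t = ga"
proof -
 have "{x. ga x ~= 0} <= J" using assms(2) by (auto simp: expo_def)
 hence "finite {x. ga x ~= 0}" using assms(1) finite_subset by blast
 hence "lookup (Abs_poly_mapping ga) = ga" by (simp add: lookup_Abs_poly_mapping)
 moreover from this have "keys (Abs_poly_mapping ga) <= J" using `{x. ga x ~= 0} <= J` by (auto simp: in_keys_iff)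
 ultimately show ?thesis by blast
qed

lemma pmon_independent:
 fixes d::"(nat => nat) => 'a::{idom,ring_char_0}"
 assumes "finite P" "finite E" "E <= expo P" "!!x. (SUM be:E. d be*pmon P be x) = 0" "be : E"
 shows "d be = 0"
proof -
 define T where "T = {t. keys t <= P & lookup t : E}"
 have inj: "inj_on lookup T" by (intro inj_onI poly_mapping_eqI) simp
 have img: "lookup ` T = E"
 proof
  show "lookup ` T <= E" by (auto simp: T_def)
  show "E <= lookup ` T"
  proof
   fix ga assume "ga : E"
   then obtain t where "keys t <= P" "lookup t = ga" using pmon_eq_mmon[OF assms(1), of ga] assms(3) by blast
   with `ga : E` show "ga : lookup ` T" unfolding T_def by blast
  qed
 qed
 have "finite T" using inj img assms(2) finite_imageD by metis
 obtain t where t: "t : T" "lookup t = be" using img assms(5) by blast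
 have "(SUM t:T. d (lookup t)*mmon x t) = 0" for x
 proof -
  have "(SUM be:E. d be*pmon P be x) = (SUM t:T. d (lookup t)*pmon P (lookup t) x)" unfolding img[symmetric] by (rule sum.reindex_cong[OF inj]) auto
  also have "... = (SUM t:T. d (lookup t)*mmon x t)" by (intro sum.cong) (auto simp: T_def pmon_lookup[OF assms(1)])
  finally show ?thesis using assms(4) by simp
 qed
 from mv_sum_zero_imp_coeffs_zero[OF assms(1) `finite T` _ this t(1)] t show ?thesis by (auto simp: T_def)
qed

text \<open>Given a nontrivial relation among \<open>f\<^sub>0, \<dots>\<close>, monomials divisible by its leading monomial (for the
 graded lexicographic order) can be rewritten.\<close>

lemma relation_reduces_monomials:
 fixes G::"(nat,'a::field) mvpoly"
 assumes J: "finite J" and G: "G ~= 0" "mv_in J G" "!!y. y : Y ==> mv_eval (%j. Z j y) G = 0"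
 shows "EX t0. ALL n t. keys t <= J --> sum (lookup t) J <= n --> (%y. mmon (%j. Z j y) t) : span_on Y {%y. mmon (%j. Z j y) t' | t'.
   keys t' <= J & sum (lookup t') J <= n & (EX j:J. lookup t' j < lookup t0 j)}"
proof -
 let ?deg = "%t::nat \<Rightarrow>\<^sub>0 nat. sum (lookup t) J"
 let ?key = "%t. (?deg t,t)"
 let ?f = "%t y. mmon (%j. Z j y) t"
 have deg_add: "?deg (s+t) = ?deg s + ?deg t" for s t by (simp add: lookup_add sum.distrib)
 have key_add: "?key (u+s) < ?key (u+t)" if "?key s < ?key t" for u s t::"nat \<Rightarrow>\<^sub>0 nat"
 proof -
  have "s < t ==> u + s < u + t" by (rule add_strict_left_mono)
  thus ?thesis using that unfolding less_prod_def fst_conv snd_conv deg_add by fastforce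
 qed
 have fk: "finite (keys G)" "keys G ~= {}" using G(1) by auto
 have "Max (?key ` keys G) : ?key ` keys G" using fk by (intro Max_in) auto
 then obtain t0 where t0: "t0 : keys G" "?key t0 = Max (?key ` keys G)" by (elim imageE) metis
 have less: "?key t < ?key t0" if "t : keys G" "t ~= t0" for t
 proof -
  have "?key t <= ?key t0" unfolding t0(2) using that fk by (intro Max_ge) auto
  moreover have "?key t ~= ?key t0" using that by simp
  ultimately show ?thesis by (meson order_le_less)
 qed
 have rel: "?f t0 y = (SUM t:keys G - {t0}. - (lookup G t / lookup G t0)*?f t y)" if "y : Y" for y
 proof -
  have nz: "lookup G t0 ~= 0" using t0 by (simp add: in_keys_iff)
  have "0 = lookup G t0*?f t0 y + (SUM t:keys G - {t0}. lookup G t*?f t y)"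
   using G(3)[OF that] t0 fk by (subst sum.remove[symmetric]) (auto simp: mv_eval_eq_subst mv_subst_monom)
  hence "?f t0 y = - (SUM t:keys G - {t0}. lookup G t*?f t y) / lookup G t0" using nz by (simp add: field_simps add_eq_0_iff)
  thus ?thesis by (simp add: sum_negf[symmetric] sum_divide_distrib)
 qed
 have "?f t : span_on Y {?f t' | t'. keys t' <= J & ?deg t' <= n & (EX j:J. lookup t' j < lookup t0 j)}" (is "_ : span_on Y (?S n)")
  if t: "keys t <= J" "?deg t <= n" for n t
 proof (rule ccontr)
  assume nt: "?f t ~: span_on Y (?S n)"
  define B where "B = {t. keys t <= J & ?deg t <= n & ?f t ~: span_on Y (?S n)}"
  have "finite B"
  proof -
   have "lookup t : {ga : expo J. ALL j:J. ga j <= n}" if "t : B" for t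
   proof -
    have "lookup t j <= n" if "j : J" for j using member_le_sum[of j J "lookup t"] J that `t : B` by (auto simp: B_def)
    moreover have "lookup t i = 0" if "i ~: J" for i using that `t : B` by (auto simp: B_def in_keys_iff)
    ultimately show ?thesis by (auto simp: expo_def)
   qed
   hence "lookup ` B <= {ga : expo J. ALL j:J. ga j <= n}" by blast
   hence "finite (lookup ` B)" using card_expo_le(1)[OF J] finite_subset by blast
   moreover have "inj_on lookup B" by (intro inj_onI poly_mapping_eqI) simp
   ultimately show ?thesis by (rule finite_imageD)
  qed
  moreover have "B ~= {}" using t nt by (auto simp: B_def)
  ultimately have "Min (?key ` B) : ?key ` B" by (intro Min_in) auto
  \<comment> \<open>A smallest monomial that cannot be rewritten must be divisible by the leading
    monomial \<open>t0\<close>; replacing \<open>t0\<close> by the lower terms of the relation gives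
    smaller monomials, which can be rewritten.\<close>
  then obtain s where s: "s : B" "?key s = Min (?key ` B)" by auto
  have min: "?key s <= ?key b" if "b : B" for b unfolding s(2) using `finite B` that by (intro Min_le) auto
  have "lookup t0 j <= lookup s j" for j
  proof (cases "j : J")
   case True
   show ?thesis
   proof (rule ccontr)
    assume "~ ?thesis"
    hence "EX j:J. lookup s j < lookup t0 j" using True by (auto simp: not_le)
    moreover have sB: "keys s <= J" "?deg s <= n" "?f s ~: span_on Y (?S n)" using s(1) unfolding B_def by blast+
    ultimately have "?f s : ?S n" by blast
    hence "?f s : span_on Y (?S n)" by (rule span_on_base)
    with sB show False by blast
   qed
  next
   case False
   moreover have "keys t0 <= J" using t0(1) G(2) unfolding mv_in_def by blast
   ultimately have "j ~: keys t0" by (metis subsetD)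
   hence "lookup t0 j = 0" by (simp only: not_in_keys_iff_lookup_eq_zero)
   thus ?thesis by simp
  qed
  hence st0: "s = (s-t0) + t0" by (intro poly_mapping_eqI) (simp add: lookup_add lookup_minus)
  let ?u = "s-t0"
  have "?f (?u + t) : span_on Y (?S n)" if "t : keys G - {t0}" for t
  proof (rule ccontr)
   assume n: "?f (?u + t) ~: span_on Y (?S n)"
   have l: "?key (?u + t) < ?key s" using key_add[OF less, of t ?u] that st0 by simp
   hence "?deg (?u + t) <= n" using s(1) by (auto simp: B_def less_prod_def)
   moreover have "keys (?u + t) <= J"
   proof -
    have "keys ?u <= J" using s(1) by (auto simp: B_def in_keys_iff lookup_minus)
    moreover have "keys t <= J" using that G(2) by (auto simp: mv_in_def)
    ultimately show ?thesis using keys_add[of ?u t] by blast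
   qed
   ultimately have "?u + t : B" using n by (auto simp: B_def)
   with min l show False by (meson not_le)
  qed
  hence "(%y. SUM t:keys G - {t0}. - (lookup G t / lookup G t0)*?f (?u + t) y) : span_on Y (?S n)" by (intro span_on_sum span_on_scale)
  hence "?f s : span_on Y (?S n)"
  proof (rule span_on_cong)
   fix y assume "y : Y"
   have "?f s y = ?f ?u y*?f t0 y" by (subst st0) (simp add: mmon_add)
   also have "... = (SUM t:keys G - {t0}. - (lookup G t / lookup G t0)*?f (?u + t) y)"
    unfolding rel[OF `y : Y`] sum_distrib_left by (intro sum.cong) (auto simp: mmon_add)
   finally show "(SUM t:keys G - {t0}. - (lookup G t / lookup G t0)*?f (?u + t) y) = ?f s y" by simp
  qed
  with s(1) show False by (simp add: B_def)
 qed
 thus ?thesis by (intro exI[of _ t0]) auto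
qed

text \<open>One exponent is bounded by that of \<open>t0\<close>, independently of \<open>n\<close>,
  and the others by \<open>n\<close>. So the count has order one less than that of all
  monomials.\<close>

lemma card_bounded_monomials:
 assumes "finite (J::nat set)"
 shows "finite {t. keys t <= J & sum (lookup t) J <= n & (EX j:J. lookup t j < lookup t0 j)}" (is "finite ?A")
  and "card {t. keys t <= J & sum (lookup t) J <= n & (EX j:J. lookup t j < lookup t0 j)} <= sum (lookup t0) J*(n+1)^(card J-1)"
proof -
 define E where "E = (%j. {..<lookup t0 j} \<times> {ga : expo (J - {j}). ALL i:J - {j}. ga i <= n})"
 have fE: "finite (E j)" "card (E j) = lookup t0 j*(n+1)^(card J-1)" if "j : J" for j
  using card_expo_le[of "J - {j}" n] assms that by (auto simp: E_def card_cartesian_product)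
 define ph where "ph = (%(j,c,ga). Abs_poly_mapping (ga(j := c))::nat \<Rightarrow>\<^sub>0 nat)"
 have sub: "?A <= ph ` Sigma J E"
 proof
  fix t assume t: "t : ?A"
  then obtain j where j: "j : J" "lookup t j < lookup t0 j" by blast
  have le: "lookup t i <= n" if "i : J" for i using member_le_sum[of i J "lookup t"] assms that t by auto
  have "lookup t i = 0" if "i ~: J" for i using that t by (auto simp: in_keys_iff)
  hence "(j,lookup t j,(lookup t)(j := 0)) : Sigma J E" using j le by (auto simp: E_def expo_def)
  moreover have "t = ph (j,lookup t j,(lookup t)(j := 0))" by (simp add: ph_def lookup_inverse)
  ultimately show "t : ph ` Sigma J E" by blast
 qed
 have fin: "finite (Sigma J E)" using assms fE by blast
 show "finite ?A" using finite_subset[OF sub finite_imageI[OF fin]] .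
 have "card ?A <= card (Sigma J E)" using card_mono[OF finite_imageI[OF fin] sub] card_image_le[OF fin, of ph] by simp
 also have "... = (SUM j:J. card (E j))" using assms fE by (subst card_SigmaI) auto
 also have "... = sum (lookup t0) J*(n+1)^(card J-1)" using fE by (simp add: sum_distrib_right)
 finally show "card ?A <= sum (lookup t0) J*(n+1)^(card J-1)" .
qed

text \<open>With r variables there are (s + 1)^r independent monomials with exponents up to s. A
  relation among the r functions \<open>Z j\<close> would place them in the span of a number of
  functions of order s^(r-1).\<close>

lemma no_relation_if_finite:
 fixes Z::"nat => (nat => 'a::field_char_0) => 'a"
 assumes P: "finite P" and J: "finite J" "card J = card P" and M: "M > 0"
  and red: "!!be. sum be P = M ==> pmon P be : span_on UNIV (red_mons (<=) P M J Z M)"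
  and G: "G ~= 0" "mv_in J G" "!!y. mv_eval (%j. Z j y) G = 0"
 shows False
proof -
 define r where "r = card P"
 obtain t0 where t0: "!!n t. keys t <= J ==> sum (lookup t) J <= n ==> (%y. mmon (%j. Z j y) t) : span_on UNIV {%y. mmon (%j. Z j y) t' | t'.
   keys t' <= J & sum (lookup t') J <= n & (EX j:J. lookup t' j < lookup t0 j)}"
  using relation_reduces_monomials[OF J(1) G(1,2), where Y = UNIV and Z = Z] G(3) by blast
 define T where "T = (%n. {t. keys t <= J & sum (lookup t) J <= n & (EX j:J. lookup t j < lookup t0 j)})"
 define S where "S = (%n. (%(al,t) y. pmon P al y*mmon (%j. Z j y) t) ` (Box P M \<times> T n))"
 have T: "finite (T n)" "card (T n) <= sum (lookup t0) J*(n+1)^(card J-1)" for n using card_bounded_monomials[OF J(1), of n t0] unfolding T_def by auto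
 have fS: "finite (S n)" and cS: "card (S n) <= card (Box P M)*(sum (lookup t0) J*(n+1)^(r-1))" for n
 proof -
  show "finite (S n)" unfolding S_def using finite_Box[OF P] T(1) by blast
  have "card (S n) <= card (Box P M \<times> T n)" unfolding S_def using finite_Box[OF P] T(1) by (intro card_image_le) blast
  also have "... <= card (Box P M)*(sum (lookup t0) J*(n+1)^(r-1))"
   unfolding card_cartesian_product r_def J(2)[symmetric] using T(2) by (intro mult_left_mono) auto
  finally show "card (S n) <= card (Box P M)*(sum (lookup t0) J*(n+1)^(r-1))" .
 qed
 have inS: "pmon P be : span_on UNIV (S n)" if "sum be P <= n" for be n
 proof -
  have "(%y. pmon P be y*pmon J (%_. 0) (%j. Z j y)) : span_on UNIV (red_mons (<=) P M J Z (sum be P + sum (%_. 0) J))"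
   by (rule span_red_mons[OF P J(1) M]) (use red in auto)
  hence "pmon P be : span_on UNIV (red_mons (<=) P M J Z (sum be P))" by (simp add: pmon_def[of J])
  thus ?thesis
  proof (rule span_on_trans)
   fix g assume "g : red_mons (<=) P M J Z (sum be P)"
   then obtain al ga where g: "g = (%y. pmon P al y*pmon J ga (%j. Z j y))" "al : Box P M" "ga : expo J" "sum al P + sum ga J <= sum be P" by (auto simp: red_mons_def)
   obtain t where t: "keys t <= J" "lookup t = ga" using pmon_eq_mmon[OF J(1) g(3)] by blast
   have eq: "pmon J ga (%j. Z j y) = mmon (%j. Z j y) t" for y using pmon_lookup[OF J(1) t(1)] t(2) by simp
   have "(%y. mmon (%j. Z j y) t) : span_on UNIV {%y. mmon (%j. Z j y) t' | t'. t' : T n}" using t0[OF t(1), of n] t(2) g(4) that unfolding T_def by simp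
   hence "(%y. pmon P al y*mmon (%j. Z j y) t) : span_on UNIV (S n)" by (rule span_on_mult) (use g(2) in "auto intro!: span_on_base simp: S_def")
   thus "g : span_on UNIV (S n)" unfolding g eq .
  qed
 qed
 have le: "(s+1)^r <= card (Box P M)*(sum (lookup t0) J*(r*s + 1)^(r-1))" for s
 proof -
  let ?E = "{be : expo P. ALL i:P. be i <= s}"
  have "card ?E <= card (S (r*s))"
  proof (rule card_le_if_independent_on[OF _ fS])
   show "finite ?E" by (rule card_expo_le(1)[OF P])
   show "pmon P be : span_on UNIV (S (r*s))" if "be : ?E" for be
   proof (rule inS)
    have "sum be P <= card P*s" using sum_bounded_above[of P be s] that by auto
    thus "sum be P <= r*s" by (simp add: r_def)
   qed
   show "ALL be:?E. d be = 0" if "!!y::nat => 'a. y : UNIV ==> (SUM be:?E. d be*pmon P be y) = 0" for d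
    using pmon_independent[OF P card_expo_le(1)[OF P], of s d] that by blast
  qed
  thus ?thesis using cS[of "r*s"] card_expo_le(2)[OF P, of s] by (simp add: r_def)
 qed
 show False
 proof (cases r)
  case 0
  hence "J = {}" using J P by (simp add: r_def)
  thus False using le[of 0] 0 by simp
 next
  case (Suc q)
  have "(s+1)^Suc q <= (card (Box P M)*sum (lookup t0) J)*(r*s + 1)^q" for s using le[of s] Suc by (simp add: mult.assoc)
  thus False by (rule power_growth_contradiction)
 qed
qed

text \<open>Lying over at the origin: the alternative is an algebraic relation among the
  \<open>Z j\<close>, which the monomial count excludes because there are as many functions as
  variables.\<close>

theorem exists_common_zero:
 fixes Z::"nat => (nat => 'a::{alg_closed_field,field_char_0}) => 'a"
 assumes P: "finite P" and J: "finite J" "card J = card P" and M: "M > 0"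
  and Z: "!!j. j : J ==> pfun P (Z j)"
  and red: "!!be. sum be P = M ==> pmon P be : span_on UNIV (red_mons (<=) P M J Z M)"
 shows "EX c. ALL j:J. Z j c = 0"
proof -
 interpret finite_reduction P P J UNIV Z M using assms span_red_mons_subset_reprs[OF P J(1) red] by unfold_locales auto
 have "~ (EX g. pfun J g & g (%_. 0) ~= 0 & (ALL y:UNIV. g (%j. Z j y) = 0))"
 proof
  assume "EX g. pfun J g & g (%_. 0) ~= 0 & (ALL y:UNIV. g (%j. Z j y) = 0)"
  then obtain g where g: "pfun J g" "g (%_. 0) ~= 0" "!!y. g (%j. Z j y) = 0" by blast
  obtain G where G: "mv_in J G" "ALL a. mv_eval a G = g a" using pfun_imp_mvpoly[OF g(1)] by blast
  have "G ~= 0" using G(2) g(2) by force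
  from no_relation_if_finite[OF P J M assms(6) this G(1)] G(2) g(3) show False by simp
 qed
 thus ?thesis using point_or_relation[of "%_. 0"] by blast
qed

section \<open>Forms as functions\<close>

definition lmon::"nat => nat list => (nat => 'a) => 'a::comm_semiring_1" where "lmon k m x = (PROD i<k. x i^(m ! i))"

definition pform::"nat => nat => (nat list => 'a) => (nat => 'a) => 'a::comm_semiring_1" where "pform k d c x = (SUM m:multi k d. c m*lmon k m x)"

lemma form_eq_pform: "form k d c v = pform k d c (($) v)" by (simp add: form_def pform_def lmon_def)

lemma finite_mi [simp]: "finite (multi k d)"
proof (rule finite_subset)
 show "multi k d <= {xs. set xs <= {..d} & length xs = k}" using member_le_sum_list by (fastforce simp: mi_def)
 show "finite {xs. set xs <= {..d} & length xs = k}" by (rule finite_lists_length_eq) simp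
qed

lemma lmon_cong: "(!!i. i < k ==> x i = y i) ==> lmon k m x = lmon k m y" by (simp add: lmon_def)
lemma pform_cong: "(!!i. i < k ==> x i = y i) ==> pform k d c x = pform k d c y" unfolding pform_def using lmon_cong by (metis (no_types, lifting))

definition Hom::"nat => nat => ((nat => 'a) => 'a::field) set" where "Hom k d = fs.span (lmon k ` multi k d)"

lemma Hom_add: "f : Hom k d ==> g : Hom k d ==> (%x. f x + g x) : Hom k d" unfolding Hom_def by (rule fs_span_add)
lemma Hom_zero: "(%x. 0) : Hom k d" unfolding Hom_def by (rule fs_span_zero)
lemma Hom_scale: "f : Hom k d ==> (%x. c*f x) : Hom k d" unfolding Hom_def by (rule fs.span_scale)
lemma Hom_sum: "(!!i. i : A ==> f i : Hom k d) ==> (%x. SUM i:A. f i x) : Hom k d" unfolding Hom_def by (rule fs_span_sum)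
lemma lmon_Hom: "m : multi k d ==> lmon k m : Hom k d" unfolding Hom_def by (rule fs.span_base) simp
lemma pform_Hom: "pform k d c : Hom k d" unfolding pform_def[abs_def] by (intro Hom_sum Hom_scale lmon_Hom)

lemma Hom_imp_pform:
 fixes f::"(nat => 'a::field) => 'a"
 assumes "f : Hom k d"
 obtains c where "f = pform k d c"
proof -
 have "EX c. f = pform k d c"
 proof (rule fs.span_induct[where P = "%f. EX c. f = pform k d c", OF assms[unfolded Hom_def]])
  show "fs.subspace {f::'a fn. EX c. f = pform k d c}"
  proof (rule fs.subspaceI)
   show "0 : {f::'a fn. EX c. f = pform k d c}" by (intro CollectI exI[of _ "%_. 0"]) (auto simp: pform_def fun_eq_iff)
  next
   fix f g::"'a fn" assume "f : {f. EX c. f = pform k d c}" "g : {f. EX c. f = pform k d c}"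
   then obtain a b where "f = pform k d a" "g = pform k d b" by blast
   thus "f + g : {f. EX c. f = pform k d c}" by (intro CollectI exI[of _ "%m. a m + b m"]) (auto simp: pform_def fun_eq_iff distrib_right sum.distrib)
  next
   fix b and f::"'a fn" assume "f : {f. EX c. f = pform k d c}"
   then obtain a where "f = pform k d a" by blast
   thus "(%x. b*f x) : {f. EX c. f = pform k d c}" by (intro CollectI exI[of _ "%m. b*a m"]) (auto simp: pform_def fun_eq_iff sum_distrib_left mult.assoc)
  qed
 next
  fix f::"'a fn" assume "f : lmon k ` multi k d"
  then obtain m where m: "m : multi k d" "f = lmon k m" by blast
  have "f = pform k d (%m'. if m' = m then 1 else 0)"
  proof
   fix x::"nat => 'a"
   have "pform k d (%m'. if m' = m then 1 else 0) x = (SUM m':multi k d. if m' = m then lmon k m x else 0)" unfolding pform_def by (intro sum.cong) auto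
   thus "f x = pform k d (%m'. if m' = m then 1 else 0) x" using m by simp
  qed
  thus "EX c. f = pform k d c" by blast
 qed
 with that show thesis by blast
qed

lemma lmon_mult:
 assumes "length m = k" "length m' = k"
 shows "lmon k m x*lmon k m' x = lmon k (map2 (+) m m') x" using assms by (simp add: lmon_def prod.distrib[symmetric] power_add)

lemma sum_list_map2_add: "length m = length m' ==> sum_list (map2 (+) m m') = sum_list m + sum_list (m'::nat list)" by (induction m m' rule: list_induct2) auto

lemma Hom_mult:
 assumes "f : Hom k d" "g : Hom k e"
 shows "(%x. f x*g x) : Hom k (d+e)" using assms(2) unfolding Hom_def
proof (rule fs_span_mult)
 fix g'::"'a fn" assume "g' : lmon k ` multi k e"
 then obtain m' where m': "g' = lmon k m'" "length m' = k" "sum_list m' = e" by (auto simp: mi_def)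
 have "(%x. g' x*f x) : fs.span (lmon k ` multi k (d+e))" using assms(1) unfolding Hom_def
 proof (rule fs_span_mult)
  fix f'::"'a fn" assume "f' : lmon k ` multi k d"
  then obtain m where m: "f' = lmon k m" "length m = k" "sum_list m = d" by (auto simp: mi_def)
  have "(%x. g' x*f' x) = lmon k (map2 (+) m m')" using lmon_mult[OF m(2) m'(2)] m m' by (auto simp: fun_eq_iff mult.commute)
  moreover have "map2 (+) m m' : multi k (d+e)" using m m' by (simp add: mi_def sum_list_map2_add)
  ultimately show "(%x. g' x*f' x) : fs.span (lmon k ` multi k (d+e))" by (auto intro: fs.span_base)
 qed
 thus "(%x. f x*g' x) : fs.span (lmon k ` multi k (d+e))" by (simp add: mult.commute)
qed

lemma Hom_one: "(%_. 1) : Hom k 0" using lmon_Hom[of "replicate k 0" k 0] by (simp add: mi_def lmon_def[abs_def])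

lemma Hom_power: "f : Hom k d ==> (%x. f x^n) : Hom k (d*n)"
proof (induction n)
 case (Suc n)
 thus ?case using Hom_mult[of f k d "%x. f x^n" "d*n"] by simp
qed (simp add: Hom_one)

lemma Hom_prod: "finite A ==> (!!i. i : A ==> f i : Hom k (d i)) ==> (%x. PROD i:A. f i x) : Hom k (SUM i:A. d i)"
 by (induction A rule: finite_induct) (auto intro: Hom_one Hom_mult)

lemma Hom_var:
 assumes "i < k" shows "(%x. x i) : Hom k 1"
proof -
 have "lmon k ((replicate k 0)[i := 1]) = (%x. x i::'a)"
 proof
  fix x::"nat => 'a"
  have "lmon k ((replicate k 0)[i := 1]) x = (PROD j<k. if j = i then x i else 1)" unfolding lmon_def by (intro prod.cong) (auto simp: nth_list_update)
  thus "lmon k ((replicate k 0)[i := 1]) x = x i" using assms by simp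
 qed
 moreover have "(replicate k 0)[i := 1] : multi k 1" using assms by (simp add: mi_def sum_list_update)
 ultimately show ?thesis using lmon_Hom by metis
qed

lemma Hom_pfun: "f : Hom k d ==> pfun {..<k} f" by (erule Hom_imp_pform) (auto simp: pform_def[abs_def] lmon_def intro!: pfunI)

lemma pmon_Hom:
 assumes "P <= {..<k}" shows "pmon P be : Hom k (sum be P)"
proof -
 have "(%x. PROD i:P. x i^be i) : Hom k (SUM i:P. 1*be i)" using assms by (intro Hom_prod Hom_power Hom_var) (auto intro: finite_subset)
 thus ?thesis by (simp add: pmon_def[abs_def])
qed

lemma lmon_split:
 assumes "P <= {..<k}" "Q = {..<k} - P"
 shows "lmon k m x = pmon P (%i. if i : P then m ! i else 0) x*pmon Q (%i. if i : Q then m ! i else 0) x"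
  and "length m = k ==> (SUM i:P. if i : P then m ! i else 0)+(SUM i:Q. if i : Q then m ! i else 0) = sum_list m"
proof -
 have *: "{..<k} = P Un Q" "P Int Q = {}" "finite P" "finite Q" using assms by (auto intro: finite_subset)
 show "lmon k m x = pmon P (%i. if i : P then m ! i else 0) x*pmon Q (%i. if i : Q then m ! i else 0) x"
  unfolding lmon_def pmon_def *(1) using * by (subst prod.union_disjoint) auto
 show "(SUM i:P. if i : P then m ! i else 0)+(SUM i:Q. if i : Q then m ! i else 0) = sum_list m" if "length m = k"
 proof -
  have "sum_list m = (SUM i<k. m ! i)" using that by (simp add: sum_list_sum_nth atLeast0LessThan)
  also have "... = (SUM i:P. m ! i)+(SUM i:Q. m ! i)" unfolding *(1) using * by (intro sum.union_disjoint) auto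
  finally show ?thesis by simp
 qed
qed

section \<open>The dimension of a complete intersection\<close>

text \<open>Generators of the degree \<open>M\<close> part of the ideal spanned by the forms and the
  coordinates outside \<open>P\<close>.\<close>

definition gens::"nat => nat => (nat => nat) => (cvar => 'a) => nat set => nat => ((nat => 'a) => 'a::field) set" where "gens k r p a P M =
  {%x. pform k (p j) (%m. a (j,m)) x*lmon k m x | j m. j < r & length m = k & p j + sum_list m = M} \<union>
  {%x. x q*lmon k m x | q m. q < k & q ~: P & length m = k & Suc (sum_list m) = M}"

text \<open>The variables outside \<open>P\<close> are a system of parameters for the ideal of the forms.\<close>

locale parameter_system =
 fixes k r::nat and p::"nat => nat" and a::"cvar => 'a::{alg_closed_field,field_char_0}"
  and P::"nat set" and M::nat
 assumes P: "P <= {..<k}" "card P = r" and r: "r < k" and p: "!!j. j < r ==> 0 < p j" and M: "M > 0"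
  and full: "Hom k M <= fs.span (gens k r p a P M)"
begin

abbreviation "F j == pform k (p j) (%m. a (j,m))"
abbreviation "Q == {..<k} - P"
abbreviation "X == common_zeros k r p a"

definition Y::"(nat => 'a) set" where "Y = {x. ALL j<r. F j x = 0}"

lemma finP: "finite P" and finQ: "finite Q" using P finite_subset by auto
lemma cardQ: "card Q = k - r" using P by (subst card_Diff_subset) (auto intro: finite_subset)
lemma X_iff: "v : X \<longleftrightarrow> v : carrier_vec k & v ~= 0\<^sub>v k & ($) v : Y" by (auto simp: common_zeros_def proj_zeros_def Y_def form_eq_pform)

text \<open>On the affine cone \<open>Y\<close> the multiples of the forms vanish, and what remains
  of the ideal are multiples of the coordinates in \<open>Q\<close>.\<close>

lemma red_cone:
 assumes "sum be P = M"
 shows "pmon P be : span_on Y (red_mons (=) P M Q (%q x. x q) M)"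
proof -
 have "pmon P be : fs.span (gens k r p a P M)" using pmon_Hom[OF P(1), of be] full assms by auto
 hence "pmon P be : span_on Y (gens k r p a P M)" by (auto simp: span_on_def)
 thus ?thesis
 proof (rule span_on_trans)
  fix g assume "g : gens k r p a P M"
  then consider j m where "g = (%x. F j x*lmon k m x)" "j < r"
   | q m where "g = (%x. x q*lmon k m x)" "q : Q" "length m = k" "Suc (sum_list m) = M" by (auto simp: gens_def)
  thus "g : span_on Y (red_mons (=) P M Q (%q x. x q) M)"
  proof cases
   case 1
   thus ?thesis by (intro span_on_cong[OF span_on_zero]) (auto simp: Y_def)
  next
   case (2 q m)
   let ?al = "%i. if i : P then m ! i else 0" and ?ga = "%i. if i : Q then m ! i else 0"
   note sp = lmon_split[OF P(1) refl, of m]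
   have "g = (%x. pmon P ?al x*pmon Q (?ga(q := Suc (?ga q))) x)"
   proof
    fix x::"nat => 'a"
    have "pmon Q (?ga(q := Suc (?ga q))) x = x q*pmon Q ?ga x" by (rule pmon_Suc[OF finQ 2(2)])
    thus "g x = pmon P ?al x*pmon Q (?ga(q := Suc (?ga q))) x" unfolding 2(1) sp(1) by (simp only: mult.left_commute)
   qed
   moreover have "sum ?al P + sum (?ga(q := Suc (?ga q))) Q = M" using sp(2)[OF 2(3)] 2(4) sum_fun_upd_Suc[OF finQ 2(2), of ?ga] by simp
   moreover have "sum ?al P < M" using sp(2)[OF 2(3)] 2(4) by linarith
   hence "?al : Box P M" by (auto simp: Box_def)
   moreover have "?ga(q := Suc (?ga q)) : expo Q" using 2(2) by (auto simp: expo_def)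
   ultimately have "g : red_mons (=) P M Q (%q x. x q) M" unfolding red_mons_def by blast
   thus ?thesis by (rule span_on_base)
  qed
 qed
qed

lemma Hom_on_cone:
 assumes "f : Hom k d"
 shows "f : span_on Y (red_mons (=) P M Q (%q x. x q) d)"
proof -
 have "f : span_on Y (lmon k ` multi k d)" using assms by (auto simp: span_on_def Hom_def)
 thus ?thesis
 proof (rule span_on_trans)
  fix g::"'a fn" assume "g : lmon k ` multi k d"
  then obtain m where m: "g = lmon k m" "length m = k" "sum_list m = d" by (auto simp: mi_def)
  let ?al = "%i. if i : P then m ! i else 0" and ?ga = "%i. if i : Q then m ! i else 0"
  note sp = lmon_split[OF P(1) refl, of m]
  have "(%y. pmon P ?al y*pmon Q ?ga (%j. y j)) : span_on Y (red_mons (=) P M Q (%q x. x q) (sum ?al P + sum ?ga Q))"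
   by (rule span_red_mons[OF finP finQ M]) (use red_cone in auto)
  thus "g : span_on Y (red_mons (=) P M Q (%q x. x q) d)" using sp(2)[OF m(2)] m unfolding sp(1)[abs_def] by simp
 qed
qed

lemma finite_reduction_cone: "A <= Y ==> finite_reduction {..<k} P Q A (%q x. x q) M"
proof unfold_locales
 fix be assume "A <= Y" "sum be P = M"
 hence "pmon P be : span_on A (red_mons (=) P M Q (%q x. x q) M)" using red_cone[of be] by (auto simp: span_on_def)
 thus "pmon P be : reprs A P M Q (%q x. x q)" by (rule span_red_mons_subset_reprs[OF finP finQ])
qed (use P M finQ in "auto intro: pfunI")

text \<open>Fixing the coordinates in \<open>Q\<close> leaves r inhomogeneous polynomials in the r
  variables \<open>P\<close>. The graded relations between forms specialize to relations in which
  degrees may drop, hence \<open><=\<close> in \<open>red_mons\<close>; then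
  \<open>exists_common_zero\<close> applies.\<close>

lemma point_over: "EX x:Y. ALL q:Q. x q = l q"
proof -
 define sub where "sub = (%x i. if i : P then x i else l i::'a)"
 define Z where "Z = (%j x. F j (sub x))"
 have sub_pf: "pfun P (%x. sub x i)" for i by (cases "i : P") (auto simp: sub_def intro: pfunI)
 have "EX c. ALL j:{..<r}. Z j c = 0"
 proof (rule exists_common_zero[OF finP _ _ M])
  show "pfun P (Z j)" for j unfolding Z_def using pfun_compose[OF Hom_pfun[OF pform_Hom] sub_pf] .
  fix be assume be: "sum be P = M"
  have "pmon P be : fs.span (gens k r p a P M)" using pmon_Hom[OF P(1), of be] full be by auto
  hence "(%x. pmon P be (sub x)) : span_on UNIV (red_mons (<=) P M {..<r} Z M)"
  proof (rule fs.span_induct[where P = "%f. (%x. f (sub x)) : span_on UNIV (red_mons (<=) P M {..<r} Z M)"])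
   show "fs.subspace {f. (%x. f (sub x)) : span_on UNIV (red_mons (<=) P M {..<r} Z M)}"
    by (rule fs.subspaceI) (auto intro: span_on_zero span_on_add span_on_scale simp: zero_fun_def plus_fun_def)
  next
   fix g assume "g : gens k r p a P M"
   then consider j m where "g = (%x. F j x*lmon k m x)" "j < r" "length m = k" "p j + sum_list m = M"
    | q m where "g = (%x. x q*lmon k m x)" "q : Q" "length m = k" "Suc (sum_list m) = M" by (auto simp: gens_def)
   thus "(%x. g (sub x)) : span_on UNIV (red_mons (<=) P M {..<r} Z M)"
   proof cases
    case (1 j m)
    let ?al = "%i. if i : P then m ! i else 0" and ?ga = "%i. if i : Q then m ! i else 0"
    let ?de = "(%_. 0)(j := Suc 0)"
    note sp = lmon_split[OF P(1) refl, of m]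
    have s: "sum ?al P < M" "sum ?al P + 1 <= M" using sp(2)[OF 1(3)] 1(4) p[OF 1(2)] by linarith+
    have "sum ?de {..<r} = 1" using sum_fun_upd_Suc[of "{..<r}" j "%_. 0"] 1(2) by simp
    with s(2) have "sum ?al P + sum ?de {..<r} <= M" by simp
    moreover have "?al : Box P M" using s(1) by (auto simp: Box_def)
    moreover have "?de : expo {..<r}" using 1(2) by (auto simp: expo_def)
    ultimately have "(%x. pmon P ?al x*pmon {..<r} ?de (%j. Z j x)) : red_mons (<=) P M {..<r} Z M" unfolding red_mons_def by blast
    hence "(%x. pmon Q ?ga l*(pmon P ?al x*pmon {..<r} ?de (%j. Z j x))) : span_on UNIV (red_mons (<=) P M {..<r} Z M)" by (intro span_on_scale span_on_base)
    moreover have "pmon {..<r} ?de z = z j" for z::"nat => 'a" using pmon_Suc[of "{..<r}" j "%_. 0" z] 1(2) by (simp add: pmon_def)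
    moreover have "pmon P ?al (sub x) = pmon P ?al x" "pmon Q ?ga (sub x) = pmon Q ?ga l" for x unfolding pmon_def sub_def by (auto intro!: prod.cong)
    ultimately show ?thesis unfolding 1(1) sp(1) Z_def by (simp add: mult_ac)
   next
    case (2 q m)
    let ?al = "%i. if i : P then m ! i else 0" and ?ga = "%i. if i : Q then m ! i else 0"
    note sp = lmon_split[OF P(1) refl, of m]
    have s: "sum ?al P < M" using sp(2)[OF 2(3)] 2(4) by linarith
    hence "?al : Box P M" "(%_. 0) : expo {..<r}" "sum ?al P + sum (%_. 0) {..<r} <= M" by (auto simp: Box_def expo_def)
    hence "(%x. pmon P ?al x*pmon {..<r} (%_. 0) (%j. Z j x)) : red_mons (<=) P M {..<r} Z M" unfolding red_mons_def by blast
    hence "(%x. (l q*pmon Q ?ga l)*(pmon P ?al x*pmon {..<r} (%_. 0) (%j. Z j x))) : span_on UNIV (red_mons (<=) P M {..<r} Z M)"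
     by (intro span_on_scale span_on_base)
    moreover have "pmon {..<r} (%_. 0) z = 1" for z::"nat => 'a" by (simp add: pmon_def)
    moreover have "pmon P ?al (sub x) = pmon P ?al x" "pmon Q ?ga (sub x) = pmon Q ?ga l" "sub x q = l q" for x
     unfolding pmon_def sub_def using 2(2) by (auto intro!: prod.cong)
    ultimately show ?thesis unfolding 2(1) sp(1) by (simp add: mult_ac)
   qed
  qed
  moreover have "pmon P be (sub x) = pmon P be x" for x unfolding pmon_def sub_def by (auto intro!: prod.cong)
  ultimately show "pmon P be : span_on UNIV (red_mons (<=) P M {..<r} Z M)" by simp
 qed (use P(2) in auto)
 then obtain c where "ALL j:{..<r}. Z j c = 0" by blast
 hence "sub c : Y" by (auto simp: Y_def Z_def)
 moreover have "ALL q:Q. sub c q = l q" by (auto simp: sub_def)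
 ultimately show ?thesis by blast
qed

lemma finite_fibre: "finite {v : X. ALL q:Q. v $ q = l q}"
proof -
 interpret fr: finite_reduction "{..<k}" P Q Y "%q x. x q" M by (rule finite_reduction_cone) simp
 have "ALL i. EX S. i < k --> finite S & (ALL v:{v : X. ALL q:Q. v $ q = l q}. v $ i : S)"
 proof (intro allI, cases)
  fix i assume "i < k"
  obtain q where q: "q ~= 0" "(%x. poly q (x i)) : fr.ideal_at l" using fr.coordinate_algebraic[of i l] `i < k` by blast
  then obtain G where G: "!!y. y : Y ==> poly q (y i) = (SUM j:Q. (y j - l j)*G j y)" by (auto simp: fr.ideal_at_def)
  have "poly q (v $ i) = 0" if "v : X" "ALL q:Q. v $ q = l q" for v using G[of "($) v"] that by (simp add: X_iff)
  thus "EX S. i < k --> finite S & (ALL v:{v : X. ALL q:Q. v $ q = l q}. v $ i : S)" using poly_roots_finite[OF q(1)] by (intro exI[of _ "{x. poly q x = 0}"]) auto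
 qed auto
 then obtain S where S0: "ALL i. i < k --> finite (S i) & (ALL v:{v : X. ALL q:Q. v $ q = l q}. v $ i : S i)" by (rule choice[THEN exE])
 hence S: "!!i. i < k ==> finite (S i)" "!!i v. i < k ==> v : X ==> ALL q:Q. v $ q = l q ==> v $ i : S i" by auto
 have "{v : X. ALL q:Q. v $ q = l q} <= vec k ` (\<Pi>\<^sub>E i\<in>{..<k}. S i)"
 proof
  fix v assume v: "v : {v : X. ALL q:Q. v $ q = l q}"
  hence "v = vec k (restrict (($) v) {..<k})" by (intro eq_vecI) (auto simp: X_iff)
  moreover have "restrict (($) v) {..<k} : (\<Pi>\<^sub>E i\<in>{..<k}. S i)" using v S(2) by auto
  ultimately show "v : vec k ` (\<Pi>\<^sub>E i\<in>{..<k}. S i)" by blast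
 qed
 thus ?thesis using S(1) by (meson finite_PiE finite_imageI finite_lessThan finite_subset lessThan_iff)
qed

end

section \<open>Irreducible closed sets and independent forms along a chain\<close>

lemma proj_closed_Int: "proj_closed k A ==> proj_closed k B ==> proj_closed k (A Int B)"
proof -
 assume "proj_closed k A" "proj_closed k B"
 then obtain S T where "A = proj_zeros k S" "B = proj_zeros k T" by (auto simp: proj_closed_def)
 hence "A Int B = proj_zeros k (S Un T)" by (auto simp: proj_zeros_def)
 thus ?thesis by (auto simp: proj_closed_def)
qed

lemma proj_closed_Inter:
 assumes "CC ~= {}" "!!A. A : CC ==> proj_closed k A"
 shows "proj_closed k (\<Inter>CC)"
proof -
 have "ALL A:CC. EX S. A = proj_zeros k S" using assms(2) by (simp add: proj_closed_def)
 then obtain S where S: "!!A. A : CC ==> A = proj_zeros k (S A)" by metis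
 obtain A0 where A0: "A0 : CC" using assms(1) by blast
 have "\<Inter>CC = proj_zeros k (\<Union>A\<in>CC. S A)"
 proof
  show "\<Inter>CC <= proj_zeros k (\<Union>A\<in>CC. S A)"
  proof
   fix v assume v: "v : \<Inter>CC"
   hence "v : proj_zeros k (S A)" if "A : CC" for A using S[OF that] that by blast
   with A0 show "v : proj_zeros k (\<Union>A\<in>CC. S A)" unfolding proj_zeros_def by fast
  qed
  show "proj_zeros k (\<Union>A\<in>CC. S A) <= \<Inter>CC"
  proof (intro subsetI InterI)
   fix v A assume "v : proj_zeros k (\<Union>A\<in>CC. S A)" "A : CC"
   hence "v : proj_zeros k (S A)" unfolding proj_zeros_def by fast
   thus "v : A" using S[OF `A : CC`] by blast
  qed
 qed
 thus ?thesis by (auto simp: proj_closed_def)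
qed

lemma proj_closed_Hom:
 assumes "f : Hom k d"
 shows "proj_closed k {v : carrier_vec k. v ~= 0\<^sub>v k & f (($) v) = 0}"
proof -
 obtain c where "f = pform k d c" using assms by (rule Hom_imp_pform)
 hence "{v : carrier_vec k. v ~= 0\<^sub>v k & f (($) v) = 0} = proj_zeros k {(d,c)}" by (auto simp: proj_zeros_def form_eq_pform)
 thus ?thesis by (auto simp: proj_closed_def)
qed

lemma proj_irreducible_mult:
 assumes "proj_irreducible k Z" "f : Hom k d" "g : Hom k e"
  and "!!v. v : Z ==> f (($) v)*g (($) v) = 0"
 shows "(ALL v:Z. f (($) v) = 0) | (ALL v:Z. g (($) v) = 0)"
proof -
 let ?A = "{v : carrier_vec k. v ~= 0\<^sub>v k & f (($) v) = 0}"
 let ?B = "{v : carrier_vec k. v ~= 0\<^sub>v k & g (($) v) = 0}"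
 have "Z <= {v : carrier_vec k. v ~= 0\<^sub>v k}" using assms(1) by (auto simp: proj_irreducible_def proj_closed_def proj_zeros_def)
 hence "Z <= ?A Un ?B" using assms(4) by fastforce
 hence "Z <= ?A | Z <= ?B" using assms(1) proj_closed_Hom[OF assms(2)] proj_closed_Hom[OF assms(3)] unfolding proj_irreducible_def by blast
 thus ?thesis by blast
qed

lemma proj_irreducible_power:
 assumes "proj_irreducible k Z" "f : Hom k d" "!!v. v : Z ==> f (($) v)^n*g (($) v) = 0" "g : Hom k e"
  and "EX v:Z. f (($) v) ~= 0"
 shows "ALL v:Z. g (($) v) = 0" using proj_irreducible_mult[OF assms(1) Hom_power[OF assms(2)] assms(4), of n] assms(3,5) by auto

text \<open>Each \<open>h (Suc i)\<close> vanishes on \<open>Z i\<close> but not on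
  \<open>Z (Suc i)\<close>, and \<open>h 0\<close> only fills up the degree to \<open>N\<close>. In
  a relation on \<open>Z (Suc i)\<close> the least power of \<open>h (Suc i)\<close> that occurs can
  be cancelled, since the set is irreducible. Restricted to \<open>Z i\<close>, only the terms with
  this least power survive, and they form a relation one step lower.\<close>

lemma chain_forms_independent:
 assumes irr: "!!i. i <= n ==> proj_irreducible k (Z i)" and sub: "!!i. i < n ==> Z i <= Z (Suc i)"
  and h: "!!i. i <= n ==> h i : Hom k e"
  and nz: "!!i. i <= n ==> EX v:Z i. h i (($) v) ~= 0"
  and z: "!!i v. i < n ==> v : Z i ==> h (Suc i) (($) v) = 0"
 shows "i <= n ==> finite T ==> T <= expo {1..i} ==> (!!ga. ga : T ==> sum ga {1..i} <= N) ==>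
  (!!v. v : Z i ==> (SUM ga:T. b ga*(h 0 (($) v)^(N - sum ga {1..i})*(PROD l:{1..i}. h l (($) v)^ga l))) = 0) ==> ga : T ==> b ga = 0"
proof (induction i arbitrary: T N b ga)
 case 0
 have "de = (%_. 0)" if "de : T" for de using 0(3) that by (auto simp: expo_def fun_eq_iff)
 hence T: "T = {ga}" using 0(6) by blast
 obtain v where v: "v : Z 0" "h 0 (($) v) ~= 0" using nz by blast
 show ?case using 0(5)[OF v(1)] v T by simp
next
 case (Suc i)
 show ?case
 proof (rule ccontr)
  assume nb: "b ga ~= 0"
  let ?T0 = "{ga : T. b ga ~= 0}"
  define t where "t = Min ((%ga. ga (Suc i)) ` ?T0)"
  have fT0: "finite ?T0" "?T0 ~= {}" using Suc.prems nb by auto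
  have "t : (%ga. ga (Suc i)) ` ?T0" unfolding t_def using fT0 by (intro Min_in) auto
  then obtain ga1 where ga1: "ga1 : T" "b ga1 ~= 0" "ga1 (Suc i) = t" by auto
  have tle: "t <= ga (Suc i)" if "ga : T" "b ga ~= 0" for ga unfolding t_def using fT0 that by (intro Min_le) auto
  have sumS: "sum ga {1..Suc i} = sum ga {1..i} + ga (Suc i)" for ga::"nat => nat" by simp
  define w where "w = (%ga x. h 0 x^(N - sum ga {1..Suc i})*(PROD l:{1..i}. h l x^ga l))"
  define G where "G = (%x. SUM ga:?T0. b ga*(w ga x*h (Suc i) x^(ga (Suc i) - t)))"
  have GH: "G : Hom k (e*(N-t))"
  proof -
   have "(%x. w ga x*h (Suc i) x^(ga (Suc i) - t)) : Hom k (e*(N-t))" if "ga : ?T0" for ga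
   proof -
    have 1: "sum ga {1..i} + ga (Suc i) <= N" "t <= ga (Suc i)" using Suc.prems(4)[of ga] sumS[of ga] tle[of ga] that by auto
    have "(%x. h 0 x^(N - sum ga {1..Suc i})*(PROD l:{1..i}. h l x^ga l)*h (Suc i) x^(ga (Suc i) - t))
     : Hom k (e*(N - sum ga {1..Suc i})+(SUM l:{1..i}. e*ga l) + e*(ga (Suc i) - t))" using Suc.prems(1) by (intro Hom_mult Hom_power Hom_prod h) auto
    moreover have "e*(N - sum ga {1..Suc i})+(SUM l:{1..i}. e*ga l) + e*(ga (Suc i) - t) = e*((N - sum ga {1..Suc i}) + sum ga {1..i}+(ga (Suc i) - t))"
     by (simp add: sum_distrib_left algebra_simps del: sum.cl_ivl_Suc)
    moreover have "(N - sum ga {1..Suc i}) + sum ga {1..i}+(ga (Suc i) - t) = N - t" using 1 by simp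
    ultimately show ?thesis unfolding w_def by simp
   qed
   thus ?thesis unfolding G_def by (intro Hom_sum Hom_scale)
  qed
  have "ALL v:Z (Suc i). G (($) v) = 0"
  proof (rule proj_irreducible_power[OF irr[OF Suc.prems(1)] h[OF Suc.prems(1)] _ GH nz[OF Suc.prems(1)]])
   fix v assume v: "v : Z (Suc i)"
   have "h (Suc i) (($) v)^t*G (($) v) = (SUM ga:?T0. b ga*(h 0 (($) v)^(N - sum ga {1..Suc i})*(PROD l:{1..Suc i}. h l (($) v)^ga l)))"
    unfolding G_def sum_distrib_left
   proof (rule sum.cong[OF refl])
    fix ga assume "ga : ?T0"
    hence "h (Suc i) (($) v)^ga (Suc i) = h (Suc i) (($) v)^t*h (Suc i) (($) v)^(ga (Suc i) - t)" using tle[of ga] by (simp add: power_add[symmetric])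
    thus "h (Suc i) (($) v)^t*(b ga*(w ga (($) v)*h (Suc i) (($) v)^(ga (Suc i) - t)))
     = b ga*(h 0 (($) v)^(N - sum ga {1..Suc i})*(PROD l:{1..Suc i}. h l (($) v)^ga l))" by (simp add: w_def mult_ac)
   qed
   also have "... = (SUM ga:T. b ga*(h 0 (($) v)^(N - sum ga {1..Suc i})*(PROD l:{1..Suc i}. h l (($) v)^ga l)))"
    using Suc.prems(2) by (intro sum.mono_neutral_left) auto
   finally show "h (Suc i) (($) v)^t*G (($) v) = 0" using Suc.prems(5)[OF v] by simp
  qed
  hence G0: "G (($) v) = 0" if "v : Z i" for v using that sub[of i] Suc.prems(1) by auto
  define T1 where "T1 = (%ga. ga(Suc i := 0)) ` {ga : ?T0. ga (Suc i) = t}"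
  define b1 where "b1 = (%de. b (de(Suc i := t)))"
  have inj: "inj_on (%ga. ga(Suc i := 0)) {ga : ?T0. ga (Suc i) = t}"
  proof (rule inj_onI)
   fix ga de assume *: "ga : {ga : ?T0. ga (Suc i) = t}" "de : {ga : ?T0. ga (Suc i) = t}" "ga(Suc i := 0) = de(Suc i := 0)"
   show "ga = de"
   proof
    fix l show "ga l = de l" using fun_cong[OF *(3), of l] *(1,2) by (cases "l = Suc i") auto
   qed
  qed
  have sum0: "sum (ga(Suc i := 0)) {1..i} = sum ga {1..i}" for ga::"nat => nat" by (intro sum.cong) auto
  have "b1 (ga1(Suc i := 0)) = 0"
  proof (rule Suc.IH[where T = T1 and N = "N-t" and b = b1 and ga = "ga1(Suc i := 0)"])
   show "i <= n" using Suc.prems(1) by simp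
   show "finite T1" using Suc.prems(2) by (auto simp: T1_def)
   show "T1 <= expo {1..i}" using Suc.prems(3) unfolding T1_def expo_def by (auto simp: subset_iff)
   show "ga1(Suc i := 0) : T1" using ga1 by (auto simp: T1_def)
   show "sum de {1..i} <= N - t" if "de : T1" for de
   proof -
    obtain ga where g: "ga : T" "ga (Suc i) = t" "de = ga(Suc i := 0)" using `de : T1` by (auto simp: T1_def)
    thus ?thesis using Suc.prems(4)[OF g(1)] sumS[of ga] sum0[of ga] by simp
   qed
   fix v assume v: "v : Z i"
   have hz: "h (Suc i) (($) v) = 0" using z[of i v] v Suc.prems(1) by simp
   have "G (($) v) = (SUM ga:{ga : ?T0. ga (Suc i) = t}. b ga*w ga (($) v))"
   proof -
    have "G (($) v) = (SUM ga:?T0. if ga (Suc i) = t then b ga*w ga (($) v) else 0)" unfolding G_def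
    proof (rule sum.cong[OF refl])
     fix ga assume "ga : ?T0"
     hence "t <= ga (Suc i)" using tle by auto
     thus "b ga*(w ga (($) v)*h (Suc i) (($) v)^(ga (Suc i) - t)) = (if ga (Suc i) = t then b ga*w ga (($) v) else 0)" using hz by (auto simp: power_0_left)
    qed
    thus ?thesis using sum.inter_filter[OF fT0(1), of "%ga. b ga*w ga (($) v)" "%ga. ga (Suc i) = t"] by simp
   qed
   also have "... = (SUM de:T1. b1 de*(h 0 (($) v)^(N - t - sum de {1..i})*(PROD l:{1..i}. h l (($) v)^de l)))" unfolding T1_def
   proof (subst sum.reindex[OF inj], rule sum.cong[OF refl])
    fix ga assume g: "ga : {ga : ?T0. ga (Suc i) = t}"
    hence "(ga(Suc i := 0))(Suc i := t) = ga" by auto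
    moreover have "N - sum ga {1..Suc i} = N - t - sum ga {1..i}" using sumS[of ga] g by auto
    moreover have "(PROD l:{1..i}. h l (($) v)^(ga(Suc i := 0)) l) = (PROD l:{1..i}. h l (($) v)^ga l)" by (intro prod.cong) auto
    ultimately show "b ga*w ga (($) v) = ((%de. b1 de*(h 0 (($) v)^(N - t - sum de {1..i})*(PROD l:{1..i}. h l (($) v)^de l))) \<circ> (%ga. ga(Suc i := 0))) ga"
     unfolding w_def b1_def o_def sum0 by simp
   qed
   finally show "(SUM de:T1. b1 de*(h 0 (($) v)^(N - t - sum de {1..i})*(PROD l:{1..i}. h l (($) v)^de l))) = 0" using G0[OF v] by simp
  qed
  moreover have "(ga1(Suc i := 0))(Suc i := t) = ga1" using ga1(3) by auto
  ultimately show False using ga1(2) by (simp add: b1_def)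
 qed
qed

section \<open>The Krull dimension of the common zeros\<close>

context parameter_system
begin

lemma X_closed: "proj_closed k X" unfolding common_zeros_def proj_closed_def by blast

text \<open>Lying over for the cone of a closed subset \<open>Z\<close>. The condition on
  \<open>l\<close> keeps the point found away from the origin, so that it represents a projective
  point.\<close>

lemma fibre_or_relation:
 assumes "proj_closed k Z" "Z <= X" "EX q:Q. l q ~= 0"
 shows "(EX v:Z. ALL q:Q. v $ q = l q) | (EX g. pfun Q g & g l ~= 0 & (ALL v:Z. g (($) v) = 0))"
proof -
 let ?A = "(%v. ($) v) ` Z"
 have "?A <= Y" using assms(2) X_iff by auto
 then interpret fr: finite_reduction "{..<k}" P Q ?A "%q x. x q" M by (rule finite_reduction_cone)
 from fr.point_or_relation[of l] show ?thesis
 proof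
  assume "EX c. (ALL f. pfun {..<k} f --> (ALL y:?A. f y = 0) --> f c = 0) & (ALL j:Q. c j = l j)"
  then obtain c where c: "!!f. pfun {..<k} f ==> (ALL y:?A. f y = 0) ==> f c = 0" "ALL j:Q. c j = l j" by blast
  obtain S where S: "Z = proj_zeros k S" using assms(1) by (auto simp: proj_closed_def)
  have "vec k c : Z" unfolding S proj_zeros_def
  proof (intro CollectI conjI ballI)
   show "vec k c ~= 0\<^sub>v k"
   proof
    assume eq: "vec k c = 0\<^sub>v k"
    obtain q where q: "q : Q" "l q ~= 0" using assms(3) by blast
    thus False using arg_cong[OF eq, of "%v. v $ q"] c(2) by auto
   qed
   fix dc assume dc: "dc : S"
   obtain d cf where eq: "dc = (d,cf)" by force
   have "pform k d cf c = 0"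
   proof (rule c(1)[OF Hom_pfun[OF pform_Hom]])
    show "ALL y:?A. pform k d cf y = 0" using dc eq by (auto simp: S proj_zeros_def form_eq_pform)
   qed
   also have "pform k d cf c = pform k d cf (($) (vec k c))" by (intro pform_cong) auto
   finally show "case dc of (d,c') => form k d c' (vec k c) = 0" by (simp add: eq form_eq_pform)
  qed simp
  moreover have "ALL q:Q. vec k c $ q = l q" using c(2) by auto
  ultimately show ?thesis by blast
 qed auto
qed

definition enum::"nat => nat" where "enum = (SOME h. bij_betw h {..<k - r} Q)"

lemma enum: "bij_betw enum {..<k - r} Q"
proof -
 have "EX h. bij_betw h {..<k - r} Q" by (rule finite_same_card_bij) (use finQ cardQ in auto)
 thus ?thesis unfolding enum_def by (rule someI_ex)
qed

text \<open>The coordinate subspace spanned by the coordinates \<open>enum 0\<close> to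
  \<open>enum i\<close>, without its origin. A set that projects onto it plays the role of a set of
  dimension i.\<close>

definition flag::"nat => (nat => 'a) set" where "flag i = {l. (ALL q:Q. l q ~= 0 --> q : enum ` {..i}) & (EX q:Q. l q ~= 0)}"

definition covers::"nat => 'a vec set => bool" where "covers i Z \<longleftrightarrow> (ALL l:flag i. EX v:Z. ALL q:Q. v $ q = l q)"

lemma enum_in: "i < k - r ==> enum i : Q" using enum by (auto simp: bij_betw_def)

text \<open>Zorn's lemma, applied to complements. The fibres of the projection are finite, so in a
  chain of closed sets the fibre over each \<open>l\<close> becomes stationary, and the intersection
  still covers.\<close>

lemma minimal_cover:
 assumes "proj_closed k W" "W <= X" "covers i W"
 obtains Z where "proj_closed k Z" "Z <= W" "covers i Z" "!!Z'. proj_closed k Z' ==> Z' <= Z ==> covers i Z' ==> Z' = Z"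
proof -
 define ZZ where "ZZ = {Z. proj_closed k Z & Z <= W & covers i Z}"
 define A where "A = (%Z. W - Z) ` ZZ"
 have "EX m:A. ALL X:A. m <= X --> X = m"
 proof (rule subset_Zorn_nonempty)
  show "A ~= {}" using assms by (auto simp: A_def ZZ_def)
  fix CC assume CC: "CC ~= {}" "subset.chain A CC"
  define DD where "DD = {Z : ZZ. W - Z : CC}"
  have ne: "DD ~= {}" using CC by (auto simp: DD_def A_def subset_chain_def)
  have total: "Z <= Z' | Z' <= Z" if "Z : DD" "Z' : DD" for Z Z'
  proof -
   have "W - Z <= W - Z' | W - Z' <= W - Z" using that CC(2) by (auto simp: DD_def subset_chain_def)
   moreover have "Z <= W" "Z' <= W" using that by (auto simp: DD_def ZZ_def)
   ultimately show ?thesis by blast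
  qed
  have "\<Inter>DD \<in> ZZ" unfolding ZZ_def
  proof (intro CollectI conjI)
   show "proj_closed k (\<Inter>DD)" using ne by (intro proj_closed_Inter) (auto simp: DD_def ZZ_def)
   show "\<Inter>DD <= W" using ne by (auto simp: DD_def ZZ_def)
   show "covers i (\<Inter>DD)" unfolding covers_def
   proof
    fix l assume l: "l : flag i"
    define fib where "fib = (%Z. {v : Z. ALL q:Q. v $ q = l q})"
    have fin: "finite (fib Z)" if "Z : DD" for Z
    proof (rule finite_subset[OF _ finite_fibre[of l]])
     have "Z <= X" using that assms(2) unfolding DD_def ZZ_def by blast
     thus "fib Z <= {v : X. ALL q:Q. v $ q = l q}" unfolding fib_def by blast
    qed
    obtain Z0 where Z0: "Z0 : DD" "!!Z. Z : DD ==> card (fib Z0) <= card (fib Z)"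
    proof -
     obtain Z1 where "Z1 : DD" using ne by blast
     from that arg_min_nat_lemma[of "%Z. Z : DD" Z1 "%Z. card (fib Z)", OF this] show thesis by blast
    qed
    obtain v where v: "v : fib Z0" using Z0(1) l by (auto simp: fib_def DD_def ZZ_def covers_def)
    have "v : Z" if "Z : DD" for Z using total[OF that Z0(1)]
    proof
     assume "Z <= Z0"
     hence "fib Z <= fib Z0" by (auto simp: fib_def)
     hence "fib Z = fib Z0" using card_seteq[OF fin[OF Z0(1)]] Z0(2)[OF that] by blast
     with v show ?thesis by (auto simp: fib_def)
    qed (use v in "auto simp: fib_def")
    with v show "EX v:\<Inter>DD. ALL q:Q. v $ q = l q" by (auto simp: fib_def)
   qed
  qed
  moreover have "\<Union>CC = W - \<Inter>DD"
  proof
   show "\<Union>CC <= W - \<Inter>DD"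
   proof
    fix v assume "v : \<Union>CC"
    then obtain C where C: "C : CC" "v : C" by blast
    then obtain Z where Z: "Z : ZZ" "C = W - Z" using CC(2) by (auto simp: subset_chain_def A_def)
    hence "Z : DD" using C by (simp add: DD_def)
    with C Z show "v : W - \<Inter>DD" by blast
   qed
   show "W - \<Inter>DD <= \<Union>CC" by (auto simp: DD_def)
  qed
  ultimately show "\<Union>CC \<in> A" by (auto simp: A_def)
 qed
 then obtain Z where Z: "Z : ZZ" "!!Z'. Z' : ZZ ==> W - Z <= W - Z' ==> W - Z' = W - Z" by (auto simp: A_def)
 show thesis
 proof (rule that[of Z])
  show "proj_closed k Z" "Z <= W" "covers i Z" using Z(1) by (auto simp: ZZ_def)
  fix Z' assume Z': "proj_closed k Z'" "Z' <= Z" "covers i Z'"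
  hence "Z' : ZZ" using Z(1) by (auto simp: ZZ_def)
  hence "W - Z' = W - Z" using Z(2) Z'(2) by blast
  thus "Z' = Z" using Z' Z(1) by (auto simp: ZZ_def)
 qed
qed

text \<open>If \<open>Z\<close> lay in a union of two closed sets but in neither, minimality would
  give a relation on each of the two parts that does not vanish on all of \<open>flag i\<close>. The
  product of the relations vanishes on the image of \<open>Z\<close>, hence on
  \<open>flag i\<close>, which is open in a linear space and so irreducible.\<close>

lemma minimal_cover_irreducible:
 assumes "i < k - r" "proj_closed k Z" "Z <= X" "covers i Z"
  and min: "!!Z'. proj_closed k Z' ==> Z' <= Z ==> covers i Z' ==> Z' = Z"
 shows "proj_irreducible k Z" unfolding proj_irreducible_def
proof (intro conjI allI impI)
 let ?q0 = "enum 0"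
 have q0: "?q0 : Q" "?q0 : enum ` {..i}" using assms(1) by (auto intro!: enum_in[simplified])
 have "(%q. if q = ?q0 then 1 else 0) : flag i" unfolding flag_def using q0 by auto
 thus "Z ~= {}" using assms(4) by (auto simp: covers_def)
 show "proj_closed k Z" by fact
 fix A B assume AB: "proj_closed k A & proj_closed k B & Z <= A Un B"
 show "Z <= A | Z <= B"
 proof (rule ccontr)
  assume n: "~ ?thesis"
  have rel: "EX g l. pfun Q g & l : flag i & g l ~= 0 & (ALL v:Z Int C. g (($) v) = 0)"
   if C: "proj_closed k C" "~ Z <= C" for C
  proof -
   have "~ covers i (Z Int C)"
   proof
    assume "covers i (Z Int C)"
    hence "Z Int C = Z" using min[of "Z Int C"] proj_closed_Int[OF assms(2) C(1)] by blast
    with C(2) show False by blast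
   qed
   then obtain l where l: "l : flag i" "~ (EX v:Z Int C. ALL q:Q. v $ q = l q)" by (auto simp: covers_def)
   have "Z Int C <= X" "EX q:Q. l q ~= 0" using assms(3) l(1) by (auto simp: flag_def)
   with fibre_or_relation[of "Z Int C" l] proj_closed_Int[OF assms(2) C(1)] l show ?thesis by blast
  qed
  obtain g1 l1 where g1: "pfun Q g1" "l1 : flag i" "g1 l1 ~= 0" "!!v. v : Z Int A ==> g1 (($) v) = 0" using rel[of A] AB n by blast
  obtain g2 l2 where g2: "pfun Q g2" "l2 : flag i" "g2 l2 ~= 0" "!!v. v : Z Int B ==> g2 (($) v) = 0" using rel[of B] AB n by blast
  define rh where "rh = (%t q. if q : enum ` {..i} then t q else 0::'a)"
  have rhpf: "pfun UNIV (%t. rh t q)" for q unfolding rh_def by (cases "q : enum ` {..i}") (auto intro: pfunI)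
  have pf: "pfun UNIV (%t. g1 (rh t))" "pfun UNIV (%t. g2 (rh t))" using pfun_compose[OF g1(1) rhpf] pfun_compose[OF g2(1) rhpf] by auto
  \<comment> \<open>The factor \<open>t ?q0\<close> removes the points that might be the origin,
    where no element of \<open>Z\<close> need lie above.\<close>
  have prod: "(t ?q0*g1 (rh t))*g2 (rh t) = 0" for t
  proof (cases "t ?q0 = 0")
   case False
   hence "rh t : flag i" unfolding flag_def rh_def using q0 by auto
   then obtain v where v: "v : Z" "ALL q:Q. v $ q = rh t q" using assms(4) by (auto simp: covers_def)
   have "g1 (($) v) = g1 (rh t)" "g2 (($) v) = g2 (rh t)" using pfun_cong_on[OF g1(1), of "($) v" "rh t"] pfun_cong_on[OF g2(1), of "($) v" "rh t"] v(2) by auto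
   thus ?thesis using g1(4)[of v] g2(4)[of v] v(1) AB by auto
  qed simp
  have rhl: "g (rh l) = g l" if "l : flag i" "pfun Q g" for l g by (rule pfun_cong_on[OF that(2)]) (use that(1) in "auto simp: flag_def rh_def")
  have "(ALL t. t ?q0*g1 (rh t) = 0) | (ALL t. g2 (rh t) = 0)" by (rule pfun_mult_eq_0[where V = UNIV, OF _ pf(2) prod]) (intro pfunI pf(1) UNIV_I)
  thus False
  proof
   assume "ALL t. t ?q0*g1 (rh t) = 0"
   hence "t ?q0*g1 (rh t) = 0" for t by (rule spec)
   from pfun_mult_eq_0[OF pfun.var[of ?q0 UNIV, OF UNIV_I] pf(1), OF this]
   have "(ALL t::nat => 'a. t ?q0 = 0) | (ALL t. g1 (rh t) = 0)" .
   moreover have "~ (ALL t::nat => 'a. t ?q0 = 0)"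
   proof
    assume "ALL t::nat => 'a. t ?q0 = 0"
    from spec[OF this, of "%_. 1"] show False by simp
   qed
   ultimately show False using rhl[OF g1(2,1)] g1(3) by metis
  qed (use rhl[OF g2(2,1)] g2(3) in metis)
 qed
qed

text \<open>The hyperplane section of a minimal cover of \<open>flag (Suc i)\<close> by the
  coordinate \<open>enum (Suc i)\<close> covers \<open>flag i\<close>. It is a proper subset, since
  the cover also has a point where this coordinate is 1.\<close>

lemma chain_below: "i < k - r ==> proj_closed k W ==> W <= X ==> covers i W ==>
  EX Z. (ALL j<=i. proj_irreducible k (Z j) & Z j <= W) & (ALL j<i. Z j < Z (Suc j))"
proof (induction i arbitrary: W)
 case 0
 obtain Z where "proj_closed k Z" "Z <= W" "covers 0 Z" "!!Z'. proj_closed k Z' ==> Z' <= Z ==> covers 0 Z' ==> Z' = Z"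
  by (rule minimal_cover[OF 0(2-4)]) blast
 thus ?case using minimal_cover_irreducible[of 0 Z] 0 by (intro exI[of _ "%_. Z"]) auto
next
 case (Suc i)
 obtain Z where Z: "proj_closed k Z" "Z <= W" "covers (Suc i) Z" "!!Z'. proj_closed k Z' ==> Z' <= Z ==> covers (Suc i) Z' ==> Z' = Z"
  by (rule minimal_cover[OF Suc.prems(2-4)]) blast
 let ?q = "enum (Suc i)"
 have q: "?q : Q" using enum_in Suc.prems(1) by simp
 define W' where "W' = Z Int {v : carrier_vec k. v ~= 0\<^sub>v k & v $ ?q = 0}"
 have sub: "W' <= Z" by (auto simp: W'_def)
 have inj: "inj_on enum {..<k - r}" using enum by (auto simp: bij_betw_def)
 have ZX: "Z <= X" using Z(2) Suc.prems(3) by blast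
 have notin: "?q ~: enum ` {..i}"
 proof
  assume "?q : enum ` {..i}"
  then obtain j where "j <= i" "enum (Suc i) = enum j" by auto
  thus False using inj_onD[OF inj, of "Suc i" j] Suc.prems(1) by simp
 qed
 have "proj_closed k W'" unfolding W'_def using Z(1) proj_closed_Hom[OF Hom_var[of ?q k]] q by (intro proj_closed_Int) auto
 moreover have "W' <= X" using sub ZX by blast
 moreover have "covers i W'" unfolding covers_def
 proof
  fix l assume l: "l : flag i"
  hence "l : flag (Suc i)" by (fastforce simp: flag_def)
  then obtain v where v: "v : Z" "ALL q:Q. v $ q = l q" using Z(3) by (auto simp: covers_def)
  have "v $ ?q = 0" using v(2) q l notin by (auto simp: flag_def)
  hence "v : W'" using v(1) ZX X_iff by (auto simp: W'_def)
  with v show "EX v:W'. ALL q:Q. v $ q = l q" by blast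
 qed
 ultimately obtain Y where Y: "ALL j<=i. proj_irreducible k (Y j) & Y j <= W'" "ALL j<i. Y j < Y (Suc j)" using Suc.IH[of W'] Suc.prems(1) by auto
 have "W' ~= Z"
 proof
  assume eq: "W' = Z"
  have "(%q. if q = ?q then 1 else 0) : flag (Suc i)" using q by (auto simp: flag_def)
  from bspec[OF Z(3)[unfolded covers_def] this]
  obtain v where v: "v : Z" "ALL q:Q. v $ q = (if q = ?q then 1 else 0)" by (elim bexE)
  have "v $ ?q = 1" using bspec[OF v(2) q] by simp
  moreover have "v : W'" using eq v(1) by blast
  ultimately show False unfolding W'_def by simp
 qed
 with sub have "W' < Z" by blast
 define C where "C = (%j. if j <= i then Y j else Z)"
 have "ALL j<=Suc i. proj_irreducible k (C j) & C j <= W" using Y(1) sub Z(2) minimal_cover_irreducible[OF Suc.prems(1) Z(1) ZX Z(3) Z(4)] by (auto simp: C_def)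
 moreover have "C j < C (Suc j)" if "j < Suc i" for j
 proof (cases "j < i")
  case True
  thus ?thesis using Y(2) by (auto simp: C_def)
 next
  case False
  hence "j = i" using that by simp
  thus ?thesis using Y(1) `W' < Z` by (auto simp: C_def)
 qed
 ultimately show ?case by blast
qed

lemma chain_exists: "irreducible_chain k X (k-1 - r)"
proof -
 have "covers (k-1 - r) X" unfolding covers_def
 proof
  fix l assume l: "l : flag (k-1 - r)"
  obtain x where x: "x : Y" "ALL q:Q. x q = l q" using point_over by blast
  have "vec k x : X" unfolding X_iff
  proof (intro conjI)
   show "vec k x ~= 0\<^sub>v k"
   proof
    assume eq: "vec k x = 0\<^sub>v k"
    obtain q where q: "q : Q" "l q ~= 0" using l by (auto simp: flag_def)
    thus False using arg_cong[OF eq, of "%v. v $ q"] x(2) by auto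
   qed
   have "F j (($) (vec k x)) = F j x" for j by (intro pform_cong) auto
   thus "($) (vec k x) : Y" using x(1) by (simp add: Y_def)
  qed simp
  with x(2) show "EX v:X. ALL q:Q. v $ q = l q" by (intro bexI[of _ "vec k x"]) auto
 qed
 thus ?thesis using chain_below[of "k-1 - r" X] X_closed r unfolding irreducible_chain_def by auto
qed

text \<open>A chain with n + 1 members, n = k - r, would give (s + 1)^n independent forms of degree
  e n s on the cone, while the Hilbert function grows with order n - 1 only. This is one member more
  than the \<open>k - r\<close> that a chain may have.\<close>

lemma no_longer_chain: "~ irreducible_chain k X (Suc (k-1 - r))"
proof
 define n where "n = k - r"
 assume "irreducible_chain k X (Suc (k-1 - r))"
 moreover have "Suc (k-1 - r) = n" using r by (simp add: n_def)
 ultimately obtain Z where Z: "!!i. i <= n ==> proj_irreducible k (Z i)" "!!i. i <= n ==> Z i <= X"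
  "!!i. i < n ==> Z i < Z (Suc i)" by (auto simp: irreducible_chain_def)
 have n0: "n > 0" using r by (simp add: n_def)
 have "EX d f. d > 0 & f : Hom k d & (EX v:Z i. f (($) v) ~= 0) & (i > 0 --> (ALL v:Z (i-1). f (($) v) = 0))" if "i <= n" for i
 proof (cases i)
  case 0
  obtain v where v: "v : Z 0" using Z(1)[of 0] by (auto simp: proj_irreducible_def)
  hence "v : carrier_vec k" "v ~= 0\<^sub>v k" using Z(2)[of 0] X_iff by auto
  then obtain l where "l < k" "v $ l ~= 0" by (metis carrier_vecD eq_vecI index_zero_vec)
  thus ?thesis using v Hom_var[of l k] 0 by (intro exI[of _ 1] exI[of _ "%x. x l"]) auto
 next
  case (Suc i')
  have "proj_closed k (Z i')" using Z(1)[of i'] that Suc by (auto simp: proj_irreducible_def)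
  then obtain S where S: "Z i' = proj_zeros k S" by (auto simp: proj_closed_def)
  have "i' < n" using that Suc by simp
  from Z(3)[OF this] obtain v where v: "v : Z i" "v ~: Z i'" unfolding Suc by blast
  hence vX: "v : carrier_vec k" "v ~= 0\<^sub>v k" using Z(2)[OF that] X_iff by auto
  with v(2) obtain d c where dc: "(d,c) : S" "pform k d c (($) v) ~= 0" by (auto simp: S proj_zeros_def form_eq_pform)
  have z: "pform k d c (($) u) = 0" if "u : Z i'" for u using that dc(1) by (auto simp: S proj_zeros_def form_eq_pform)
  have "d > 0"
  proof (rule ccontr)
   assume "~ d > 0"
   hence "multi k d = {replicate k 0}" by (auto simp: mi_def intro!: replicate_eqI)
   hence "pform k d c x = c (replicate k 0)" for x by (simp add: pform_def lmon_def)
   moreover obtain u where "u : Z i'" using Z(1)[of i'] `i' < n` by (auto simp: proj_irreducible_def)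
   ultimately show False using z dc(2) by metis
  qed
  thus ?thesis using dc v(1) z pform_Hom Suc by (intro exI[of _ d] exI[of _ "pform k d c"]) auto
 qed
 then obtain d f where df: "!!i. i <= n ==> d i > 0" "!!i. i <= n ==> f i : Hom k (d i)" "!!i. i <= n ==> EX v:Z i. f i (($) v) ~= 0"
  "!!i v. i <= n ==> i > 0 ==> v : Z (i-1) ==> f i (($) v) = 0" by metis
 \<comment> \<open>A common degree: the forms separating the members of the chain have different
   degrees and are raised to suitable powers.\<close>
 define e where "e = (PROD i<=n. d i)"
 have e0: "e > 0" unfolding e_def using df(1) by (intro prod_pos) auto
 define h where "h = (%i x. f i x^(e div d i))"
 have dvd: "d i dvd e" if "i <= n" for i unfolding e_def using that by (intro dvd_prodI) auto
 have pos: "e div d i > 0" if "i <= n" for i using dvd[OF that] e0 df(1)[OF that] by (metis dvd_div_eq_0_iff gr0I less_numeral_extra(3))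
 have hH: "h i : Hom k e" if "i <= n" for i using Hom_power[OF df(2)[OF that], of "e div d i"] dvd[OF that] by (simp add: h_def)
 have hnz: "EX v:Z i. h i (($) v) ~= 0" if "i <= n" for i using df(3)[OF that] by (auto simp: h_def)
 have hz: "h (Suc i) (($) v) = 0" if "i < n" "v : Z i" for i v using df(4)[of "Suc i" v] that pos[of "Suc i"] by (simp add: h_def)
 have "(s+1)^n <= card (Box P M)*(e*n*s + 1)^(n-1)" for s
 proof -
  let ?E = "{ga : expo {1..n}. ALL j:{1..n}. ga j <= s}"
  let ?f = "%ga x. h 0 x^(n*s - sum ga {1..n})*(PROD l:{1..n}. h l x^ga l)"
  let ?S = "red_mons (=) P M Q (%q x. x q::'a) (e*(n*s))"
  have le: "sum ga {1..n} <= n*s" if "ga : ?E" for ga using sum_bounded_above[of "{1..n}" ga s] that by auto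
  have Qne: "Q ~= {}"
  proof
   assume "Q = {}"
   hence "card Q = 0" by (simp only: card.empty)
   thus False using cardQ n0 by (simp add: n_def)
  qed
  have fE: "finite ?E" "card ?E = (s+1)^n" using card_expo_le[of "{1..n}" s] by auto
  have "card ?E <= card ?S"
  proof (rule card_le_if_independent_on[where f = ?f and Y = "(%v. ($) v) ` Z n", OF fE(1) card_red_mons_eq(1)[OF finP finQ Qne]])
   show "?f ga : span_on ((%v. ($) v) ` Z n) ?S" if "ga : ?E" for ga
   proof -
    have "?f ga : Hom k (e*(n*s - sum ga {1..n})+(SUM l:{1..n}. e*ga l))" by (intro Hom_mult Hom_power Hom_prod hH) auto
    moreover have "e*(n*s - sum ga {1..n})+(SUM l:{1..n}. e*ga l) = e*(n*s)"
     using le[OF that] by (simp add: sum_distrib_left[symmetric] distrib_left[symmetric])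
    ultimately have "?f ga : span_on Y ?S" using Hom_on_cone by simp
    moreover have "(%v. ($) v) ` Z n <= Y" using Z(2)[of n] X_iff by auto
    ultimately show ?thesis unfolding span_on_def by blast
   qed
   fix b assume "!!y. y : (%v. ($) v) ` Z n ==> (SUM ga:?E. b ga*?f ga y) = 0"
   hence b: "(SUM ga:?E. b ga*?f ga (($) v)) = 0" if "v : Z n" for v using that by blast
   show "ALL ga:?E. b ga = 0"
   proof
    fix ga assume ga: "ga : ?E"
    show "b ga = 0"
    proof (rule chain_forms_independent[where Z = Z and n = n and h = h and i = n and T = ?E and N = "n*s" and b = b and k = k and e = e and ga = ga])
     show "Z i <= Z (Suc i)" if "i < n" for i using Z(3)[OF that] by blast
     show "?E <= expo {1..n}" by blast
     show "n <= n" by simp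
    qed (fact Z(1) hH hnz hz fE(1) le b ga)+
   qed
  qed
  also have "card ?S <= card (Box P M)*(e*(n*s) + 1)^(card Q-1)" by (rule card_red_mons_eq(2)[OF finP finQ Qne])
  finally show ?thesis using fE(2) cardQ by (simp add: n_def mult.assoc)
 qed
 hence "(s+1)^Suc (n-1) <= card (Box P M)*(e*n*s + 1)^(n-1)" for s using n0 by simp
 thus False by (rule power_growth_contradiction)
qed

theorem has_proj_dim_common_zeros: "has_proj_dim k (common_zeros k r p a) (k-1 - r)" using chain_exists no_longer_chain by (simp add: has_proj_dim_def)

end

section \<open>Rank and left kernel\<close>

text \<open>A maximal independent set of columns spans all columns, so a relation between the rows
  is a linear functional that vanishes on it. A nonzero one exists exactly when the set has fewer
  than \<open>r\<close> elements.\<close>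

lemma rank_eq_iff_left_kernel:
 fixes A::"'a::field mat"
 assumes A: "A : carrier_mat r k"
 shows "vec_space.rank r A ~= r \<longleftrightarrow> (EX w. (EX j<r. w j ~= 0) & (ALL i<k. (SUM j<r. w j*A $$ (j,i)) = 0))"
proof -
 interpret vec_space "TYPE('a)" r .
 have cols: "set (cols A) <= carrier_vec r" using cols_dim[of A] A by auto
 obtain S where S: "maximal S (%T. T <= set (cols A) & lin_indpt T)" "finite S"
  using maximal_exists_superset[of "set (cols A)" "%T. T <= set (cols A) & lin_indpt T" "{}"]
   lindep_span by (auto simp: lin_dep_def)
 have rank: "rank A = card S" by (rule rank_card_indpt[OF A S(1)])
 have SA: "S <= set (cols A)" "lin_indpt S" using S(1) by (auto simp: maximal_def)
 have Sc: "S <= carrier_vec r" using SA cols by blast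
 have le: "card S <= r" using li_le_dim(2)[OF fin_dim Sc SA(2)] dim_is_n by simp
 have in_span: "c : span S" if "c : set (cols A)" for c
 proof (rule ccontr)
  assume n: "c ~: span S"
  have "c : carrier_vec r" using that cols by blast
  hence "lin_indpt (S Un {c})" using lin_dep_iff_in_span[OF Sc SA(2)] n span_mem[OF Sc] by blast
  hence "S Un {c} = S" using S(1) that SA(1) unfolding maximal_def by blast
  thus False using n span_mem[OF Sc] by blast
 qed
 have functional: "(SUM j<r. w j*v $ j) = 0"
  if zero: "!!s. s : S ==> (SUM j<r. w j*s $ j) = 0" and v: "v : span S" for w v
 proof -
  obtain a where a: "v = lincomb a S" using v finite_in_span[OF S(2) Sc] by blast
  have "(SUM j<r. w j*v $ j) = (SUM j<r. SUM s:S. a s*(w j*s $ j))"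
   unfolding a by (intro sum.cong refl) (simp add: lincomb_index[OF _ Sc] sum_distrib_left mult.left_commute)
  also have "... = (SUM s:S. a s*(SUM j<r. w j*s $ j))" by (subst sum.swap) (simp add: sum_distrib_left)
  finally show ?thesis using zero by simp
 qed
 show ?thesis
 proof
  assume "rank A ~= r"
  hence "card S < r" using rank le by simp
  then obtain d where d: "EX e:{..<r}. d e ~= 0" "ALL s:S. (SUM e<r. d e*s $ e) = 0" using homogeneous_system[of S "{..<r}" "%e s. s $ e"] S(2) by auto
  have "(SUM j<r. d j*A $$ (j,i)) = 0" if "i < k" for i
  proof -
   have "col A i : set (cols A)" using that A by (auto simp: cols_def)
   from functional[OF _ in_span[OF this], of d] d(2) have "(SUM j<r. d j*col A i $ j) = 0" by blast
   thus ?thesis using that A by simp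
  qed
  with d(1) show "EX w. (EX j<r. w j ~= 0) & (ALL i<k. (SUM j<r. w j*A $$ (j,i)) = 0)" by blast
 next
  assume "EX w. (EX j<r. w j ~= 0) & (ALL i<k. (SUM j<r. w j*A $$ (j,i)) = 0)"
  then obtain w j0 where l: "j0 < r" "w j0 ~= 0" "!!i. i < k ==> (SUM j<r. w j*A $$ (j,i)) = 0" by blast
  show "rank A ~= r"
  proof
   assume "rank A = r"
   hence "card S = dim" using rank dim_is_n by simp
   hence "basis S" using dim_li_is_basis[OF fin_dim S(2) Sc SA(2)] by simp
   hence "span S = carrier_vec r" by (simp add: basis_def)
   have "(SUM j<r. w j*s $ j) = 0" if "s : S" for s
   proof -
    have "s : set (cols A)" using that SA by blast
    then obtain i where i: "i < k" "s = col A i" using A by (auto simp: cols_def)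
    thus ?thesis using l(3)[OF i(1)] A by simp
   qed
   from functional[OF this, of "unit_vec r j0"] have "(SUM j<r. w j*unit_vec r j0 $ j) = 0" using `span S = carrier_vec r` by simp
   also have "(SUM j<r. w j*unit_vec r j0 $ j) = (SUM j<r. if j = j0 then w j0 else 0)" using l(1) by (intro sum.cong) auto
   finally show False using l by simp
  qed
 qed
qed

section \<open>Determinants of function values\<close>

text \<open>Expand along a last column with a variable point: the result is a combination of the
  functions in which the last coefficient is the determinant already obtained, so it is not
  identically zero.\<close>

lemma exists_points_det_nonzero:
 fixes b::"nat => 'p => 'a::field"
 assumes "!!d. (!!x. (SUM i<n. d i*b i x) = 0) ==> ALL i<n. d i = 0"
 shows "EX y. det (mat n n (%(i,j). b i (y j))) ~= 0" using assms
proof (induction n)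
 case 0
 thus ?case by (simp add: det_def)
next
 case (Suc n)
 have "ALL i<n. d i = 0" if "!!x. (SUM i<n. d i*b i x) = 0" for d
 proof -
  have "(SUM i<Suc n. (if i < n then d i else 0)*b i x) = 0" for x using that[of x] by simp
  from Suc.prems[OF this] show ?thesis by (auto simp: less_Suc_eq)
 qed
 from Suc.IH[OF this] obtain y where y: "det (mat n n (%(i,j). b i (y j))) ~= 0" by blast
 define A where "A = (%x. mat (Suc n) (Suc n) (%(i,j). b i (if j < n then y j else x)))"
 define c where "c = (%i. (-1)^(i+n)*det (mat n n (%(i',j'). b (if i' < i then i' else Suc i') (y j'))))"
 have "det (A x) = (SUM i<Suc n. c i*b i x)" for x
 proof -
  have "det (A x) = (SUM i<Suc n. A x $$ (i,n)*cofactor (A x) i n)" by (rule laplace_expansion_column) (auto simp: A_def)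
  also have "... = (SUM i<Suc n. c i*b i x)"
  proof (rule sum.cong[OF refl])
   fix i assume i: "i : {..<Suc n}"
   have "mat_delete (A x) i n = mat n n (%(i',j'). b (if i' < i then i' else Suc i') (y j'))" unfolding mat_delete_def A_def by (intro eq_matI) auto
   thus "A x $$ (i,n)*cofactor (A x) i n = c i*b i x" using i by (simp add: cofactor_def c_def A_def)
  qed
  finally show ?thesis .
 qed
 moreover have "c n ~= 0"
 proof -
  have "mat n n (%(i',j'). b (if i' < n then i' else Suc i') (y j')) = mat n n (%(i,j). b i (y j))" by (intro eq_matI) auto
  with y show ?thesis by (simp add: c_def)
 qed
 ultimately obtain x where x: "det (A x) ~= 0" using Suc.prems[of c] by (metis lessI)
 have "A x = mat (Suc n) (Suc n) (%(i,j). b i ((y(n := x)) j))" unfolding A_def by (intro eq_matI) auto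
 with x show ?case by metis
qed

lemma det_values_zero_if_dependent:
 fixes g::"nat => 'p => 'a::field"
 assumes "i0 < n" "d i0 ~= 0" "!!j. j < n ==> (SUM i<n. d i*g i (y j)) = 0"
 shows "det (mat n n (%(i,j). g i (y j))) = 0"
proof -
 let ?A = "mat n n (%(i,j). g i (y j))"
 have "transpose_mat ?A *\<^sub>v vec n d = 0\<^sub>v n" using assms(3) by (intro eq_vecI) (auto simp: scalar_prod_def atLeast0LessThan mult.commute)
 moreover have "vec n d ~= 0\<^sub>v n"
 proof
  assume eq: "vec n d = 0\<^sub>v n"
  show False using arg_cong[OF eq, of "%v. v $ i0"] assms by simp
 qed
 ultimately have "det (transpose_mat ?A) = 0"
  using det_0_iff_vec_prod_zero[of "transpose_mat ?A" n] by (metis (no_types, lifting) mat_carrier transpose_carrier_mat vec_carrier)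
 thus ?thesis by (simp add: det_transpose[of ?A n])
qed

lemma det_values_imp_independent:
 fixes g::"nat => 'p => 'a::field"
 assumes "det (mat n n (%(i,j). g i (y j))) ~= 0" "!!j. j < n ==> (SUM i<n. d i*g i (y j)) = 0" "i < n"
 shows "d i = 0" using det_values_zero_if_dependent[of i n d g y] assms by blast

lemma span_if_det_values:
 fixes g::"nat => 'p => 'a::field"
 assumes B: "finite B" "card B = n" "f : fs.span B" "!!i. i < n ==> g i : fs.span B"
  and det: "det (mat n n (%(i,j). g i (y j))) ~= 0"
 shows "f : fs.span (g ` {..<n})"
proof -
 have coord: "EX C. ALL x. h x = (SUM b:B. C b*b x)" if "h : fs.span B" for h
 proof -
  have "h : range (%u. SUM v:B. (%x. u v*v x))" using that unfolding fs.span_finite[OF B(1)] .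
  then obtain C where "h = (SUM b:B. (%x. C b*b x))" by (rule imageE)
  hence "h x = (SUM b:B. C b*b x)" for x by (simp add: sum_fun_apply)
  thus ?thesis by blast
 qed
 define h where "h = (%i. if i < n then g i else f)"
 have "ALL i. EX C. ALL x. h i x = (SUM b:B. C b*b x)" using coord B(3,4) by (simp add: h_def)
 then obtain C where C: "!!i x. h i x = (SUM b:B. C i b*b x)" by metis
 obtain d where d: "EX i:{..n}. d i ~= 0" "ALL b:B. (SUM i<=n. d i*C i b) = 0" using homogeneous_system[of B "{..n}" C] B by auto
 have rel: "(SUM i<=n. d i*h i x) = 0" for x
 proof -
  have "(SUM i<=n. d i*h i x) = (SUM b:B. (SUM i<=n. d i*C i b)*b x)" unfolding C sum_distrib_left sum_distrib_right by (subst sum.swap) (simp add: mult.assoc)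
  thus ?thesis using d(2) by simp
 qed
 have split: "(SUM i<=n. d i*h i x) = (SUM i<n. d i*g i x) + d n*f x" for x by (simp add: lessThan_Suc_atMost[symmetric] h_def)
 have "d n ~= 0"
 proof
  assume "d n = 0"
  hence "(SUM i<n. d i*g i x) = 0" for x using rel[of x] split[of x] by simp
  hence "d i = 0" if "i < n" for i using det_values_imp_independent[of n g y d i] det that by blast
  with d(1) `d n = 0` show False by (auto simp: le_less)
 qed
 have "f = (%x. SUM i<n. - (d i / d n)*g i x)"
 proof
  fix x
  have "d n*f x = - (SUM i<n. d i*g i x)" using rel[of x] split[of x] by (simp add: eq_neg_iff_add_eq_0 add.commute)
  hence "f x = - (SUM i<n. d i*g i x) / d n" using `d n ~= 0` by (simp add: field_simps)
  thus "f x = (SUM i<n. - (d i / d n)*g i x)" by (simp add: sum_negf sum_divide_distrib)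
 qed
 also have "... : fs.span (g ` {..<n})" by (intro fs_span_sum fs.span_scale fs.span_base) auto
 finally show ?thesis .
qed

lemma basis_list_from_spanning:
 fixes V::"('p => 'a::field) set"
 assumes "finite (G ` I)" "V <= fs.span (G ` I)"
 obtains n i where "!!l. l < n ==> i l : I" "V <= fs.span ((%l. G (i l)) ` {..<n})"
  "card ((%l. G (i l)) ` {..<n}) = n" "!!d. (!!x. (SUM l<n. d l*G (i l) x) = 0) ==> ALL l<n. d l = 0"
proof -
 obtain B where B: "B <= G ` I" "fs.independent B" "G ` I <= fs.span B" using fs.maximal_independent_subset[of "G ` I"] by blast
 have fB: "finite B" using B(1) assms(1) finite_subset by blast
 obtain bs where bs: "set bs = B" "distinct bs" using finite_distinct_list[OF fB] by blast
 define n where "n = length bs"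
 have "ALL l. EX i. l < n --> i : I & G i = bs ! l" using B(1) bs unfolding n_def by (metis imageE nth_mem subsetD)
 then obtain i where i: "!!l. l < n ==> i l : I" "!!l. l < n ==> G (i l) = bs ! l" by metis
 have inj: "inj_on (%l. G (i l)) {..<n}" using i bs(2) by (auto intro!: inj_onI simp: n_def nth_eq_iff_index_eq)
 have img: "(%l. G (i l)) ` {..<n} = B" using i(2) bs(1) by (auto simp: n_def set_conv_nth image_iff)
 show thesis
 proof (rule that[of n i])
  show "V <= fs.span ((%l. G (i l)) ` {..<n})" unfolding img using fs.span_mono[OF B(3)] assms(2) unfolding fs.span_span by (rule order_trans[rotated])
  show "card ((%l. G (i l)) ` {..<n}) = n" using card_image[OF inj] by simp
  fix d assume d: "!!x. (SUM l<n. d l*G (i l) x) = 0"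
  define u where "u = (%b. d (the_inv_into {..<n} (%l. G (i l)) b))"
  have "(SUM b:B. (%x. u b*b x)) = 0"
  proof
   fix x
   have "(SUM b:B. (%x. u b*b x)) x = (SUM b:B. u b*b x)" by (simp add: sum_fun_apply)
   also have "... = (SUM l<n. u (G (i l))*G (i l) x)" unfolding img[symmetric] by (subst sum.reindex[OF inj]) simp
   also have "... = (SUM l<n. d l*G (i l) x)" by (intro sum.cong) (auto simp: u_def the_inv_into_f_f[OF inj])
   finally show "(SUM b:B. (%x. u b*b x)) x = 0 x" using d by simp
  qed
  hence "ALL b:B. u b = 0" using B(2) fB fs.independent_if_scalars_zero fs.dependent_finite[OF fB] by blast
  thus "ALL l<n. d l = 0" using img the_inv_into_f_f[OF inj] unfolding u_def by fastforce
 qed (use i in auto)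
qed

section \<open>Generic properties\<close>

text \<open>The property holds on a nonempty principal open set. Such sets have nonempty
  intersections, so any finite number of generic properties can be realized at once.\<close>

definition generic::"(('v => 'a::{idom,ring_char_0}) => bool) => bool" where
 "generic Q \<longleftrightarrow> (EX u. pfun UNIV u & (EX c. u c ~= 0) & (ALL c. u c ~= 0 --> Q c))"

lemma generic_conj:
 assumes "generic Q" "generic Q'"
 shows "generic (%c. Q c & Q' c)"
proof -
 obtain u c where u: "pfun UNIV u" "u c ~= 0" "!!c. u c ~= 0 ==> Q c" using assms(1) by (auto simp: generic_def)
 obtain u' c' where u': "pfun UNIV u'" "u' c' ~= 0" "!!c. u' c ~= 0 ==> Q' c" using assms(2) by (auto simp: generic_def)
 have "EX c. u c*u' c ~= 0" using pfun_mult_eq_0[OF u(1) u'(1)] u(2) u'(2) by blast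
 thus ?thesis unfolding generic_def using u u' by (intro exI[of _ "%c. u c*u' c"]) (auto intro: pfunI)
qed

lemma generic_True: "generic (%_. True)" unfolding generic_def by (intro exI[of _ "%_. 1"]) (auto intro: pfunI)

lemma generic_ball: "finite A ==> (!!i. i : A ==> generic (Q i)) ==> generic (%c. ALL i:A. Q i c)"
proof (induction A rule: finite_induct)
 case (insert i A)
 thus ?case using generic_conj[of "Q i" "%c. ALL i:A. Q i c"] by simp
qed (simp add: generic_True)

lemma generic_ex: "generic Q ==> EX c. Q c" by (auto simp: generic_def)
lemma generic_mono: "generic Q ==> (!!c. Q c ==> Q' c) ==> generic Q'" unfolding generic_def by blast

lemma generic_compose:
 fixes f::"('v => 'a::{idom,ring_char_0}) => 'w => 'a"
 assumes "generic Q" "!!v. pfun UNIV (%c. f c v)" "!!b. EX c. f c = b"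
 shows "generic (%c. Q (f c))"
proof -
 obtain u b where u: "pfun UNIV u" "u b ~= 0" "!!c. u c ~= 0 ==> Q c" using assms(1) by (auto simp: generic_def)
 obtain c where "f c = b" using assms(3) by blast
 thus ?thesis unfolding generic_def using u pfun_compose[OF u(1) assms(2)] by (intro exI[of _ "%c. u (f c)"]) auto
qed

text \<open>At \<open>cc\<close> a basis is selected from the family and points are selected where
  its determinant of values is nonzero. Wherever this determinant stays nonzero, the selected
  functions are independent elements of the fixed space \<open>W\<close>, whose dimension they
  match.\<close>

lemma generic_spanning:
 fixes G::"('v => 'a::field_char_0) => 'i => 'p => 'a"
 assumes "finite I" "W <= fs.span (G cc ` I)" "!!c i. i : I ==> G c i : W"
  and "!!i x. i : I ==> pfun UNIV (%c. G c i x)"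
 obtains u where "pfun UNIV u" "u cc ~= 0" "!!c. u c ~= 0 ==> W <= fs.span (G c ` I)"
proof -
 obtain n i where i: "!!l. l < n ==> i l : I" "W <= fs.span ((%l. G cc (i l)) ` {..<n})"
  "card ((%l. G cc (i l)) ` {..<n}) = n" "!!d. (!!x. (SUM l<n. d l*G cc (i l) x) = 0) ==> ALL l<n. d l = 0"
  by (rule basis_list_from_spanning[OF finite_imageI[OF assms(1)] assms(2)]) blast
 obtain y where y: "det (mat n n (%(l,j). G cc (i l) (y j))) ~= 0" using exists_points_det_nonzero[where n = n and b = "%l. G cc (i l)"] i(4) by blast
 show ?thesis
 proof (rule that[of "%c. det (mat n n (%(l,j). G c (i l) (y j)))"])
  show "pfun UNIV (%c. det (mat n n (%(l,j). G c (i l) (y j))))" by (intro pfun_det assms(4) i(1))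
  fix c assume d: "det (mat n n (%(l,j). G c (i l) (y j))) ~= 0"
  show "W <= fs.span (G c ` I)"
  proof
   fix f assume f: "f : W"
   have "f : fs.span ((%l. G c (i l)) ` {..<n})"
   proof (rule span_if_det_values[where B = "(%l. G cc (i l)) ` {..<n}" and y = y and n = n and f = f and g = "%l. G c (i l)", rotated 2])
    show "f : fs.span ((%l. G cc (i l)) ` {..<n})" using f i(2) by blast
    show "G c (i l) : fs.span ((%l. G cc (i l)) ` {..<n})" if "l < n" for l using assms(3)[OF i(1)[OF that]] i(2) by blast
   qed (use i(3) d in simp_all)
   moreover have "(%l. G c (i l)) ` {..<n} <= G c ` I" using i(1) by auto
   ultimately show "f : fs.span (G c ` I)" using fs.span_mono by blast
  qed
 qed (rule y)
qed

section \<open>Generic forms admit a system of parameters\<close>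

text \<open>A sufficient condition for the expected dimension that, unlike a statement about chains
  of closed sets, is visibly open in the coefficients.\<close>

definition Good::"nat => nat => (nat => nat) => (cvar => 'a::{alg_closed_field,field_char_0}) => bool" where
 "Good k r p a \<longleftrightarrow> nonzero_forms k r p a & (EX P M. parameter_system k r p a P M)"

text \<open>The functions of \<open>gens\<close>, indexed by a set that does not depend on the
  coefficients, as \<open>generic_spanning\<close> requires.\<close>

definition gen::"nat => (nat => nat) => (cvar => 'a::field) => (cvar)+(cvar) => 'a fn" where
 "gen k p a s x = (case s of Inl (j,m) => pform k (p j) (%m. a (j,m)) x*lmon k m x | Inr (q,m) => x q*lmon k m x)"

definition gen_index::"nat => nat => (nat => nat) => nat set => nat => ((cvar)+(cvar)) set" where
 "gen_index k r p P M = Inl ` {(j,m). j < r & length m = k & p j + sum_list m = M} Un Inr ` {(q,m). q < k & q ~: P & length m = k & Suc (sum_list m) = M}"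

lemma finite_gen_index: "finite (gen_index k r p P M)"
proof -
 have fin: "finite {m. length m = k & sum_list m <= M}" for k M::nat
  by (rule finite_subset[of _ "\<Union>d\<in>{..M}. multi k d"]) (use finite_mi[unfolded mi_def] in "auto simp: mi_def")
 have "{(j,m). j < r & length m = k & p j + sum_list m = M} <= {..<r} \<times> {m. length m = k & sum_list m <= M}"
  "{(q,m). q < k & q ~: P & length m = k & Suc (sum_list m) = M} <= {..<k} \<times> {m. length m = k & sum_list m <= M}" by auto
 thus ?thesis unfolding gen_index_def using fin by (meson finite_SigmaI finite_UnI finite_imageI finite_lessThan finite_subset)
qed

lemma gens_eq_image: "gens k r p a P M = gen k p a ` gen_index k r p P M"
proof -
 have img: "{f j m | j m. Q j m} = (%s. f (fst s) (snd s)) ` {(j,m). Q j m}"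
  for f::"nat => nat list => 'a fn" and Q by force
 show ?thesis unfolding gens_def img gen_index_def image_Un image_image by (intro arg_cong2[of _ _ _ _ "(\<union>)"] image_cong) (auto simp: gen_def[abs_def])
qed

lemma gen_Hom: "s : gen_index k r p P M ==> gen k p a s : Hom k M"
proof (cases s)
 case (Inl jm)
 obtain j m where jm: "jm = (j,m)" by fastforce
 assume "s : gen_index k r p P M"
 hence "m : multi k (sum_list m)" "p j + sum_list m = M" by (auto simp: gen_index_def Inl jm mi_def)
 thus ?thesis using Hom_mult[OF pform_Hom[of k "p j" "%m. a (j,m)"] lmon_Hom] by (auto simp: gen_def[abs_def] Inl jm)
next
 case (Inr qm)
 obtain q m where qm: "qm = (q,m)" by fastforce
 assume "s : gen_index k r p P M"
 hence "m : multi k (sum_list m)" "q < k" "1 + sum_list m = M" by (auto simp: gen_index_def Inr qm mi_def)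
 thus ?thesis using Hom_mult[OF Hom_var lmon_Hom, of q k m "sum_list m"] by (auto simp: gen_def[abs_def] Inr qm)
qed

lemma pfun_gen: "pfun UNIV (%a. gen k p a s x)" by (cases s) (auto simp: gen_def pform_def split: prod.split intro!: pfunI)

lemma Good_open:
 assumes "Good k r p a0"
 shows "EX u. mv_eval a0 u ~= 0 & (ALL a. mv_eval a u ~= 0 --> Good k r p a)"
proof -
 obtain P M where PM: "parameter_system k r p a0 P M" using assms by (auto simp: Good_def)
 interpret ps: parameter_system k r p a0 P M by (rule PM)
 obtain h where h: "pfun UNIV h" "h a0 ~= 0" "!!a. h a ~= 0 ==> Hom k M <= fs.span (gens k r p a P M)"
  using generic_spanning[OF finite_gen_index ps.full[unfolded gens_eq_image] gen_Hom[of _ k r p P M] pfun_gen] unfolding gens_eq_image by blast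
 have "ALL j. EX m. j < r --> m : multi k (p j) & a0 (j,m) ~= 0" using assms by (auto simp: Good_def nonzero_forms_def)
 then obtain m where m: "!!j. j < r ==> m j : multi k (p j) & a0 (j,m j) ~= 0" by metis
 have "pfun UNIV (%a. h a*(PROD j<r. a (j,m j)))" by (intro pfunI h) auto
 then obtain u where u: "!!a. mv_eval a u = h a*(PROD j<r. a (j,m j))" by (auto dest!: pfun_imp_mvpoly)
 have "Good k r p a" if a: "mv_eval a u ~= 0" for a
 proof -
  have "nonzero_forms k r p a" using a m by (auto simp: nonzero_forms_def u)
  moreover have "parameter_system k r p a P M" using h(3) a ps.P ps.r ps.p ps.M unfolding u by unfold_locales auto
  ultimately show ?thesis by (auto simp: Good_def)
 qed
 thus ?thesis using h(2) m by (intro exI[of _ u]) (auto simp: u)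
qed

section \<open>Ideals that contain a power of every coordinate\<close>

abbreviation "idl k r p a P d == fs.span (gens k r p a P d)"

lemma gens_mult_lmon:
 assumes "g : gens k r p a P d" "length m = k"
 shows "(%x. g x*lmon k m x) : gens k r p a P (d + sum_list m)"
proof -
 consider j m' where "g = (%x. pform k (p j) (%m. a (j,m)) x*lmon k m' x)" "j < r" "length m' = k" "p j + sum_list m' = d"
  | q m' where "g = (%x. x q*lmon k m' x)" "q < k" "q ~: P" "length m' = k" "Suc (sum_list m') = d" using assms(1) by (auto simp: gens_def)
 thus ?thesis
 proof cases
  case 1
  have "(%x. g x*lmon k m x) = (%x. pform k (p j) (%m. a (j,m)) x*lmon k (map2 (+) m' m) x)" unfolding 1(1) by (simp add: mult.assoc lmon_mult[OF 1(3) assms(2)])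
  moreover have "p j + sum_list (map2 (+) m' m) = d + sum_list m" using 1 assms by (simp add: sum_list_map2_add)
  ultimately show ?thesis using 1 assms unfolding gens_def by (intro UnI1 CollectI exI[of _ j] exI[of _ "map2 (+) m' m"]) auto
 next
  case 2
  have "(%x. g x*lmon k m x) = (%x. x q*lmon k (map2 (+) m' m) x)" unfolding 2(1) by (simp add: mult.assoc lmon_mult[OF 2(4) assms(2)])
  moreover have "Suc (sum_list (map2 (+) m' m)) = d + sum_list m" using 2 assms by (simp add: sum_list_map2_add)
  ultimately show ?thesis using 2 assms unfolding gens_def by (intro UnI2 CollectI exI[of _ q] exI[of _ "map2 (+) m' m"]) auto
 qed
qed

lemma idl_mult:
 assumes "f : idl k r p a P d" "g : Hom k e"
 shows "(%x. f x*g x) : idl k r p a P (d+e)" using assms(2) unfolding Hom_def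
proof (rule fs_span_mult)
 fix g'::"'a fn" assume "g' : lmon k ` multi k e"
 then obtain m where m: "g' = lmon k m" "length m = k" "sum_list m = e" by (auto simp: mi_def)
 have "(%x. g' x*f x) : idl k r p a P (d+e)" using assms(1)
 proof (rule fs_span_mult)
  fix f' assume "f' : gens k r p a P d"
  hence "(%x. f' x*g' x) : gens k r p a P (d+e)" using gens_mult_lmon m by metis
  thus "(%x. g' x*f' x) : idl k r p a P (d+e)" by (simp add: mult.commute fs.span_base)
 qed
 thus "(%x. f x*g' x) : idl k r p a P (d+e)" by (simp add: mult.commute)
qed

lemma idl_form: "j < r ==> pform k (p j) (%m. a (j,m)) : idl k r p a P (p j)"
 by (intro fs.span_base, unfold gens_def, intro UnI1 CollectI exI[of _ j] exI[of _ "replicate k 0"]) (auto simp: lmon_def)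

lemma idl_var: "q < k ==> q ~: P ==> (%x. x q) : idl k r p a P 1" by (intro fs.span_base, unfold gens_def, intro UnI2 CollectI exI[of _ q] exI[of _ "replicate k 0"])
  (auto simp: lmon_def)

lemma idl_power_add:
 assumes "A : idl k r p a P d" "A : Hom k d" "B : Hom k d"
 shows "(%x. (A x + B x)^n - B x^n) : idl k r p a P (d*n)"
proof (induction n)
 case (Suc n)
 have "(%x. ((A x + B x)^n - B x^n)*(A x + B x)) : idl k r p a P (d*n + d)" by (intro idl_mult Suc Hom_add assms)
 moreover have "(%x. A x*B x^n) : idl k r p a P (d + d*n)" by (intro idl_mult assms Hom_power)
 ultimately have "(%x. ((A x + B x)^n - B x^n)*(A x + B x) + A x*B x^n) : idl k r p a P (d*Suc n)" by (auto intro!: fs_span_add simp: add.commute)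
 thus ?case by (simp add: algebra_simps)
qed (simp add: fs_span_zero)

text \<open>Modulo the form, \<open>x i^p j\<close> is a multiple of \<open>x i'^p j\<close>. Its
  power with exponent \<open>N\<close> is then a multiple of \<open>x i'^N\<close>, which lies in
  the ideal.\<close>

lemma idl_power_step:
 assumes j: "j < r" "0 < p j" and i: "i < k" "i' < k"
  and F: "!!x. pform k (p j) (%m. a (j,m)) x = c*x i^p j + c'*x i'^p j" "c ~= 0"
  and N: "(%x. x i'^N) : idl k r p a P N"
 shows "(%x. x i^(p j*N)) : idl k r p a P (p j*N)"
proof -
 let ?A = "%x. inverse c*pform k (p j) (%m. a (j,m)) x"
 let ?B = "%x. - c' / c*x i'^p j"
 have "?A : idl k r p a P (p j)" by (intro fs.span_scale idl_form j)
 moreover have "?A : Hom k (p j)" by (intro Hom_scale pform_Hom)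
 moreover have "?B : Hom k (p j)" using Hom_power[OF Hom_var[OF i(2)], of "p j"] by (intro Hom_scale) simp
 ultimately have 1: "(%x. (?A x + ?B x)^N - ?B x^N) : idl k r p a P (p j*N)" by (rule idl_power_add)
 have "(%x. x i'^N*x i'^((p j-1)*N)) : idl k r p a P (N + (p j-1)*N)" using Hom_power[OF Hom_var[OF i(2)], of "(p j-1)*N"] by (intro idl_mult N) simp
 hence "(%x. (- c' / c)^N*(x i'^N*x i'^((p j-1)*N))) : idl k r p a P (N + (p j-1)*N)" by (rule fs.span_scale)
 moreover have "N + (p j-1)*N = p j*N" using j(2) by (cases "p j") auto
 moreover from this have "(- c' / c)^N*(x i'^N*x i'^((p j-1)*N)) = ?B x^N" for x
  by (simp only: power_add[symmetric] power_mult_distrib power_mult[symmetric])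
 ultimately have "(%x. ?B x^N) : idl k r p a P (p j*N)" by (simp only:)
 from fs_span_add[OF 1 this] have "(%x. (?A x + ?B x)^N) : idl k r p a P (p j*N)" by simp
 moreover have "?A x + ?B x = x i^p j" for x using F by (simp add: field_simps)
 ultimately show ?thesis by (simp add: power_mult)
qed

text \<open>Pigeonhole: a monomial whose degree exceeds the sum of the \<open>N i\<close> is
  divisible by one of the powers.\<close>

lemma Hom_subset_idl_if_powers:
 assumes "!!i. i < k ==> (%x. x i^N i) : idl k r p a P (N i)" "(SUM i<k. N i) < M"
 shows "Hom k M <= idl k r p a P M" unfolding Hom_def
proof (rule fs.span_minimal)
 show "lmon k ` multi k M <= idl k r p a P M"
 proof
  fix f::"'a fn" assume "f : lmon k ` multi k M"
  then obtain m where m: "f = lmon k m" "length m = k" "sum_list m = M" by (auto simp: mi_def)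
  have "EX i<k. N i <= m ! i"
  proof (rule ccontr)
   assume "~ (EX i<k. N i <= m ! i)"
   hence "(SUM i<k. m ! i) <= (SUM i<k. N i)" by (intro sum_mono) force
   thus False using m assms(2) by (simp add: sum_list_sum_nth atLeast0LessThan)
  qed
  then obtain i where i: "i < k" "N i <= m ! i" by blast
  define m' where "m' = m[i := m ! i - N i]"
  have "lmon k m = (%x. x i^N i*lmon k m' x::'a)"
  proof
   fix x::"nat => 'a"
   have "lmon k m' x = x i^(m ! i - N i)*(PROD l:{..<k}-{i}. x l^(m ! l))"
    unfolding lmon_def m'_def using i m by (subst prod.remove[of _ i]) (auto intro!: prod.cong)
   moreover have "lmon k m x = x i^(m ! i)*(PROD l:{..<k}-{i}. x l^(m ! l))" unfolding lmon_def using i by (subst prod.remove[of _ i]) auto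
   ultimately show "lmon k m x = x i^N i*lmon k m' x" using i(2) by (simp add: mult.assoc[symmetric] power_add[symmetric])
  qed
  moreover have "sum_list m' = M - N i" "length m' = k" "N i <= M" using m i by (auto simp: m'_def sum_list_update intro: le_trans[OF _ member_le_sum_list])
  hence "(%x. x i^N i*lmon k m' x) : idl k r p a P (N i + (M - N i))" by (intro idl_mult assms i lmon_Hom) (auto simp: mi_def)
  ultimately show "f : idl k r p a P M" using m(1) `N i <= M` by simp
 qed
qed simp

lemma parameter_system_if_powers:
 fixes a::"cvar => 'a::{alg_closed_field,field_char_0}"
 assumes "P <= {..<k}" "card P = r" "r < k" "!!j. j < r ==> 0 < p j" "!!i. i < k ==> EX N. (%x. x i^N) : idl k r p a P N"
 shows "EX M. parameter_system k r p a P M"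
proof -
 obtain N where N: "!!i. i < k ==> (%x. x i^N i) : idl k r p a P (N i)" using assms(5) by metis
 have "parameter_system k r p a P (Suc (SUM i<k. N i))" using assms(1-4) Hom_subset_idl_if_powers[OF N] by unfold_locales auto
 thus ?thesis by blast
qed

section \<open>A plane of complete intersections\<close>

definition power_index::"nat => nat => nat => nat list" where "power_index k i d = (replicate k 0)[i := d]"

lemma power_index_in: "i < k ==> power_index k i d : multi k d" by (simp add: power_index_def mi_def sum_list_update)

lemma lmon_power_index: "i < k ==> lmon k (power_index k i d) x = x i^d"
proof -
 assume i: "i < k"
 have "lmon k (power_index k i d) x = (PROD l<k. if l = i then x i^d else 1)" unfolding lmon_def power_index_def by (intro prod.cong) (auto simp: nth_list_update)
 thus ?thesis using i by simp
qed

lemma power_index_inj: "i < k ==> j < k ==> 0 < d ==> power_index k i d = power_index k j d \<longleftrightarrow> i = j"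
proof -
 assume *: "i < k" "j < k" "0 < d"
 have "power_index k i d ~= power_index k j d" if "i ~= j"
 proof -
  have "power_index k i d ! i = d" "power_index k j d ! i = 0" using * that by (simp_all add: power_index_def)
  thus ?thesis using * by auto
 qed
 thus ?thesis by blast
qed

text \<open>The coefficients of the binomials s x_j^p_j + t x_(j+1)^p_j. They are linear in (s, t),
  and consecutive coordinates are linked so that powers propagate along the sequence in one of the
  two directions.\<close>

definition plane::"nat => (nat => nat) => 'a => 'a => cvar => 'a::field" where
 "plane k p s t v = (case v of (j,m) => (if m = power_index k j (p j) then s else 0)+(if m = power_index k (Suc j) (p j) then t else 0))"

lemma pform_plane:
 assumes "Suc j < k"
 shows "pform k (p j) (%m. plane k p s t (j,m)) x = s*x j^p j + t*x (Suc j)^p j"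
proof -
 have *: "(SUM m:multi k (p j). (if m = power_index k i (p j) then c else 0)*lmon k m x) = c*x i^p j"
  if "i < k" for i c
 proof -
  have "(SUM m:multi k (p j). (if m = power_index k i (p j) then c else 0)*lmon k m x)
    = (SUM m:multi k (p j). if m = power_index k i (p j) then c*x i^p j else 0)" using lmon_power_index[OF that] by (intro sum.cong) auto
  thus ?thesis using power_index_in[OF that, of "p j"] by simp
 qed
 show ?thesis unfolding pform_def plane_def using assms by (simp add: distrib_right sum.distrib *)
qed

text \<open>For s nonzero the parameters are the coordinates from \<open>r\<close> on, and powers
  propagate downwards to 0. For s = 0 they are the coordinate 0 and those beyond \<open>r\<close>,
  and powers propagate upwards.\<close>

lemma Good_plane:
 fixes s t::"'a::{alg_closed_field,field_char_0}"
 assumes r: "r < k" and p: "!!j. j < r ==> 0 < p j" and st: "s ~= 0 | t ~= 0"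
 shows "Good k r p (plane k p s t)"
proof -
 let ?a = "plane k p s t"
 have "nonzero_forms k r p ?a" unfolding nonzero_forms_def
 proof (intro allI impI)
  fix j assume j: "j < r"
  have "plane k p s t (j,power_index k j (p j)) = s" "plane k p s t (j,power_index k (Suc j) (p j)) = t" using j r p[OF j] by (auto simp: plane_def power_index_inj)
  moreover have "power_index k j (p j) : multi k (p j)" "power_index k (Suc j) (p j) : multi k (p j)" using j r by (simp_all add: power_index_in)
  ultimately show "EX m:multi k (p j). ?a (j,m) ~= 0" using st by (metis (no_types, lifting))
 qed
 moreover have "EX P M. parameter_system k r p ?a P M"
 proof (cases "s = 0")
  case False
  have "EX N. (%x. x i^N) : idl k r p ?a {..<r} N" if "i < k" for i using that
  proof (induction "k-i" arbitrary: i rule: less_induct)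
   case less
   show ?case
   proof (cases "i < r")
    case True
    hence "EX N. (%x. x (Suc i)^N) : idl k r p ?a {..<r} N" using less r by (intro less(1)) auto
    then obtain N where "(%x. x (Suc i)^N) : idl k r p ?a {..<r} N" by blast
    moreover have F: "pform k (p i) (%m. ?a (i,m)) x = s*x i^p i + t*x (Suc i)^p i" for x using True r by (intro pform_plane) auto
    ultimately have "(%x. x i^(p i*N)) : idl k r p ?a {..<r} (p i*N)"
     using True r p by (intro idl_power_step[where j = i and i' = "Suc i" and c = s and c' = t and p = p and a = "plane k p s t", OF True _ _ _ F False]) auto
    thus ?thesis by blast
   next
    assume "~ i < r"
    hence "(%x. x i^1) : idl k r p ?a {..<r} 1" using idl_var[of i k "{..<r}"] less by simp
    thus ?thesis by blast
   qed
  qed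
  hence "EX M. parameter_system k r p ?a {..<r} M" using r p by (intro parameter_system_if_powers) auto
  thus ?thesis by blast
 next
  case True
  hence t: "t ~= 0" using st by simp
  have "EX N. (%x. x i^N) : idl k r p ?a {1..r} N" if "i < k" for i using that
  proof (induction i)
   case 0
   hence "(%x. x 0^1) : idl k r p ?a {1..r} 1" using idl_var[of 0 k "{1..r}"] by simp
   thus ?case by blast
  next
   case (Suc i)
   show ?case
   proof (cases "i < r")
    case True
    obtain N where N: "(%x. x i^N) : idl k r p ?a {1..r} N" using Suc by auto
    have F: "pform k (p i) (%m. ?a (i,m)) x = t*x (Suc i)^p i + s*x i^p i" for x using pform_plane[OF Suc(2)] by (simp add: add.commute)
    have "(%x. x (Suc i)^(p i*N)) : idl k r p ?a {1..r} (p i*N)"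
     using True r p Suc N by (intro idl_power_step[where j = i and i = "Suc i" and i' = i and c = t and c' = s and p = p and a = "plane k p s t", OF True _ _ _ F t]) auto
    thus ?thesis by blast
   next
    assume "~ i < r"
    hence "(%x. x (Suc i)^1) : idl k r p ?a {1..r} 1" using idl_var[of "Suc i" k "{1..r}"] Suc by simp
    thus ?thesis by blast
   qed
  qed
  hence "EX M. parameter_system k r p ?a {1..r} M" using r p by (intro parameter_system_if_powers) auto
  thus ?thesis by blast
 qed
 ultimately show ?thesis by (simp add: Good_def)
qed

lemma poly_without_roots:
 fixes p::"'a::alg_closed_field poly"
 assumes "!!x. poly p x ~= 0"
 shows "poly p x = poly p y"
proof -
 have "degree p = 0" using alg_closed_imp_poly_has_root[of p] assms by auto
 then obtain c where "p = [:c:]" by (rule degree_eq_zeroE)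
 thus ?thesis by simp
qed

text \<open>Along lines of the plane that miss the origin \<open>f\<close> has no root, so it is
  constant there; hence it is constant on the plane and nonzero at the origin. If D(a) is nonzero,
  homogeneity of \<open>D\<close> keeps \<open>f\<close> without roots on the line from 0 to
  \<open>a\<close>, so f(a) = f(0). This holds on an open set.\<close>

lemma unit_if_no_zero_on_plane:
 fixes f D::"('v,'a::{alg_closed_field,field_char_0}) mvpoly"
 assumes pl: "!!s t. s ~= 0 | t ~= 0 ==> mv_eval (%v. s*b v + t*c v) f ~= 0"
  and hom: "!!mu a. mu ~= 0 ==> mv_eval (%v. mu*a v) D = mu^d*mv_eval a D"
  and dvd: "f dvd D" and D: "D ~= 0"
 shows "f dvd 1"
proof -
 define F where "F = (%s t. mv_eval (%v. s*b v + t*c v) f)"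
 obtain g where g: "D = f*g" using dvd by blast
 have line: "F s t = F s' t'" if "s*t' ~= t*s'" for s t s' t'
 proof -
  obtain P where P: "!!x. mv_eval (%v. (s*b v + t*c v) + x*((s' - s)*b v + (t' - t)*c v)) f = poly P x"
   using pfun_line[OF pfun_mv_UNIV, of "%v. s*b v + t*c v" "%v. (s' - s)*b v + (t' - t)*c v" f] by blast
  have PF: "poly P x = F (s + x*(s' - s)) (t + x*(t' - t))" for x unfolding P[symmetric] F_def by (simp add: algebra_simps)
  have "poly P x ~= 0" for x
  proof -
   have "s + x*(s' - s) ~= 0 | t + x*(t' - t) ~= 0"
   proof (rule ccontr)
    assume "~ ?thesis"
    hence "s + x*(s' - s) = 0" "t + x*(t' - t) = 0" by auto
    hence "(s + x*(s' - s))*(t' - t)-(t + x*(t' - t))*(s' - s) = 0" by simp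
    moreover have "(s + x*(s' - s))*(t' - t)-(t + x*(t' - t))*(s' - s) = s*t' - t*s'" by (simp add: algebra_simps)
    ultimately show False using that by simp
   qed
   thus ?thesis unfolding PF F_def by (rule pl)
  qed
  hence "poly P 0 = poly P 1" by (rule poly_without_roots)
  thus ?thesis by (simp add: PF)
 qed
 have F_const: "F s 0 = F 1 0" if "s ~= 0" for s using line[where s = s and t = 0 and s' = 1 and t' = 1] line[where s = 1 and t = 1 and s' = 1 and t' = 0] that by simp
 obtain P where P: "!!x. mv_eval (%v. (0::'a) + x*b v) f = poly P x" using pfun_line[OF pfun_mv_UNIV, of "%v. 0" b f] by blast
 have "poly P s = F s 0" for s using P[of s] by (simp add: F_def)
 have "P - [:F 1 0:] = 0"
 proof (rule poly_eq_0_infinite)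
  show "infinite (UNIV - {0::'a})" using infinite_UNIV_char_0 by simp
  show "poly (P - [:F 1 0:]) s = 0" if "s : UNIV - {0}" for s using that F_const[of s] `!!s. poly P s = F s 0` by simp
 qed
 hence "poly P 0 = F 1 0" by simp
 hence f0: "mv_eval (%v. 0) f ~= 0" using P[of 0] pl[of 1 0] by (simp add: F_def)
 have const: "mv_eval a f = mv_eval (%v. 0) f" if a: "mv_eval a D ~= 0" for a
 proof -
  obtain Q where Q: "!!x. mv_eval (%v. (0::'a) + x*a v) f = poly Q x" using pfun_line[OF pfun_mv_UNIV, of "%v. 0" a f] by blast
  have "poly Q x ~= 0" for x
  proof (cases "x = 0")
   case True
   thus ?thesis using Q[of 0] f0 by simp
  next
   case False
   hence "mv_eval (%v. x*a v) f*mv_eval (%v. x*a v) g ~= 0" using hom[of x a] a by (simp add: g)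
   thus ?thesis using Q[of x] by auto
  qed
  hence "poly Q 1 = poly Q 0" by (rule poly_without_roots)
  thus ?thesis using Q[of 1] Q[of 0] by simp
 qed
 have "mv_eval a (f - mv_const (mv_eval (%v. 0) f))*mv_eval a D = 0" for a using const by auto
 hence "(ALL a. mv_eval a (f - mv_const (mv_eval (%v. 0) f)) = 0) | (ALL a. mv_eval a D = 0)" by (rule pfun_mult_eq_0[OF pfun_mv_UNIV pfun_mv_UNIV])
 hence "f = mv_const (mv_eval (%v. 0) f)" using D mv_eval_zero_imp_zero[of D] by (intro mv_eval_eqI) auto
 hence "f*mv_const (inverse (mv_eval (%v. 0) f)) = 1" using f0 by (intro mv_eval_eqI) (metis mv_eval_const mv_eval_simps(2) mv_eval_simps(4) right_inverse)
 thus ?thesis by (metis dvdI)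
qed

section \<open>Weights\<close>

text \<open>Scaling by 2 is enough: different exponents give different powers of 2 in characteristic
  0, so comparing coefficients determines the weight of every monomial.\<close>

lemma weights_of_monomials:
 fixes D::"('v,'a::field_char_0) mvpoly"
 assumes "!!mu a. mu ~= 0 ==> mv_eval (%v. mu^W v*a v) D = mu^d*mv_eval a D" "t : keys D"
 shows "(SUM v:keys t. W v*lookup t v) = d"
proof -
 let ?w = "%t. SUM v:keys t. W v*lookup t v"
 have mon: "mmon (%v. 2^W v*a v) t = 2^?w t*mmon a t" for a::"'v => 'a" and t by (simp add: mmon_def power_mult_distrib prod.distrib power_mult power_sum)
 have "lookup D t*(2^?w t - 2^d) = 0"
 proof (rule mv_sum_zero_imp_coeffs_zero[where V = "\<Union>t\<in>keys D. keys t" and T = "keys D"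
    and c = "%t. lookup D t*(2^?w t - 2^d)"])
  fix a::"'v => 'a"
  have "mv_eval (%v. 2^W v*a v) D - 2^d*mv_eval a D = 0" using assms(1)[of 2 a] by simp
  thus "(SUM t:keys D. lookup D t*(2^?w t - 2^d)*mmon a t) = 0"
   unfolding mv_eval_eq_subst mv_subst_monom mon by (simp add: sum_distrib_left sum_subtractf[symmetric] algebra_simps)
 qed (use assms(2) in auto)
 hence "(2::'a)^?w t = 2^d" using assms(2) by (simp add: in_keys_iff)
 hence "(of_nat (2^?w t)::'a) = of_nat (2^d)" by simp
 hence "2^?w t = (2::nat)^d" unfolding of_nat_eq_iff .
 thus ?thesis by simp
qed

locale discriminant =
 fixes k r degvar::nat and p deg::"nat => nat"
  and D::"(cvar,'a::{alg_closed_field,field_char_0}) mvpoly"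
 assumes r: "0 < r" "r < k" and p: "!!j. j < r ==> 0 < p j"
  and disc: "is_discriminant k r p D"
  and form_degrees: "has_form_degrees r D deg"
  and variable_degree: "has_variable_degree k D degvar"
begin

lemma D_nz: "D ~= 0" using disc by (auto simp: is_discriminant_def)

lemma D_keys:
 assumes "t : keys D" "(j,m) : keys t"
 shows "j < r" "m : multi k (p j)" using disc assms by (auto simp: is_discriminant_def mv_in_def coeff_vars_def)

lemma form_weight:
 assumes "j < r" "t : keys D"
 shows "(SUM v:keys t. (if fst v = j then 1 else 0)*lookup t v) = deg j"
proof (rule weights_of_monomials[OF _ assms(2)])
 fix mu::'a and a::"cvar => 'a" assume mu: "mu ~= 0"
 have "mv_eval (%(i,m). (if i = j then mu else 1)*a (i,m)) D = (PROD i<r. (if i = j then mu else 1)^deg i)*mv_eval a D"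
  using form_degrees[unfolded has_form_degrees_def, rule_format, of "%i. if i = j then mu else 1" a] mu by auto
 also have "(PROD i<r. (if i = j then mu else 1)^deg i) = (PROD i<r. if i = j then mu^deg j else 1)" by (intro prod.cong) auto
 also have "(%(i,m). (if i = j then mu else 1)*a (i,m)) = (%v. mu^(if fst v = j then 1 else 0)*a v)" by auto
 finally show "mv_eval (%v. mu^(if fst v = j then 1 else 0)*a v) D = mu^deg j*mv_eval a D" using assms(1) by simp
qed

lemma variable_weight:
 assumes "i < k" "t : keys D"
 shows "(SUM v:keys t. snd v ! i*lookup t v) = degvar"
proof (rule weights_of_monomials[OF _ assms(2)])
 fix mu::'a and a::"cvar => 'a" assume mu: "mu ~= 0"
 have "mv_eval (%(j,m). (PROD l<k. (if l = i then mu else 1)^(m ! l))*a (j,m)) D = (PROD l<k. (if l = i then mu else 1))^degvar*mv_eval a D"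
  using variable_degree[unfolded has_variable_degree_def, rule_format, of "%l. if l = i then mu else 1" a] mu by auto
 also have "(%(j,m). (PROD l<k. (if l = i then mu else 1)^(m ! l))*a (j,m)) = (%v. mu^(snd v ! i)*a v)"
 proof
  fix v::"cvar"
  have "(PROD l<k. (if l = i then mu else 1)^(snd v ! l)) = (PROD l<k. if l = i then mu^(snd v ! i) else 1)" by (intro prod.cong) auto
  thus "(case v of (j,m) => (PROD l<k. (if l = i then mu else 1)^(m ! l))*a (j,m)) = mu^(snd v ! i)*a v" using assms(1) by (cases v) simp
 qed
 finally show "mv_eval (%v. mu^(snd v ! i)*a v) D = mu^degvar*mv_eval a D" using assms(1) by simp
qed

lemma weighted_form_sum:
 assumes "t : keys D"
 shows "(SUM v:keys t. f (fst v)*lookup t v) = (SUM j<r. f j*deg j)"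
proof -
 have "(SUM j<r. f j*deg j) = (SUM j<r. f j*(SUM v:keys t. (if fst v = j then 1 else 0)*lookup t v))" using form_weight assms by simp
 also have "... = (SUM v:keys t. SUM j<r. if j = fst v then f j*lookup t v else 0)" unfolding sum_distrib_left by (subst sum.swap) (auto intro!: sum.cong)
 also have "... = (SUM v:keys t. f (fst v)*lookup t v)"
 proof (rule sum.cong[OF refl])
  fix v assume "v : keys t"
  hence "fst v < r" using D_keys[OF assms, of "fst v" "snd v"] by simp
  thus "(SUM j<r. if j = fst v then f j*lookup t v else 0) = f (fst v)*lookup t v" by simp
 qed
 finally show ?thesis by simp
qed

lemma homogeneous: "mv_homogeneous (SUM j<r. deg j) D" using weighted_form_sum[where f = "%_. 1"] by (simp add: mv_homogeneous_def)

text \<open>In a single monomial of \<open>D\<close>, the weights of all variables are added up in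
  two ways: a coefficient of the form j contributes its total exponent \<open>p j\<close>.\<close>

lemma weighted_sum_deg: "(SUM j<r. p j*deg j) = k*degvar"
proof -
 obtain t where t: "t : keys D" using D_nz by (metis all_not_in_conv keys_eq_empty)
 have "k*degvar = (SUM i<k. SUM v:keys t. snd v ! i*lookup t v)" using variable_weight t by simp
 also have "... = (SUM v:keys t. (SUM i<k. snd v ! i)*lookup t v)" unfolding sum_distrib_right by (rule sum.swap)
 also have "... = (SUM v:keys t. p (fst v)*lookup t v)"
 proof (rule sum.cong[OF refl])
  fix v assume "v : keys t"
  hence "snd v : multi k (p (fst v))" using D_keys(2)[OF t, of "fst v" "snd v"] by simp
  thus "(SUM i<k. snd v ! i)*lookup t v = p (fst v)*lookup t v" by (auto simp: mi_def sum_list_sum_nth atLeast0LessThan)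
 qed
 finally show ?thesis using weighted_form_sum[OF t, of p] by simp
qed

lemma scaling: "mu ~= 0 ==> mv_eval (%v. mu*a v) D = mu^(SUM j<r. deg j)*mv_eval a D"
 using form_degrees[unfolded has_form_degrees_def, rule_format, of "%_. mu" a] by (simp add: power_sum case_prod_unfold)

end

section \<open>The ideal of the discriminant\<close>

definition dform::"nat => nat => (nat list => 'a) => nat => (nat => 'a) => 'a::comm_semiring_1" where
 "dform k d c i x = (SUM m:multi k d. c m*of_nat (m ! i)*(PROD l<k. x l^(if l = i then m ! l-1 else m ! l)))"

text \<open>The Jacobian matrix has rank less than \<open>r\<close> at some common zero; the linear relation between its
 rows is made explicit.\<close>

definition sing::"nat => nat => (nat => nat) => (cvar => 'a::field) => bool" where
 "sing k r p a \<longleftrightarrow> (EX x w. (EX i<k. x i ~= 0) & (EX j<r. w j ~= 0) & (ALL j<r. pform k (p j) (%m. a (j,m)) x = 0) &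
  (ALL i<k. (SUM j<r. w j*dform k (p j) (%m. a (j,m)) i x) = 0))"

lemma sing_iff: "sing k r p a \<longleftrightarrow> (EX v:common_zeros k r p a. vec_space.rank r (jacobian k r p a v) ~= r)"
proof
 assume "sing k r p a"
 then obtain x w where xw: "EX i<k. x i ~= 0" "EX j<r. w j ~= 0" "!!j. j < r ==> pform k (p j) (%m. a (j,m)) x = 0"
  "!!i. i < k ==> (SUM j<r. w j*dform k (p j) (%m. a (j,m)) i x) = 0" by (auto simp: sing_def)
 have "pform k (p j) (%m. a (j,m)) (($) (vec k x)) = pform k (p j) (%m. a (j,m)) x" for j by (rule pform_cong) simp
 moreover have "vec k x ~= 0\<^sub>v k" using xw(1) by (metis index_vec index_zero_vec(1))
 ultimately have "vec k x : common_zeros k r p a" using xw(3) by (auto simp: common_zeros_def proj_zeros_def form_eq_pform)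
 moreover have "vec_space.rank r (jacobian k r p a (vec k x)) ~= r"
 proof (subst rank_eq_iff_left_kernel[of _ _ k], simp add: jacobian_def, intro exI[of _ w] conjI xw(2) allI impI)
  fix i assume i: "i < k"
  have "form_pderiv k d c i (vec k x) = dform k d c i x" for d and c::"nat list => 'a"
   unfolding form_pderiv_def dform_def by (intro sum.cong arg_cong2[of _ _ _ _ "(*)"] prod.cong) auto
  thus "(SUM j<r. w j*jacobian k r p a (vec k x) $$ (j,i)) = 0" using xw(4)[OF i] i by (simp add: jacobian_def)
 qed
 ultimately show "EX v:common_zeros k r p a. vec_space.rank r (jacobian k r p a v) ~= r" by blast
next
 assume "EX v:common_zeros k r p a. vec_space.rank r (jacobian k r p a v) ~= r"
 then obtain v where v: "v : common_zeros k r p a" "vec_space.rank r (jacobian k r p a v) ~= r" by blast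
 then obtain w where w: "EX j<r. w j ~= 0" "!!i. i < k ==> (SUM j<r. w j*jacobian k r p a v $$ (j,i)) = 0"
  using rank_eq_iff_left_kernel[of "jacobian k r p a v" r k] by (auto simp: jacobian_def)
 have "v : carrier_vec k" "v ~= 0\<^sub>v k" using v(1) by (auto simp: common_zeros_def proj_zeros_def)
 hence v0: "EX i<k. v $ i ~= 0" by (metis carrier_vecD eq_vecI index_zero_vec(1) index_zero_vec(2))
 show "sing k r p a" unfolding sing_def
 proof (rule exI[of _ "($) v"], rule exI[of _ w], intro conjI allI impI)
  show "EX i<k. v $ i ~= 0" by (rule v0)
  show "EX j<r. w j ~= 0" by (rule w(1))
  show "pform k (p j) (%m. a (j,m)) (($) v) = 0" if "j < r" for j using v(1) that by (auto simp: common_zeros_def proj_zeros_def form_eq_pform)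
  show "(SUM j<r. w j*dform k (p j) (%m. a (j,m)) i (($) v)) = 0" if "i < k" for i using w(2)[OF that] that by (simp add: jacobian_def form_pderiv_def dform_def)
 qed
qed

context discriminant
begin

lemma D_zero_if_sing:
 assumes "nonzero_forms k r p a" "sing k r p a"
 shows "mv_eval a D = 0" using disc assms sing_iff[of k r p a] by (auto simp: is_discriminant_def discriminant_locus_def smooth_complete_intersection_def)

text \<open>Where some \<open>u\<close> with \<open>Good\<close> behaviour is nonzero the dimension
  is right, so a zero of \<open>D\<close> is a tuple with a singular point. A common factor of
  \<open>D\<close> and all these \<open>u\<close> has no zero on the punctured plane of
  \<open>Good\<close> tuples and is therefore a unit.\<close>

theorem D_dvd_if_vanishing_on_sing:
 assumes "!!a. sing k r p a ==> mv_eval a E = 0"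
 shows "D dvd E"
proof (rule squarefree_dvd_if_vanishing[where U = "{u. ALL a. mv_eval a u ~= 0 --> Good k r p a}"])
 show "squarefree D" using disc by (simp add: is_discriminant_def)
 show "mv_homogeneous (SUM j<r. deg j) D" by (rule homogeneous)
 fix u a assume "u : {u. ALL a. mv_eval a u ~= 0 --> Good k r p a}" and a: "mv_eval a D = 0" "mv_eval a u ~= 0"
 hence good: "Good k r p a" by blast
 hence "a : discriminant_locus k r p" using a disc by (simp add: Good_def is_discriminant_def)
 moreover have "has_proj_dim k (common_zeros k r p a) (k-1 - r)" using good parameter_system.has_proj_dim_common_zeros by (auto simp: Good_def)
 ultimately have "sing k r p a" unfolding sing_iff by (auto simp: discriminant_locus_def smooth_complete_intersection_def)
 thus "mv_eval a E = 0" by (rule assms)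
next
 fix f assume f: "f dvd D" and U: "!!u. u : {u. ALL a. mv_eval a u ~= 0 --> Good k r p a} ==> f dvd u"
 show "f dvd 1"
 proof (rule unit_if_no_zero_on_plane[OF _ scaling f D_nz])
  fix s t::'a assume "s ~= 0 | t ~= 0"
  hence "Good k r p (plane k p s t)" using r p by (intro Good_plane) auto
  then obtain u where u: "mv_eval (plane k p s t) u ~= 0" "ALL a. mv_eval a u ~= 0 --> Good k r p a" using Good_open by blast
  hence "f dvd u" using U by blast
  hence "mv_eval (plane k p s t) f ~= 0" using u(1) by (auto simp: dvd_def)
  moreover have "plane k p s t = (%v. s*plane k p 1 0 v + t*plane k p 0 1 v)" by (auto simp: plane_def fun_eq_iff)
  ultimately show "mv_eval (%v. s*plane k p 1 0 v + t*plane k p 0 1 v) f ~= 0" by simp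
 qed
qed

end

lemma fs_span_map:
 fixes Ph::"('p => 'a::field) => 'q => 'a"
 assumes "f : fs.span S" "!!f g. Ph (%x. f x + g x) = (%y. Ph f y + Ph g y)" "!!c f. Ph (%x. c*f x) = (%y. c*Ph f y)" "!!s. s : S ==> Ph s : fs.span T"
 shows "Ph f : fs.span T"
proof (rule fs.span_induct[where P = "%f. Ph f : fs.span T", OF assms(1)])
 show "fs.subspace {f. Ph f : fs.span T}"
 proof (rule fs.subspaceI)
  have "Ph (%x. 0*0) = (%y. 0*Ph (%x. 0) y)" by (rule assms(3))
  thus "0 : {f. Ph f : fs.span T}" by (simp add: zero_fun_def fs_span_zero)
  show "f + g : {f. Ph f : fs.span T}" if "f : {f. Ph f : fs.span T}" "g : {f. Ph f : fs.span T}" for f g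
   using that assms(2)[of f g] by (simp add: plus_fun_def fs_span_add)
  show "(%x. c*f x) : {f. Ph f : fs.span T}" if "f : {f. Ph f : fs.span T}" for c f using that assms(3)[of c f] by (simp add: fs.span_scale)
 qed
qed (rule assms(4))

section \<open>Derivatives of forms\<close>

lemma pform_add: "pform k d (%m. c m + c' m) x = pform k d c x + pform k d c' x" by (simp add: pform_def distrib_right sum.distrib)
lemma dform_add: "dform k d (%m. c m + c' m) i x = dform k d c i x + dform k d c' i x" by (simp add: dform_def distrib_right sum.distrib)
lemma pform_scale: "pform k d (%m. b*c m) x = b*pform k d c x" by (simp add: pform_def sum_distrib_left mult.assoc)
lemma dform_scale: "dform k d (%m. b*c m) i x = b*dform k d c i x" by (simp add: dform_def sum_distrib_left mult.assoc)
lemma pform_zero: "pform k d (%m. 0) x = 0" by (simp add: pform_def)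
lemma dform_zero: "dform k d (%m. 0) i x = 0" by (simp add: dform_def)
lemma dform_sum: "dform k d (%m. SUM l:A. c l m) i x = (SUM l:A. dform k d (c l) i x)" by (induction A rule: infinite_finite_induct) (auto simp: dform_add dform_zero)

lemma pform_single: "m0 : multi k d ==> pform k d (%m. if m = m0 then b else 0) x = b*lmon k m0 x"
proof -
 assume m0: "m0 : multi k d"
 have "pform k d (%m. if m = m0 then b else 0) x = (SUM m:multi k d. if m = m0 then b*lmon k m0 x else 0)" unfolding pform_def by (intro sum.cong) auto
 thus ?thesis using m0 by simp
qed

lemma dform_single: "m0 : multi k d ==> dform k d (%m. if m = m0 then b else 0) i x =
  b*of_nat (m0 ! i)*(PROD l<k. x l^(if l = i then m0 ! l-1 else m0 ! l))"
proof -
 assume m0: "m0 : multi k d"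
 have "dform k d (%m. if m = m0 then b else 0) i x =
   (SUM m:multi k d. if m = m0 then b*of_nat (m0 ! i)*(PROD l<k. x l^(if l = i then m0 ! l-1 else m0 ! l)) else 0)"
  unfolding dform_def by (intro sum.cong) auto
 thus ?thesis using m0 by simp
qed

lemma pform_power: "j < k ==> pform k d (%m. if m = power_index k j d then b else 0) x = b*x j^d" by (simp add: pform_single power_index_in lmon_power_index)

lemma dform_power:
 assumes "j < k" "i < k"
 shows "dform k d (%m. if m = power_index k j d then b else 0) i x = (if i = j then b*of_nat d*x j^(d-1) else 0)"
proof (cases "i = j")
 case True
 have "(PROD l<k. x l^(if l = i then power_index k j d ! l-1 else power_index k j d ! l)) = (PROD l<k. if l = j then x j^(d-1) else 1)"
  using True assms by (intro prod.cong) (auto simp: power_index_def nth_list_update)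
 thus ?thesis using True assms by (simp add: dform_single power_index_in) (simp add: power_index_def)
next
 case False
 thus ?thesis using assms by (simp add: dform_single power_index_in) (simp add: power_index_def)
qed

lemma dform_Hom:
 fixes c::"nat list => 'a::field"
 assumes "i < k" shows "dform k d c i : Hom k (d-1)" unfolding dform_def[abs_def]
proof (intro Hom_sum)
 fix m assume m: "m : multi k d"
 show "(%x. c m*of_nat (m ! i)*(PROD l<k. x l^(if l = i then m ! l-1 else m ! l))) : Hom k (d-1)"
 proof (cases "m ! i = 0")
  case True
  thus ?thesis by (simp add: Hom_zero)
 next
  case False
  have m': "m[i := m ! i-1] : multi k (d-1)" using m assms False elem_le_sum_list[of i m] by (auto simp: mi_def sum_list_update)
  have "lmon k (m[i := m ! i-1]) = (%x::nat => 'a. PROD l<k. x l^(if l = i then m ! l-1 else m ! l))"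
   using m by (auto simp: lmon_def[abs_def] fun_eq_iff mi_def nth_list_update intro!: prod.cong)
  hence "(%x::nat => 'a. PROD l<k. x l^(if l = i then m ! l-1 else m ! l)) : Hom k (d-1)" using lmon_Hom[where 'a = 'a, OF m'] by (simp only:)
  thus ?thesis by (rule Hom_scale)
 qed
qed

lemma sum_multi_indices_snoc: "(SUM m:multi (Suc k) d. if last m = 0 then f (butlast m) m else 0) = (SUM m:multi k d. f m (m @ [0]))"
proof -
 have img: "(%m. m @ [0]) ` multi k d = {m : multi (Suc k) d. last m = 0}"
 proof (intro equalityI subsetI)
  fix m assume "m : {m : multi (Suc k) d. last m = 0}"
  hence *: "length m = Suc k" "sum_list m = d" "last m = 0" by (auto simp: mi_def)
  hence "m ~= []" by auto
  hence "m = butlast m @ [0]" using *(3) by (metis append_butlast_last_id)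
  moreover from this have "sum_list (butlast m) = d" using *(2) by (metis add.right_neutral sum_list.Cons sum_list.Nil sum_list.append)
  ultimately show "m : (%m. m @ [0]) ` multi k d" using *(1) by (intro image_eqI[of _ _ "butlast m"]) (auto simp: mi_def)
 qed (auto simp: mi_def)
 have "(SUM m:multi (Suc k) d. if last m = 0 then f (butlast m) m else 0) = (SUM m:{m : multi (Suc k) d. last m = 0}. f (butlast m) m)"
  by (rule sum.mono_neutral_cong_right) auto
 also have "... = (SUM m:multi k d. f m (m @ [0]))" unfolding img[symmetric] by (subst sum.reindex) (auto simp: inj_on_def)
 finally show ?thesis .
qed

lemma pform_snoc: "pform (Suc k) d (%m. if last m = 0 then c (butlast m) else 0) x = pform k d c x"
proof -
 have "pform (Suc k) d (%m. if last m = 0 then c (butlast m) else 0) x = (SUM m:multi (Suc k) d. if last m = 0 then c (butlast m)*lmon (Suc k) m x else 0)"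
  unfolding pform_def by (intro sum.cong) auto
 also have "... = pform k d c x" unfolding sum_multi_indices_snoc[of "%b m. c b*lmon (Suc k) m x"] pform_def
  by (intro sum.cong refl) (auto simp: lmon_def mi_def nth_append)
 finally show ?thesis .
qed

lemma dform_snoc: "dform (Suc k) d (%m. if last m = 0 then c (butlast m) else 0) i x = (if i < k then dform k d c i x else 0)" if "i <= k"
proof -
 let ?g = "%k m. of_nat (m ! i)*(PROD l<k. x l^(if l = i then m ! l-1 else m ! l))"
 have "dform (Suc k) d (%m. if last m = 0 then c (butlast m) else 0) i x = (SUM m:multi (Suc k) d. if last m = 0 then c (butlast m)*?g (Suc k) m else 0)"
  unfolding dform_def by (intro sum.cong) (auto simp: mult.assoc)
 also have "... = (SUM m:multi k d. c m*?g (Suc k) (m @ [0]))" by (rule sum_multi_indices_snoc)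
 also have "... = (if i < k then dform k d c i x else 0)"
 proof (cases "i < k")
  case True
  have "?g (Suc k) (m @ [0]) = ?g k m" if "m : multi k d" for m
   using that True by (auto simp: mi_def nth_append intro!: arg_cong2[of _ _ _ _ "(*)"] prod.cong)
  thus ?thesis using True unfolding dform_def by (auto intro!: sum.cong simp: mult.assoc)
 next
  case False
  thus ?thesis using that by (auto simp: mi_def nth_append intro!: sum.neutral)
 qed
 finally show ?thesis .
qed

section \<open>The module of relations at singular points\<close>

text \<open>A function on pairs \<open>(x, i)\<close> stands for a vector of polynomials. The columns of the Jacobian
 matrix and the multiples of the constraints \<open>F\<^sub>i\<close>, \<open>j0 \<le> i < n\<close>, generate the vectors
 that are annihilated by the multipliers of every singular point.\<close>

definition emb::"nat => ('x => 'a) => 'x \<times> nat => 'a::zero" where "emb i f = (%(x,l). if l = i then f x else 0)"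

definition fm::"nat => (nat => nat) => (cvar => 'a) => nat => (nat => 'a) => 'a::field" where "fm k q c i = pform k (q i) (%m. c (i,m))"

definition jac_col::"nat => nat => (nat => nat) => (cvar => 'a) => nat => ('a fn) => (nat => 'a) \<times> nat => 'a::field" where
 "jac_col k n q c l u = (%(x,i). if i < n then dform k (q i) (%m. c (i,m)) l x*u x else 0)"

text \<open>The twist by \<open>q i\<close> makes a column of the Jacobian matrix, multiplied by a
  form of degree \<open>m + 1\<close>, homogeneous of the right degree in every component.\<close>

definition vectors::"nat => nat => (nat => nat) => nat => ((nat => 'a) \<times> nat => 'a::field) set" where
 "vectors k n q m = {emb i f | i f. i < n & f : Hom k (m + q i)}"

definition rel_gen::"nat => nat => (nat => nat) => (cvar => 'a)
  => (cvar)+(nat \<times> cvar) => (nat => 'a) \<times> nat => 'a::field" where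
 "rel_gen k n q c s = (case s of Inl (l,m) => jac_col k n q c l (lmon k m) | Inr (i,i',m) => emb i (%x. fm k q c i' x*lmon k m x))"

definition rel_index::"nat => nat => nat => (nat => nat) => nat => ((cvar)+(nat \<times> cvar)) set" where
 "rel_index k n j0 q m = Inl ` {(l,b). l < k & b : multi k (Suc m)} \<union>
  Inr ` {(i,i',b). i < n & j0 <= i' & i' < n & length b = k & sum_list b + q i' = m + q i}"

abbreviation "rels k n j0 q c m == rel_gen k n q c ` rel_index k n j0 q m"

definition codim_le::"nat => nat => nat => (nat => nat) => nat => nat => (cvar => 'a::field) => bool" where
 "codim_le k n j0 q m N c \<longleftrightarrow> (EX B. finite B & card B <= N & vectors k n q m <= fs.span (rels k n j0 q c m Un B))"

lemma finite_rel_index: "finite (rel_index k n j0 q m)"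
proof -
 have "{(l,b). l < k & b : multi k (Suc m)} = {..<k} \<times> multi k (Suc m)" by auto
 moreover have "{(i,i',b). i < n & j0 <= i' & i' < n & length b = k & sum_list b + q i' = m + q i} <=
   {..<n} \<times> {..<n} \<times> (\<Union>i<n. \<Union>d\<le>m + q i. multi k d)" by (auto simp: mi_def)
 hence "finite {(i,i',b). i < n & j0 <= i' & i' < n & length b = k & sum_list b + q i' = m + q i}" by (rule finite_subset) auto
 ultimately show ?thesis unfolding rel_index_def by simp
qed

lemma emb_add: "emb i (%x. f x + g x) = (%y. emb i f y + emb i g y::'a::field)"
 and emb_scale: "emb i (%x. c*h x) = (%y. c*emb i h y::'a::field)" by (auto simp: emb_def fun_eq_iff)

lemma emb_span: "f : fs.span S ==> (!!s. s : S ==> emb i s : fs.span T) ==> emb i f : fs.span T"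
 by (rule fs_span_map[where Ph = "emb i"]) (simp_all add: emb_add emb_scale)

lemma jac_col_in_rels:
 assumes "l < k" "u : Hom k (Suc m)"
 shows "jac_col k n q c l u : fs.span (rels k n j0 q c m)" using assms(2) unfolding Hom_def
proof (rule fs_span_map)
 fix s::"'a fn" assume "s : lmon k ` multi k (Suc m)"
 then obtain b where b: "s = lmon k b" "b : multi k (Suc m)" by blast
 hence "jac_col k n q c l s = rel_gen k n q c (Inl (l,b))" "Inl (l,b) : rel_index k n j0 q m" using assms(1) by (auto simp: rel_gen_def rel_index_def)
 thus "jac_col k n q c l s : fs.span (rels k n j0 q c m)" by (auto intro: fs.span_base)
qed (auto simp: jac_col_def fun_eq_iff algebra_simps)

lemma constraint_in_rels:
 assumes "i < n" "j0 <= i'" "i' < n" "u : Hom k e" "e + q i' = m + q i"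
 shows "emb i (%x. fm k q c i' x*u x) : fs.span (rels k n j0 q c m)" using assms(4) unfolding Hom_def
proof (rule fs_span_map)
 fix s::"'a fn" assume "s : lmon k ` multi k e"
 then obtain b where b: "s = lmon k b" "b : multi k e" by blast
 hence "emb i (%x. fm k q c i' x*s x) = rel_gen k n q c (Inr (i,i',b))" "Inr (i,i',b) : rel_index k n j0 q m"
  using assms by (auto simp: rel_gen_def rel_index_def mi_def)
 thus "emb i (%x. fm k q c i' x*s x) : fs.span (rels k n j0 q c m)" by (auto intro: fs.span_base)
qed (auto simp: emb_def fun_eq_iff algebra_simps)

lemma fm_Hom: "fm k q c i : Hom k (q i)" unfolding fm_def by (rule pform_Hom)

lemma vector_in_span:
 assumes "!!i. i < n ==> f i : Hom k (m + q i)"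
 shows "(%(x,i). if i < n then f i x else 0) : fs.span (vectors k n q m)"
proof -
 have "(%(x,i). if i < n then f i x else 0) = (%y. SUM i<n. emb i (f i) y)" by (auto simp: emb_def fun_eq_iff)
 also have "... : fs.span (vectors k n q m)" using assms by (intro fs_span_sum fs.span_base) (auto simp: vectors_def)
 finally show ?thesis .
qed

lemma rels_in_vectors:
 assumes "!!i. i < n ==> 0 < q i" "s : rel_index k n j0 q m"
 shows "rel_gen k n q c s : fs.span (vectors k n q m)"
proof (cases s)
 case (Inl lb)
 obtain l b where lb: "lb = (l,b)" by fastforce
 have l: "l < k" "b : multi k (Suc m)" using assms(2) by (auto simp: Inl lb rel_index_def)
 have "(%x. dform k (q i) (%m. c (i,m)) l x*lmon k b x) : Hom k (m + q i)" if "i < n" for i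
  using Hom_mult[OF dform_Hom[OF l(1), of "q i" "%m. c (i,m)"] lmon_Hom[OF l(2)]] assms(1)[OF that] by (simp add: add.commute)
 thus ?thesis using vector_in_span[of n "%i x. dform k (q i) (%m. c (i,m)) l x*lmon k b x"] by (simp add: Inl lb rel_gen_def jac_col_def)
next
 case (Inr t)
 obtain i i' b where t: "t = (i,i',b)" by (metis prod_cases3)
 have *: "i < n" "b : multi k (sum_list b)" "q i' + sum_list b = m + q i" using assms(2) by (auto simp: Inr t rel_index_def mi_def)
 have "(%x. fm k q c i' x*lmon k b x) : Hom k (m + q i)" using Hom_mult[OF fm_Hom[of k q c i'] lmon_Hom[OF *(2)]] *(3) by simp
 thus ?thesis using *(1) by (auto simp: Inr t rel_gen_def vectors_def intro!: fs.span_base)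
qed

lemma pfun_rel_gen: "pfun UNIV (%c. rel_gen k n q c s y)" by (cases s; cases y) (auto simp only: rel_gen_def jac_col_def emb_def fm_def pform_def dform_def
   sum.case prod.case UNIV_I split: prod.split intro!: pfunI pfun_if)

text \<open>The complementary set \<open>B\<close> found at \<open>c0\<close> stays fixed while the
  relations vary with \<open>c\<close>; spanning is then an open condition.\<close>

lemma generic_codim_le:
 fixes c0::"cvar => 'a::field_char_0"
 assumes "codim_le k n j0 q m N c0" "!!i. i < n ==> 0 < q i"
 shows "generic (codim_le k n j0 q m N::(cvar => 'a) => bool)"
proof -
 obtain B where B: "finite B" "card B <= N" "vectors k n q m <= fs.span (rels k n j0 q c0 m Un B)" using assms(1) by (auto simp: codim_le_def)
 define G where "G = (%(c::cvar => 'a) s. case s of Inl s => rel_gen k n q c s | Inr b => b)"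
 define I where "I = Inl ` rel_index k n j0 q m Un Inr ` B"
 have GI: "G c ` I = rels k n j0 q c m Un B" for c::"cvar => 'a" by (simp add: G_def I_def image_Un image_image)
 have "generic (%c. fs.span (vectors k n q m) Un B <= fs.span (G c ` I))"
 proof (rule generic_spanning[where G = G and cc = c0 and I = I and W = "fs.span (vectors k n q m) Un B"])
  show "finite I" using B(1) finite_rel_index by (simp add: I_def)
  show "fs.span (vectors k n q m) Un B <= fs.span (G c0 ` I)"
   unfolding GI using fs.span_minimal[OF B(3) fs.subspace_span] fs.span_superset[of "rels k n j0 q c0 m Un B"] by blast
  show "G c i : fs.span (vectors k n q m) Un B" if "i : I" for c i using that rels_in_vectors[OF assms(2), of n] by (auto simp: I_def G_def)
  show "pfun UNIV (%c. G c i x)" for i x by (cases i) (auto simp: G_def pfun_rel_gen intro: pfunI)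
 qed (auto simp: generic_def)
 thus ?thesis
 proof (rule generic_mono)
  fix c assume "fs.span (vectors k n q m) Un B <= fs.span (G c ` I)"
  hence "vectors k n q m <= fs.span (rels k n j0 q c m Un B)" unfolding GI using fs.span_superset[of "vectors k n q m"] by blast
  thus "codim_le k n j0 q m N c" unfolding codim_le_def using B(1,2) by blast
 qed
qed

section \<open>Codimension bounds by induction on the number of variables\<close>

definition ext_system::"nat => nat => (nat => nat) => (cvar => 'a) => cvar => 'a::field" where
 "ext_system k nu q c = (%(i,m). (if last m = 0 then c (i,butlast m) else 0)+(if m = power_index (Suc k) k (q i) then if i = nu then 1 else 0 else 0))"

lemma fm_ext: "fm (Suc k) q (ext_system k nu q c) i x = fm k q c i x + (if i = nu then x k^q i else 0)"
 unfolding fm_def ext_system_def prod.case pform_add pform_snoc[of k _ "%b. c (i,b)"] by (subst pform_power) auto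

lemma dform_ext: "l <= k ==> dform (Suc k) (q i) (%m. ext_system k nu q c (i,m)) l x =
  (if l < k then dform k (q i) (%m. c (i,m)) l x else if i = nu then of_nat (q i)*x k^(q i-1) else 0)" unfolding ext_system_def prod.case dform_add
 by (subst dform_snoc[where c = "%b. c (i,b)"], simp, subst dform_power) auto

lemma Hom_Suc: "f : Hom k d ==> f : Hom (Suc k) d"
proof (erule Hom_imp_pform)
 fix c assume "f = pform k d c"
 hence "f = pform (Suc k) d (%m. if last m = 0 then c (butlast m) else 0)" by (simp add: fun_eq_iff pform_snoc)
 thus "f : Hom (Suc k) d" by (metis pform_Hom)
qed

lemma Hom_Suc_power: "f : Hom k d ==> a + d = e ==> (%x. x k^a*f x) : Hom (Suc k) e"
 using Hom_mult[OF Hom_power[OF Hom_var[of k "Suc k"], of a] Hom_Suc, of f d] by simp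

definition zmul::"nat => nat => ((nat => 'a) \<times> nat => 'a) => (nat => 'a) \<times> nat => 'a::comm_semiring_1" where "zmul k a b = (%(x,i). x k^a*b (x,i))"

lemma zmul_emb: "zmul k a (emb i f) = emb i (%x. x k^a*f x)" by (auto simp: zmul_def emb_def fun_eq_iff)

text \<open>The quotient for the last form \<open>z ^ e + h\<close> is spanned by \<open>z ^ a\<close>, \<open>a < e - 1\<close>, times
 the quotient with \<open>h\<close> as last form, and \<open>z ^ (e - 1 + a)\<close>, \<open>a < e\<close>, times the quotient
 without a last form: high powers of \<open>z\<close> in the last component are killed by the derivative
 with respect to \<open>z\<close>, and \<open>z ^ e\<close> can be replaced by \<open>- h\<close> in the other components.\<close>

lemma codim_le_ext:
 fixes c::"cvar => 'a::field_char_0"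
 assumes q: "!!i. i < Suc nu ==> 0 < q i" and j0: "j0 <= nu" and m: "2*q nu <= m"
  and A1: "!!a. a < q nu-1 ==> codim_le k (Suc nu) j0 q (m-a) N1 c"
  and A0: "!!a. a < q nu ==> codim_le k nu j0 q (m - (q nu-1 + a)) N0 c"
 shows "codim_le (Suc k) (Suc nu) j0 q m ((q nu-1)*N1 + q nu*N0) (ext_system k nu q c)"
proof -
 let ?e = "q nu" and ?c = "ext_system k nu q c"
 have "ALL a. EX B. a < ?e-1 --> finite B & card B <= N1 & vectors k (Suc nu) q (m-a) <= fs.span (rels k (Suc nu) j0 q c (m-a) Un B)"
  using A1 by (auto simp: codim_le_def)
 then obtain B1 where B1: "!!a. a < ?e-1 ==> finite (B1 a) & card (B1 a) <= N1 &
   vectors k (Suc nu) q (m-a) <= fs.span (rels k (Suc nu) j0 q c (m-a) Un B1 a)" by (rule choice[THEN exE]) blast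
 have "ALL a. EX B. a < ?e --> finite B & card B <= N0 & vectors k nu q (m - (?e-1 + a)) <= fs.span (rels k nu j0 q c (m - (?e-1 + a)) Un B)"
  using A0 by (auto simp: codim_le_def)
 then obtain B0 where B0: "!!a. a < ?e ==> finite (B0 a) & card (B0 a) <= N0 &
   vectors k nu q (m - (?e-1 + a)) <= fs.span (rels k nu j0 q c (m - (?e-1 + a)) Un B0 a)" by (rule choice[THEN exE]) blast
 define C1 where "C1 = (\<Union>a\<in>{..<?e-1}. zmul k a ` B1 a)"
 define C0 where "C0 = (\<Union>a\<in>{..<?e}. zmul k (?e-1 + a) ` B0 a)"
 define B where "B = C1 Un C0"
 have fin: "finite C1" "finite C0" using B1 B0 by (auto simp: C1_def C0_def)
 have "card C1 <= (SUM a:{..<?e-1}. card (zmul k a ` B1 a))" unfolding C1_def by (rule card_UN_le) simp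
 also have "... <= (SUM a:{..<?e-1}. N1)"
 proof (rule sum_mono)
  fix a assume "a : {..<?e-1}"
  thus "card (zmul k a ` B1 a) <= N1" using B1[of a] card_image_le[of "B1 a" "zmul k a"] by auto
 qed
 finally have c1: "card C1 <= (?e-1)*N1" by simp
 have "card C0 <= (SUM a:{..<?e}. card (zmul k (?e-1 + a) ` B0 a))" unfolding C0_def by (rule card_UN_le) simp
 also have "... <= (SUM a:{..<?e}. N0)"
 proof (rule sum_mono)
  fix a assume "a : {..<?e}"
  thus "card (zmul k (?e-1 + a) ` B0 a) <= N0" using B0[of a] card_image_le[of "B0 a" "zmul k (?e-1 + a)"] by auto
 qed
 finally have "card B <= (?e-1)*N1 + ?e*N0" unfolding B_def using c1 card_Un_le[of C1 C0] by simp
 moreover have "finite B" using fin by (simp add: B_def)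
 moreover have "vectors (Suc k) (Suc nu) q m <= fs.span (rels (Suc k) (Suc nu) j0 q ?c m Un B)"
 proof -
  define T where "T = fs.span (rels (Suc k) (Suc nu) j0 q ?c m Un B)"
  have T_rels: "f : T" if "f : fs.span (rels (Suc k) (Suc nu) j0 q ?c m)" for f using that fs.span_mono[OF Un_upper1] unfolding T_def by blast
  have T_diff: "(%y. f y - g y) : T" if "f : T" "g : T" for f g using fs.span_diff[OF that[unfolded T_def]] by (simp add: T_def fun_diff_def)
  have B_T: "b : B ==> b : T" for b unfolding T_def by (rule fs.span_base) simp
  have col: "jac_col (Suc k) (Suc nu) q ?c l u : T" if "l < Suc k" "u : Hom (Suc k) (Suc m)" for l u by (rule T_rels, rule jac_col_in_rels[OF that])
  have con: "emb i (%x. fm (Suc k) q ?c i' x*u x) : T"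
   if "i < Suc nu" "j0 <= i'" "i' < Suc nu" "u : Hom (Suc k) d" "d + q i' = m + q i" for i i' u d by (rule T_rels, rule constraint_in_rels[OF that])
  have e: "0 < ?e" using q by simp
  have last: "emb nu (%x. x k^a*f x) : T" if "?e-1 <= a" "f : Hom k d" "a + d = m + ?e" for a d f
  proof -
   let ?u = "%x::nat => 'a. x k^(a - (?e-1))*f x"
   have "?u : Hom (Suc k) (Suc m)" using that e by (intro Hom_Suc_power[of _ _ d]) auto
   hence "(%y. inverse (of_nat ?e)*jac_col (Suc k) (Suc nu) q ?c k ?u y) : T" unfolding T_def by (intro fs.span_scale) (use col in "simp add: T_def")
   moreover have "(%y. inverse (of_nat ?e)*jac_col (Suc k) (Suc nu) q ?c k ?u y) = emb nu (%x. x k^a*f x)"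
   proof
    fix y::"(nat => 'a) \<times> nat"
    obtain x i where y: "y = (x,i)" by fastforce
    have "x k^(?e-1)*x k^(a - (?e-1)) = x k^a" using that(1) by (simp add: power_add[symmetric])
    thus "inverse (of_nat ?e)*jac_col (Suc k) (Suc nu) q ?c k ?u y = emb nu (%x. x k^a*f x) y"
     using e unfolding y jac_col_def emb_def prod.case by (simp add: dform_ext mult.assoc[symmetric])
   qed
   ultimately show ?thesis by simp
  qed
  have old: "emb i (%x. x k^a*(fm k q c i' x*lmon k b x)) : T"
   if "i < Suc nu" "j0 <= i'" "i' < nu" "length b = k" "a + sum_list b + q i' = m + q i" for i i' a b
  proof -
   have "(%x. x k^a*lmon k b x) : Hom (Suc k) (a + sum_list b)" using that by (intro Hom_Suc_power[OF lmon_Hom]) (auto simp: mi_def)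
   from con[OF that(1,2) _ this that(5)] that(3)
   have "emb i (%x. fm (Suc k) q ?c i' x*(x k^a*lmon k b x)) : T" by simp
   thus ?thesis using that(3) by (simp add: fm_ext mult.left_commute)
  qed
  \<comment> \<open>Induction on \<open>a\<close>. From \<open>2*?e - 1\<close> on, z^e is replaced
    by - h. Below, the bounds \<open>B0\<close> without the last form apply; extending a column to
    the last form adds an entry in component \<open>nu\<close>, which \<open>last\<close>
    removes.\<close>
  have high: "emb i (%x. x k^a*f x) : T"
   if "i < Suc nu" "?e-1 <= a" "f : Hom k d" "a + d = m + q i" for a d f i using that
  proof (induction a arbitrary: d f i rule: less_induct)
   case (less a)
   show ?case
   proof (cases "i = nu")
    case True
    thus ?thesis using last less.prems by simp
   next
    case False
    hence i: "i < nu" using less.prems by simp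
    show ?thesis
    proof (cases "a < 2*?e-1")
     case True
     define a' where "a' = a - (?e-1)"
     have a': "a' < ?e" "?e-1 + a' = a" using True less.prems e by (auto simp: a'_def)
     have am: "a <= m" using True m by simp
     have "f : Hom k (m - a + q i)" using less.prems am by (metis Nat.add_diff_assoc2 add_diff_cancel_left')
     hence "emb i f : vectors k nu q (m-a)" using i by (auto simp: vectors_def)
     hence "emb i f : fs.span (rels k nu j0 q c (m-a) Un B0 a')" using B0[OF a'(1)] a'(2) by auto
     hence "zmul k a (emb i f) : fs.span (rels (Suc k) (Suc nu) j0 q ?c m Un B)"
     proof (rule fs_span_map)
      fix s assume "s : rels k nu j0 q c (m-a) Un B0 a'"
      then consider l b where "s = jac_col k nu q c l (lmon k b)" "l < k" "b : multi k (Suc (m-a))"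
       | i i' b where "s = emb i (%x. fm k q c i' x*lmon k b x)" "i < nu" "j0 <= i'" "i' < nu" "length b = k" "sum_list b + q i' = m - a + q i"
       | "s : B0 a'" by (auto simp: rel_index_def rel_gen_def)
      hence "zmul k a s : T"
      proof cases
       case (1 l b)
       let ?u = "%x::nat => 'a. x k^a*lmon k b x"
       have u: "?u : Hom (Suc k) (Suc m)" using 1 am by (intro Hom_Suc_power[OF lmon_Hom]) auto
       have d: "(%x. dform k ?e (%m. c (nu,m)) l x*lmon k b x) : Hom k (?e-1 + Suc (m-a))" using 1 by (intro Hom_mult dform_Hom lmon_Hom) auto
       have "zmul k a s = (%y. jac_col (Suc k) (Suc nu) q ?c l ?u y - emb nu (%x. x k^a*(dform k ?e (%m. c (nu,m)) l x*lmon k b x)) y)" using 1(2) unfolding 1(1)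
        by (auto simp: fun_eq_iff zmul_def jac_col_def emb_def dform_ext less_Suc_eq)
       moreover have "... : T" using 1(2) am e less.prems(2) by (intro T_diff col u last[OF _ d]) auto
       ultimately show ?thesis by simp
      next
       case (2 i i' b)
       thus ?thesis unfolding 2(1) zmul_emb using am by (intro old) auto
      next
       case 3
       hence "zmul k a s : C0" using a' by (auto simp: C0_def)
       thus ?thesis by (intro B_T) (simp add: B_def)
      qed
      thus "zmul k a s : fs.span (rels (Suc k) (Suc nu) j0 q ?c m Un B)" by (simp add: T_def)
     qed (auto simp: zmul_def fun_eq_iff algebra_simps)
     thus ?thesis by (simp add: zmul_emb T_def)
    next
     case False
     hence a: "?e-1 <= a - ?e" "a - ?e < a" "?e <= a" using e by auto
     have hf: "(%x. fm k q c nu x*f x) : Hom k (?e + d)" by (intro Hom_mult fm_Hom less.prems)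
     have "emb i (%x. x k^(a - ?e)*(fm k q c nu x*f x)) : T" using less.prems a by (intro less.IH[OF a(2) _ a(1) hf]) auto
     moreover have "emb i (%x. fm (Suc k) q ?c nu x*(x k^(a - ?e)*f x)) : T"
      using less.prems a j0 by (intro con[OF _ _ _ Hom_Suc_power[OF less.prems(3) refl]]) auto
     ultimately have "(%y. emb i (%x. fm (Suc k) q ?c nu x*(x k^(a - ?e)*f x)) y -
       emb i (%x. x k^(a - ?e)*(fm k q c nu x*f x)) y) : T" by (rule T_diff[rotated])
     moreover have "x k^a = x k^?e*x k^(a - ?e)" for x::"nat => 'a" using a by (simp add: power_add[symmetric])
     hence "(%y. emb i (%x. fm (Suc k) q ?c nu x*(x k^(a - ?e)*f x)) y - emb i (%x. x k^(a - ?e)*(fm k q c nu x*f x)) y) = emb i (%x. x k^a*f x)"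
      by (auto simp: emb_def fun_eq_iff fm_ext algebra_simps)
     ultimately show ?thesis by simp
    qed
   qed
  qed
  have low: "emb i (%x. x k^a*f x) : T"
   if "i < Suc nu" "a < ?e-1" "f : Hom k d" "a + d = m + q i" for a d f i
  proof -
   have am: "a <= m" using that m by simp
   have "f : Hom k (m - a + q i)" using that am by (metis Nat.add_diff_assoc2 add_diff_cancel_left')
   hence "emb i f : vectors k (Suc nu) q (m-a)" using that by (auto simp: vectors_def)
   hence "emb i f : fs.span (rels k (Suc nu) j0 q c (m-a) Un B1 a)" using B1[OF that(2)] by auto
   hence "zmul k a (emb i f) : fs.span (rels (Suc k) (Suc nu) j0 q ?c m Un B)"
   proof (rule fs_span_map)
    fix s assume "s : rels k (Suc nu) j0 q c (m-a) Un B1 a"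
    then consider l b where "s = jac_col k (Suc nu) q c l (lmon k b)" "l < k" "b : multi k (Suc (m-a))"
     | i i' b where "s = emb i (%x. fm k q c i' x*lmon k b x)" "i < Suc nu" "j0 <= i'" "i' < Suc nu" "length b = k" "sum_list b + q i' = m - a + q i"
     | "s : B1 a" by (auto simp: rel_index_def rel_gen_def)
    hence "zmul k a s : T"
    proof cases
     case (1 l b)
     let ?u = "%x::nat => 'a. x k^a*lmon k b x"
     have "?u : Hom (Suc k) (Suc m)" using 1 am by (intro Hom_Suc_power[OF lmon_Hom]) auto
     moreover have "zmul k a s = jac_col (Suc k) (Suc nu) q ?c l ?u" using 1(2) unfolding 1(1) by (auto simp: fun_eq_iff zmul_def jac_col_def dform_ext)
     ultimately show ?thesis using col 1(2) by simp
    next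
     case (2 i i' b)
     show ?thesis
     proof (cases "i' = nu")
      case False
      thus ?thesis unfolding 2(1) zmul_emb using am 2 by (intro old) auto
     next
      case True
      have b: "lmon k b : Hom k (sum_list b)" using 2 by (intro lmon_Hom) (simp add: mi_def)
      \<comment> \<open>The last constraint is now h + z^e. A multiple of h is therefore a multiple
        of this constraint minus a term with the power \<open>a + ?e\<close> of z, to which
        \<open>high\<close> applies.\<close>
      have "emb i (%x. fm (Suc k) q ?c nu x*(x k^a*lmon k b x)) : T" using 2 am j0 True by (intro con[OF _ _ _ Hom_Suc_power[OF b refl]]) auto
      moreover have "emb i (%x. x k^(a + ?e)*lmon k b x) : T" using 2 am True by (intro high[OF _ _ b]) auto
      ultimately have "(%y. emb i (%x. fm (Suc k) q ?c nu x*(x k^a*lmon k b x)) y - emb i (%x. x k^(a + ?e)*lmon k b x) y) : T" by (rule T_diff)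
      moreover have "(%y. emb i (%x. fm (Suc k) q ?c nu x*(x k^a*lmon k b x)) y - emb i (%x. x k^(a + ?e)*lmon k b x) y) = zmul k a s"
       unfolding 2(1) zmul_emb True by (auto simp: emb_def fun_eq_iff fm_ext algebra_simps power_add)
      ultimately show ?thesis by simp
     qed
    next
     case 3
     hence "zmul k a s : C1" using that(2) by (auto simp: C1_def)
     thus ?thesis by (intro B_T) (simp add: B_def)
    qed
    thus "zmul k a s : fs.span (rels (Suc k) (Suc nu) j0 q ?c m Un B)" by (simp add: T_def)
   qed (auto simp: zmul_def fun_eq_iff algebra_simps)
   thus ?thesis by (simp add: zmul_emb T_def)
  qed
  show ?thesis
  proof
   fix g::"(nat => 'a) \<times> nat => 'a" assume "g : vectors (Suc k) (Suc nu) q m"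
   then obtain i f where g: "g = emb i f" "i < Suc nu" "f : Hom (Suc k) (m + q i)" by (auto simp: vectors_def)
   show "g : fs.span (rels (Suc k) (Suc nu) j0 q ?c m Un B)" unfolding g(1)
   proof (rule emb_span[OF g(3)[unfolded Hom_def]])
    fix s::"'a fn" assume "s : lmon (Suc k) ` multi (Suc k) (m + q i)"
    then obtain b where b: "s = lmon (Suc k) b" "length b = Suc k" "sum_list b = m + q i" by (auto simp: mi_def)
    obtain b' a where ba: "b = b' @ [a]" "length b' = k" using b(2) by (metis length_Suc_conv_rev)
    have "s = (%x. x k^a*lmon k b' x)" unfolding b(1) ba(1) using ba(2) by (auto simp: fun_eq_iff lmon_def nth_append mult.commute)
    moreover have "a + sum_list b' = m + q i" "lmon k b' : Hom k (sum_list b')" using b(3) ba by (auto intro!: lmon_Hom simp: mi_def)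
    ultimately have "emb i s : T" using high[OF g(2), of a "lmon k b'"] low[OF g(2), of a "lmon k b'"] by (cases "a < ?e-1") auto
    thus "emb i s : fs.span (rels (Suc k) (Suc nu) j0 q ?c m Un B)" by (simp add: T_def)
   qed
  qed
 qed
 ultimately show ?thesis unfolding codim_le_def by blast
qed

lemma codim_le_no_variables:
 assumes "!!i. i < n ==> 0 < q i"
 shows "codim_le 0 n j0 q m 0 c"
proof -
 have "multi 0 (m + q i) = {}" if "i < n" for i using assms[OF that] by (auto simp: mi_def)
 hence "f = 0" if "f : vectors 0 n q m" for f using that by (auto simp: vectors_def Hom_def emb_def zero_fun_def fun_eq_iff)
 hence "vectors 0 n q m <= fs.span (rels 0 n j0 q c m Un {})" using fs.span_zero by (metis subsetI)
 thus ?thesis unfolding codim_le_def by (intro exI[of _ "{}"]) auto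
qed

text \<open>Diagonal forms: the column of the Jacobian matrix for \<open>x l\<close> is, up to a
  constant, the vector of weights \<open>w i l\<close> times a power of \<open>x l\<close>, if all
  degrees agree.\<close>

definition power_sums::"nat => (nat => nat) => (nat => nat => 'a) => cvar => 'a::field" where
 "power_sums k q w = (%(i,m). SUM l<k. if m = power_index k l (q i) then w i l else 0)"

lemma dform_power_sums: "l < k ==> dform k (q i) (%m. power_sums k q w (i,m)) l x = w i l*of_nat (q i)*x l^(q i-1)"
 unfolding power_sums_def prod.case dform_sum by (subst sum.cong[OF refl dform_power]) auto

lemma power_sums_column:
 fixes w::"nat => nat => 'a::field_char_0"
 assumes l: "l < k" "d-1 <= b ! l" and q: "!!i. i < n ==> q i = d" "0 < d" and b: "b : multi k (m+d)"
 shows "(%(x,i). if i < n then w i l*lmon k b x else 0) : fs.span (rels k n j0 q (power_sums k q w) m)"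
proof -
 define b' where "b' = b[l := b ! l - (d-1)]"
 have lb: "length b = k" using b by (simp add: mi_def)
 have "b ! l <= m + d" using elem_le_sum_list[of l b] l(1) b by (simp add: mi_def)
 have "b' : multi k (Suc m)" using b l q(2) elem_le_sum_list[of l b] by (auto simp: mi_def b'_def sum_list_update)
 hence "jac_col k n q (power_sums k q w) l (lmon k b') : fs.span (rels k n j0 q (power_sums k q w) m)" by (intro jac_col_in_rels[OF l(1)] lmon_Hom)
 hence *: "(%y. inverse (of_nat d)*jac_col k n q (power_sums k q w) l (lmon k b') y) : fs.span (rels k n j0 q (power_sums k q w) m)" by (rule fs.span_scale)
 have mon: "x l^(d-1)*lmon k b' x = lmon k b x" for x::"nat => 'a"
 proof -
  have "lmon k b' x = x l^(b ! l - (d-1))*(PROD l':{..<k}-{l}. x l'^(b ! l'))"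
   unfolding lmon_def b'_def using l lb by (subst prod.remove[of _ l]) (auto intro!: prod.cong)
  moreover have "lmon k b x = x l^(b ! l)*(PROD l':{..<k}-{l}. x l'^(b ! l'))" unfolding lmon_def using l by (subst prod.remove[of _ l]) auto
  ultimately show ?thesis using l(2) by (simp add: mult.assoc[symmetric] power_add[symmetric])
 qed
 have "(%y. inverse (of_nat d)*jac_col k n q (power_sums k q w) l (lmon k b') y) = (%(x,i). if i < n then w i l*lmon k b x else 0)"
 proof
  fix y::"(nat => 'a) \<times> nat"
  obtain x i where y: "y = (x,i)" by fastforce
  show "inverse (of_nat d)*jac_col k n q (power_sums k q w) l (lmon k b') y = (case y of (x,i) => if i < n then w i l*lmon k b x else 0)"
   using q dform_power_sums[OF l(1), of q i w x] unfolding y jac_col_def prod.case mon[of x, symmetric] by (cases "i < n") simp_all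
 qed
 with * show ?thesis by simp
qed

lemma large_exponent:
 assumes "b : multi k (m+d)" "k*d <= m" "0 < d"
 shows "EX l<k. d-1 <= b ! l"
proof (rule ccontr)
 assume "~ (EX l<k. d-1 <= b ! l)"
 hence "(SUM l<k. b ! l) <= (SUM l<k. d)" by (intro sum_mono) force
 thus False using assms by (auto simp: mi_def sum_list_sum_nth atLeast0LessThan)
qed

text \<open>For a sum of powers the partial derivatives are multiples of x_l^(d-1), and every
  monomial of large degree is divisible by one of them.\<close>

lemma codim_le_single:
 assumes "0 < q 0" "k*q 0 <= m"
 shows "codim_le k 1 1 q m 0 (power_sums k q (%_ _. 1)::cvar => 'a::field_char_0)"
proof -
 let ?c = "power_sums k q (%_ _. 1)::cvar => 'a"
 have "vectors k 1 q m <= fs.span (rels k 1 1 q ?c m)"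
 proof
  fix g::"(nat => 'a) \<times> nat => 'a" assume "g : vectors k 1 q m"
  then obtain f where g: "g = emb 0 f" "f : Hom k (m + q 0)" by (auto simp: vectors_def)
  show "g : fs.span (rels k 1 1 q ?c m)" unfolding g(1)
  proof (rule emb_span[OF g(2)[unfolded Hom_def]])
   fix s::"'a fn" assume "s : lmon k ` multi k (m + q 0)"
   then obtain b where b: "s = lmon k b" "b : multi k (m + q 0)" by blast
   then obtain l where l: "l < k" "q 0-1 <= b ! l" using large_exponent assms by blast
   have "emb 0 s = (%(x,i). if i < 1 then 1*lmon k b x else 0)" by (auto simp: emb_def b(1) fun_eq_iff)
   also have "... : fs.span (rels k 1 1 q ?c m)" by (rule power_sums_column[where w = "%_ _. 1", OF l _ assms(1) b(2)]) simp
   finally show "emb 0 s : fs.span (rels k 1 1 q ?c m)" .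
  qed
 qed
 thus ?thesis unfolding codim_le_def by (intro exI[of _ "{}"]) auto
qed

text \<open>Apart from the choice of \<open>l\<close> and the \<open>k - 1\<close> small exponents
  nothing is free: the exponent at \<open>l\<close> is determined by the degree.\<close>

lemma card_few_large_exponents:
 fixes d::nat
 shows "finite {b : multi k M. EX l<k. ALL l'<k. l' ~= l --> b ! l' < d} &
  card {b : multi k M. EX l<k. ALL l'<k. l' ~= l --> b ! l' < d} <= k*d^(k-1)"
proof -
 let ?S = "{b : multi k M. EX l<k. ALL l'<k. l' ~= l --> b ! l' < d}"
 let ?I = "SIGMA l:{..<k}. PiE ({..<k}-{l}) (%_. {..<d})"
 let ?h = "%(l,g). map (%l'. if l' = l then M - (SUM i:{..<k}-{l}. g i) else g l') [0..<k]"
 have "?S <= ?h ` ?I"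
 proof
  fix b assume "b : ?S"
  then obtain l where b: "length b = k" "sum_list b = M" "l < k" "!!l'. l' < k ==> l' ~= l ==> b ! l' < d" by (auto simp: mi_def)
  define g where "g = restrict ((!) b) ({..<k}-{l})"
  have "M = b ! l + (SUM i:{..<k}-{l}. b ! i)" using b(1-3) by (subst sum.remove[symmetric]) (auto simp: sum_list_sum_nth atLeast0LessThan)
  hence "b = ?h (l,g)" using b(1) by (intro nth_equalityI) (auto simp: g_def)
  moreover have "(l,g) : ?I" using b by (auto simp: g_def)
  ultimately show "b : ?h ` ?I" by blast
 qed
 moreover have I: "finite ?I" by (intro finite_SigmaI finite_PiE) auto
 ultimately have "card ?S <= card (?h ` ?I)" by (intro card_mono finite_imageI)
 also have "... <= card ?I" using I by (rule card_image_le)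
 also have "card ?I = (SUM l<k. d^(k-1))" by (subst card_SigmaI) (auto simp: card_PiE intro!: finite_PiE)
 finally show ?thesis by simp
qed

text \<open>The column of \<open>x l\<close> is (1, l) x_l^(d-1) up to a constant. If two exponents
  of a monomial are at least d - 1, two such vectors with different second entries produce both
  components. If only one is, there is still one relation between the components, so each such
  monomial costs one dimension. There are at most k (d-1)^(k-1) of these.\<close>

lemma codim_le_pencil:
 fixes q::"nat => nat"
 assumes "0 < q 0" "q 1 = q 0" "k*q 0 <= m"
 shows "codim_le k 2 2 q m (k*(q 0-1)^(k-1)) (power_sums k q (%i l. if i = 0 then 1 else of_nat l)::cvar => 'a::field_char_0)"
proof -
 let ?w = "%i l. if i = 0 then 1 else of_nat l::'a"
 let ?c = "power_sums k q ?w" and ?d = "q 0"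
 let ?S = "{b : multi k (m + ?d). EX l<k. ALL l'<k. l' ~= l --> b ! l' < ?d-1}"
 define B where "B = (%b. emb 1 (lmon k b::_ => 'a)) ` ?S"
 note S = card_few_large_exponents[of k "m + ?d" "?d-1"]
 have "finite B" "card B <= k*(?d-1)^(k-1)" using S card_image_le[of ?S "%b. emb 1 (lmon k b::_ => 'a)"] by (auto simp: B_def)
 moreover have "vectors k 2 q m <= fs.span (rels k 2 2 q ?c m Un B)"
 proof
  let ?T = "fs.span (rels k 2 2 q ?c m Un B)"
  have q: "!!i. i < 2 ==> q i = ?d" using assms(2) by (auto simp: less_2_cases_iff)
  have mon: "emb 0 (lmon k b) : ?T & emb 1 (lmon k b) : ?T" if b: "b : multi k (m + ?d)" for b
  proof -
   have col: "(%y. emb 0 (lmon k b) y + of_nat l*emb 1 (lmon k b) y) : ?T" if "l < k" "?d-1 <= b ! l" for l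
   proof -
    have "(%y. emb 0 (lmon k b) y + of_nat l*emb 1 (lmon k b) y) = (%(x,i). if i < 2 then ?w i l*lmon k b x else 0)" by (auto simp: emb_def fun_eq_iff)
    also have "... : fs.span (rels k 2 2 q ?c m)" by (rule power_sums_column[where w = ?w, OF that q assms(1) b])
    finally show ?thesis by (rule subsetD[OF fs.span_mono[OF Un_upper1]])
   qed
   obtain l where l: "l < k" "?d-1 <= b ! l" using large_exponent[OF b assms(3,1)] by blast
   have 1: "emb 1 (lmon k b) : ?T"
   proof (cases "EX l'<k. l' ~= l & ?d-1 <= b ! l'")
    case True
    then obtain l' where l': "l' < k" "l' ~= l" "?d-1 <= b ! l'" by blast
    have "(%y. inverse (of_nat l' - of_nat l)*(((%y. emb 0 (lmon k b) y + of_nat l'*emb 1 (lmon k b) y) -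
      (%y. emb 0 (lmon k b) y + of_nat l*emb 1 (lmon k b) y)) y)) : ?T" by (rule fs.span_scale[OF fs.span_diff[OF col[OF l'(1,3)] col[OF l]]])
    moreover have "(of_nat l' - of_nat l::'a) ~= 0" using l' by simp
    hence "(%y. inverse (of_nat l' - of_nat l)*(((%y. emb 0 (lmon k b) y + of_nat l'*emb 1 (lmon k b) y) -
      (%y. emb 0 (lmon k b) y + of_nat l*emb 1 (lmon k b) y)) y)) = emb 1 (lmon k b::_ => 'a)" by (auto simp: fun_eq_iff field_simps)
    ultimately show ?thesis by simp
   next
    case False
    hence "b : ?S" using b l(1) by (auto simp: not_le)
    thus ?thesis by (intro fs.span_base) (auto simp: B_def)
   qed
   have "(%y. emb 0 (lmon k b) y + of_nat l*emb 1 (lmon k b) y)-(%y. of_nat l*emb 1 (lmon k b) y) : ?T" by (rule fs.span_diff[OF col[OF l] fs.span_scale[OF 1]])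
   moreover have "(%y. emb 0 (lmon k b) y + of_nat l*emb 1 (lmon k b) y)-(%y. of_nat l*emb 1 (lmon k b) y) = emb 0 (lmon k b::_ => 'a)" by (simp add: fun_eq_iff)
   ultimately show ?thesis using 1 by simp
  qed
  fix g::"(nat => 'a) \<times> nat => 'a" assume "g : vectors k 2 q m"
  then obtain i f where g: "g = emb i f" "i < 2" "f : Hom k (m + q i)" by (auto simp: vectors_def)
  show "g : ?T" unfolding g(1)
  proof (rule emb_span[OF g(3)[unfolded Hom_def q[OF g(2)]]])
   fix s::"'a fn" assume "s : lmon k ` multi k (m + ?d)"
   thus "emb i s : ?T" using mon g(2) by (auto simp: less_2_cases_iff)
  qed
 qed
 ultimately show ?thesis unfolding codim_le_def by blast
qed

text \<open>The recursion of \<open>codim_le_ext\<close>. It stops at \<open>n <= j0\<close>, where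
  no constrained form is left: for \<open>j0 = 2\<close> this is the pencil, for
  \<open>j0 = 1\<close> a single form.\<close>

fun codim_bound::"nat => (nat => nat) => nat => nat => nat" where "codim_bound j0 q 0 n = 0"
| "codim_bound j0 q (Suc k) n = (if n <= j0 then if j0 = 2 then Suc k*(q 0-1)^k else 0
  else (q (n-1)-1)*codim_bound j0 q k n + q (n-1)*codim_bound j0 q k (n-1))"

lemma codim_bound_1: "codim_bound 1 q k n = 0" by (induction k arbitrary: n) auto

text \<open>The induction must carry genericity and not just existence, because
  \<open>codim_le_ext\<close> needs one tuple for which finitely many bounds, in different degrees
  and for both numbers of forms, hold together.\<close>

lemma generic_codim_bound:
 assumes "j0 = 1 | j0 = 2 & q 1 = q 0" "j0 <= n" "!!i. i < n ==> 0 < q i"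
 shows "EX m0. ALL m>=m0. generic (codim_le k n j0 q m (codim_bound j0 q k n)::(cvar => 'a::field_char_0) => bool)" using assms(2,3)
proof (induction k arbitrary: n)
 case 0
 have "generic (codim_le 0 n j0 q m (codim_bound j0 q 0 n)::(cvar => 'a) => bool)" for m
  using 0(2) by (intro generic_codim_le[of _ _ _ _ _ _ "%_. 0"]) (simp_all add: codim_le_no_variables)
 thus ?case by blast
next
 case (Suc k)
 show ?case
 proof (cases "n = j0")
  case True
  show ?thesis
  proof (intro exI[of _ "Suc k*q 0"] allI impI)
   fix m assume m: "Suc k*q 0 <= m"
   show "generic (codim_le (Suc k) n j0 q m (codim_bound j0 q (Suc k) n)::(cvar => 'a) => bool)"
   proof (cases "j0 = 1")
    case j1: True
    thus ?thesis using codim_le_single[of q "Suc k" m] Suc.prems m True by (intro generic_codim_le[where ?c0.0 = "power_sums (Suc k) q (%_ _. 1)"]) auto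
   next
    case False
    hence j2: "j0 = 2" "q 1 = q 0" using assms(1) by auto
    have "codim_le (Suc k) n j0 q m (codim_bound j0 q (Suc k) n) (power_sums (Suc k) q (%i l. if i = 0 then 1 else of_nat l)::cvar => 'a)"
     using codim_le_pencil[of q "Suc k" m, OF _ j2(2) m] Suc.prems True j2(1) by simp
    thus ?thesis using Suc.prems by (intro generic_codim_le) auto
   qed
  qed
 next
  case False
  then obtain nu where nu: "n = Suc nu" "j0 <= nu" using Suc.prems(1) by (cases n) auto
  let ?e = "q nu"
  obtain m1 where m1: "!!m. m1 <= m ==> generic (codim_le k n j0 q m (codim_bound j0 q k n)::(cvar => 'a) => bool)" using Suc.IH[OF Suc.prems] by blast
  obtain m0 where m0: "!!m. m0 <= m ==> generic (codim_le k nu j0 q m (codim_bound j0 q k nu)::(cvar => 'a) => bool)"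
   using Suc.IH[OF nu(2)] Suc.prems(2) nu(1) by auto
  show ?thesis
  proof (intro exI[of _ "m1 + m0 + 2*?e"] allI impI)
   fix m assume m: "m1 + m0 + 2*?e <= m"
   have "generic (%c::cvar => 'a. (ALL a:{..<?e-1}. codim_le k n j0 q (m-a) (codim_bound j0 q k n) c) &
     (ALL a:{..<?e}. codim_le k nu j0 q (m - (?e-1 + a)) (codim_bound j0 q k nu) c))" using m by (intro generic_conj generic_ball m1 m0) auto
   then obtain c::"cvar => 'a" where c: "!!a. a < ?e-1 ==> codim_le k n j0 q (m-a) (codim_bound j0 q k n) c"
     "!!a. a < ?e ==> codim_le k nu j0 q (m - (?e-1 + a)) (codim_bound j0 q k nu) c" using generic_ex by (metis (no_types, lifting) lessThan_iff)
   have "codim_le (Suc k) n j0 q m ((?e-1)*codim_bound j0 q k n + ?e*codim_bound j0 q k nu) (ext_system k nu q c)"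
    using codim_le_ext[of nu q j0 m k "codim_bound j0 q k n" c "codim_bound j0 q k nu"] c Suc.prems(2) m nu by auto
   thus "generic (codim_le (Suc k) n j0 q m (codim_bound j0 q (Suc k) n)::(cvar => 'a) => bool)"
    using nu Suc.prems(2) by (intro generic_codim_le[where ?c0.0 = "ext_system k nu q c"]) auto
  qed
 qed
qed

section \<open>Upper bounds for the degrees in the coefficients of one form\<close>

text \<open>A basis of the span of \<open>G\<close> I\<open>is extended within\<close>G
  \<open>(I Un J)\<close>. As \<open>C\<close> supplies the missing dimensions, at most
  \<open>N\<close> new elements are needed; they are listed by \<open>L\<close>.\<close>

lemma basis_list_codim:
 fixes G::"'i => 'p => 'a::field"
 assumes fin: "finite (G ` I)" "finite (G ` J)" and span: "V <= fs.span (G ` (I Un J))" "G ` (I Un J) <= fs.span V"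
  and codim: "V <= fs.span (G ` I Un C)" "finite C" "card C <= N"
 obtains n i L where "!!l. l < n ==> i l : I Un J" "V <= fs.span ((%l. G (i l)) ` {..<n})"
  "card ((%l. G (i l)) ` {..<n}) = n" "!!d. (!!x. (SUM l<n. d l*G (i l) x) = 0) ==> ALL l<n. d l = 0"
  "L <= {..<n}" "card L <= N" "!!l. l < n ==> l ~: L ==> i l : I"
proof -
 obtain B1 where B1: "B1 <= G ` I" "fs.independent B1" "G ` I <= fs.span B1" using fs.maximal_independent_subset[of "G ` I"] by blast
 have "B1 <= G ` (I Un J)" using B1(1) by blast
 then obtain B where B: "B1 <= B" "B <= G ` (I Un J)" "fs.independent B" "G ` (I Un J) <= fs.span B"
  using fs.maximal_independent_subset_extend[OF _ B1(2)] by blast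
 have fB: "finite B" by (rule finite_subset[OF B(2)]) (simp add: image_Un fin)
 have "fs.span V <= fs.span (B1 Un C)"
 proof (rule fs.span_minimal[OF _ fs.subspace_span])
  have "G ` I Un C <= fs.span (B1 Un C)" using B1(3) fs.span_mono[of B1 "B1 Un C"] fs.span_superset[of "B1 Un C"] by blast
  from fs.span_minimal[OF this fs.subspace_span] show "V <= fs.span (B1 Un C)" using codim(1) by blast
 qed
 hence "B <= fs.span (B1 Un C)" using B(2) span(2) by blast
 moreover have f1: "finite (B1 Un C)" using finite_subset[OF B(1) fB] codim(2) by simp
 ultimately have "card B <= card (B1 Un C)" using fs.independent_span_bound[OF _ B(3)] by blast
 also have "... <= card B1 + N" using card_Un_le[of B1 C] codim(3) by simp
 finally have cB: "card (B-B1) <= N" using B(1) fB by (simp add: card_Diff_subset finite_subset)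
 have "ALL b. EX i. b : B --> i : I Un J & G i = b & (b : B1 --> i : I)"
 proof
  fix b
  show "EX i. b : B --> i : I Un J & G i = b & (b : B1 --> i : I)" using B1(1) B(2) by (cases "b : B1") blast+
 qed
 then obtain idx where idx: "!!b. b : B ==> idx b : I Un J & G (idx b) = b & (b : B1 --> idx b : I)" by (rule choice[THEN exE]) blast
 have "finite (G ` idx ` B)" using fB by simp
 moreover have GB: "G ` idx ` B = B" using idx by (force simp: image_image)
 hence "B <= fs.span (G ` idx ` B)" using fs.span_superset[of B] by simp
 ultimately obtain n i where i: "!!l. l < n ==> i l : idx ` B" "B <= fs.span ((%l. G (i l)) ` {..<n})"
  "card ((%l. G (i l)) ` {..<n}) = n" "!!d. (!!x. (SUM l<n. d l*G (i l) x) = 0) ==> ALL l<n. d l = 0" by (rule basis_list_from_spanning) blast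
 have inj: "inj_on (%l. G (i l)) {..<n}" using i(3) by (simp add: eq_card_imp_inj_on)
 define L where "L = {l : {..<n}. G (i l) ~: B1}"
 show thesis
 proof (rule that[of n i L])
  show "i l : I Un J" if l: "l < n" for l
  proof -
   obtain b where "i l = idx b" "b : B" using i(1)[OF l] by (rule imageE)
   thus ?thesis using idx[of b] by simp
  qed
  have "V <= fs.span B" using span(1) fs.span_minimal[OF B(4) fs.subspace_span] by blast
  thus "V <= fs.span ((%l. G (i l)) ` {..<n})" using fs.span_minimal[OF i(2) fs.subspace_span] by blast
  show "L <= {..<n}" by (auto simp: L_def)
  have "card L = card ((%l. G (i l)) ` L)" by (rule card_image[symmetric], rule inj_on_subset[OF inj]) (auto simp: L_def)
  also have "(%l. G (i l)) ` L <= B - B1" using i(1) idx by (force simp: L_def)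
  hence "card ((%l. G (i l)) ` L) <= card (B-B1)" using fB by (intro card_mono) auto
  finally show "card L <= N" using cB by simp
  fix l assume l: "l < n" "l ~: L"
  obtain b where "b : B" "i l = idx b" using i(1)[OF l(1)] by blast
  moreover from this have "b : B1" using l idx by (auto simp: L_def)
  ultimately show "i l : I" using idx by auto
 qed (use i in auto)
qed

text \<open>By the Leibniz formula, since only the rows in \<open>L\<close> depend on the parameter,
  and they do so linearly.\<close>

lemma degree_det_le:
 fixes A::"nat => nat => 'a::comm_ring_1 poly"
 assumes L: "L <= {..<n}" and deg: "!!l j. l < n ==> j < n ==> degree (A l j) <= (if l : L then 1 else 0)"
 shows "EX P. degree P <= card L & (ALL s. poly P s = det (mat n n (%(l,j). poly (A l j) s)))"
proof (intro exI conjI allI)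
 let ?P = "SUM q | q permutes {0..<n}. of_int (sign q)*(PROD i = 0..<n. A i (q i))"
 have "degree (of_int (sign q)*(PROD i = 0..<n. A i (q i))) <= card L" if "q permutes {0..<n}" for q
 proof -
  have "degree (PROD i = 0..<n. A i (q i)) <= (SUM i = 0..<n. degree (A i (q i)))" using degree_prod_sum_le[of "{0..<n}" "%i. A i (q i)"] by (simp add: comp_def)
  also have "... <= (SUM i = 0..<n. if i : L then 1 else 0)" using permutes_in_image[OF that] by (intro sum_mono deg) auto
  also have "... = card L" using L by (simp add: sum.If_cases Int_absorb1 atLeast0LessThan)
  finally show ?thesis using degree_mult_le[of "of_int (sign q)" "PROD i = 0..<n. A i (q i)"] by simp
 qed
 thus "degree ?P <= card L" by (intro degree_sum_le) (auto simp: finite_permutations)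
 fix s
 show "poly ?P s = det (mat n n (%(l,j). poly (A l j) s))" by (simp add: poly_sum poly_prod det_def)
qed

context discriminant
begin

text \<open>Homogeneity in the form \<open>j\<close> gives P(s) = s^(deg j) Q(1/s), where Q(0) is
  the value of \<open>D\<close> at \<open>b\<close>. So this value is the leading coefficient of
  \<open>P\<close>.\<close>

lemma deg_eq_degree:
 assumes j: "j < r" and P: "!!s. poly P s = mv_eval (%(i,m). if i = j then s*b (i,m) + c (i,m) else b (i,m)) D"
  and b: "mv_eval b D ~= 0"
 shows "degree P = deg j"
proof -
 obtain Q where Q: "!!t. mv_eval (%v. b v + t*(if fst v = j then c v else 0)) D = poly Q t"
  using pfun_line[OF pfun_mv_UNIV, of b "%v. if fst v = j then c v else 0" D] by blast
 have scale: "poly P s = s^deg j*poly Q (inverse s)" if "s ~= 0" for s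
 proof -
  have "mv_eval (%(i,m). (if i = j then s else 1)*(%v. b v + inverse s*(if fst v = j then c v else 0)) (i,m)) D =
    (PROD i<r. (if i = j then s else 1)^deg i)*mv_eval (%v. b v + inverse s*(if fst v = j then c v else 0)) D"
   by (rule form_degrees[unfolded has_form_degrees_def, rule_format, of "%i. if i = j then s else 1"
      "%v. b v + inverse s*(if fst v = j then c v else 0)"]) (use that in auto)
  also have "(%(i,m). (if i = j then s else 1)*(%v. b v + inverse s*(if fst v = j then c v else 0)) (i,m)) =
    (%(i,m). if i = j then s*b (i,m) + c (i,m) else b (i,m))" using that by (auto simp: fun_eq_iff field_simps)
  also have "(PROD i<r. (if i = j then s else 1)^deg i) = (PROD i<r. if i = j then s^deg j else 1)" by (intro prod.cong) auto
  finally show ?thesis using j by (simp add: P Q)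
 qed
 have "poly (monom 1 (degree Q)*P - monom 1 (deg j)*reflect_poly Q) s = 0" if "s : UNIV - {0}" for s
  using that scale[of s] by (simp add: poly_monom poly_reflect_poly_nz)
 moreover have "infinite (UNIV - {0::'a})" using infinite_UNIV_char_0 by simp
 ultimately have "monom 1 (degree Q)*P - monom 1 (deg j)*reflect_poly Q = 0" by (rule poly_eq_0_infinite[rotated])
 hence eq: "monom 1 (degree Q)*P = monom 1 (deg j)*reflect_poly Q" by simp
 have Q0: "coeff Q 0 ~= 0" using Q[of 0] b by (simp add: poly_0_coeff_0)
 hence "reflect_poly Q ~= 0" by auto
 moreover from this have "P ~= 0" using eq by (metis monom_eq_0_iff mult_eq_0_iff one_neq_zero)
 ultimately have "degree Q + degree P = deg j + degree (reflect_poly Q)" using arg_cong[OF eq, of degree] by (simp add: degree_mult_eq degree_monom_eq)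
 thus ?thesis using Q0 by simp
qed

text \<open>There are r + 1 forms of degrees \<open>q\<close>: places 0 and 1 hold the two members
  c_0, c_1 of the pencil s c_0 + c_1 for the form \<open>j\<close>, the other places hold the
  remaining forms. The map \<open>sg\<close> exchanges \<open>j\<close> and 0, so that the form
  \<open>i\<close> sits in place \<open>Suc (sg i)\<close>. The minor \<open>E\<close> has rows from
  columns of the Jacobian matrix, from constraints, and at most \<open>N\<close> rows depending on
  s.\<close>

lemma deg_le_codim_bound:
 assumes j: "j < r"
 shows "deg j <= codim_bound 2 (%i. p (if i-1 = 0 then j else if i-1 = j then 0 else i-1)) k (Suc r)"
proof -
 define sg where "sg = (%i. if i = 0 then j else if i = j then 0 else i)"
 define q where "q = (%i. p (sg (i-1)))"
 define N where "N = codim_bound 2 q k (Suc r)"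
 have sgsg: "sg (sg i) = i" for i by (auto simp: sg_def)
 have sgr: "sg i < r \<longleftrightarrow> i < r" for i using j by (auto simp: sg_def)
 have sg0: "sg i = 0 \<longleftrightarrow> i = j" for i by (auto simp: sg_def)
 have sgj: "sg i = j \<longleftrightarrow> i = 0" for i by (auto simp: sg_def)
 have q_pos: "0 < q i" if "i < Suc r" for i using p[of "sg (i-1)"] sgr[of "i-1"] that r unfolding q_def by auto
 have q01: "q 1 = q 0" by (simp add: q_def)
 define form_of where "form_of = (%(c::cvar => 'a) (i,m). if i = j then c (0,m) else c (Suc (sg i),m))"
 define shift where "shift = (%(c::cvar => 'a) (i,m). c (Suc i,m))"
 obtain m1 where m1: "!!m. m1 <= m ==> generic (codim_le k (Suc r) 2 q m N::(cvar => 'a) => bool)"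
  using generic_codim_bound[of 2 q "Suc r" k, where 'a = 'a] q_pos q01 r unfolding N_def by auto
 obtain m2 where m2: "!!m. m2 <= m ==> generic (codim_le k r 1 (%i. q (Suc i)) m 0::(cvar => 'a) => bool)"
  using generic_codim_bound[of 1 "%i. q (Suc i)" r k, where 'a = 'a] q_pos r unfolding codim_bound_1 by auto
 define m where "m = m1 + m2"
 have gen2: "generic (%c::cvar => 'a. codim_le k r 1 (%i. q (Suc i)) m 0 (shift c))"
 proof (rule generic_compose[OF m2])
  show "pfun UNIV (%c. shift c v)" for v by (cases v) (auto simp: shift_def intro: pfunI)
  show "EX c. shift c = b" for b by (rule exI[of _ "%(i,m). b (i-1,m)"]) (auto simp: shift_def)
 qed (simp add: m_def)
 have gen3: "generic (%c. mv_eval (form_of c) D ~= 0)"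
 proof (rule generic_compose[of "%a. mv_eval a D ~= 0"])
  show "generic (%a. mv_eval a D ~= 0)" unfolding generic_def using D_nz mv_eval_zero_imp_zero[of D] by (intro exI[of _ "%a. mv_eval a D"]) (auto simp: pfun_mv_UNIV)
  show "pfun UNIV (%c. form_of c v)" for v by (cases v) (auto simp: form_of_def intro!: pfunI pfun_if)
  show "EX c. form_of c = b" for b by (rule exI[of _ "%(i,m). b (sg (i-1),m)"]) (auto simp: form_of_def sgsg fun_eq_iff sg_def)
 qed
 have "generic (%c::cvar => 'a. codim_le k (Suc r) 2 q m N c & codim_le k r 1 (%i. q (Suc i)) m 0 (shift c) & mv_eval (form_of c) D ~= 0)"
  by (intro generic_conj gen2 gen3 m1) (simp add: m_def)
 from generic_ex[OF this] obtain c where "codim_le k (Suc r) 2 q m N c & codim_le k r 1 (%i. q (Suc i)) m 0 (shift c) & mv_eval (form_of c) D ~= 0" by (rule exE)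
 note c = this[THEN conjunct1] this[THEN conjunct2, THEN conjunct1] this[THEN conjunct2, THEN conjunct2]
 let ?V = "vectors k (Suc r) q m::((nat => 'a) \<times> nat => 'a) set"
 \<comment> \<open>Since the form \<open>j\<close> is s c_0 + c_1, its multiplier acts on component
   0 with an additional factor s. These vectors are the ones on which the two contributions
   cancel.\<close>
 define extra where "extra = (%s b (y::(nat => 'a) \<times> nat). emb 0 (lmon k b) y - s*emb 1 (lmon k b) y::'a)"
 define G where "G = (%c s x. case x of Inl io => rel_gen k (Suc r) q c io | Inr b => extra s b)"
 define I where "I = (Inl ` rel_index k (Suc r) 2 q m::(((cvar)+(nat \<times> cvar)) + nat list) set)"
 define J where "J = (Inr ` multi k (m + q 0)::(((cvar)+(nat \<times> cvar)) + nat list) set)"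
 have G_V: "G c s i : fs.span ?V" if "i : I Un J" for c s i
 proof (cases i)
  case (Inl io)
  thus ?thesis using that rels_in_vectors[of "Suc r" q io k 2 m c] q_pos by (auto simp: I_def J_def G_def)
 next
  case (Inr b)
  hence "lmon k b : Hom k (m + q 0)" "lmon k b : Hom k (m + q 1)" using that q01 by (auto simp: I_def J_def intro!: lmon_Hom)
  hence v: "emb 0 (lmon k b) : fs.span ?V" "emb 1 (lmon k b) : fs.span ?V" using r by (auto simp: vectors_def intro!: fs.span_base)
  have "G c s i = emb 0 (lmon k b)-(%y. s*emb 1 (lmon k b) y)" by (simp add: Inr G_def extra_def fun_eq_iff)
  thus ?thesis using fs.span_diff[OF v(1) fs.span_scale[OF v(2)]] by simp
 qed
 obtain C where C: "finite C" "card C <= N" "?V <= fs.span (rels k (Suc r) 2 q c m Un C)" using c(1) by (auto simp: codim_le_def)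
 have GI: "G c 0 ` I = rels k (Suc r) 2 q c m" by (simp add: I_def G_def image_image)
 \<comment> \<open>At s = 0 the vectors \<open>extra\<close> fill component 0. What remains is the
   system of the \<open>r\<close> forms in places 1 to \<open>r\<close>, without a pencil, for which
   the generic codimension is 0.\<close>
 have full: "?V <= fs.span (G c 0 ` (I Un J))"
 proof
  let ?T = "fs.span (G c 0 ` (I Un J))"
  fix g assume "g : ?V"
  then obtain i f where g: "g = emb i f" "i < Suc r" "f : Hom k (m + q i)" by (auto simp: vectors_def)
  have zero: "emb 0 f : ?T" if "f : Hom k (m + q 0)" for f
  proof (rule emb_span[OF that[unfolded Hom_def]])
   fix s::"'a fn" assume "s : lmon k ` multi k (m + q 0)"
   then obtain b where "s = lmon k b" "b : multi k (m + q 0)" by blast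
   hence "emb 0 s = G c 0 (Inr b)" "Inr b : I Un J" by (auto simp: G_def extra_def J_def)
   thus "emb 0 s : ?T" by (metis fs.span_base imageI)
  qed
  show "g : ?T"
  proof (cases i)
   case 0
   thus ?thesis using zero g by simp
  next
   case (Suc i')
   define up where "up = (%g (x::nat => 'a,i::nat). if i = (0::nat) then 0 else g (x,i-1)::'a)"
   have rT: "h : ?T" if "h : fs.span (rels k (Suc r) 2 q c m)" for h using that fs.span_mono[of "rels k (Suc r) 2 q c m" "G c 0 ` (I Un J)"] GI by blast
   have "emb i' f : vectors k r (%i. q (Suc i)) m" using g Suc by (auto simp: vectors_def)
   hence "emb i' f : fs.span (rels k r 1 (%i. q (Suc i)) (shift c) m)" using c(2) by (auto simp: codim_le_def)
   hence "up (emb i' f) : ?T"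
   proof (rule fs_span_map)
    fix s assume "s : rels k r 1 (%i. q (Suc i)) (shift c) m"
    then consider l b where "s = jac_col k r (%i. q (Suc i)) (shift c) l (lmon k b)" "l < k" "b : multi k (Suc m)"
     | i i' b where "s = emb i (%x. fm k (%i. q (Suc i)) (shift c) i' x*lmon k b x)" "i < r" "1 <= i'" "i' < r" "length b = k" "sum_list b + q (Suc i') = m + q (Suc i)"
     by (auto simp: rel_index_def rel_gen_def)
    thus "up s : ?T"
    proof cases
     case (1 l b)
     have up: "up s = jac_col k (Suc r) q c l (lmon k b) - emb 0 (%x. dform k (q 0) (%m. c (0,m)) l x*lmon k b x)"
      unfolding 1(1) by (auto simp: up_def jac_col_def emb_def shift_def fun_eq_iff gr0_conv_Suc)
     have "(%x. dform k (q 0) (%m. c (0,m)) l x*lmon k b x) : Hom k (q 0-1 + Suc m)" using 1 by (intro Hom_mult dform_Hom lmon_Hom)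
     hence z: "emb 0 (%x. dform k (q 0) (%m. c (0,m)) l x*lmon k b x) : ?T" using q_pos[of 0] by (intro zero) (simp add: add.commute)
     have "jac_col k (Suc r) q c l (lmon k b) : ?T" using 1 by (intro rT jac_col_in_rels lmon_Hom)
     thus ?thesis unfolding up by (rule fs.span_diff[OF _ z])
    next
     case (2 i i' b)
     have "up s = emb (Suc i) (%x. fm k q c (Suc i') x*lmon k b x)" unfolding 2(1) by (auto simp: up_def emb_def fm_def shift_def fun_eq_iff)
     also have "... : ?T" using 2 by (intro rT constraint_in_rels[where e = "sum_list b"] lmon_Hom) (auto simp: mi_def)
     finally show ?thesis .
    qed
   qed (auto simp: up_def fun_eq_iff)
   moreover have "up (emb i' f) = g" unfolding g(1) Suc by (auto simp: up_def emb_def fun_eq_iff)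
   ultimately show ?thesis by simp
  qed
 qed
 have fin: "finite (G c 0 ` I)" "finite (G c 0 ` J)" by (simp_all add: I_def J_def finite_rel_index)
 obtain n i L where i: "!!l. l < n ==> i l : I Un J" "?V <= fs.span ((%l. G c 0 (i l)) ` {..<n})"
  "card ((%l. G c 0 (i l)) ` {..<n}) = n" "!!d. (!!x. (SUM l<n. d l*G c 0 (i l) x) = 0) ==> ALL l<n. d l = 0"
  and L: "L <= {..<n}" "card L <= N" "!!l. l < n ==> l ~: L ==> i l : I" by (rule basis_list_codim[OF fin full _ C(3)[folded GI] C(1,2)]) (use G_V in blast)+
 obtain y where y: "det (mat n n (%(l,j). G c 0 (i l) (y j))) ~= 0" using exists_points_det_nonzero[where n = n and b = "%l. G c 0 (i l)"] i(4) by blast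
 text \<open>The variable \<open>(r, [])\<close> is not a coefficient and serves as the parameter of the pencil.\<close>
 define unpencil where "unpencil = (%(a::cvar => 'a) (i,m). if i > r then c (i,m) else if i = 0 then c (0,m)
  else a (sg (i-1),m)-(if i = 1 then a (r,[])*c (0,m) else 0))"
 have "pfun UNIV (%a. unpencil a v)" for v by (cases v) (auto simp: unpencil_def intro!: pfunI pfun_if)
 hence pf: "pfun UNIV (%a. rel_gen k (Suc r) q (unpencil a) io x)" for io x by (rule pfun_compose[OF pfun_rel_gen])
 have "pfun UNIV (%a. G (unpencil a) (a (r,[])) t x)" for t x by (cases t) (auto simp: G_def extra_def pf intro!: pfunI)
 hence "pfun UNIV (%a. det (mat n n (%(l,j). G (unpencil a) (a (r,[])) (i l) (y j))))" by (intro pfun_det)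
 then obtain E where E: "!!a. mv_eval a E = det (mat n n (%(l,j). G (unpencil a) (a (r,[])) (i l) (y j)))" by (auto dest!: pfun_imp_mvpoly)
 have "D dvd E"
 proof (rule D_dvd_if_vanishing_on_sing)
  fix a::"cvar => 'a" assume "sing k r p a"
  then obtain x w l0 j0 where x: "l0 < k" "x l0 ~= 0" "j0 < r" "w j0 ~= 0" "!!j. j < r ==> pform k (p j) (%m. a (j,m)) x = 0"
   "!!i. i < k ==> (SUM j<r. w j*dform k (p j) (%m. a (j,m)) i x) = 0" by (auto simp: sing_def)
  let ?s = "a (r,[])" and ?c = "unpencil a"
  \<comment> \<open>Evaluation at the singular point against the multipliers; it annihilates every
    row of the minor.\<close>
  define Lm where "Lm = (%g::(nat => 'a) \<times> nat => 'a. w j*?s*g (x,0)+(SUM i<r. w i*g (x,Suc (sg i))))"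
  have sum_single: "(SUM i<r. w i*(if Suc (sg i) = i' then u else 0)) = (if 0 < i' & i' < Suc r then w (sg (i'-1))*u else 0)" for i' u
  proof (cases "0 < i' & i' < Suc r")
   case True
   hence "(SUM i<r. w i*(if Suc (sg i) = i' then u else 0)) = (SUM i<r. if i = sg (i'-1) then w (sg (i'-1))*u else 0)" using sgsg by (intro sum.cong) auto
   thus ?thesis using True sgr[of "i'-1"] by auto
  next
   case False
   hence "(SUM i<r. w i*(if Suc (sg i) = i' then u else 0)) = (SUM i<r. 0)" using sgr by (intro sum.cong) auto
   thus ?thesis using False by auto
  qed
  have kill: "Lm (G ?c ?s t) = 0" if "t : I Un J" for t
  proof -
   from that consider l b where "t = Inl (Inl (l,b))" "l < k"
    | i i' b where "t = Inl (Inr (i,i',b))" "i < Suc r" "2 <= i'" "i' < Suc r"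
    | b where "t = Inr b" by (auto simp: I_def J_def rel_index_def)
   thus ?thesis
   proof cases
    case (1 l b)
    have "(SUM i<r. w i*dform k (p i) (%m. ?c (Suc (sg i),m)) l x) =
     (SUM i<r. w i*dform k (p i) (%m. a (i,m)) l x - (if i = j then w j*?s*dform k (p j) (%m. c (0,m)) l x else 0))"
    proof (rule sum.cong[OF refl])
     fix i assume "i : {..<r}"
     hence "?c (Suc (sg i),m) = a (i,m)+(if i = j then - ?s else 0)*c (0,m)" for m using sgr[of i] by (auto simp: unpencil_def sgsg sg0)
     hence "dform k (p i) (%m. ?c (Suc (sg i),m)) l x = dform k (p i) (%m. a (i,m)) l x + (if i = j then - ?s else 0)*dform k (p i) (%m. c (0,m)) l x"
      by (simp only: dform_add dform_scale)
     thus "w i*dform k (p i) (%m. ?c (Suc (sg i),m)) l x = w i*dform k (p i) (%m. a (i,m)) l x - (if i = j then w j*?s*dform k (p j) (%m. c (0,m)) l x else 0)"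
      by (auto simp: algebra_simps)
    qed
    also have "... = - (w j*?s*dform k (p j) (%m. c (0,m)) l x)" using j x(6)[OF 1(2)] by (simp add: sum_subtractf)
    finally have s: "(SUM i<r. w i*dform k (p i) (%m. ?c (Suc (sg i),m)) l x) = - (w j*?s*dform k (p j) (%m. c (0,m)) l x)" .
    have "Lm (G ?c ?s t) = (w j*?s*dform k (p j) (%m. c (0,m)) l x + (SUM i<r. w i*dform k (p i) (%m. ?c (Suc (sg i),m)) l x))*lmon k b x"
     unfolding 1 Lm_def G_def using sgr by (simp add: rel_gen_def jac_col_def q_def sgsg distrib_right sum_distrib_right mult.assoc) (simp add: unpencil_def sg_def)
    thus ?thesis using s by simp
   next
    case (2 i i' b)
    have "sg (i'-1) < r" "i' ~= 0" "i' ~= 1" "~ r < i'" using 2 sgr[of "i'-1"] by auto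
    hence "fm k q ?c i' x = 0" using x(5)[of "sg (i'-1)"] by (simp add: fm_def q_def unpencil_def)
    thus ?thesis unfolding 2 Lm_def G_def by (simp add: rel_gen_def emb_def)
   next
    case (3 b)
    have "(SUM i<r. w i*G ?c ?s t (x,Suc (sg i))) = (SUM i<r. w i*(if Suc (sg i) = 1 then - (?s*lmon k b x) else 0))"
     by (intro sum.cong refl) (simp add: 3 G_def extra_def emb_def)
    also have "... = w (sg 0)*- (?s*lmon k b x)" using r sum_single[of 1 "- (?s*lmon k b x)"] by simp
    also have "sg 0 = j" by (simp add: sg_def)
    finally have "(SUM i<r. w i*G ?c ?s t (x,Suc (sg i))) = - (w j*?s*lmon k b x)" by simp
    moreover have "G ?c ?s t (x,0) = lmon k b x" by (simp add: 3 G_def extra_def emb_def)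
    ultimately show ?thesis by (simp add: Lm_def)
   qed
  qed
  have "det (mat n n (%(l,j). G ?c ?s (i l) (y j))) = 0"
  proof (rule ccontr)
   assume d: "det (mat n n (%(l,j). G ?c ?s (i l) (y j))) ~= 0"
   \<comment> \<open>A nonzero minor would make the rows span all vectors, so \<open>Lm\<close>
     would vanish identically. Its value on this vector is a nonzero multiplier times a power of a
     nonzero coordinate.\<close>
   define f where "f = emb (Suc (sg j0)) (lmon k (power_index k l0 (m + q (Suc (sg j0))))::'a fn)"
   have fV: "f : ?V" unfolding f_def vectors_def using x(1,3) sgr[of j0] by (auto intro!: lmon_Hom power_index_in)
   have sub: "fs.span ?V <= fs.span ((%l. G c 0 (i l)) ` {..<n})" by (rule fs.span_minimal[OF i(2) fs.subspace_span])
   have "f : fs.span ((%l. G ?c ?s (i l)) ` {..<n})"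
   proof (rule span_if_det_values[where B = "(%l. G c 0 (i l)) ` {..<n}" and y = y and n = n and f = f and g = "%l. G ?c ?s (i l)", rotated 2])
    show "f : fs.span ((%l. G c 0 (i l)) ` {..<n})" using fV i(2) by blast
    show "G ?c ?s (i l) : fs.span ((%l. G c 0 (i l)) ` {..<n})" if "l < n" for l using G_V[OF i(1)[OF that]] sub by blast
   qed (use i(3) d in simp_all)
   hence "(%_::nat. Lm f) : fs.span {}"
   proof (rule fs_span_map)
    fix g assume "g : (%l. G ?c ?s (i l)) ` {..<n}"
    hence "Lm g = 0" using kill i(1) by auto
    thus "(%_::nat. Lm g) : fs.span {}" by (simp add: zero_fun_def)
   qed (auto simp: Lm_def fun_eq_iff algebra_simps sum.distrib sum_distrib_left)
   hence "Lm f = 0" by (simp add: zero_fun_def fun_eq_iff)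
   moreover have "Lm f = w j0*x l0^(m + q (Suc (sg j0)))"
    using sum_single[of "Suc (sg j0)"] x(1,3) sgr[of j0] by (simp add: Lm_def f_def emb_def lmon_power_index sgsg)
   ultimately show False using x by simp
  qed
  thus "mv_eval a E = 0" by (simp add: E)
 qed
 then obtain E' where E': "E = D*E'" by blast
 \<comment> \<open>The pencil as a line in the coefficient space: along it \<open>unpencil\<close>
   is constantly \<open>c\<close>, so only the rows from \<open>extra\<close> vary.\<close>
 define pen where "pen = (%s (i,m). if (i,m) = (r,[]) then s else if i = j then s*form_of c (i,m) + c (1,m) else form_of c (i,m))"
 have unpen: "unpencil (pen s) = c" for s
 proof
  fix v::"cvar"
  obtain i m where v: "v = (i,m)" by fastforce
  show "unpencil (pen s) v = c v"
  proof (cases "i = 0 | r < i")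
   case True
   thus ?thesis by (auto simp: v unpencil_def)
  next
   case False
   hence "sg (i-1) < r" "Suc (i-1) = i" using sgr[of "i-1"] by auto
   thus ?thesis using False by (auto simp: v unpencil_def pen_def form_of_def sgsg sgj sg0)
  qed
 qed
 have pen_r: "pen s (r,[]) = s" for s by (simp add: pen_def)
 define cur where "cur = (%v. if v = (r,[]) then [:0,1:] else if fst v = j then [:c (1,snd v),form_of c v:] else [:form_of c v:])"
 have pen_cur: "pen s = (%v. poly (cur v) s)" for s by (auto simp: pen_def cur_def fun_eq_iff)
 obtain PD where PD: "!!s. mv_eval (pen s) D = poly PD s" unfolding pen_cur using pfun_curve[OF pfun_mv_UNIV, of cur D] by blast
 obtain PE where PE: "!!s. mv_eval (pen s) E' = poly PE s" unfolding pen_cur using pfun_curve[OF pfun_mv_UNIV, of cur E'] by blast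
 define A where "A = (%l jj. case i l of Inl io => [:rel_gen k (Suc r) q c io (y jj):] | Inr b => [:emb 0 (lmon k b) (y jj),- emb 1 (lmon k b) (y jj):])"
 have A: "poly (A l jj) s = G c s (i l) (y jj)" for l jj s by (cases "i l") (auto simp: A_def G_def extra_def)
 have "EX P. degree P <= card L & (ALL s. poly P s = det (mat n n (%(l,jj). poly (A l jj) s)))"
 proof (rule degree_det_le[OF L(1)])
  fix l jj assume "l < n"
  thus "degree (A l jj) <= (if l : L then 1 else 0)" using L(3)[of l] by (cases "i l") (auto simp: A_def I_def)
 qed
 then obtain R where R: "degree R <= card L" "!!s. poly R s = det (mat n n (%(l,jj). G c s (i l) (y jj)))" unfolding A by blast
 have "poly R s = poly (PD*PE) s" for s using E[of "pen s"] unfolding unpen pen_r E' by (simp add: R(2) PD PE)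
 hence RP: "R = PD*PE" by (intro poly_eqI_degree_lead_coeff poly_ext) blast
 have "R ~= 0" using R(2)[of 0] y by auto
 hence "degree PD <= N" using RP R(1) L(2) degree_mult_eq[of PD PE] by auto
 moreover have "degree PD = deg j"
 proof (rule deg_eq_degree[OF j _ c(3), where c = "%v. c (1,snd v)"])
  fix s
  have "mv_in (coeff_vars k r p) D" using disc by (simp add: is_discriminant_def)
  hence "mv_eval (pen s) D = mv_eval (%(i,m). if i = j then s*form_of c (i,m) + c (1,m) else form_of c (i,m)) D"
   by (rule pfun_cong_on[OF pfun_mv_eval]) (auto simp: pen_def coeff_vars_def)
  thus "poly PD s = mv_eval (%(i,m). if i = j then s*form_of c (i,m) + c (1,snd (i,m)) else form_of c (i,m)) D" by (simp only: PD[symmetric] snd_conv)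
 qed
 ultimately have "deg j <= codim_bound 2 q k (Suc r)" by (simp add: N_def)
 thus ?thesis unfolding q_def sg_def .
qed

end

section \<open>Directional derivatives and curves\<close>

text \<open>The directional derivative, read off from the restriction to a line, so that a function
  needs no chosen polynomial behind it.\<close>

definition dd::"(('v => 'a) => 'a) => ('v => 'a) => ('v => 'a) => 'a::field_char_0" where "dd f u v = coeff (SOME P. ALL s. f (%i. u i + s*v i) = poly P s) 1"

definition along::"(('v => 'a) => 'a) => ('v => 'a poly) => 'a::field_char_0 poly" where "along f c = (SOME P. ALL s. f (%i. poly (c i) s) = poly P s)"

abbreviation unit_at::"'v => 'v => 'a::zero_neq_one" where "unit_at i j == if i = j then 1 else 0"

lemma poly_some_eq:
 fixes P::"'a::field_char_0 poly"
 assumes "!!s. F s = poly P s"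
 shows "(SOME P. ALL s. F s = poly P s) = P"
proof (rule some_equality)
 fix Q assume "ALL s. F s = poly Q s"
 thus "Q = P" using assms by (intro poly_ext) simp
qed (use assms in simp)

lemma dd_eqI: "(!!s. f (%i. u i + s*v i) = poly P s) ==> dd f u v = coeff P 1" unfolding dd_def by (simp add: poly_some_eq)
lemma along_eqI: "(!!s. f (%i. poly (c i) s) = poly P s) ==> along f c = P" unfolding along_def by (rule poly_some_eq)
lemma poly_along: "pfun V f ==> poly (along f c) s = f (%i. poly (c i) s)" using pfun_curve[of V f c] along_eqI[of f c] by metis
lemma dd_along: "pfun V f ==> dd f u v = coeff (along f (%i. [:u i,v i:])) 1" by (rule dd_eqI) (simp add: poly_along)

lemma along_simps: "along (%_. b) c = [:b:]" "along (%x. x i) c = c i" "pfun V f ==> pfun V g ==> along (%x. f x + g x) c = along f c + along g c"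
 "pfun V f ==> pfun V g ==> along (%x. f x*g x) c = along f c*along g c" by (rule along_eqI, simp add: poly_along)+

lemma coeff_along_0: "pfun V f ==> coeff (along f c) 0 = f (%i. coeff (c i) 0)" using poly_along[of V f c 0] by (simp add: poly_0_coeff_0)
lemma coeff_mult_1: "coeff (p*q) 1 = coeff p 1*coeff q 0 + coeff p 0*coeff q (1::nat)" by (simp add: coeff_mult add.commute)

lemma dd_simps: "dd (%_. b) u v = 0" "dd (%x. x i) u v = v i" "pfun V f ==> pfun V g ==> dd (%x. f x + g x) u v = dd f u v + dd g u v"
 "pfun V f ==> pfun V g ==> dd (%x. f x*g x) u v = dd f u v*g u + f u*dd g u v"
proof -
 show "dd (%_. b) u v = 0" by (subst dd_eqI[where P = "[:b:]"]) auto
 show "dd (%x. x i) u v = v i" by (subst dd_eqI[where P = "[:u i,v i:]"]) auto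
 assume V: "pfun V f" "pfun V g"
 show "dd (%x. f x + g x) u v = dd f u v + dd g u v" using V by (subst (1 2 3) dd_along[of V]) (auto simp: along_simps intro: pfunI)
 have "pfun V (%x. f x*g x)" using V by (rule pfun.mult)
 thus "dd (%x. f x*g x) u v = dd f u v*g u + f u*dd g u v"
  using V by (simp add: dd_along[of V] along_simps coeff_mult_1 coeff_along_0 mult.commute del: One_nat_def)
qed

lemma dd_sum: "(!!i. i : A ==> pfun V (f i)) ==> dd (%x. SUM i:A. f i x) u v = (SUM i:A. dd (f i) u v)"
proof (induction A rule: infinite_finite_induct)
 case (insert i A)
 thus ?case by (simp add: dd_simps(3)[of V] pfun_sum)
qed (simp_all add: dd_simps)

lemma dd_poly: "dd (%x. poly p (x i)) u v = poly (pderiv p) (u i)*v i"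
proof (induction p)
 case (pCons a p)
 have "pfun UNIV (%x. poly p (x i))" unfolding poly_altdef by (intro pfunI) simp
 hence "dd (%x. a + x i*poly p (x i)) u v = v i*poly p (u i) + u i*(poly (pderiv p) (u i)*v i)"
  by (subst dd_simps(3)[of UNIV], auto intro!: pfunI, subst dd_simps(4)[of UNIV]) (auto simp: dd_simps pCons.IH intro!: pfunI)
 thus ?case by (simp add: pderiv_pCons algebra_simps)
qed (simp add: dd_simps)

lemma pfun_dd: "pfun V f ==> pfun V (%u. dd f u v)" by (induction rule: pfun.induct) (auto simp: dd_simps intro: pfunI)

lemma coeff_along_1: "pfun V f ==> coeff (along f c) 1 = dd f (%i. coeff (c i) 0) (%i. coeff (c i) 1)" by (induction rule: pfun.induct)
  (simp_all add: along_simps dd_simps coeff_mult_1 coeff_along_0 del: One_nat_def, simp_all)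

lemma dd_finite_support:
 assumes "pfun V f" "finite U" "!!j. j ~: U ==> v j = 0"
 shows "dd f u v = (SUM j:U. v j*dd f u (unit_at j))" using assms(1)
proof (induction rule: pfun.induct)
 case (var i)
 thus ?case using assms(2,3) by (cases "i : U") (auto simp: dd_simps if_distrib cong: if_cong)
next
 case (mult f g)
 thus ?case by (simp add: dd_simps distrib_left sum.distrib sum_distrib_left sum_distrib_right mult_ac)
qed (simp_all add: dd_simps distrib_left sum.distrib)

lemma perturb_identity:
 fixes X::"'a::comm_ring_1"
 shows "(a + X*A + d*X^Suc n + X^Suc (Suc n)*Q)*(b + X*B + e*X^Suc n + X^Suc (Suc n)*R) =
  (a + X*A)*(b + X*B)+(d*b*X^Suc n + a*e*X^Suc n) + X^Suc (Suc n) *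
  (d*B + A*e + d*e*X^n + Q*(b + X*B + e*X^Suc n + X^Suc (Suc n)*R) + R*(a + X*A + d*X^Suc n))" by (simp add: algebra_simps)

text \<open>Taylor expansion to first order: adding v X^m to a curve changes the value of
  \<open>f\<close> by X^m times its derivative in the direction \<open>v\<close>, modulo X^(m+1).
  This is the correction step of Newton's method.\<close>

lemma along_perturb:
 assumes "pfun V f" "0 < m"
 shows "EX Q. along f (%i. c i + smult (v i) ([:0,1:]^m)) = along f c + smult (dd f (%i. coeff (c i) 0) v) ([:0,1:]^m) + [:0,1:]^Suc m*Q" using assms(1)
proof (induction rule: pfun.induct)
 case (mult f g)
 let ?X = "[:0,1:]::'b poly" and ?u = "%i. coeff (c i) 0" and ?c = "%i. c i + smult (v i) ([:0,1:]^m)"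
 obtain Q R where QR: "along f ?c = along f c + smult (dd f ?u v) (?X^m) + ?X^Suc m*Q"
  "along g ?c = along g c + smult (dd g ?u v) (?X^m) + ?X^Suc m*R" using mult.IH by blast
 have decomp: "EX P'. P = [:coeff P 0:] + ?X*P'" for P::"'b poly" by (cases P) (auto intro!: exI simp: )
 obtain A' B' where AB: "along f c = [:f ?u:] + ?X*A'" "along g c = [:g ?u:] + ?X*B'"
  using decomp[of "along f c"] decomp[of "along g c"] mult.hyps by (auto simp: coeff_along_0)
 obtain n where n: "m = Suc n" using assms(2) by (cases m) auto
 have s: "smult t p = [:t:]*p" and c2: "[:t*t':] = [:t:]*[:t':]" for t t' and p::"'b poly" by simp_all
 show ?case unfolding along_simps(4)[OF mult.hyps] dd_simps(4)[OF mult.hyps] n QR[unfolded n] AB smult_add_left s[of "dd f ?u v*g ?u"] s[of "f ?u*dd g ?u v"] c2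
   s[of "dd f ?u v"] s[of "dd g ?u v"] by (rule exI, rule perturb_identity)
next
 case (add f g)
 then obtain Q R where "along f (%i. c i + smult (v i) ([:0,1:]^m)) = along f c + smult (dd f (%i. coeff (c i) 0) v) ([:0,1:]^m) + [:0,1:]^Suc m*Q"
  "along g (%i. c i + smult (v i) ([:0,1:]^m)) = along g c + smult (dd g (%i. coeff (c i) 0) v) ([:0,1:]^m) + [:0,1:]^Suc m*R" by blast
 thus ?case by (intro exI[of _ "Q+R"]) (simp add: along_simps(3)[OF add.hyps] dd_simps(3)[OF add.hyps] smult_add_left algebra_simps)
qed (auto simp: along_simps dd_simps intro!: exI[of _ 0])

section \<open>Persistence of nondegenerate zeros\<close>

text \<open>Invertibility of the square Jacobian matrix, stated as triviality of its kernel;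
  equations and unknowns share the index set \<open>U\<close>.\<close>

definition nondeg::"('i => ('i => 'a) => 'a) => 'i set => ('i => 'a::field_char_0) => bool" where
 "nondeg H U u \<longleftrightarrow> (ALL v. (ALL j. j ~: U --> v j = 0) --> (ALL e:U. dd (H e) u v = 0) --> (ALL j:U. v j = 0))"

lemma nondegD: "nondeg H U u ==> (!!j. j ~: U ==> v j = 0) ==> (!!e. e : U ==> dd (H e) u v = 0) ==> j : U ==> v j = 0" unfolding nondeg_def by blast

lemma nondeg_solve:
 fixes H::"'i => ('i => 'a::field_char_0) => 'a"
 assumes U: "finite U" and pf: "!!e. e : U ==> pfun V (H e)" and nd: "nondeg H U u"
 shows "EX v. (ALL j. j ~: U --> v j = 0) & (ALL e:U. dd (H e) u v = b e)"
proof -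
 define C where "C = (%j e. case j of Some j => dd (H e) u (unit_at j) | None => - b e)"
 let ?E = "insert None (Some ` U)"
 have "card U < card ?E" using U by (simp add: card_image)
 then obtain d where d: "EX j:?E. d j ~= 0" "ALL e:U. (SUM j:?E. d j*C j e) = 0" using homogeneous_system[of U ?E C] U by auto
 have lin: "dd (H e) u (%j. if j : U then t*d (Some j) else 0) = t*(d None*b e)" if e: "e : U" for e t
 proof -
  have "dd (H e) u (%j. if j : U then t*d (Some j) else 0) = (SUM j:U. t*d (Some j)*dd (H e) u (unit_at j))" by (subst dd_finite_support[OF pf[OF e] U]) auto
  also have "... = t*(SUM j:U. d (Some j)*dd (H e) u (unit_at j))" by (simp add: sum_distrib_left mult.assoc)
  also have "(SUM j:U. d (Some j)*dd (H e) u (unit_at j)) = d None*b e" using bspec[OF d(2) e] U by (simp add: C_def sum.reindex)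
  finally show ?thesis .
 qed
 have "d None ~= 0"
 proof
  assume n: "d None = 0"
  have "(if j : U then 1*d (Some j) else 0) = 0" if "j : U" for j by (rule nondegD[OF nd]) (use that lin[of _ 1] n in auto)
  thus False using d(1) n by auto
 qed
 thus ?thesis using lin[of _ "inverse (d None)"] by (intro exI[of _ "%j. if j : U then inverse (d None)*d (Some j) else 0"]) auto
qed

lemma nondeg_open:
 fixes H::"'i => ('i => 'a::field_char_0) => 'a"
 assumes U: "finite U" and pf: "!!e. e : U ==> pfun V (H e)" and nd: "nondeg H U u0"
 shows "EX t. pfun V t & t u0 ~= 0 & (ALL u. t u ~= 0 --> nondeg H U u)"
proof -
 obtain m e where e: "bij_betw e {..<m::nat} U" using ex_bij_betw_nat_finite[OF U] by (auto simp: atLeast0LessThan)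
 hence eU': "U = e ` {..<m}" by (simp add: bij_betw_def)
 have eU: "e i : U" if "i < m" for i using e that by (auto simp: bij_betw_def)
 let ?A = "%u. mat (m) (m) (%(i,j). dd (H (e j)) u (unit_at (e i)))"
 have sum: "dd (H (e j)) u v = (SUM i<m. v (e i)*dd (H (e j)) u (unit_at (e i)))"
  if "j < m" "!!j. j ~: U ==> v j = 0" for j u v by (subst dd_finite_support[OF pf[OF eU[OF that(1)]] U that(2)]) (auto intro: sum.reindex_bij_betw[OF e, symmetric])
 show ?thesis
 proof (intro exI[of _ "%u. det (?A u)"] conjI allI impI)
  show "pfun V (%u. det (?A u))" by (intro pfun_det pfun_dd pf eU)
  show "det (?A u0) ~= 0"
  proof
   assume "det (?A u0) = 0"
   hence "det (transpose_mat (?A u0)) = 0" by (simp add: det_transpose[of _ "m"])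
   then obtain x where x: "x : carrier_vec (m)" "x ~= 0\<^sub>v (m)" "transpose_mat (?A u0) *\<^sub>v x = 0\<^sub>v (m)"
    using det_0_iff_vec_prod_zero[of "transpose_mat (?A u0)" "m"] by auto
   define v where "v = (%j. if j : U then x $ (the_inv_into {..<m} e j) else 0)"
   have ve: "v (e i) = x $ i" if "i < m" for i using that eU[OF that] e by (simp add: v_def bij_betw_def the_inv_into_f_f)
   have kern: "dd (H e') u0 v = 0" if e': "e' : U" for e'
   proof -
    obtain j where j: "j < m" "e' = e j" using e' unfolding eU' by auto
    have "dd (H (e j)) u0 v = (SUM i<m. v (e i)*dd (H (e j)) u0 (unit_at (e i)))" by (rule sum[OF j(1)]) (simp add: v_def)
    also have "... = (SUM i<m. x $ i*dd (H (e j)) u0 (unit_at (e i)))" by (simp add: ve)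
    also have "... = (transpose_mat (?A u0) *\<^sub>v x) $ j" using j(1) x(1) by (simp add: scalar_prod_def atLeast0LessThan mult.commute)
    finally show ?thesis using x(3) j by simp
   qed
   have "v j = 0" if "j : U" for j by (rule nondegD[OF nd _ kern that]) (simp_all add: v_def)
   hence "x $ i = 0" if "i < m" for i using ve[OF that] eU[OF that] by simp
   hence "x = 0\<^sub>v m" using x(1) by (intro eq_vecI) auto
   thus False using x(2) by simp
  qed
  fix u assume d: "det (?A u) ~= 0"
  show "nondeg H U u" unfolding nondeg_def
  proof (intro allI impI ballI)
   fix v::"'i => 'a" and j assume v: "ALL j. j ~: U --> v j = 0" "ALL e:U. dd (H e) u v = 0" and j: "j : U"
   obtain i where i: "i < m" "j = e i" using j unfolding eU' by auto
   show "v j = 0"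
   proof (rule ccontr)
    assume "v j ~= 0"
    hence "det (?A u) = 0" using sum[of _ v u] v eU i
     by (intro det_values_zero_if_dependent[where g = "%i f. dd f u (unit_at (e i))" and y = "%j. H (e j)" and ?i0.0 = i and d = "%i. v (e i)"]) auto
    with d show False by simp
   qed
  qed
 qed
qed

text \<open>Newton's method over the ring of polynomials in the parameter.\<close>

lemma approximate_curve:
 fixes H::"'i => ('i => 'a::field_char_0) => 'a"
 assumes U: "finite U" "z ~: U" and pf: "!!e. e : U ==> pfun V (H e)" and nd: "nondeg H U u0"
  and zero: "u0 z = 0" "!!e. e : U ==> H e u0 = 0"
 shows "EX c. c z = [:0,1:] & (ALL i. coeff (c i) 0 = u0 i) & (ALL i. i ~: U --> i ~= z --> c i = [:u0 i:]) & (ALL e:U. [:0,1:]^Suc N dvd along (H e) c)"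
proof (induction N)
 case 0
 have "[:0,1:] dvd along (H e) (%i. if i = z then [:0,1:] else [:u0 i:])" if e: "e : U" for e
 proof -
  have "(%i. coeff (if i = z then [:0,1:] else [:u0 i:]) 0) = u0" using zero(1) by auto
  hence "coeff (along (H e) (%i. if i = z then [:0,1:] else [:u0 i:])) 0 = 0" using zero(2)[OF e] by (simp add: coeff_along_0[OF pf[OF e]])
  thus ?thesis using poly_eq_0_iff_dvd[of "along (H e) (%i. if i = z then [:0,1:] else [:u0 i:])" 0] by (simp add: poly_0_coeff_0)
 qed
 thus ?case using U zero(1) by (intro exI[of _ "%i. if i = z then [:0,1:] else [:u0 i:]"]) auto
next
 case (Suc N)
 let ?X = "[:0,1:]::'a poly"
 obtain c where c: "c z = ?X" "!!i. coeff (c i) 0 = u0 i" "!!i. i ~: U ==> i ~= z ==> c i = [:u0 i:]" "!!e. e : U ==> ?X^Suc N dvd along (H e) c" using Suc.IH by blast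
 have "ALL e. EX q. e : U --> along (H e) c = ?X^Suc N*q" using c(4) by (meson dvdE)
 then obtain q where q: "!!e. e : U ==> along (H e) c = ?X^Suc N*q e" by metis
 obtain v where v: "!!j. j ~: U ==> v j = 0" "!!e. e : U ==> dd (H e) u0 v = - coeff (q e) 0" using nondeg_solve[OF U(1) pf nd, of "%e. - coeff (q e) 0"] by blast
 let ?c = "%i. c i + smult (v i) (?X^Suc N)"
 have "?X^Suc (Suc N) dvd along (H e) ?c" if e: "e : U" for e
 proof -
  obtain Q where Q: "along (H e) ?c = along (H e) c + smult (dd (H e) (%i. coeff (c i) 0) v) (?X^Suc N) + ?X^Suc (Suc N)*Q"
   using along_perturb[OF pf[OF e], of "Suc N" c v] by blast
  obtain q' where q': "q e = [:coeff (q e) 0:] + ?X*q'" by (cases "q e") auto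
  have "along (H e) ?c = ?X^Suc N*([:coeff (q e) 0:] + ?X*q') + smult (- coeff (q e) 0) (?X^Suc N) + ?X^Suc (Suc N)*Q"
   unfolding Q using q[OF e] q' v(2)[OF e] by (simp add: c(2))
  also have "... = ?X^Suc (Suc N)*(q' + Q)" by (simp add: algebra_simps)
  finally show ?thesis by (rule dvdI)
 qed
 thus ?case using c v(1) U(2) by (intro exI[of _ ?c]) (auto simp: coeff_mult coeff_0_power)
qed

text \<open>The coordinate \<open>None\<close> is the Rabinowitsch variable, evaluated at 1 / T. The
  exponent that clears it depends only on \<open>g\<close>, not on the curve, so the precision of
  the curve can be fixed afterwards.\<close>

lemma clear_power_denominators:
 fixes g::"('i option => 'a::field_char_0) => 'a"
 assumes "pfun V g"
 shows "EX N0. ALL N>=N0. ALL c T. EX G. ALL s. poly T s ~= 0 --> poly T s^N*g (frac_at T c s) = poly G s" using assms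
proof (induction rule: pfun.induct)
 case (const b)
 have "EX G. ALL s. poly T s ~= 0 --> poly T s^N*b = poly G s" for T::"'a poly" and N by (rule exI[of _ "T^N*[:b:]"]) simp
 thus ?case by simp
next
 case (var v)
 show ?case
 proof (rule exI[of _ 1], intro allI impI)
  fix N::nat and c::"'i => 'a poly" and T::"'a poly" assume N: "1 <= N"
  show "EX G. ALL s. poly T s ~= 0 --> poly T s^N*frac_at T c s v = poly G s"
  proof (cases v)
   case None
   have "N = Suc (N-1)" using N by simp
   hence "poly T s^N = poly T s^(N-1)*poly T s" for s by (metis power_Suc2)
   thus ?thesis using None by (intro exI[of _ "T^(N-1)"]) simp
  next
   case (Some i)
   thus ?thesis by (intro exI[of _ "T^N*c i"]) simp
  qed
 qed
next
 case (add f g)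
 then obtain N1 N2 where N: "!!N c T. N1 <= N ==> EX G. ALL s. poly T s ~= 0 --> poly T s^N*f (frac_at T c s) = poly G s"
  "!!N c T. N2 <= N ==> EX G. ALL s. poly T s ~= 0 --> poly T s^N*g (frac_at T c s) = poly G s" by meson
 show ?case
 proof (intro exI[of _ "N1+N2"] allI impI)
  fix N and c::"'i => 'a poly" and T::"'a poly" assume "N1 + N2 <= N"
  then obtain F G where "!!s. poly T s ~= 0 ==> poly T s^N*f (frac_at T c s) = poly F s" "!!s. poly T s ~= 0 ==> poly T s^N*g (frac_at T c s) = poly G s"
   using N(1)[of N T c] N(2)[of N T c] by auto
  thus "EX G. ALL s. poly T s ~= 0 --> poly T s^N*(f (frac_at T c s) + g (frac_at T c s)) = poly G s" by (intro exI[of _ "F+G"]) (simp add: distrib_left)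
 qed
next
 case (mult f g)
 then obtain N1 N2 where N: "!!N c T. N1 <= N ==> EX G. ALL s. poly T s ~= 0 --> poly T s^N*f (frac_at T c s) = poly G s"
  "!!N c T. N2 <= N ==> EX G. ALL s. poly T s ~= 0 --> poly T s^N*g (frac_at T c s) = poly G s" by meson
 show ?case
 proof (intro exI[of _ "N1+N2"] allI impI)
  fix N and c::"'i => 'a poly" and T::"'a poly" assume le: "N1 + N2 <= N"
  hence "N2 <= N - N1" by linarith
  then obtain F G where "!!s. poly T s ~= 0 ==> poly T s^N1*f (frac_at T c s) = poly F s" "!!s. poly T s ~= 0 ==> poly T s^(N-N1)*g (frac_at T c s) = poly G s"
   using N(1)[of N1 T c] N(2)[of "N-N1" T c] by auto
  moreover have "poly T s^N = poly T s^N1*poly T s^(N-N1)" for s using le by (simp add: power_add[symmetric])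
  ultimately show "EX G. ALL s. poly T s ~= 0 --> poly T s^N*(f (frac_at T c s)*g (frac_at T c s)) = poly G s" by (intro exI[of _ "F*G"]) (simp add: mult_ac)
 qed
qed

lemma order_le_1:
 fixes P::"'a::field_char_0 poly"
 assumes "coeff P 0 ~= 0 | coeff P 1 ~= 0"
 shows "P ~= 0 & order 0 P <= 1"
proof -
 have "P ~= 0" using assms by auto
 moreover have "~ [:- 0,1:]^2 dvd P"
 proof
  assume "[:- 0,1:]^2 dvd P"
  then obtain Q where "P = [:0,1:]*([:0,1:]*Q)" by (auto simp: dvd_def power2_eq_square mult.assoc)
  thus False using assms by simp
 qed
 ultimately show ?thesis using order_divides[of 0 2 P] by auto
qed

text \<open>If there were no zero for a parameter \<open>s\<close> with the required properties, the Nullstellensatz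
 would put a power of the product of the inequations into the ideal of the equations. Along a
 curve that solves the equations to high order in \<open>s\<close>, this contradicts the bounded order of the
 inequations.\<close>

theorem persistence:
 fixes H::"'i => ('i => 'a::{alg_closed_field,field_char_0}) => 'a"
 assumes U: "finite U" "z ~: U" and pf: "!!e. e : U ==> pfun (insert z U) (H e)"
  and nd: "nondeg H U u0" and zero: "u0 z = 0" "!!e. e : U ==> H e u0 = 0"
  and Th: "finite Th" "!!t. t : Th ==> pfun (insert z U) t"
  and ineq: "!!t c. t : Th ==> c z = [:0,1:] ==> (!!i. coeff (c i) 0 = u0 i) ==>
   (!!e. e : U ==> [:0,1:]^2 dvd along (H e) c) ==> coeff (along t c) 0 ~= 0 | coeff (along t c) 1 ~= 0"
  and h: "h ~= 0"
 shows "EX u. poly h (u z) ~= 0 & (ALL e:U. H e u = 0) & (ALL t:Th. t u ~= 0)"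
proof (rule ccontr)
 assume none: "~ ?thesis"
 let ?W = "insert z U"
 define T where "T = (%u. poly h (u z)*(PROD t:Th. t u))"
 have pfh: "pfun ?W (%u. poly h (u z))" unfolding poly_altdef by (intro pfunI) simp
 have pfT: "pfun ?W T" unfolding T_def by (intro pfunI pfh Th(2))
 define V where "V = insert None (Some ` ?W)"
 define L where "L = (%x::'i option => 'a. %i. x (Some i))"
 have pfL: "pfun V (%x. f (L x))" if "pfun ?W f" for f unfolding L_def using that by (rule pfun_compose) (auto simp: V_def intro: pfunI)
 define K where "K = {%x. (SUM e:U. g e x*H e (L x)) + g' x*(1 - x None*T (L x)) | g g'. (ALL e. pfun V (g e)) & pfun V g'}"
 have KI: "(%x. (SUM e:U. g e x*H e (L x)) + g' x*(1 - x None*T (L x))) : K"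
  if "!!e. pfun V (g e)" "pfun V g'" for g g' unfolding K_def using that by blast
 have N: "None : V" by (simp add: V_def)
 have "polyideal V K" unfolding polyideal_def
 proof (intro conjI ballI allI impI)
  fix f assume "f : K"
  thus "pfun V f" using pf N by (auto simp: K_def intro!: pfunI pfL pfT)
 next
  show "(%_. 0) : K" using KI[of "%_ _. 0" "%_. 0"] by (simp add: pfunI)
 next
  fix f f'::"('i option => 'a) => 'a" assume "f : K" "f' : K"
  then obtain g g' k k' where *: "!!e. pfun V (g e)" "pfun V g'" "!!e. pfun V (k e)" "pfun V k'"
   "f = (%x. (SUM e:U. g e x*H e (L x)) + g' x*(1 - x None*T (L x)))"
   "f' = (%x. (SUM e:U. k e x*H e (L x)) + k' x*(1 - x None*T (L x)))" by (auto simp: K_def)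
  have "(%x. (SUM e:U. (g e x + k e x)*H e (L x))+(g' x + k' x)*(1 - x None*T (L x))) : K" by (intro KI pfunI *)
  thus "(%x. f x + f' x) : K" by (simp add: *(5,6) distrib_right sum.distrib add_ac)
 next
  fix f b::"('i option => 'a) => 'a" assume "f : K" and b: "pfun V b"
  then obtain g g' where *: "!!e. pfun V (g e)" "pfun V g'" "f = (%x. (SUM e:U. g e x*H e (L x)) + g' x*(1 - x None*T (L x)))" by (auto simp: K_def)
  have "(%x. (SUM e:U. (b x*g e x)*H e (L x))+(b x*g' x)*(1 - x None*T (L x))) : K" by (intro KI pfunI * b)
  thus "(%x. b x*f x) : K" by (simp add: *(3) distrib_left sum_distrib_left mult.assoc)
 qed
 moreover have "\<nexists>c. ALL f:K. f c = 0"
 proof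
  assume "EX c. ALL f:K. f c = 0"
  then obtain c where c: "!!f. f : K ==> f c = 0" by blast
  have "H e (L c) = 0" if "e : U" for e using c[OF KI[of "%e' _. if e' = e then 1 else 0" "%_. 0"]] that U(1)
   by (simp add: pfunI pfun_if if_distrib[of "%x. x*_"] cong: if_cong)
  moreover have "T (L c) ~= 0" using c[OF KI[of "%_ _. 0" "%_. 1"]] by (auto simp: pfunI)
  hence "poly h (L c z) ~= 0" "ALL t:Th. t (L c) ~= 0" using Th(1) by (auto simp: T_def)
  ultimately show False using none by blast
 qed
 ultimately have "(%_. 1) : K" using nullstellensatz[of V K] U(1) by (auto simp: V_def)
 then obtain g g' where g: "!!e. pfun V (g e)" "(%_. 1) = (%x. (SUM e:U. g e x*H e (L x)) + g' x*(1 - x None*T (L x)))" by (auto simp: K_def)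
 have "ALL e. EX N0. ALL N>=N0. ALL c T. EX G. ALL s. poly T s ~= 0 --> poly T s^N*g e (frac_at T c s) = poly G s" using clear_power_denominators[OF g(1)] by blast
 from choice[OF this] obtain N0 where N0: "!!e N c T. N0 e <= N ==> EX G. ALL s. poly T s ~= 0 --> poly T s^N*g e (frac_at T c s) = poly G s" by blast
 define N where "N = (SUM e:U. N0 e)"
 have N: "N0 e <= N" if "e : U" for e unfolding N_def using member_le_sum[OF that, of N0] U(1) by simp
 \<comment> \<open>A bound for the order at 0 of the product \<open>t\<close> of the inequations
   along any admissible curve. The identity below equates t^N, of order at most \<open>N*q\<close>,
   with a combination of equations of higher order.\<close>
 define q where "q = order 0 h + card Th"
 obtain c where c: "c z = [:0,1:]" "!!i. coeff (c i) 0 = u0 i" "!!e. e : U ==> [:0,1:]^Suc (N*q + 1) dvd along (H e) c"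
  using approximate_curve[OF U pf nd zero, of "N*q + 1"] by blast
 define t where "t = along T c"
 have tT: "poly t s = T (%i. poly (c i) s)" for s unfolding t_def by (rule poly_along[OF pfT])
 have two: "[:0,1:]^2 dvd along (H e) c" if "e : U" for e using c(3)[OF that] le_imp_power_dvd[of 2 "Suc (N*q + 1)" "[:0,1:]::'a poly"] dvd_trans by auto
 have th: "along t' c ~= 0 & order 0 (along t' c) <= 1" if "t' : Th" for t' by (rule order_le_1[OF ineq[OF that c(1,2) two]])
 have "S <= Th ==> (PROD t:S. along t c) ~= 0 & order 0 (PROD t:S. along t c) <= card S" for S
 proof (induction S rule: infinite_finite_induct)
  case (insert a S)
  hence "order 0 (along a c*(PROD t:S. along t c)) <= 1 + card S" using th[of a] by (subst order_mult) auto
  thus ?case using insert th[of a] by auto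
 qed (use Th(1) finite_subset in auto)
 hence prod: "(PROD t:Th. along t c) ~= 0" "order 0 (PROD t:Th. along t c) <= card Th" by auto
 have t: "t = h*(PROD t:Th. along t c)" by (rule poly_ext) (simp add: tT T_def poly_prod c(1) poly_along[OF Th(2)] cong: prod.cong)
 have t_nz: "t ~= 0" and t_order: "order 0 t <= q" using h prod by (auto simp: t q_def order_mult)
 have "ALL e. EX G. e : U --> (ALL s. poly t s ~= 0 --> poly t s^N*g e (case_option (inverse (poly t s)) (%i. poly (c i) s)) = poly G s)" using N0[OF N] by blast
 then obtain G where G: "!!e s. e : U ==> poly t s ~= 0 ==> poly t s^N*g e (case_option (inverse (poly t s)) (%i. poly (c i) s)) = poly (G e) s"
  by (rule choice[THEN exE]) blast
 have "t^N - (SUM e:U. G e*along (H e) c) = 0"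
 proof (rule poly_eq_0_infinite)
  have "UNIV = {s. poly t s = 0} Un {s. poly t s ~= 0}" by auto
  thus "infinite {s. poly t s ~= 0}" using infinite_UNIV_char_0 poly_roots_finite[OF t_nz] by (metis finite_UnI)
  fix s assume "s : {s. poly t s ~= 0}"
  hence s: "poly t s ~= 0" by simp
  let ?x = "case_option (inverse (poly t s)) (%i. poly (c i) s)"
  have L: "L ?x = (%i. poly (c i) s)" by (simp add: L_def)
  have "1 = (SUM e:U. g e ?x*H e (L ?x)) + g' ?x*(1 - ?x None*T (L ?x))" by (rule fun_cong[OF g(2)])
  also have "?x None*T (L ?x) = 1" unfolding L using s by (simp add: tT)
  finally have "1 = (SUM e:U. g e ?x*H e (%i. poly (c i) s))" by (simp add: L)
  hence "poly t s^N = (SUM e:U. poly t s^N*g e ?x*H e (%i. poly (c i) s))" by (metis (no_types, lifting) mult.assoc mult.right_neutral sum.cong sum_distrib_left)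
  also have "... = (SUM e:U. poly (G e) s*poly (along (H e) c) s)" by (intro sum.cong refl) (simp add: G s poly_along[OF pf])
  finally show "poly (t^N - (SUM e:U. G e*along (H e) c)) s = 0" by (simp add: poly_sum)
 qed
 hence "t^N = (SUM e:U. G e*along (H e) c)" by simp
 moreover have "[:0,1:]^Suc (N*q + 1) dvd (SUM e:U. G e*along (H e) c)" by (intro dvd_sum dvd_mult c(3))
 ultimately have "[:- 0,1:]^Suc (N*q + 1) dvd t^N" by (simp only: minus_zero)
 hence "t^N = 0 | Suc (N*q + 1) <= order 0 (t^N)" by (rule order_divides[THEN iffD1])
 hence "Suc (N*q + 1) <= order 0 (t^N)" using t_nz power_not_zero by blast
 moreover have "order 0 (t^n) = n*order 0 t" for n using t_nz by (induction n) (auto simp: order_mult)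
 ultimately show False using mult_le_mono2[OF t_order, of N] by simp
qed

text \<open>The simultaneous version: the systems labelled by \<open>A\<close> share the parameter, which is the
 coordinate \<open>0\<close>.\<close>

definition curve_at::"(nat => 'a fn) => nat set => (nat => 'a) => (nat => 'a::field_char_0 poly) => bool" where
 "curve_at H U b c \<longleftrightarrow> c 0 = [:0,1:] & (ALL j. coeff (c j) 0 = b j) & (ALL j. j ~: insert 0 U --> c j = [:b j:]) &
  (ALL e:U. [:0,1:]^2 dvd along (H e) c)"

text \<open>\<open>R\<close> lists the pairs to be told apart by \<open>Ps\<close>. Values that
  agree at parameter 0 are allowed if they differ to first order; critical values are separated in
  this way.\<close>

corollary persistence_family:
 fixes H::"'b => nat => (nat => 'a::{alg_closed_field,field_char_0}) => 'a"
 assumes A: "finite A" "!!a. a : A ==> finite (U a)" "!!a. a : A ==> 0 ~: U a"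
  and pf: "!!a e. a : A ==> e : U a ==> pfun UNIV (H a e)"
  and b: "!!a. a : A ==> b a 0 = 0" "!!a e. a : A ==> e : U a ==> H a e (b a) = 0" "!!a. a : A ==> nondeg (H a) (U a) (b a)"
  and th: "!!a. a : A ==> pfun UNIV (th a)" "!!a. a : A ==> th a (b a) ~= 0"
  and R: "R <= A \<times> A" "!!a a'. (a,a') : R ==> pfun UNIV (Ps a a')"
   "!!a a' c c'. (a,a') : R ==> curve_at (H a) (U a) (b a) c ==> curve_at (H a') (U a') (b a') c' ==>
    coeff (along (Ps a a') c) 0 ~= coeff (along (Ps a a') c') 0 | coeff (along (Ps a a') c) 1 ~= coeff (along (Ps a a') c') 1"
  and h: "h ~= 0"
 shows "EX ep u. poly h ep ~= 0 & (ALL a:A. u a 0 = ep & (ALL j. j ~: insert 0 (U a) --> u a j = b a j) & (ALL e:U a. H a e (u a) = 0) &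
  nondeg (H a) (U a) (u a) & th a (u a) ~= 0) & (ALL (a,a'):R. Ps a a' (u a) ~= Ps a a' (u a'))"
proof -
 \<comment> \<open>The index of the shared parameter. Since 0 lies in no \<open>U a\<close>, it
   differs from all indices in \<open>I\<close>, whatever label stands in front.\<close>
 define z where "z = (undefined::'b,0::nat)"
 define I where "I = (SIGMA a:A. U a)"
 let ?Z = "insert z I"
 define loc where "loc = (%(w::'b \<times> nat => 'a) a j. if j = 0 then w z else if j : U a then w (a,j) else b a j)"
 define cloc where "cloc = (%(c::'b \<times> nat => 'a poly) a j. if j = 0 then c z else if j : U a then c (a,j) else [:b a j:])"
 define HH where "HH = (%(a,e) w. H a e (loc w a))"
 define w0 where "w0 = (%(a,j). if j = 0 then 0 else b a j)"
 have z: "z ~: I" using A(3) by (auto simp: z_def I_def)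
 have loc_pf: "pfun ?Z (%w. f (loc w a))" if "pfun UNIV f" "a : A" for f a
 proof (rule pfun_compose[OF that(1), of ?Z "%j w. loc w a j"])
  show "pfun ?Z (%w. loc w a j)" for j unfolding loc_def using that(2) by (intro pfun_if pfunI) (auto simp: I_def)
 qed
 have along_loc: "along (%w. f (loc w a)) c = along f (cloc c a)" if "pfun UNIV f" for f a c
 proof (rule along_eqI)
  have "loc (%i. poly (c i) s) a = (%j. poly (cloc c a j) s)" for s by (auto simp: loc_def cloc_def)
  thus "f (loc (%i. poly (c i) s) a) = poly (along f (cloc c a)) s" for s by (simp add: poly_along[OF that])
 qed
 have loc0: "loc w0 a = b a" if "a : A" for a using b(1)[OF that] by (auto simp: loc_def w0_def z_def fun_eq_iff)
 have finI: "finite I" unfolding I_def using A by auto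
 have HH_pf: "pfun ?Z (HH e)" if e: "e : I" for e
 proof -
  obtain a j where "e = (a,j)" "a : A" "j : U a" using e unfolding I_def by blast
  thus ?thesis by (simp add: HH_def loc_pf pf)
 qed
 have cloc_curve: "curve_at (H a) (U a) (b a) (cloc c a)"
  if a: "a : A" and c: "c z = [:0,1:]" "!!i. coeff (c i) 0 = w0 i" "!!e. e : I ==> [:0,1:]^2 dvd along (HH e) c" for a c
 proof -
  have "[:0,1:]^2 dvd along (H a e) (cloc c a)" if "e : U a" for e using c(3)[of "(a,e)"] that a along_loc[OF pf[OF a that], of a c] by (simp add: HH_def I_def)
  thus ?thesis using a A(3)[OF a] c b(1)[OF a] by (auto simp: curve_at_def cloc_def w0_def)
 qed
 have "ALL a. EX t. a : A --> pfun UNIV t & t (b a) ~= 0 & (ALL u. t u ~= 0 --> nondeg (H a) (U a) u)" using nondeg_open[OF A(2) pf b(3)] by blast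
 then obtain t where t: "!!a. a : A ==> pfun UNIV (t a)" "!!a. a : A ==> t a (b a) ~= 0"
  "!!a u. a : A ==> t a u ~= 0 ==> nondeg (H a) (U a) u" by (rule choice[THEN exE]) blast
 define T1 where "T1 = (%a w. t a (loc w a)) ` A"
 define T2 where "T2 = (%a w. th a (loc w a)) ` A"
 define T3 where "T3 = (%(a,a') w. Ps a a' (loc w a) - Ps a a' (loc w a')) ` R"
 have nd: "nondeg HH I w0" unfolding nondeg_def
 proof (intro allI impI ballI)
  fix v::"'b \<times> nat => 'a" and i assume v: "ALL j. j ~: I --> v j = 0" "ALL e:I. dd (HH e) w0 v = 0" and i: "i : I"
  obtain a j where aj: "i = (a,j)" "a : A" "j : U a" using i by (auto simp: I_def)
  define v' where "v' = (%j. if j : U a then v (a,j) else 0)"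
  have "v' j = 0"
  proof (rule nondegD[OF b(3)[OF aj(2)] _ _ aj(3)])
   fix e assume e: "e : U a"
   have "(%j. b a j + s*v' j) = loc (%i. w0 i + s*v i) a" for s using v(1) z A(3)[OF aj(2)] b(1)[OF aj(2)] by (auto simp: loc_def w0_def v'_def z_def fun_eq_iff)
   hence "dd (H a e) (b a) v' = dd (HH (a,e)) w0 v" by (simp add: dd_def HH_def)
   thus "dd (H a e) (b a) v' = 0" using v(2) e aj(2) by (simp add: I_def)
  qed (simp add: v'_def)
  thus "v i = 0" using aj by (simp add: v'_def)
 qed
 have "EX w. poly h (w z) ~= 0 & (ALL e:I. HH e w = 0) & (ALL t:T1 Un T2 Un T3. t w ~= 0)"
 proof (rule persistence[OF finI z HH_pf nd _ _ _ _ _ h])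
  show "w0 z = 0" by (simp add: w0_def z_def)
  show "HH e w0 = 0" if "e : I" for e using that loc0 b(2) by (auto simp: HH_def I_def)
  have "finite R" using R(1) A(1) finite_subset by blast
  thus "finite (T1 Un T2 Un T3)" using A(1) by (simp add: T1_def T2_def T3_def)
  show "pfun ?Z f" if "f : T1 Un T2 Un T3" for f using that R(1) by (auto simp: T1_def T2_def T3_def intro!: loc_pf t th R(2) pfun_diff)
  fix f and c::"'b \<times> nat => 'a poly"
  assume f: "f : T1 Un T2 Un T3" and c: "c z = [:0,1:]" "!!i. coeff (c i) 0 = w0 i" "!!e. e : I ==> [:0,1:]^2 dvd along (HH e) c"
  have c0: "(%i. coeff (c i) 0) = w0" using c(2) by auto
  show "coeff (along f c) 0 ~= 0 | coeff (along f c) 1 ~= 0"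
  proof (cases "f : T1 Un T2")
   case True
   hence "f w0 ~= 0" "pfun ?Z f" by (auto simp: T1_def T2_def loc0 t th intro!: loc_pf)
   thus ?thesis by (simp add: coeff_along_0 c0)
  next
   case False
   then obtain a a' where a: "(a,a') : R" "f = (%w. Ps a a' (loc w a) - Ps a a' (loc w a'))" using f by (auto simp: T3_def)
   hence aA: "a : A" "a' : A" using R(1) by auto
   note pR = R(2)[OF a(1)]
   have "along f c = along (Ps a a') (cloc c a) - along (Ps a a') (cloc c a')"
    by (rule poly_ext) (use a(2) pR in "simp add: along_loc[symmetric] poly_along[OF loc_pf] aA poly_along[OF pfun_diff[OF loc_pf loc_pf]]")
   thus ?thesis using R(3)[OF a(1) cloc_curve[OF aA(1) c] cloc_curve[OF aA(2) c]] by auto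
  qed
 qed
 then obtain w where w: "poly h (w z) ~= 0" "!!e. e : I ==> HH e w = 0" "!!t. t : T1 Un T2 Un T3 ==> t w ~= 0" by blast
 have "t a (loc w a) ~= 0" "th a (loc w a) ~= 0" if "a : A" for a using w(3)[of "%w. t a (loc w a)"] w(3)[of "%w. th a (loc w a)"] that by (auto simp: T1_def T2_def)
 moreover have "Ps a a' (loc w a) ~= Ps a a' (loc w a')" if "(a,a') : R" for a a'
  using w(3)[of "%w. Ps a a' (loc w a) - Ps a a' (loc w a')"] that by (force simp: T3_def)
 moreover have "H a e (loc w a) = 0" if "a : A" "e : U a" for a e using w(2)[of "(a,e)"] that by (simp add: I_def HH_def)
 ultimately show ?thesis using w(1) t(3) by (intro exI[of _ "w z"] exI[of _ "loc w"]) (auto simp: loc_def)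
qed

section \<open>Critical points of a function on a complete intersection\<close>

text \<open>The coordinates \<open>u (2 * l)\<close>, \<open>1 \<le> l \<le> n\<close>, are those of the point, \<open>u (2 * i + 1)\<close> is the
 Lagrange multiplier of \<open>f i\<close>, where \<open>u 1 = 1\<close> belongs to the function \<open>f 0\<close> on the zero set of
 \<open>f 1, \<dots>, f s\<close>. The coordinate 0 is reserved for a parameter.\<close>

definition point_vars::"nat => nat set" where "point_vars n = {e. even e & 0 < e & e <= 2*n}"

definition crit_vars::"nat => nat => nat set" where "crit_vars n s = point_vars n Un {e. odd e & 1 < e & e <= 2*s + 1}"

text \<open>Unknowns and equations are paired: to a coordinate belongs the derivative of the
  Lagrangian, to a multiplier its constraint.\<close>

definition crit_eq::"(nat => 'a fn) => nat => nat => (nat => 'a) => 'a::field_char_0" where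
 "crit_eq f s e u = (if even e then SUM i<=s. u (2*i + 1)*dd (f i) u (unit_at e) else f (e div 2) u)"

text \<open>All coordinates outside the problem are normalized to 0, so that nodes can be
  counted.\<close>

definition node::"(nat => 'a fn) => nat => nat => (nat => 'a::field_char_0) => bool" where
 "node f n s u \<longleftrightarrow> u 1 = 1 & (ALL j. j ~: crit_vars n s --> j ~= 1 --> u j = 0) &
  (ALL e:crit_vars n s. crit_eq f s e u = 0) & nondeg (crit_eq f s) (crit_vars n s) u"

lemma finite_crit_vars: "finite (crit_vars n s)" by (rule finite_subset[of _ "{..2*n + 2*s + 1}"]) (auto simp: crit_vars_def point_vars_def)

section \<open>Critical points under the addition of one variable\<close>

definition new_var::"nat => nat" where "new_var n = 2*Suc n"

lemma crit_vars_not [simp]: "0 ~: crit_vars n s" "1 ~: crit_vars n s" "Suc 0 ~: crit_vars n s" "new_var n ~: crit_vars n s"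
  "new_var n ~: point_vars n" "even (new_var n)" "new_var n ~= 0" "new_var n ~= Suc (2*i)" "Suc (2*i) ~= new_var n" "0 ~= new_var n"
  "new_var n ~= Suc 0" "Suc 0 ~= new_var n" by (auto simp: crit_vars_def point_vars_def new_var_def) presburger+

lemma crit_vars_Suc: "crit_vars (Suc n) s = insert (new_var n) (crit_vars n s)" by (auto simp: crit_vars_def point_vars_def new_var_def le_Suc_eq)
lemma crit_vars_Suc_multiplier: "crit_vars n (Suc s) = insert (2*Suc s + 1) (crit_vars n s)" by (auto simp: crit_vars_def point_vars_def le_Suc_eq)

lemma dd_cong:
 assumes "pfun V f" "!!i. i : V ==> u i = u' i" "!!i. i : V ==> v i = v' i"
 shows "dd f u v = dd f u' v'"
proof -
 have "f (%i. u i + s*v i) = f (%i. u' i + s*v' i)" for s by (rule pfun_cong_on[OF assms(1)]) (simp add: assms)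
 thus ?thesis by (simp add: dd_def)
qed

lemma dd_zero: "pfun V f ==> dd f u (%_. 0) = 0" by (subst dd_eqI[where P = "[:f u:]"]) auto
lemma dd_outside: "pfun V f ==> (!!i. i : V ==> v i = 0) ==> dd f u v = 0" using dd_cong[of V f u u v "%_. 0"] dd_zero[of V f u] by simp

lemma crit_eq_cong: "(!!i. i <= s ==> f i = g i) ==> e : crit_vars n s ==> crit_eq f s e = crit_eq g s e"
 unfolding crit_eq_def by (intro ext) (auto simp: crit_vars_def point_vars_def intro!: sum.cong)

lemma crit_eq_pfun: "(!!i. i <= s ==> pfun V (f i)) ==> e : crit_vars n s ==> pfun (V Un {j. odd j & j <= 2*s + 1}) (crit_eq f s e)"
proof -
 assume f: "!!i. i <= s ==> pfun V (f i)" and e: "e : crit_vars n s"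
 have "pfun (V Un {j. odd j & j <= 2*s + 1}) (f i)" if "i <= s" for i using f[OF that] by (rule pfun_mono) auto
 thus ?thesis using e unfolding crit_eq_def[abs_def] by (intro pfun_if pfunI pfun_dd) (auto simp: crit_vars_def point_vars_def)
qed

lemma nondeg_cong: "(!!e v. e : U ==> (!!j. j ~: U ==> v j = 0) ==> dd (H e) u v = dd (H' e) u' v) ==> nondeg H U u \<longleftrightarrow> nondeg H' U u'"
 unfolding nondeg_def by (metis (no_types, lifting))

text \<open>Adding a new variable \<open>z\<close> through polynomials \<open>d i * ga i z\<close>; in the first version \<open>z\<close> is
 frozen.\<close>

locale new_variable =
 fixes f::"nat => (nat => 'a) => 'a::{alg_closed_field,field_char_0}" and ga::"nat => 'a poly" and n::nat
 assumes f: "!!i. pfun (point_vars n) (f i)"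
begin

abbreviation "ze == new_var n"
definition "frozen z d i u = f i u + d i*poly (ga i) z"
definition "extended d i u = f i u + d i*poly (ga i) (u ze)"

lemma zeta: "ze ~: point_vars n" by simp
lemma poly_coord: "i : V ==> pfun V (%u. poly p (u i))" unfolding poly_altdef by (intro pfunI)

lemma dd_extended: "dd (extended d i) u v = dd (f i) u v + d i*poly (pderiv (ga i)) (u ze)*v ze"
proof -
 have "pfun UNIV (f i)" using f[of i] by (rule pfun_mono) simp
 thus ?thesis unfolding extended_def[abs_def] by (subst dd_simps(3)[of UNIV], simp, intro pfunI poly_coord, simp, subst dd_simps(4)[of UNIV])
   (auto simp: dd_simps dd_poly poly_coord intro!: pfunI)
qed

lemma dd_frozen: "dd (frozen z d i) u v = dd (f i) u v"
 unfolding frozen_def[abs_def] using f[of i] by (subst dd_simps(3)[of "point_vars n"]) (auto simp: dd_simps intro: pfunI)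

lemma crit_eq_extended: "e : point_vars n ==> crit_eq (extended d) s e = crit_eq f s e"
 "crit_eq (extended d) s ze u = (SUM i<=s. u (2*i + 1)*(d i*poly (pderiv (ga i)) (u ze)))" "crit_eq (extended d) s (2*i + 1) = extended d i"
proof -
 show "crit_eq (extended d) s e = crit_eq f s e" if "e : point_vars n"
 proof -
  have "even e" "ze ~= e" using that by (auto simp: point_vars_def new_var_def)
  thus ?thesis by (simp add: crit_eq_def fun_eq_iff dd_extended)
 qed
 have "dd (f i) u (unit_at ze) = 0" for i using zeta by (intro dd_outside[OF f]) auto
 thus "crit_eq (extended d) s ze u = (SUM i<=s. u (2*i + 1)*(d i*poly (pderiv (ga i)) (u ze)))" by (simp add: crit_eq_def dd_extended)
qed (simp add: crit_eq_def fun_eq_iff)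

lemma dd_crit_eq_zeta:
 assumes "!!i. i < s ==> d i = 0"
 shows "dd (crit_eq (extended d) s ze) u v = v (2*s + 1)*(d s*poly (pderiv (ga s)) (u ze)) + u (2*s + 1)*(d s*(poly (pderiv (pderiv (ga s))) (u ze)*v ze))"
proof -
 have "(SUM i<=s. u (2*i + 1)*(d i*poly (pderiv (ga i)) (u ze))) = (SUM i<=s. if i = s then u (2*s + 1)*(d s*poly (pderiv (ga s)) (u ze)) else 0)" for u
  using assms by (intro sum.cong) auto
 hence "crit_eq (extended d) s ze = (%u. u (2*s + 1)*(d s*poly (pderiv (ga s)) (u ze)))" using crit_eq_extended(2)[of d s] by (auto simp: fun_eq_iff)
 thus ?thesis by (simp only:) (subst dd_simps(4)[of UNIV], simp_all add: dd_simps pfunI poly_coord dd_simps(4)[of UNIV] dd_poly)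
qed

lemma crit_vars_cases:
 assumes "e : crit_vars n s"
 obtains "e : point_vars n" | i where "e = 2*i + 1" "1 <= i" "i <= s"
proof (cases "even e")
 case False
 then obtain i where "e = 2*i + 1" by (elim oddE)
 thus ?thesis using assms that(2)[of i] by (auto simp: crit_vars_def point_vars_def)
qed (use assms that(1) in "auto simp: crit_vars_def")

lemma f_upd: "f i (u(ze := z)) = f i u" by (rule pfun_cong_on[OF f]) (use zeta in auto)
lemma dd_upd: "dd (f i) (u(ze := z)) v = dd (f i) u v" by (rule dd_cong[OF f]) (use zeta in auto)
lemma crit_eq_f_upd: "e : crit_vars n s ==> crit_eq f s e (u(ze := z)) = crit_eq f s e u" by (auto simp: crit_eq_def dd_upd f_upd)

lemma dd_crit_eq_f_upd: "e : crit_vars n s ==> dd (crit_eq f s e) (u(ze := z)) v = dd (crit_eq f s e) u (v(ze := 0))"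
 by (rule dd_cong[OF crit_eq_pfun[OF f]], assumption) (use zeta in auto)

text \<open>Among the \<open>d i\<close> with \<open>i <= s\<close> only \<open>d s\<close> is
  nonzero, so the equation for the new coordinate says that it is critical for \<open>ga s\<close>.
  It splits off; nonzero multiplier and nonzero second derivative make it nondegenerate.\<close>

lemma node_critical:
 assumes u: "node (frozen z d) n s u" and d: "!!i. i < s ==> d i = 0" "d s ~= 0"
  and z: "poly (pderiv (ga s)) z = 0" "poly (pderiv (pderiv (ga s))) z ~= 0" and l: "u (2*s + 1) ~= 0"
 shows "node (extended d) (Suc n) s (u(ze := z))" unfolding node_def
proof (intro conjI allI impI ballI)
 let ?u = "u(ze := z)"
 show "?u 1 = 1" using u by (simp add: node_def)
 show "?u j = 0" if "j ~: crit_vars (Suc n) s" "j ~= 1" for j using that u by (auto simp: node_def crit_vars_Suc)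
 have eq: "crit_eq f s e ?u = 0" if "e : point_vars n" for e
 proof -
  have "crit_eq f s e u = crit_eq (frozen z d) s e u" using that by (auto simp: crit_eq_def dd_frozen point_vars_def)
  also have "... = 0" using u that by (auto simp: node_def crit_vars_def)
  finally show ?thesis using that crit_eq_f_upd[of e s u z] by (simp add: crit_vars_def)
 qed
 show "crit_eq (extended d) s e ?u = 0" if "e : crit_vars (Suc n) s" for e
 proof (cases "e = ze")
  case True
  have "(SUM i<=s. ?u (2*i + 1)*(d i*poly (pderiv (ga i)) (?u ze))) = 0" using d z by (intro sum.neutral) (auto simp: le_less)
  thus ?thesis unfolding True crit_eq_extended(2) .
 next
  case False
  hence "e : crit_vars n s" using that by (auto simp: crit_vars_Suc)
  thus ?thesis
  proof (cases rule: crit_vars_cases)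
   case 1
   thus ?thesis using eq by (simp add: crit_eq_extended)
  next
   case (2 i)
   have "crit_eq (frozen z d) s e u = 0" using u `e : crit_vars n s` by (simp add: node_def)
   thus ?thesis unfolding 2 crit_eq_extended(3) by (simp add: crit_eq_def extended_def frozen_def f_upd)
  qed
 qed
 show "nondeg (crit_eq (extended d) s) (crit_vars (Suc n) s) ?u" unfolding nondeg_def
 proof (intro allI impI ballI)
  fix v::"nat => 'a" and j
  assume v: "ALL j. j ~: crit_vars (Suc n) s --> v j = 0" "ALL e:crit_vars (Suc n) s. dd (crit_eq (extended d) s e) ?u v = 0"
   and j: "j : crit_vars (Suc n) s"
  have "dd (crit_eq (extended d) s ze) ?u v = 0" using v(2) by (simp add: crit_vars_Suc)
  hence v0: "v ze = 0" using d l z by (simp add: dd_crit_eq_zeta )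
  have "v j = 0" if "j : crit_vars n s" for j
  proof (rule nondegD[of "crit_eq (frozen z d) s" "crit_vars n s" u, OF _ _ _ that])
   show "nondeg (crit_eq (frozen z d) s) (crit_vars n s) u" using u by (simp add: node_def)
   show "v j = 0" if "j ~: crit_vars n s" for j using that v(1) v0 by (cases "j = ze") (auto simp: crit_vars_Suc)
   fix e assume e: "e : crit_vars n s"
   have ve: "dd (crit_eq (extended d) s e) ?u v = 0" using v(2) e by (simp add: crit_vars_Suc)
   have vv: "v(ze := 0) = v" using v0 by auto
   show "dd (crit_eq (frozen z d) s e) u v = 0" using e
   proof (cases rule: crit_vars_cases)
    case 1
    hence "crit_eq (frozen z d) s e = crit_eq f s e" by (auto simp: crit_eq_def dd_frozen point_vars_def fun_eq_iff)
    thus ?thesis using ve dd_crit_eq_f_upd[OF e, of u z v] vv 1 by (simp add: crit_eq_extended)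
   next
    case (2 i)
    have "crit_eq (frozen z d) s e = frozen z d i" by (simp add: 2 crit_eq_def fun_eq_iff)
    thus ?thesis using ve v0 unfolding 2 crit_eq_extended(3) by (simp add: dd_frozen dd_extended dd_upd)
   qed
  qed
  thus "v j = 0" using j v0 by (auto simp: crit_vars_Suc)
 qed
qed

text \<open>A critical point of the problem without the last constraint is lifted: that constraint
  determines the new coordinate as a simple root, and its multiplier is 0.\<close>

lemma node_root:
 assumes u: "node f n s u" and d: "!!i. i <= s ==> d i = 0" "d (Suc s) ~= 0"
  and z: "f (Suc s) u + d (Suc s)*poly (ga (Suc s)) z = 0" "poly (pderiv (ga (Suc s))) z ~= 0"
 shows "node (extended d) (Suc n) (Suc s) (u(ze := z))" unfolding node_def
proof (intro conjI allI impI ballI)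
 let ?u = "u(ze := z)" and ?m = "2*Suc s + 1"
 have m: "?m ~: crit_vars n s" "?m ~= ze" "?m ~= 1" by (auto simp: crit_vars_def point_vars_def new_var_def) presburger+
 have um: "u ?m = 0" using u m by (simp add: node_def)
 have ext: "extended d i = f i" if "i <= s" for i using d(1)[OF that] by (simp add: extended_def[abs_def])
 have split: "crit_eq f (Suc s) e = (%u. crit_eq f s e u + u ?m*dd (f (Suc s)) u (unit_at e))" if "e : point_vars n" for e
  using that by (auto simp: crit_eq_def point_vars_def)
 have vars: "e = ze | e = ?m | e : crit_vars n s" if "e : crit_vars (Suc n) (Suc s)" for e using that unfolding crit_vars_Suc crit_vars_Suc_multiplier by blast
 have vars': "ze : crit_vars (Suc n) (Suc s)" "?m : crit_vars (Suc n) (Suc s)" "e : crit_vars n s ==> e : crit_vars (Suc n) (Suc s)" for e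
  unfolding crit_vars_Suc crit_vars_Suc_multiplier by auto
 show "?u 1 = 1" using u by (simp add: node_def)
 show "?u j = 0" if "j ~: crit_vars (Suc n) (Suc s)" "j ~= 1" for j using that vars' u by (auto simp: node_def)
 show "crit_eq (extended d) (Suc s) e ?u = 0" if e: "e : crit_vars (Suc n) (Suc s)" for e using vars[OF e]
 proof (elim disjE)
  assume "e = ze"
  have "(SUM i<=Suc s. ?u (2*i + 1)*(d i*poly (pderiv (ga i)) (?u ze))) = 0" using d um m by (intro sum.neutral) (auto simp: le_Suc_eq)
  thus ?thesis unfolding `e = ze` crit_eq_extended(2) .
 next
  assume "e = ?m"
  thus ?thesis unfolding `e = ?m` crit_eq_extended(3) using z(1) by (simp add: extended_def f_upd)
 next
  assume e: "e : crit_vars n s"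
  hence "crit_eq f s e ?u = 0" using u crit_eq_f_upd[OF e] by (simp add: node_def)
  with e show ?thesis
  proof (cases rule: crit_vars_cases)
   case 1
   thus ?thesis using `crit_eq f s e ?u = 0` um m by (simp add: crit_eq_extended split)
  next
   case (2 i)
   thus ?thesis using `crit_eq f s e ?u = 0` ext[of i] unfolding 2(1) crit_eq_extended(3) by (simp add: crit_eq_def)
  qed
 qed
 show "nondeg (crit_eq (extended d) (Suc s)) (crit_vars (Suc n) (Suc s)) ?u" unfolding nondeg_def
 proof (intro allI impI ballI)
  fix v::"nat => 'a" and j
  assume v: "ALL j. j ~: crit_vars (Suc n) (Suc s) --> v j = 0" "ALL e:crit_vars (Suc n) (Suc s). dd (crit_eq (extended d) (Suc s) e) ?u v = 0"
   and j: "j : crit_vars (Suc n) (Suc s)"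
  have "dd (crit_eq (extended d) (Suc s) ze) ?u v = 0" using v(2) vars' by blast
  moreover have "dd (crit_eq (extended d) (Suc s) ze) ?u v = v ?m*(d (Suc s)*poly (pderiv (ga (Suc s))) z)" using um m d(1) by (subst dd_crit_eq_zeta) auto
  ultimately have vm: "v ?m = 0" using d(2) z(2) by simp
  define v' where "v' = v(ze := 0)"
  have v'0: "v' j = 0" if "j : crit_vars n s" for j
  proof (rule nondegD[of "crit_eq f s" "crit_vars n s" u, OF _ _ _ that])
   show "nondeg (crit_eq f s) (crit_vars n s) u" using u by (simp add: node_def)
   show "v' j = 0" if "j ~: crit_vars n s" for j using that v(1) vm vars[of j] by (auto simp: v'_def)
   fix e assume e: "e : crit_vars n s"
   have ve: "dd (crit_eq (extended d) (Suc s) e) ?u v = 0" using v(2) e vars' by blast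
   have c: "dd (crit_eq f s e) ?u v = dd (crit_eq f s e) u v'" unfolding v'_def by (rule dd_crit_eq_f_upd[OF e])
   show "dd (crit_eq f s e) u v' = 0" using e
   proof (cases rule: crit_vars_cases)
    case 1
    have pf: "pfun UNIV (crit_eq f s e)" "pfun UNIV (%u. dd (f (Suc s)) u (unit_at e))"
     using pfun_mono[OF crit_eq_pfun[OF f e]] pfun_mono[OF pfun_dd[OF f]] by auto
    have "dd (crit_eq (extended d) (Suc s) e) ?u v = dd (crit_eq f s e) ?u v +
      (v ?m*dd (f (Suc s)) ?u (unit_at e) + ?u ?m*dd (%u. dd (f (Suc s)) u (unit_at e)) ?u v)" unfolding crit_eq_extended(1)[OF 1] split[OF 1]
     by (subst dd_simps(3)[of UNIV], rule pf, intro pfunI pf, simp, subst dd_simps(4)[of UNIV]) (auto simp: dd_simps pf intro!: pfunI)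
    thus ?thesis using ve vm um m c by simp
   next
    case (2 i)
    hence "crit_eq (extended d) (Suc s) e = crit_eq f s e" using ext[of i] by (auto simp: crit_eq_def fun_eq_iff)
    thus ?thesis using ve c by simp
   qed
  qed
  have vf: "v' j = 0" if "j : point_vars n" for j using v'0 that by (simp add: crit_vars_def)
  have "dd (crit_eq (extended d) (Suc s) ?m) ?u v = 0" using v(2) vars' by blast
  hence "dd (f (Suc s)) ?u v + d (Suc s)*poly (pderiv (ga (Suc s))) z*v ze = 0" unfolding crit_eq_extended(3) by (simp add: dd_extended)
  moreover have "dd (f (Suc s)) ?u v = 0"
  proof (rule dd_outside[OF f])
   show "v j = 0" if "j : point_vars n" for j using vf[OF that] that zeta by (cases "j = ze") (auto simp: v'_def)
  qed
  ultimately have "v ze = 0" using d(2) z(2) by simp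
  thus "v j = 0" using vars[OF j] vm v'0[of j] by (cases "j = ze") (auto simp: v'_def)
 qed
qed

end

section \<open>Counting nodes with one more variable\<close>

lemma card_simple_roots:
 fixes q::"'a::{alg_closed_field,field_char_0} poly"
 assumes "q ~= 0" "!!z. poly q z = 0 ==> poly (pderiv q) z ~= 0"
 shows "card {z. poly q z = 0} = degree q" using assms
proof (induction "degree q" arbitrary: q)
 case 0
 obtain c where "q = [:c:]" using 0(1)[symmetric] by (rule degree_eq_zeroE)
 thus ?case using 0 by simp
next
 case (Suc m)
 then obtain z where z: "poly q z = 0" using alg_closed_imp_poly_has_root[of q] by auto
 then obtain q' where q': "q = [:- z,1:]*q'" by (auto simp: poly_eq_0_iff_dvd)
 have nz: "q' ~= 0" using Suc.prems(1) q' by auto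
 hence deg: "degree q = Suc (degree q')" unfolding q' by (subst degree_mult_eq) auto
 have pd: "poly (pderiv q) w = poly q' w + (w-z)*poly (pderiv q') w" for w unfolding q' pderiv_mult by (simp add: pderiv_pCons algebra_simps)
 have qz: "poly q' z ~= 0" using Suc.prems(2)[OF z] pd[of z] by simp
 have "card {z. poly q' z = 0} = degree q'"
 proof (rule Suc.hyps(1))
  fix w assume w: "poly q' w = 0"
  hence "poly q w = 0" by (simp add: q')
  thus "poly (pderiv q') w ~= 0" using Suc.prems(2)[of w] pd[of w] w by auto
 qed (use Suc.hyps(2) deg nz in auto)
 moreover have "{z. poly q z = 0} = insert z {z. poly q' z = 0}" by (auto simp: q')
 ultimately show ?case using qz poly_roots_finite[OF nz] deg by simp
qed

text \<open>The univariate polynomials added with a new variable. The conditions on values ensure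
  that, for almost all \<open>ep\<close>, the roots of a constant plus \<open>ep\<close> times
  \<open>ga (Suc i)\<close> avoid the critical points of \<open>ga i\<close> and of
  \<open>ga (Suc i)\<close>.\<close>

locale bricks =
 fixes ga::"nat => 'a::{alg_closed_field,field_char_0} poly" and p::"nat => nat"
 assumes degree: "degree (ga i) = p i" and p_pos: "0 < p i"
  and card_crit: "card {z. poly (pderiv (ga i)) z = 0} = p i-1"
  and simple_crit: "poly (pderiv (ga i)) z = 0 ==> poly (pderiv (pderiv (ga i))) z ~= 0"
  and crit_value: "poly (pderiv (ga i)) z = 0 ==> poly (ga i) z ~= 0"
  and crit_value_next: "poly (pderiv (ga i)) z = 0 ==> poly (ga (Suc i)) z ~= 0"
begin

lemma finite_crit: "finite {z. poly (pderiv (ga i)) z = 0}" using poly_roots_finite[of "pderiv (ga i)"] degree[of i] p_pos[of i] by (simp add: pderiv_eq_0_iff)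

end

text \<open>The polynomial z^p + z has only simple critical points, and for p = 1 it is 2 z with
  none. A constant outside a finite set is added to satisfy the conditions on values.\<close>

lemma bricks_exist:
 assumes p: "!!i. 0 < p i"
 shows "EX ga::nat => 'a::{alg_closed_field,field_char_0} poly. bricks ga p"
proof -
 define g where "g = (%i. monom 1 (p i) + [:0,1:]::'a poly)"
 have pd: "poly (pderiv (g i)) z = of_nat (p i)*z^(p i-1) + 1" for i z by (simp add: g_def pderiv_add pderiv_monom poly_monom pderiv_pCons)
 have pd2: "poly (pderiv (pderiv (g i))) z = of_nat (p i)*of_nat (p i-1)*z^(p i-1-1)" for i z
  by (simp add: g_def pderiv_add pderiv_monom poly_monom pderiv_pCons)
 have coeff_p: "coeff (g i) (p i) ~= 0" for i
 proof (cases "p i = 1")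
  case False
  then obtain m where "p i = Suc (Suc m)" using p[of i] by (metis One_nat_def gr0_implies_Suc nat.exhaust)
  thus ?thesis by (simp add: g_def)
 qed (simp add: g_def)
 have deg: "degree (g i) = p i" for i
 proof (rule antisym)
  show "degree (g i) <= p i" unfolding g_def using p[of i] by (intro degree_add_le degree_monom_le) (simp add: Suc_leI)
  show "p i <= degree (g i)" using coeff_p by (rule le_degree)
 qed
 have nz: "pderiv (g i) ~= 0" for i using deg[of i] p[of i] by (simp add: pderiv_eq_0_iff)
 have simple: "poly (pderiv (pderiv (g i))) z ~= 0" if "poly (pderiv (g i)) z = 0" for i z
 proof
  assume "poly (pderiv (pderiv (g i))) z = 0"
  hence "p i-1 = 0 | z^(p i-1-1) = 0" using p[of i] unfolding pd2 by auto
  thus False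
  proof
   assume "p i-1 = 0"
   hence "p i = 1" using p[of i] by simp
   thus False using that unfolding pd by simp
  next
   assume z: "z^(p i-1-1) = 0"
   hence "z = 0" "p i-1 ~= 0" by (auto simp: power_0_left split: if_splits)
   thus False using that unfolding pd by (simp add: power_0_left)
  qed
 qed
 let ?C = "%i. {z. poly (pderiv (g i)) z = 0}"
 have finC: "finite (?C i)" for i by (rule poly_roots_finite[OF nz])
 have "ALL i. EX t. t ~: (%z. - poly (g i) z) ` (?C i Un ?C (i-1))" using finC infinite_UNIV_char_0 by (metis ex_new_if_finite finite_UnI finite_imageI)
 then obtain t where t: "!!i. t i ~: (%z. - poly (g i) z) ` (?C i Un ?C (i-1))" by metis
 define ga where "ga = (%i. g i + [:t i:])"
 have pdga: "pderiv (ga i) = pderiv (g i)" for i by (simp add: ga_def pderiv_add)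
 have val: "poly (ga i) z ~= 0" if "z : ?C i Un ?C (i-1)" for i z
 proof
  assume "poly (ga i) z = 0"
  hence "t i = - poly (g i) z" by (simp add: ga_def eq_neg_iff_add_eq_0 add.commute)
  with t[of i] that show False by blast
 qed
 have "bricks ga p"
 proof
  show "degree (ga i) = p i" for i unfolding ga_def using p[of i] deg[of i] by (subst degree_add_eq_left) auto
  show "card {z. poly (pderiv (ga i)) z = 0} = p i-1" for i unfolding pdga using card_simple_roots[OF nz simple] deg by (simp add: degree_pderiv)
  show "poly (pderiv (ga i)) z = 0 ==> poly (ga (Suc i)) z ~= 0" for i z using val[of z "Suc i"] by (simp add: pdga)
 qed (use p simple val in "auto simp: pdga")
 thus ?thesis by blast
qed

text \<open>The last multiplier is required to be nonzero because \<open>node_critical\<close> needs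
  it when the next variable is added.\<close>

definition has_nodes::"(nat => (nat => 'a) => 'a::field_char_0) => nat => nat => nat => bool" where
 "has_nodes f n s M \<longleftrightarrow> (EX B. finite B & card B = M & (ALL u:B. node f n s u & u (2*s + 1) ~= 0))"

text \<open>In a direction that does not move the parameter \<open>w 0\<close>, the system may be
  differentiated with its parameter frozen. The coordinate 0 can then be reset to 0, as nodes
  require.\<close>

lemma freeze_parameter:
 fixes g::"'a::field_char_0 => nat => 'a fn"
 assumes g: "!!ep i. pfun V (g ep i)" "0 ~: V" and e: "e : crit_vars m s" and v: "v 0 = 0"
 shows "dd (%w. crit_eq (g (w 0)) s e w) w v = dd (crit_eq (g (w 0)) s e) (w(0 := 0)) v"
proof -
 have "dd (%w. crit_eq (g (w 0)) s e w) w v = dd (crit_eq (g (w 0)) s e) w v" using v by (simp add: dd_def)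
 also have "... = dd (crit_eq (g (w 0)) s e) (w(0 := 0)) v" by (rule dd_cong[OF crit_eq_pfun[OF g(1) e]]) (use g(2) in auto)
 finally show ?thesis .
qed

locale new_brick = new_variable f ga n + bricks ga p
 for f::"nat => (nat => 'a) => 'a::{alg_closed_field,field_char_0}" and ga n p
begin

text \<open>The coefficients \<open>d i\<close> are switched on in descending order of i. Nodes from
  \<open>node_root\<close> at level s still have last multiplier 0; the alternative records what
  will make it nonzero once \<open>d (s-1)\<close> is switched on.\<close>

definition stage::"(nat => nat) => nat => nat => (nat => 'a) => bool" where
 "stage M' S s d \<longleftrightarrow> (ALL i<s. d i = 0) & (ALL s'. s <= s' --> s' <= S --> (EX A. finite A & card A = M' s' &
  (ALL u:A. node (extended d) (Suc n) s' u & (u (2*s' + 1) ~= 0 | s' = s & 0 < s & u (2*(s-1) + 1) ~= 0 & poly (pderiv (ga (s-1))) (u ze) ~= 0))))"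

lemma stage_step:
 assumes B: "!!s. s <= S ==> finite (B s) & card (B s) = M s & (ALL u:B s. node f n s u & u (2*s + 1) ~= 0)"
  and M': "!!s. M' s = (p s-1)*M s + (if s = 0 then 0 else p s*M (s-1))"
  and s: "s <= S" and d: "stage M' S (Suc s) d"
 shows "EX ep. stage M' S s (d(s := ep))"
proof -
 have d0: "d i = 0" if "i <= s" for i using d that by (simp add: stage_def)
 have "ALL s'. EX A. Suc s <= s' --> s' <= S --> finite A & card A = M' s' & (ALL u:A. node (extended d) (Suc n) s' u & (u (2*s' + 1) ~= 0 |
   s' = Suc s & u (2*s + 1) ~= 0 & poly (pderiv (ga s)) (u ze) ~= 0))" using d unfolding stage_def by fastforce
 from choice[OF this] obtain A where A: "!!s'. Suc s <= s' ==> s' <= S ==> finite (A s') & card (A s') = M' s' &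
  (ALL u:A s'. node (extended d) (Suc n) s' u & (u (2*s' + 1) ~= 0 | s' = Suc s & u (2*s + 1) ~= 0 & poly (pderiv (ga s)) (u ze) ~= 0))" by blast
 define Z where "Z = {z. poly (pderiv (ga s)) z = 0}"
 \<comment> \<open>Labels of the zeros to be followed: the nodes already found at levels above
   \<open>s\<close>, with a dummy 0, and for each critical point \<open>z\<close> of
   \<open>ga s\<close> the nodes of the problem frozen at \<open>z\<close>.\<close>
 define L where "L = (\<Union>s'\<in>{Suc s..S}. (%u. (s',0::'a,u)) ` A s') Un (%(z,u). (s,z,u)) ` (Z \<times> B s)"
 have finL: "finite L" using A B[OF s] finite_crit by (auto simp: L_def Z_def)
 have L_cases: "(EX s' u. a = (s',0,u) & s < s' & s' <= S & u : A s') | (EX z u. a = (s,z,u) & z : Z & u : B s)" if "a : L" for a using that by (auto simp: L_def)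
 define vars where "vars = (%(s',z::'a,u::nat => 'a). crit_vars (if s' = s then n else Suc n) s')"
 define F where "F = (%(s',z,u::nat => 'a) ep. if s' = s then frozen z (d(s := ep)) else extended (d(s := ep)))"
 define H where "H = (%a e w. crit_eq (F a (w 0)) (fst a) e w)"
 define base where "base = (%(s'::nat,z::'a,u::nat => 'a). u)"
 \<comment> \<open>Inequations to be preserved: the last multiplier where it is already nonzero,
   otherwise the product that will force it to be nonzero.\<close>
 define th where "th = (%(s',z::'a,u::nat => 'a) w. if s' = s | u (2*s' + 1) ~= 0 then w (2*s' + 1) else w (2*s + 1)*poly (pderiv (ga s)) (w ze))"
 define R where "R = {(a,a'). a : L & a' : L & base a ~= base a'}"
 define coord where "coord = (%a a'. SOME j. base a j ~= base a' j)"
 have coord: "base a (coord a a') ~= base a' (coord a a')" if "(a,a') : R" for a a'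
 proof -
  have "EX j. base a j ~= base a' j" using that by (auto simp: R_def fun_eq_iff)
  thus ?thesis unfolding coord_def by (rule someI_ex)
 qed
 define crits where "crits = Z Un {z. poly (pderiv (ga (s-1))) z = 0}"
 \<comment> \<open>Excludes \<open>ep = 0\<close> and the finitely many values for which a root of
   \<open>f s u + ep*ga s\<close> is a critical point of \<open>ga s\<close> or of
   \<open>ga (s-1)\<close>.\<close>
 define h where "h = [:0,1:]*(if s = 0 then 1 else PROD (u,z):B (s-1) \<times> crits. [:f s u,poly (ga s) z:])"
 have fin_crits: "finite crits" using finite_crit by (auto simp: crits_def Z_def)
 have crits_val: "poly (ga s) z ~= 0" if "z : crits" "s ~= 0" for z using that crit_value[of s z] crit_value_next[of "s-1" z] by (auto simp: crits_def Z_def)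
 have h: "h ~= 0" unfolding h_def using fin_crits B[of "s-1"] s crits_val by (auto simp: prod_zero_iff)
 have Fpf: "pfun (insert ze (point_vars n)) (F a ep i)" for a ep i
 proof -
  have "pfun (insert ze (point_vars n)) (f i)" using f[of i] by (rule pfun_mono) auto
  thus ?thesis by (cases a) (auto simp: F_def frozen_def[abs_def] extended_def[abs_def] intro!: pfunI poly_coord)
 qed
 have Hdd: "dd (H a e) w v = dd (crit_eq (F a (w 0)) (fst a) e) (w(0 := 0)) v" if "e : vars a" "v 0 = 0" for a e w v
  using freeze_parameter[of "insert ze (point_vars n)" "F a" e _ "fst a" v w, OF Fpf _ _ that(2)] that(1) by (cases a) (simp add: H_def vars_def point_vars_def)
 have v0: "v 0 = 0" if "!!j. j ~: vars a ==> v j = 0" for v::"nat => 'a" and a using that[of 0] by (cases a) (auto simp: vars_def)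
 have Hnd: "nondeg (H a) (vars a) w \<longleftrightarrow> nondeg (crit_eq (F a (w 0)) (fst a)) (vars a) (w(0 := 0))" for a w
  by (rule nondeg_cong) (rule Hdd, assumption, rule v0)
 have F0: "crit_eq (F a 0) (fst a) e = crit_eq (if fst a = s then f else extended d) (fst a) e" if "a : L" "e : vars a" for a e
 proof -
  have "d(s := 0) = d" using d0 by auto
  moreover have "frozen z d i = f i" if "i <= s" for i z using d0[OF that] by (simp add: frozen_def[abs_def])
  ultimately show ?thesis using that by (cases a) (auto simp: F_def vars_def intro!: crit_eq_cong split: if_splits)
 qed
 have base_node: "node (if fst a = s then f else extended d) (if fst a = s then n else Suc n) (fst a) (base a)" if "a : L" for a
  using L_cases[OF that] A B[OF s] by (auto simp: base_def)
 have base0: "base a 0 = 0" "(base a)(0 := 0) = base a" if "a : L" for a using base_node[OF that] by (auto simp: node_def fun_eq_iff split: if_splits)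
 have vars_eq: "vars a = crit_vars (if fst a = s then n else Suc n) (fst a)" for a by (cases a) (simp add: vars_def)
 have "EX ep w. poly h ep ~= 0 & (ALL a:L. w a 0 = ep & (ALL j. j ~: insert 0 (vars a) --> w a j = base a j) & (ALL e:vars a. H a e (w a) = 0) &
  nondeg (H a) (vars a) (w a) & th a (w a) ~= 0) & (ALL (a,a'):R. w a (coord a a') ~= w a' (coord a a'))"
 proof (rule persistence_family[where Ps = "%a a' w. w (coord a a')" and A = L and H = H and U = vars and b = base and th = th and R = R and h = h])
  show "finite L" by (rule finL)
  show "base a 0 = 0" if "a : L" for a by (rule base0(1)[OF that])
  show "h ~= 0" by (rule h)
  show "finite (vars a)" "0 ~: vars a" for a by (simp_all add: vars_eq finite_crit_vars)
  show "pfun UNIV (H a e)" if "a : L" "e : vars a" for a e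
  proof -
   obtain s' z u where a: "a = (s',z,u)" by (metis prod_cases3)
   have fU: "pfun UNIV (f i)" for i using f[of i] by (rule pfun_mono) simp
   have upd: "pfun UNIV (%w. (d(s := w 0)) i)" for i by (cases "i = s") (auto intro: pfunI)
   show ?thesis unfolding H_def a F_def crit_eq_def fst_conv prod.case
    by (cases "s' = s"; simp only: if_True if_False simp_thms dd_frozen dd_extended; unfold frozen_def extended_def)
     (intro pfun_if pfunI pfun_dd fU upd poly_coord UNIV_I)+
  qed
  show "H a e (base a) = 0" if "a : L" "e : vars a" for a e
  proof -
   have "crit_eq (if fst a = s then f else extended d) (fst a) e (base a) = 0" using base_node[OF that(1)] that(2) unfolding node_def vars_eq by blast
   thus ?thesis unfolding H_def base0(1)[OF that(1)] F0[OF that] .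
  qed
  show "nondeg (H a) (vars a) (base a)" if "a : L" for a
  proof -
   have "nondeg (crit_eq (F a 0) (fst a)) (vars a) (base a) \<longleftrightarrow> nondeg (crit_eq (if fst a = s then f else extended d) (fst a)) (vars a) (base a)"
    by (rule nondeg_cong) (simp only: F0[OF that])
   thus ?thesis using base_node[OF that] unfolding Hnd base0[OF that] by (simp add: node_def vars_eq)
  qed
  show "pfun UNIV (th a)" for a by (cases a) (auto simp: th_def intro!: pfun_if pfunI poly_coord)
  show "th a (base a) ~= 0" if "a : L" for a using L_cases[OF that]
  proof (elim disjE exE conjE)
   fix s' u assume a: "a = (s',0,u)" "s < s'" "s' <= S" "u : A s'"
   hence "u (2*s' + 1) ~= 0 | u (2*s + 1) ~= 0 & poly (pderiv (ga s)) (u ze) ~= 0" using A[of s'] by auto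
   thus ?thesis using a(2) by (auto simp: a(1) th_def base_def)
  next
   fix z u assume "a = (s,z,u)" "u : B s"
   thus ?thesis using B[OF s] by (simp add: th_def base_def)
  qed
  show "R <= L \<times> L" by (auto simp: R_def)
  show "pfun UNIV (%w. w (coord a a'))" for a a' by (intro pfunI) simp
  fix a a' c c' assume "(a,a') : R" and c: "curve_at (H a) (vars a) (base a) c" "curve_at (H a') (vars a') (base a') c'"
  hence "coeff (c (coord a a')) 0 ~= coeff (c' (coord a a')) 0" using coord[of a a'] by (simp add: curve_at_def)
  thus "coeff (along (%w. w (coord a a')) c) 0 ~= coeff (along (%w. w (coord a a')) c') 0 |
    coeff (along (%w. w (coord a a')) c) 1 ~= coeff (along (%w. w (coord a a')) c') 1" by (simp add: along_simps)
 qed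
 then obtain ep w where ep: "poly h ep ~= 0"
  and w: "!!a. a : L ==> w a 0 = ep" "!!a j. a : L ==> j ~: insert 0 (vars a) ==> w a j = base a j"
   "!!a e. a : L ==> e : vars a ==> H a e (w a) = 0" "!!a. a : L ==> nondeg (H a) (vars a) (w a)"
   "!!a. a : L ==> th a (w a) ~= 0" "!!a a'. (a,a') : R ==> w a (coord a a') ~= w a' (coord a a')" by blast
 have e0: "ep ~= 0" using ep by (auto simp: h_def)
 have eB: "f s u + ep*poly (ga s) z ~= 0" if "s ~= 0" "u : B (s-1)" "z : crits" for u z
 proof -
  have "(PROD (u,z):B (s-1) \<times> crits. f s u + ep*poly (ga s) z) ~= 0" using ep that(1) by (simp add: h_def poly_prod case_prod_unfold)
  thus ?thesis using that B[of "s-1"] s fin_crits by (force simp: prod_zero_iff)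
 qed
 let ?d = "d(s := ep)"
 define N where "N = (%a. (w a)(0 := 0))"
 have N_node: "node (F a ep) (if fst a = s then n else Suc n) (fst a) (N a)" if a: "a : L" for a unfolding node_def
 proof (intro conjI allI impI ballI)
  have b: "node (if fst a = s then f else extended d) (if fst a = s then n else Suc n) (fst a) (base a)" by (rule base_node[OF a])
  thus "N a 1 = 1" using w(2)[OF a, of 1] by (simp add: N_def node_def vars_eq)
  show "N a j = 0" if "j ~: crit_vars (if fst a = s then n else Suc n) (fst a)" "j ~= 1" for j using b w(2)[OF a, of j] that by (auto simp: N_def node_def vars_eq)
  show "crit_eq (F a ep) (fst a) e (N a) = 0" if e: "e : crit_vars (if fst a = s then n else Suc n) (fst a)" for e
  proof -
   have "crit_eq (F a ep) (fst a) e (N a) = crit_eq (F a ep) (fst a) e (w a)" by (rule pfun_cong_on[OF crit_eq_pfun[OF Fpf e]]) (auto simp: N_def point_vars_def)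
   thus ?thesis using w(3)[OF a, of e] e w(1)[OF a] by (simp add: H_def vars_eq)
  qed
  show "nondeg (crit_eq (F a ep) (fst a)) (crit_vars (if fst a = s then n else Suc n) (fst a)) (N a)"
   using w(4)[OF a] unfolding Hnd w(1)[OF a] by (simp add: N_def vars_eq)
 qed
 have N_inj: "N a ~= N a'" if "a : L" "a' : L" "base a ~= base a'" for a a'
 proof -
  have R: "(a,a') : R" using that by (simp add: R_def)
  hence "coord a a' ~= 0" using coord[OF R] base0(1)[OF that(1)] base0(1)[OF that(2)] by metis
  thus ?thesis using w(6)[OF R] by (auto simp: N_def fun_eq_iff)
 qed
 have old: "EX A'. finite A' & card A' = M' s' & (ALL u:A'. node (extended ?d) (Suc n) s' u & u (2*s' + 1) ~= 0)"
  if s': "s < s'" "s' <= S" for s'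
 proof (intro exI[of _ "(%u. N (s',0,u)) ` A s'"] conjI ballI)
  have As: "finite (A s')" "card (A s') = M' s'" using A[of s'] s' by auto
  have La: "(s',0,u) : L" if "u : A s'" for u using that s' by (auto simp: L_def)
  have "inj_on (%u. N (s',0,u)) (A s')" by (rule inj_onI) (metis La N_inj base_def prod.case)
  thus "card ((%u. N (s',0,u)) ` A s') = M' s'" using As by (simp add: card_image)
  show "finite ((%u. N (s',0,u)) ` A s')" using As by simp
  fix v assume "v : (%u. N (s',0,u)) ` A s'"
  then obtain u where u: "u : A s'" "v = N (s',0,u)" by blast
  note a = La[OF u(1)]
  show nv: "node (extended ?d) (Suc n) s' v" using N_node[OF a] s' by (simp add: u F_def)
  show "v (2*s' + 1) ~= 0"
  proof (cases "u (2*s' + 1) = 0")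
   case False
   thus ?thesis using w(5)[OF a] by (simp add: th_def u N_def)
  next
   case True
   hence ss: "s' = Suc s" using A[of s'] s' u(1) by auto
   have t: "v (2*s + 1) ~= 0" "poly (pderiv (ga s)) (v ze) ~= 0" using w(5)[OF a] True s' by (auto simp: th_def u N_def)
   have "ze : crit_vars (Suc n) s'" by (simp add: crit_vars_Suc)
   hence "crit_eq (extended ?d) s' ze v = 0" using nv unfolding node_def by blast
   \<comment> \<open>The equation for the new coordinate now has two terms. The one containing
     \<open>ep\<close> is nonzero, so the other is, and with it the last multiplier.\<close>
   moreover have "(SUM i<=s. v (2*i + 1)*(?d i*poly (pderiv (ga i)) (v ze))) = (SUM i<=s. if i = s then v (2*s + 1)*(ep*poly (pderiv (ga s)) (v ze)) else 0)"
    using d0 by (intro sum.cong) auto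
   ultimately have "v (2*s + 1)*(ep*poly (pderiv (ga s)) (v ze)) + v (2*s' + 1)*(?d s'*poly (pderiv (ga s')) (v ze)) = 0"
    unfolding crit_eq_extended(2) ss by simp
   thus ?thesis using t e0 by auto
  qed
 qed
 have new: "EX A'. finite A' & card A' = M' s & (ALL u:A'. node (extended ?d) (Suc n) s u & (u (2*s + 1) ~= 0 |
   0 < s & u (2*(s-1) + 1) ~= 0 & poly (pderiv (ga (s-1))) (u ze) ~= 0))"
 proof -
  have La: "(s,z,u) : L" if "z : Z" "u : B s" for z u using that by (auto simp: L_def)
  have Ns: "node (frozen z ?d) n s (N (s,z,u))" "N (s,z,u) (2*s + 1) ~= 0" if "z : Z" "u : B s" for z u
   using N_node[OF La[OF that]] w(5)[OF La[OF that]] by (auto simp: F_def th_def N_def)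
  have zeta0: "N (s,z,u) ze = 0" if "z : Z" "u : B s" for z u using Ns(1)[OF that] by (simp add: node_def)
  \<comment> \<open>Nodes of the first kind: one for each critical point of \<open>ga s\<close> and
    each node at level \<open>s\<close>.\<close>
  define A1 where "A1 = (%(z,u). (N (s,z,u))(ze := z)) ` (Z \<times> B s)"
  have "inj_on (%(z,u). (N (s,z,u))(ze := z)) (Z \<times> B s)"
  proof (rule inj_onI, clarify)
   fix z u z' u' assume *: "z : Z" "u : B s" "z' : Z" "u' : B s" "(N (s,z,u))(ze := z) = (N (s,z',u'))(ze := z')"
   have z: "z = z'" using fun_cong[OF *(5), of ze] by simp
   have "N (s,z,u) = N (s,z',u')"
   proof
    fix j show "N (s,z,u) j = N (s,z',u') j" by (cases "j = ze") (use fun_cong[OF *(5), of j] zeta0[OF *(1,2)] zeta0[OF *(3,4)] in simp_all)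
   qed
   thus "z = z' & u = u'" using N_inj[OF La[OF *(1,2)] La[OF *(3,4)]] z by (auto simp: base_def)
  qed
  hence c1: "card A1 = (p s-1)*M s" using B[OF s] card_crit[of s] by (simp add: A1_def card_image card_cartesian_product Z_def)
  have f1: "finite A1" using B[OF s] finite_crit by (simp add: A1_def Z_def)
  have n1: "node (extended ?d) (Suc n) s v & v (2*s + 1) ~= 0" if v: "v : A1" for v
  proof -
   obtain z u where zu: "z : Z" "u : B s" "v = (N (s,z,u))(ze := z)" using v by (auto simp: A1_def)
   have "node (extended ?d) (Suc n) s v" unfolding zu(3) using d0 e0 zu(1) simple_crit by (intro node_critical Ns zu) (auto simp: Z_def)
   thus ?thesis using Ns(2)[OF zu(1,2)] zu(3) by simp
  qed
  show ?thesis
  proof (cases s)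
   case 0
   thus ?thesis using f1 c1 n1 M' by (intro exI[of _ A1]) auto
  next
   case (Suc s1)
   have Bs: "finite (B s1)" "card (B s1) = M s1" "!!u. u : B s1 ==> node f n s1 u & u (2*s1 + 1) ~= 0" using B[of s1] s Suc by auto
   define Q where "Q = (%u. smult ep (ga s) + [:f s u:])"
   \<comment> \<open>Nodes of the second kind: over each node at level \<open>s - 1\<close>, the new
     coordinate is one of the \<open>p s\<close> simple roots of the last constraint. Their last
     multiplier is 0, which separates them from \<open>A1\<close>.\<close>
   define A2 where "A2 = (%(u,z). u(ze := z)) ` (SIGMA u:B s1. {z. poly (Q u) z = 0})"
   have Q: "degree (Q u) = p s" for u unfolding Q_def using degree[of s] p_pos[of s] e0 by (subst degree_add_eq_left) auto
   have cardQ: "finite {z. poly (Q u) z = 0}" "card {z. poly (Q u) z = 0} = p s" if u: "u : B s1" for u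
   proof -
    have nz: "Q u ~= 0" using Q[of u] p_pos[of s] by auto
    thus "finite {z. poly (Q u) z = 0}" by (rule poly_roots_finite)
    show "card {z. poly (Q u) z = 0} = p s" unfolding Q[of u, symmetric]
    proof (rule card_simple_roots[OF nz])
     fix z assume z: "poly (Q u) z = 0"
     show "poly (pderiv (Q u)) z ~= 0" using eB[of u z] u z e0 Suc by (auto simp: Q_def pderiv_add pderiv_smult crits_def Z_def algebra_simps)
    qed
   qed
   have zeta0: "u ze = 0" if "u : B s1" for u using Bs(3)[OF that] by (simp add: node_def)
   have "inj_on (%(u,z). u(ze := z)) (SIGMA u:B s1. {z. poly (Q u) z = 0})"
   proof (rule inj_onI, clarify)
    fix u z u' z' assume *: "u : B s1" "u' : B s1" "u(ze := z) = u'(ze := z')"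
    have "u j = u' j" for j by (cases "j = ze") (use fun_cong[OF *(3), of j] zeta0[OF *(1)] zeta0[OF *(2)] in simp_all)
    thus "u = u' & z = z'" using fun_cong[OF *(3), of ze] by auto
   qed
   hence c2: "card A2 = p s*M s1" unfolding A2_def using Bs cardQ by (simp add: card_image card_SigmaI)
   have f2: "finite A2" unfolding A2_def using Bs cardQ by auto
   have n2: "node (extended ?d) (Suc n) s v & v (2*s + 1) = 0 & v (2*s1 + 1) ~= 0 & poly (pderiv (ga s1)) (v ze) ~= 0" if v: "v : A2" for v
   proof -
    obtain u z where uz: "u : B s1" "poly (Q u) z = 0" "v = u(ze := z)" using v by (auto simp: A2_def)
    have z: "z ~: crits" using eB[of u z] uz Suc by (auto simp: Q_def algebra_simps)
    have "node (extended ?d) (Suc n) (Suc s1) v" unfolding uz(3) using Bs(3)[OF uz(1)] d0 e0 uz(2) z Suc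
     by (intro node_root) (auto simp: Q_def crits_def Z_def algebra_simps)
    moreover have "2*s + 1 ~: crit_vars n s1" using Suc by (auto simp: crit_vars_def point_vars_def)
    hence "u (2*s + 1) = 0" using Bs(3)[OF uz(1)] Suc by (simp add: node_def)
    moreover have "2*s + 1 ~= ze" "2*s1 + 1 ~= ze" by (simp_all del: mult_Suc_right)
    ultimately show ?thesis using z uz(3) Bs(3)[OF uz(1)] Suc by (simp add: crits_def)
   qed
   have "A1 Int A2 = {}" using n1 n2 by blast
   hence "card (A1 Un A2) = M' s" using c1 c2 f1 f2 M' Suc by (simp add: card_Un_disjoint)
   moreover have "ALL u:A1 Un A2. node (extended ?d) (Suc n) s u & (u (2*s + 1) ~= 0 |
     0 < s & u (2*(s-1) + 1) ~= 0 & poly (pderiv (ga (s-1))) (u ze) ~= 0)" using n1 n2 Suc by auto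
   ultimately show ?thesis using f1 f2 by (intro exI[of _ "A1 Un A2"]) simp
  qed
 qed
 have "stage M' S s ?d" unfolding stage_def
 proof (intro conjI allI impI)
  show "?d i = 0" if "i < s" for i using d0 that by simp
  fix s' assume "s <= s'" "s' <= S"
  then consider "s' = s" | "s < s'" by linarith
  thus "EX A. finite A & card A = M' s' & (ALL u:A. node (extended ?d) (Suc n) s' u & (u (2*s' + 1) ~= 0 |
   s' = s & 0 < s & u (2*(s-1) + 1) ~= 0 & poly (pderiv (ga (s-1))) (u ze) ~= 0))"
  proof cases
   case 1
   thus ?thesis using new by simp
  next
   case 2
   thus ?thesis using old[OF 2 `s' <= S`] by blast
  qed
 qed
 thus ?thesis by blast
qed

lemma nodes_step:
 assumes M: "!!s. s <= S ==> has_nodes f n s (M s)"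
 shows "EX d. ALL s<=S. has_nodes (extended d) (Suc n) s ((p s-1)*M s + (if s = 0 then 0 else p s*M (s-1)))"
proof -
 let ?M' = "%s. (p s-1)*M s + (if s = 0 then 0 else p s*M (s-1))"
 have "ALL s. EX B. s <= S --> finite B & card B = M s & (ALL u:B. node f n s u & u (2*s + 1) ~= 0)" using M by (auto simp: has_nodes_def)
 from choice[OF this] obtain B where B: "!!s. s <= S ==> finite (B s) & card (B s) = M s & (ALL u:B s. node f n s u & u (2*s + 1) ~= 0)" by blast
 have "EX d. stage ?M' S (Suc S - j) d" if "j <= Suc S" for j using that
 proof (induction j)
  case 0
  show ?case by (intro exI[of _ "%_. 0"]) (simp add: stage_def)
 next
  case (Suc j)
  have "Suc (Suc S - Suc j) = Suc S - j" using Suc.prems by simp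
  then obtain d where "stage ?M' S (Suc (Suc S - Suc j)) d" using Suc.IH Suc.prems by auto
  thus ?case using stage_step[OF B, of S ?M' "Suc S - Suc j" d] by auto
 qed
 from this[of "Suc S"] obtain d where d: "stage ?M' S 0 d" by auto
 have "has_nodes (extended d) (Suc n) s (?M' s)" if sS: "s <= S" for s
 proof -
  obtain A where "finite A" "card A = ?M' s" "ALL u:A. node (extended d) (Suc n) s u & (u (2*s + 1) ~= 0 | s = 0 & 0 < (0::nat) &
    u (2*(0-1) + 1) ~= 0 & poly (pderiv (ga (0-1))) (u ze) ~= 0)" using d[unfolded stage_def, THEN conjunct2, rule_format, OF le0 sS] by blast
  thus ?thesis unfolding has_nodes_def by (intro exI[of _ A]) auto
 qed
 thus ?thesis by blast
qed

end

fun crit_count::"(nat => nat) => nat => nat => nat" where "crit_count p 0 s = (if s = 0 then 1 else 0)"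
| "crit_count p (Suc n) s = (p s-1)*crit_count p n s + (if s = 0 then 0 else p s*crit_count p n (s-1))"

text \<open>Homogeneous coordinates in the chart where the coordinate 0 is 1.\<close>

definition hpoint::"(nat => 'a) => nat => 'a::one" where "hpoint u l = (if l = 0 then 1 else u (2*l))"

lemma pfun_hpoint:
 assumes "pfun {..<Suc n} g"
 shows "pfun (point_vars n) (%u. g (hpoint u))"
proof (rule pfun_compose[OF assms, of _ "%l u. hpoint u l"])
 show "pfun (point_vars n) (%u. hpoint u l)" if "l : {..<Suc n}" for l using that unfolding hpoint_def by (intro pfun_if pfunI) (auto simp: point_vars_def)
qed

text \<open>The induction starts with zero forms on a point, which have one node without constraints
  and none otherwise. In each step the polynomials \<open>ga i\<close> are homogenized by the
  coordinate 0.\<close>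

lemma forms_with_nodes:
 fixes p::"nat => nat"
 assumes "!!i. 0 < p i"
 shows "EX g::nat => (nat => 'a::{alg_closed_field,field_char_0}) => 'a.
  (ALL i. g i : Hom (Suc n) (p i)) & (ALL s<=S. has_nodes (%i u. g i (hpoint u)) n s (crit_count p n s))"
proof (induction n)
 case 0
 have "has_nodes (%i u. 0::'a) 0 s (crit_count p 0 s)" for s
 proof (cases "s = 0")
  case True
  have "node (%i u. 0::'a) 0 0 (unit_at 1)" by (auto simp: node_def crit_vars_def point_vars_def nondeg_def)
  thus ?thesis using True unfolding has_nodes_def by (intro exI[of _ "{unit_at 1}"]) auto
 next
  case False
  thus ?thesis unfolding has_nodes_def by (intro exI[of _ "{}"]) auto
 qed
 thus ?case using Hom_zero by (intro exI[of _ "%_ _. 0"]) auto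
next
 case (Suc n)
 then obtain g::"nat => 'a fn" where g: "!!i. g i : Hom (Suc n) (p i)" "!!s. s <= S ==> has_nodes (%i u. g i (hpoint u)) n s (crit_count p n s)" by blast
 obtain ga::"nat => 'a poly" where ga: "bricks ga p" using bricks_exist[of p, OF assms] by blast
 interpret b: bricks ga p by (rule ga)
 interpret nb: new_brick "%i u. g i (hpoint u)" ga n p by unfold_locales (rule pfun_hpoint[OF Hom_pfun[OF g(1)]])
 obtain d where d: "!!s. s <= S ==> has_nodes (nb.extended d) (Suc n) s (crit_count p (Suc n) s)" using nb.nodes_step[of S "crit_count p n"] g(2) by auto
 define g' where "g' = (%i x. g i x + d i*(SUM e<=p i. coeff (ga i) e*(x 0^(p i - e)*x (Suc n)^e)))"
 have "g' i : Hom (Suc (Suc n)) (p i)" for i unfolding g'_def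
 proof (intro Hom_add Hom_scale Hom_sum Hom_Suc[OF g(1)])
  fix e assume e: "e : {..p i}"
  have "(%x. x 0^(p i - e)*x (Suc n)^e) : Hom (Suc (Suc n)) (1*(p i - e) + 1*e)" by (intro Hom_mult Hom_power Hom_var) auto
  thus "(%x. x 0^(p i - e)*x (Suc n)^e) : Hom (Suc (Suc n)) (p i)" using e by simp
 qed
 moreover have "(%i u. g' i (hpoint u)) = nb.extended d" by (auto simp: fun_eq_iff g'_def nb.extended_def hpoint_def new_var_def poly_altdef b.degree)
 ultimately show ?case using d by (intro exI[of _ g']) auto
qed

lemma euler:
 fixes x::"nat => 'a::field_char_0"
 shows "(SUM i<k. x i*dform k d c i x) = of_nat d*pform k d c x"
proof -
 have mon: "x i*(of_nat (m ! i)*(PROD l<k. x l^(if l = i then m ! l-1 else m ! l))) = of_nat (m ! i)*lmon k m x" if "i < k" for m i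
 proof (cases "m ! i")
  case (Suc e)
  have "(PROD l<k. x l^(if l = i then m ! l-1 else m ! l)) = x i^(m ! i-1)*(PROD l:{..<k}-{i}. x l^(m ! l))"
   using that by (subst prod.remove[of _ i]) (auto intro!: prod.cong)
  moreover have "lmon k m x = x i^(m ! i)*(PROD l:{..<k}-{i}. x l^(m ! l))" unfolding lmon_def using that by (subst prod.remove[of _ i]) auto
  ultimately show ?thesis using Suc by simp
 qed simp
 have "(SUM i<k. x i*dform k d c i x) = (SUM i<k. SUM m:multi k d. c m*(of_nat (m ! i)*lmon k m x))" unfolding dform_def sum_distrib_left
  by (intro sum.cong refl) (simp add: mon[symmetric] mult_ac)
 also have "... = (SUM m:multi k d. c m*((SUM i<k. of_nat (m ! i))*lmon k m x))" by (subst sum.swap) (simp add: sum_distrib_left sum_distrib_right)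
 also have "... = (SUM m:multi k d. of_nat d*(c m*lmon k m x))"
 proof (rule sum.cong[OF refl])
  fix m assume "m : multi k d"
  hence "(SUM i<k. m ! i) = d" by (auto simp: mi_def sum_list_sum_nth atLeast0LessThan)
  hence "(SUM i<k. of_nat (m ! i)) = (of_nat d::'a)" by (metis of_nat_sum)
  thus "c m*((SUM i<k. of_nat (m ! i))*lmon k m x) = of_nat d*(c m*lmon k m x)" by simp
 qed
 finally show ?thesis by (simp add: pform_def sum_distrib_left)
qed

lemma dd_pform:
 fixes u::"nat => 'a::field_char_0"
 assumes i: "0 < i" "i < k"
 shows "dd (%u. pform k d c (hpoint u)) u (unit_at (2*i)) = dform k d c i (hpoint u)"
proof -
 let ?R = "%m u. PROD l:{..<k}-{i}. hpoint u l^(m ! l)"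
 have pfR: "pfun (- {2*i}) (?R m)" for m unfolding hpoint_def by (intro pfunI pfun_if) auto
 have pfi: "pfun UNIV (%u. u (2*i)^e)" for e by (intro pfunI) simp
 have split: "lmon k m (hpoint u) = u (2*i)^(m ! i)*?R m u" for m u unfolding lmon_def using i by (subst prod.remove[of _ i]) (auto simp: hpoint_def)
 have pw: "dd (%u. u (2*i)^e) u (unit_at (2*i)) = of_nat e*u (2*i)^(e-1)" for e
  using dd_poly[of "monom 1 e" "2*i" u "unit_at (2*i)"] by (simp add: poly_monom pderiv_monom)
 have mon: "dd (%u. c m*lmon k m (hpoint u)) u (unit_at (2*i)) = c m*of_nat (m ! i)*(PROD l<k. hpoint u l^(if l = i then m ! l-1 else m ! l))" for m
 proof -
  have R: "pfun UNIV (?R m)" using pfR[of m] by (rule pfun_mono) simp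
  have "dd (?R m) u (unit_at (2*i)) = 0" by (rule dd_outside[OF pfR]) auto
  hence "dd (%u. c m*lmon k m (hpoint u)) u (unit_at (2*i)) = c m*(of_nat (m ! i)*(u (2*i)^(m ! i-1)*?R m u))"
   unfolding split by (simp add: mult.assoc dd_simps(1) dd_simps(4)[of UNIV] R pfi pw pfunI)
  also have "u (2*i)^(m ! i-1)*?R m u = (PROD l<k. hpoint u l^(if l = i then m ! l-1 else m ! l))"
   using i by (subst prod.remove[of "{..<k}" i]) (auto simp: hpoint_def intro!: prod.cong)
  finally show ?thesis by (simp add: mult.assoc)
 qed
 have "pfun UNIV (%u. c m*lmon k m (hpoint u))" for m unfolding lmon_def hpoint_def by (intro pfunI pfun_if) auto
 hence "dd (%u. SUM m:multi k d. c m*lmon k m (hpoint u)) u (unit_at (2*i)) =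
   (SUM m:multi k d. dd (%u. c m*lmon k m (hpoint u)) u (unit_at (2*i)))" by (rule dd_sum)
 thus ?thesis unfolding pform_def dform_def mon .
qed

text \<open>For a fixed point the equations are affine linear in the multipliers, so the difference
  of two solutions lies in the kernel of the derivative, which is trivial at a node.\<close>

lemma node_point_inj:
 assumes f: "!!i. pfun (point_vars n) (f i)" and u: "node f n s u" "node f n s u'"
  and eq: "!!e. e : point_vars n ==> u e = u' e"
 shows "u = u'"
proof -
 define v where "v = (%j. u j - u' j)"
 have v: "v j = 0" if "j ~: crit_vars n s" for j using that u by (cases "j = 1") (auto simp: v_def node_def)
 have vp: "v e = 0" if "e : point_vars n" for e using eq[OF that] by (simp add: v_def)
 have fU: "pfun UNIV (f i)" for i using f[of i] by (rule pfun_mono) simp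
 have "v j = 0" if "j : crit_vars n s" for j
 proof (rule nondegD[of "crit_eq f s" "crit_vars n s" u, OF _ v _ that])
  show "nondeg (crit_eq f s) (crit_vars n s) u" using u by (simp add: node_def)
  fix e assume e: "e : crit_vars n s"
  show "dd (crit_eq f s e) u v = 0"
  proof (cases "even e")
   case True
   have "dd (crit_eq f s e) u v = (SUM i<=s. dd (%u. u (2*i + 1)*dd (f i) u (unit_at e)) u v)"
    unfolding crit_eq_def using True by (simp, subst dd_sum[of _ UNIV]) (auto intro!: pfunI pfun_dd fU)
   also have "... = (SUM i<=s. v (2*i + 1)*dd (f i) u (unit_at e))" using dd_outside[OF pfun_dd[OF f] vp]
    by (intro sum.cong refl) (subst dd_simps(4)[of UNIV], auto simp: dd_simps intro!: pfunI pfun_dd fU)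
   also have "... = crit_eq f s e u - crit_eq f s e u'"
    using True dd_cong[OF f, of u u' "unit_at e" "unit_at e"] eq by (simp add: crit_eq_def v_def left_diff_distrib sum_subtractf)
   finally show ?thesis using u e by (simp add: node_def)
  next
   case False
   hence "crit_eq f s e = f (e div 2)" by (simp add: crit_eq_def fun_eq_iff)
   thus ?thesis using dd_outside[OF f vp] by simp
  qed
 qed
 hence "v j = 0" for j using v by blast
 thus ?thesis by (auto simp: v_def)
qed

text \<open>To first order, the critical values of \<open>f 0 + ep * g 0\<close> on the zero set of the other
 \<open>f i + ep * g i\<close> move by \<open>ep\<close> times the value of the perturbed Lagrangian.\<close>

lemma split_critical_values:
 fixes f g::"nat => (nat => 'a::{alg_closed_field,field_char_0}) => 'a"
 assumes f: "!!i. pfun (point_vars n) (f i)" and g: "!!i. pfun (point_vars n) (g i)"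
  and B: "finite B" "!!u. u : B ==> node f n s u" and inj: "inj_on (%u. SUM i<=s. u (2*i + 1)*g i u) B" and h: "h ~= 0"
 shows "EX ep w. poly h ep ~= 0 & inj_on (%u. f 0 (w u) + ep*g 0 (w u)) B &
  (ALL u:B. w u 1 = 1 & (ALL e:crit_vars n s. crit_eq (%i x. f i x + ep*g i x) s e (w u) = 0))"
proof -
 define F where "F = (%ep i x. f i x + ep*g i x)"
 define H where "H = (%e w. crit_eq (F (w 0)) s e w)"
 let ?U = "crit_vars n s"
 have fU: "pfun UNIV (f i)" and gU: "pfun UNIV (g i)" for i by (rule pfun_mono[OF f], simp, rule pfun_mono[OF g], simp)
 have Fpf: "pfun (point_vars n) (F ep i)" for ep i unfolding F_def using f g by (intro pfunI)
 have F0: "F 0 = f" by (simp add: F_def)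
 have ddF: "dd (F ep i) u v = dd (f i) u v + ep*dd (g i) u v" for ep i u v
  unfolding F_def by (subst dd_simps(3)[of UNIV], rule fU, intro pfunI gU, subst dd_simps(4)[of UNIV]) (auto simp: dd_simps gU intro: pfunI)
 have FwU: "pfun UNIV (%w. F (w 0) i w)" for i unfolding F_def by (intro pfunI fU gU) simp
 have ddFw: "dd (%w. F (w 0) i w) u v = dd (f i) u v + g i u" if "u 0 = 0" "v 0 = 1" for i u v
 proof -
  have v0: "pfun UNIV (%w::nat => 'a. w 0)" by (intro pfunI) simp
  show ?thesis unfolding F_def dd_simps(3)[OF fU pfun.mult[OF v0 gU]] dd_simps(4)[OF v0 gU] dd_simps(2) using that by simp
 qed
 have Hpf: "pfun UNIV (H e)" for e unfolding H_def crit_eq_def ddF by (intro pfun_if) (auto intro!: pfunI pfun_dd fU gU FwU)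
 have Hodd: "H (2*i + 1) = (%w. F (w 0) i w)" for i by (simp add: H_def crit_eq_def fun_eq_iff)
 have Hdd: "dd (H e) w v = dd (crit_eq (F (w 0)) s e) (w(0 := 0)) v" if "e : ?U" "v 0 = 0" for e w v
  unfolding H_def by (rule freeze_parameter[where g = F and V = "point_vars n"]) (use that Fpf in "simp_all add: point_vars_def")
 have node0: "u 0 = 0" "u(0 := 0) = u" if "u : B" for u using B(2)[OF that] by (auto simp: node_def fun_eq_iff)
 \<comment> \<open>Along the curve the constraints give that \<open>f i\<close> changes by
   \<open>- g i\<close> for \<open>i >= 1\<close>, while stationarity of the Lagrangian makes the
   multiplier sum of the changes of all \<open>f i\<close> vanish. Together they determine the
   change of \<open>f 0\<close>.\<close>
 have slope: "coeff (along (%w. F (w 0) 0 w) c) 1 = (SUM i<=s. u (2*i + 1)*g i u)" if u: "u : B" and c: "curve_at H ?U u c" for u c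
 proof -
  let ?v = "%j. coeff (c j) 1"
  have c0: "(%j. coeff (c j) 0) = u" "?v 0 = 1" using c by (auto simp: curve_at_def)
  have cF: "coeff (along (%w. F (w 0) i w) c) 1 = dd (f i) u ?v + g i u" for i using coeff_along_1[OF FwU, of i c] ddFw[of u ?v i] node0(1)[OF u] c0 by simp
  have odd0: "dd (f i) u ?v = - g i u" if "1 <= i" "i <= s" for i
  proof -
   have "2*i + 1 : ?U" using that by (auto simp: crit_vars_def)
   hence "[:0,1:]^2 dvd along (H (2*i + 1)) c" using c by (auto simp: curve_at_def)
   then obtain q where q: "along (H (2*i + 1)) c = [:0,1:]^2*q" by (rule dvdE)
   have "coeff (along (H (2*i + 1)) c) 1 = 0" unfolding q by (simp add: power2_eq_square)
   thus ?thesis unfolding Hodd cF by (simp add: add_eq_0_iff)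
  qed
  have supp: "dd (f i) u ?v = (SUM j:point_vars n. ?v j*dd (f i) u (unit_at j))" for i
  proof -
   have fin: "finite (point_vars n)" by (rule finite_subset[OF _ finite_crit_vars[of n s]]) (auto simp: crit_vars_def)
   have "dd (f i) u ?v = dd (f i) u (%j. if j : point_vars n then ?v j else 0)" by (rule dd_cong[OF f]) auto
   also have "... = (SUM j:point_vars n. ?v j*dd (f i) u (unit_at j))" by (subst dd_finite_support[OF f fin]) auto
   finally show ?thesis .
  qed
  have "(SUM i<=s. u (2*i + 1)*dd (f i) u ?v) = (SUM j:point_vars n. ?v j*(SUM i<=s. u (2*i + 1)*dd (f i) u (unit_at j)))"
   unfolding supp sum_distrib_left by (subst sum.swap) (simp add: mult_ac)
  also have "... = (SUM j:point_vars n. ?v j*crit_eq f s j u)" by (intro sum.cong) (auto simp: crit_eq_def point_vars_def)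
  also have "... = 0" using B(2)[OF u] by (intro sum.neutral) (auto simp: node_def crit_vars_def)
  finally have L: "(SUM i<=s. u (2*i + 1)*dd (f i) u ?v) = 0" .
  have u1: "u (2*0 + 1) = 1" using B(2)[OF u] by (simp add: node_def)
  have split: "(SUM i<=s. u (2*i + 1)*G i) = G 0 + (SUM i:{1..s}. u (2*i + 1)*G i)" for G::"nat => 'a"
   using u1 by (subst sum.remove[of _ 0]) (auto intro!: arg_cong2[where f = "(+)"] sum.cong)
  have "(SUM i:{1..s}. u (2*i + 1)*dd (f i) u ?v) = (SUM i:{1..s}. - (u (2*i + 1)*g i u))" using odd0 by (intro sum.cong) auto
  hence "dd (f 0) u ?v = (SUM i:{1..s}. u (2*i + 1)*g i u)" using L unfolding split by (simp add: sum_negf)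
  thus ?thesis unfolding cF split by simp
 qed
 have "EX ep w. poly h ep ~= 0 & (ALL a:B. w a 0 = ep & (ALL j. j ~: insert 0 ?U --> w a j = a j) & (ALL e:?U. H e (w a) = 0) &
  nondeg H ?U (w a) & (1::'a) ~= 0) & (ALL (a,a'):{(a,a'). a : B & a' : B & a ~= a'}. F (w a 0) 0 (w a) ~= F (w a' 0) 0 (w a'))"
 proof (rule persistence_family[where Ps = "%a a' w. F (w 0) 0 w" and A = B and H = "%_. H" and U = "%_. ?U" and b = "%a. a" and th = "%_ _. 1"
    and R = "{(a,a'). a : B & a' : B & a ~= a'}" and h = h])
  show "H e a = 0" if "a : B" "e : ?U" for a e using B(2)[OF that(1)] that(2) by (simp add: H_def node0(1)[OF that(1)] F0 node_def)
  show "nondeg H ?U a" if "a : B" for a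
  proof -
   have "nondeg H ?U a \<longleftrightarrow> nondeg (crit_eq f s) ?U a"
   proof (rule nondeg_cong)
    fix e and v::"nat => 'a" assume e: "e : ?U" and v: "!!j. j ~: ?U ==> v j = 0"
    have "v 0 = 0" by (rule v) simp
    thus "dd (H e) a v = dd (crit_eq f s e) a v" using Hdd[OF e, of v a] node0[OF that] F0 by simp
   qed
   thus ?thesis using B(2)[OF that] by (simp add: node_def)
  qed
  fix a a' c c' assume "(a,a') : {(a,a'). a : B & a' : B & a ~= a'}" and c: "curve_at H ?U a c" "curve_at H ?U a' c'"
  thus "coeff (along (%w. F (w 0) 0 w) c) 0 ~= coeff (along (%w. F (w 0) 0 w) c') 0 | coeff (along (%w. F (w 0) 0 w) c) 1 ~= coeff (along (%w. F (w 0) 0 w) c') 1"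
   using inj by (auto simp: slope[OF _ c(1)] slope[OF _ c(2)] inj_on_def simp del: One_nat_def)
 qed (auto simp: B(1) finite_crit_vars Hpf node0 FwU h intro: pfunI)
 then obtain ep w where e: "poly h ep ~= 0" and w: "!!a. a : B ==> w a 0 = ep" "!!a j. a : B ==> j ~: insert 0 ?U ==> w a j = a j"
   "!!a e. a : B ==> e : ?U ==> H e (w a) = 0"
  and R: "!!a a'. a : B ==> a' : B ==> a ~= a' ==> F (w a 0) 0 (w a) ~= F (w a' 0) 0 (w a')" by blast
 show ?thesis
 proof (intro exI[of _ ep] exI[of _ w] conjI ballI e)
  show "inj_on (%u. f 0 (w u) + ep*g 0 (w u)) B"
  proof (rule inj_onI, rule ccontr)
   fix a a' assume *: "a : B" "a' : B" "f 0 (w a) + ep*g 0 (w a) = f 0 (w a') + ep*g 0 (w a')" "a ~= a'"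
   thus False using R[of a a'] w(1) by (simp add: F_def)
  qed
  fix a assume a: "a : B"
  show "w a 1 = 1" using w(2)[OF a, of 1] B(2)[OF a] by (simp add: node_def)
  show "crit_eq (%i x. f i x + ep*g i x) s e (w a) = 0" if "e : ?U" for e using w(3)[OF a that] w(1)[OF a] by (simp add: H_def F_def)
 qed
qed

lemma coeff_variable_degree:
 fixes D::"('v,'a::field_char_0) mvpoly"
 assumes "!!t. t : keys D ==> lookup t v0 <= N"
 shows "EX P. degree P <= N & (ALL s. poly P s = mv_eval (%v. a v + (if v = v0 then s else 0)) D)"
proof (intro exI conjI allI)
 let ?l = "%v. [:a v,if v = v0 then 1 else 0:]"
 let ?P = "SUM t:keys D. smult (lookup D t) (mmon ?l t)"
 show "degree ?P <= N"
 proof (intro degree_sum_le)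
  fix t assume t: "t : keys D"
  have "degree (mmon ?l t) <= (SUM v:keys t. degree (?l v^lookup t v))"
   unfolding mmon_def using degree_prod_sum_le[of "keys t" "%v. ?l v^lookup t v"] by (simp add: comp_def)
  also have "... <= (SUM v:keys t. if v = v0 then lookup t v0 else 0)"
  proof (intro sum_mono)
   fix v
   have "degree (?l v^lookup t v) <= degree (?l v)*lookup t v" by (rule degree_power_le)
   thus "degree (?l v^lookup t v) <= (if v = v0 then lookup t v0 else 0)" by (auto split: if_splits)
  qed
  also have "... <= N" using assms[OF t] by (simp add: sum.delta)
  finally have "degree (mmon ?l t) <= N" .
  thus "degree (smult (lookup D t) (mmon ?l t)) <= N" by (rule order_trans[OF degree_smult_le])
 qed simp
 have "poly (mmon ?l t) s = mmon (%v. a v + (if v = v0 then s else 0)) t" for t s unfolding mmon_def by (auto simp: poly_prod intro!: prod.cong)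
 thus "poly ?P s = mv_eval (%v. a v + (if v = v0 then s else 0)) D" for s by (simp add: poly_sum mv_eval_eq_subst mv_subst_monom)
qed

context discriminant
begin

text \<open>Subtracting the critical value times x_0^(p 0) makes the critical point a zero of the
  first form. The Lagrange multipliers are the relation between the rows; its component for
  \<open>x 0\<close> follows from Euler's identity, because all forms vanish there.\<close>

lemma sing_at_node:
 assumes a: "!!j e. j < r ==> f j = (%u. pform k (p j) (%m. a (j,m)) (hpoint u))"
  and u1: "u 1 = 1" and eq: "!!e. e : crit_vars (k-1) (r-1) ==> crit_eq f (r-1) e u = 0"
 shows "sing k r p (%v. a v + (if v = (0,power_index k 0 (p 0)) then - f 0 u else 0))"
proof -
 let ?a = "%v. a v + (if v = (0,power_index k 0 (p 0)) then - f 0 u else 0)" and ?x = "hpoint u"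
 have a': "(%m. ?a (j,m)) = (%m. a (j,m)+(if m = power_index k 0 (p 0) then if j = 0 then - f 0 u else 0 else 0))" for j by (auto simp: fun_eq_iff)
 have x0: "?x 0 = 1" by (simp add: hpoint_def)
 have F: "pform k (p j) (%m. ?a (j,m)) ?x = 0" if "j < r" for j
 proof (cases "j = 0")
  case True
  have "pform k (p 0) (%m. if m = power_index k 0 (p 0) then - f 0 u else 0) ?x = - f 0 u" using r by (subst pform_power) (auto simp: x0)
  thus ?thesis unfolding a' pform_add using a[OF that] True by simp
 next
  case False
  hence "2*j + 1 : crit_vars (k-1) (r-1)" using that by (auto simp: crit_vars_def)
  hence "f j u = 0" using eq[of "2*j + 1"] by (simp add: crit_eq_def)
  thus ?thesis unfolding a' pform_add using a[OF that] False by (simp add: pform_zero)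
 qed
 have G: "(SUM j<r. u (2*j + 1)*dform k (p j) (%m. ?a (j,m)) i ?x) = 0" if "0 < i" "i < k" for i
 proof -
  have "(SUM j<r. u (2*j + 1)*dform k (p j) (%m. ?a (j,m)) i ?x) = (SUM j<r. u (2*j + 1)*dd (f j) u (unit_at (2*i)))"
  proof (rule sum.cong[OF refl])
   fix j assume j: "j : {..<r}"
   have "dform k (p j) (%m. if m = power_index k 0 (p 0) then if j = 0 then - f 0 u else 0 else 0) i ?x = 0"
   proof (cases "j = 0")
    case True
    thus ?thesis using that r by (simp add: dform_power)
   qed (simp add: dform_zero cong: if_cong)
   thus "u (2*j + 1)*dform k (p j) (%m. ?a (j,m)) i ?x = u (2*j + 1)*dd (f j) u (unit_at (2*i))"
    unfolding a' dform_add using a[of j] j dd_pform[OF that, of "p j" "%m. a (j,m)" u] by simp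
  qed
  also have "... = crit_eq f (r-1) (2*i) u" using r by (auto simp: crit_eq_def intro!: sum.cong)
  finally show ?thesis using eq[of "2*i"] that by (simp add: crit_vars_def point_vars_def)
 qed
 have "(SUM i<k. ?x i*(SUM j<r. u (2*j + 1)*dform k (p j) (%m. ?a (j,m)) i ?x)) = (SUM j<r. u (2*j + 1)*(SUM i<k. ?x i*dform k (p j) (%m. ?a (j,m)) i ?x))"
  unfolding sum_distrib_left by (subst sum.swap) (simp add: mult_ac)
 also have "... = 0" unfolding euler using F by simp
 also have "(SUM i<k. ?x i*(SUM j<r. u (2*j + 1)*dform k (p j) (%m. ?a (j,m)) i ?x)) =
   (SUM i<k. if i = 0 then SUM j<r. u (2*j + 1)*dform k (p j) (%m. ?a (j,m)) 0 ?x else 0)" using G x0 by (intro sum.cong) auto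
 finally have G0: "(SUM j<r. u (2*j + 1)*dform k (p j) (%m. ?a (j,m)) 0 ?x) = 0" using r by simp
 show ?thesis unfolding sing_def
 proof (rule exI[of _ ?x], rule exI[of _ "%j. u (2*j + 1)"], intro conjI allI impI)
  show "EX i<k. ?x i ~= 0" using x0 r by (intro exI[of _ 0]) auto
  show "EX j<r. u (2*j + 1) ~= 0" using u1 r by (intro exI[of _ 0]) auto
  show "(SUM j<r. u (2*j + 1)*dform k (p j) (%m. ?a (j,m)) i ?x) = 0" if "i < k" for i using G[OF _ that] G0 by (cases "i = 0") auto
 qed (rule F)
qed

lemma degvar_ge: "p 0*crit_count (%i. if i < r then p i else 1) (k-1) (r-1) <= degvar"
proof -
 \<comment> \<open>The default 1 is there because \<open>forms_with_nodes\<close> asks for positive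
   degrees at all indices.\<close>
 define q where "q = (%i. if i < r then p i else 1)"
 have q: "0 < q i" for i using p by (simp add: q_def)
 have k: "Suc (k-1) = k" "1 < k" using r by auto
 let ?s = "r-1"
 obtain g::"nat => 'a fn" where g: "!!i. g i : Hom k (q i)" "has_nodes (%i u. g i (hpoint u)) (k-1) ?s (crit_count q (k-1) ?s)"
  using forms_with_nodes[of q "k-1" ?s, OF q, where ?'a = 'a] unfolding k by blast
 have "ALL i. EX c. g i = pform k (q i) c" using Hom_imp_pform[OF g(1)] by blast
 from choice[OF this] obtain c0' where c0': "!!i. g i = pform k (q i) (c0' i)" by blast
 define c0 where "c0 = (%(i,m). c0' i m)"
 define F where "F = (%(c::cvar => 'a) i u. pform k (q i) (%m. c (i,m)) (hpoint u))"
 have Fg: "F c0 = (%i u. g i (hpoint u))" by (simp add: F_def c0_def c0' fun_eq_iff)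
 obtain B where B: "finite B" "card B = crit_count q (k-1) ?s" "!!u. u : B ==> node (F c0) (k-1) ?s u" using g(2) unfolding has_nodes_def Fg by blast
 have Fpf: "pfun (point_vars (k-1)) (F c i)" for c i
 proof -
  have "pfun {..<k} (pform k (q i) (%m. c (i,m)))" unfolding pform_def[abs_def] lmon_def by (intro pfunI) auto
  thus ?thesis unfolding F_def by (rule pfun_hpoint[of "k-1", unfolded k(1)])
 qed
 have Fadd: "F (%v. c v + e*d v) i u = F c i u + e*F d i u" for c d e i u by (simp add: F_def pform_add pform_scale)
 let ?T = "%c u. SUM i<=?s. u (2*i + 1)*F c i u"
 \<comment> \<open>A direction \<open>c1\<close> of perturbation is chosen with three properties:
   \<open>D\<close> is nonzero at \<open>c0 + c1\<close>, each form keeps a nonzero coefficient of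
   x_1^(p i) and thus stays nonzero when that of x_0^(p 0) varies, and the critical values are split
   to first order.\<close>
 have "generic (%c. mv_eval (%v. c0 v + c v) D ~= 0)"
 proof -
  obtain b where "mv_eval b D ~= 0" using D_nz mv_eval_zero_imp_zero[of D] by blast
  hence "mv_eval (%v. c0 v + (b v - c0 v)) D ~= 0" by simp
  moreover have "pfun UNIV (%c. mv_eval (%v. c0 v + c v) D)" by (rule pfun_compose[OF pfun_mv_UNIV]) (intro pfunI, simp)
  ultimately show ?thesis unfolding generic_def by (intro exI[of _ "%c. mv_eval (%v. c0 v + c v) D"] conjI exI[of _ "%v. b v - c0 v"]) auto
 qed
 moreover have "generic (%c. ALL i:{..<r}. c0 (i,power_index k 1 (p i)) + c (i,power_index k 1 (p i)) ~= 0)"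
 proof (rule generic_ball)
  fix i show "generic (%c. c0 (i,power_index k 1 (p i)) + c (i,power_index k 1 (p i)) ~= 0)" unfolding generic_def
   by (intro exI[of _ "%c. c0 (i,power_index k 1 (p i)) + c (i,power_index k 1 (p i))"] conjI exI[of _ "%v. 1 - c0 v"]) (auto intro!: pfunI)
 qed simp
 moreover have "generic (%c. ALL (u,u'):{(u,u'). u : B & u' : B & u ~= u'}. ?T c u ~= ?T c u')"
 proof (rule generic_ball)
  show "finite {(u,u'). u : B & u' : B & u ~= u'}" by (rule finite_subset[of _ "B \<times> B"]) (auto simp: B(1))
  fix z assume z: "z : {(u,u'). u : B & u' : B & u ~= u'}"
  obtain u u' where zu: "z = (u,u')" by (rule prod.exhaust)
  hence u: "u : B" "u' : B" "u ~= u'" using z by auto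
  obtain e where e: "e : point_vars (k-1)" "u e ~= u' e" using node_point_inj[OF Fpf B(3)[OF u(1)] B(3)[OF u(2)]] u(3) by blast
  obtain l where l: "e = 2*l" "0 < l" "l < k" using e(1) by (auto simp: point_vars_def elim!: evenE)
  \<comment> \<open>Perturbing the form 0 by this monomial moves the critical value to first order
    by the coordinate \<open>u e\<close>, in which the two nodes differ.\<close>
  have "(%x::nat => 'a. x 0^(q 0-1)*x l) : Hom k (1*(q 0-1) + 1)" using l by (intro Hom_mult Hom_power Hom_var) auto
  hence "(%x::nat => 'a. x 0^(q 0-1)*x l) : Hom k (q 0)" using q[of 0] by simp
  then obtain c where c: "(%x::nat => 'a. x 0^(q 0-1)*x l) = pform k (q 0) c" by (rule Hom_imp_pform)
  define c1 where "c1 = (%(i,m). if i = (0::nat) then c m else 0)"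
  have Fc: "F c1 i w = (if i = 0 then w e else 0)" for i w using fun_cong[OF c, of "hpoint w"] l by (auto simp: F_def c1_def pform_zero hpoint_def)
  have T1: "?T c1 w = w e" if "w : B" for w using B(3)[OF that] unfolding Fc by (simp add: node_def if_distrib cong: if_cong)
  have pf: "pfun UNIV (%c. ?T c w)" for w unfolding F_def pform_def by (intro pfunI) auto
  have "generic (%c. ?T c u - ?T c u' ~= 0)" unfolding generic_def
  proof (intro exI[of _ "%c. ?T c u - ?T c u'"] conjI exI[of _ c1] allI impI)
   show "pfun UNIV (%c. ?T c u - ?T c u')" by (intro pfun_diff pf)
   show "?T c1 u - ?T c1 u' ~= 0" unfolding T1[OF u(1)] T1[OF u(2)] using e by simp
  qed
  thus "generic (%c. case z of (u,u') => ?T c u ~= ?T c u')" unfolding zu by simp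
 qed
 ultimately obtain c1 where c1: "mv_eval (%v. c0 v + c1 v) D ~= 0" "!!i. i < r ==> c0 (i,power_index k 1 (p i)) + c1 (i,power_index k 1 (p i)) ~= 0" "inj_on (?T c1) B"
  using generic_ex[OF generic_conj[OF _ generic_conj]] unfolding inj_on_def by fast
 obtain P where P: "!!e. mv_eval (%v. c0 v + e*c1 v) D = poly P e" using pfun_line[OF pfun_mv_UNIV] by blast
 define h where "h = P*(PROD i<r. [:c0 (i,power_index k 1 (p i)),c1 (i,power_index k 1 (p i)):])"
 have "poly h 1 ~= 0" using c1 P[of 1] by (simp add: h_def poly_prod)
 hence "h ~= 0" by auto
 from split_critical_values[OF Fpf Fpf B(1,3) c1(3) this]
 obtain ep w where h: "poly h ep ~= 0" and inj: "inj_on (%u. F c0 0 (w u) + ep*F c1 0 (w u)) B"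
  and w: "!!u. u : B ==> w u 1 = 1" "!!u e. u : B ==> e : crit_vars (k-1) ?s ==> crit_eq (%i x. F c0 i x + ep*F c1 i x) ?s e (w u) = 0" by blast
 define a where "a = (%v. c0 v + ep*c1 v)"
 have Fa: "F c0 i x + ep*F c1 i x = F a i x" for i x unfolding a_def Fadd ..
 have aD: "mv_eval a D ~= 0" and ai: "!!i. i < r ==> a (i,power_index k 1 (p i)) ~= 0" using h P[of ep] by (auto simp: h_def a_def poly_prod)
 let ?v0 = "(0::nat,power_index k 0 (p 0))"
 have "lookup t ?v0 <= degvar div p 0" if t: "t : keys D" for t
 proof -
  have "p 0*lookup t ?v0 <= degvar"
  proof (cases "?v0 : keys t")
   case True
   have "snd ?v0 ! 0*lookup t ?v0 <= (SUM v:keys t. snd v ! 0*lookup t v)" by (rule member_le_sum[where f = "%v. snd v ! 0*lookup t v", OF True]) auto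
   thus ?thesis using variable_weight[of 0 t] t r by (simp add: power_index_def)
  qed (simp add: in_keys_iff)
  thus ?thesis using p[of 0] r by (simp add: less_eq_div_iff_mult_less_eq mult.commute)
 qed
 from coeff_variable_degree[OF this, of D a]
 obtain Q where Q: "degree Q <= degvar div p 0" "!!s. poly Q s = mv_eval (%v. a v + (if v = ?v0 then s else 0)) D" by blast
 have Q0: "Q ~= 0" using Q(2)[of 0] aD by auto
 have root: "poly Q (- F a 0 (w u)) = 0" if u: "u : B" for u unfolding Q(2)
 proof (rule D_zero_if_sing)
  show "sing k r p (%v. a v + (if v = ?v0 then - F a 0 (w u) else 0))" using w[OF u] unfolding Fa by (intro sing_at_node) (simp_all add: F_def q_def)
  show "nonzero_forms k r p (%v. a v + (if v = ?v0 then - F a 0 (w u) else 0))" unfolding nonzero_forms_def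
  proof (intro allI impI)
   fix i assume i: "i < r"
   have "power_index k 1 (p 0) ~= power_index k 0 (p 0)" using power_index_inj[of 1 k 0 "p 0"] p[of 0] r k(2) by simp
   hence "(i,power_index k 1 (p i)) ~= ?v0" by auto
   thus "EX m:multi k (p i). a (i,m)+(if (i,m) = ?v0 then - F a 0 (w u) else 0) ~= 0"
    using ai[OF i] power_index_in[of 1 k "p i"] k(2) by (intro bexI[of _ "power_index k 1 (p i)"]) auto
  qed
 qed
 have "card B = card ((%u. - F a 0 (w u)) ` B)" using inj unfolding Fa by (subst card_image) (auto simp: inj_on_def)
 also have "... <= card {x. poly Q x = 0}" using root poly_roots_finite[OF Q0] by (intro card_mono) auto
 also have "... <= degvar div p 0" using poly_roots_degree[OF Q0] Q(1) by simp
 finally have "p 0*card B <= p 0*(degvar div p 0)" by simp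
 also have "... <= degvar" by simp
 finally show ?thesis unfolding B(2) q_def .
qed

end

section \<open>The degree formulas\<close>

text \<open>The series 1 / (1 - c X).\<close>

definition geo::"'a => 'a::comm_ring_1 fps" where "geo c = Abs_fps (%n. c^n)"

lemma geo_nth: "fps_nth (geo c) n = c^n" by (simp add: geo_def)

lemma geo_rec: "geo c*F = F + fps_const c*(fps_X*(geo c*F))"
proof -
 have "geo c = 1 + fps_const c*(fps_X*geo c)"
 proof (rule fps_ext)
  show "fps_nth (geo c) n = fps_nth (1 + fps_const c*(fps_X*geo c)) n" for n by (cases n) (simp_all add: geo_nth)
 qed
 from arg_cong[OF this, of "%G. G*F"] have "geo c*F = (1 + fps_const c*(fps_X*geo c))*F" .
 thus ?thesis by (simp only: distrib_right mult_1_left mult.assoc)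
qed

lemma geo_shift_nth: "fps_nth (fps_X*(geo c*F)) (Suc n) = c*fps_nth (fps_X*(geo c*F)) n + fps_nth F n" by (simp, subst geo_rec) (simp add: geo_nth)

text \<open>The shifted complete symmetric polynomials: the coefficient of \<open>X ^ n\<close> is
 \<open>h\<^bsub>n + 1 - card I\<^esub>\<close>.\<close>

definition csym::"('i => 'a::comm_ring_1) => 'i set => 'a fps" where "csym x I = fps_X^(card I-1)*(PROD i:I. geo (x i))"

lemma csym_insert:
 assumes "finite I" "I ~= {}" "i ~: I"
 shows "csym x (insert i I) = fps_X*(geo (x i)*csym x I)"
proof -
 obtain c where "card I = Suc c" using assms by (metis card_eq_0_iff not0_implies_Suc)
 thus ?thesis using assms by (simp add: csym_def mult_ac)
qed

lemma csym_nth_Suc: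
 assumes "finite I" "I ~= {}" "i ~: I"
 shows "fps_nth (csym x (insert i I)) (Suc n) = x i*fps_nth (csym x (insert i I)) n + fps_nth (csym x I) n" unfolding csym_insert[OF assms] by (rule geo_shift_nth)

lemma csym_nth_0: "finite I ==> I ~= {} ==> i ~: I ==> fps_nth (csym x (insert i I)) 0 = 0" unfolding csym_insert by simp
lemma csym_shift: "card I <= k ==> 0 < card I ==> fps_nth (csym x I) (k-1) = fps_nth (PROD i:I. geo (x i)) (k - card I)" by (simp add: csym_def fps_X_power_mult_nth)

text \<open>The left side is the divided difference of x^n. Both sides satisfy the same recursion in
  \<open>n\<close>, with a point \<open>j\<close> removed. At n = 0, comparing the removal of two
  different points shows that the sum is 0 as soon as \<open>I\<close> has two elements.\<close>

lemma divided_difference: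
 fixes x::"'i => 'a::field"
 assumes "finite I" "I ~= {}" "inj_on x I"
 shows "(SUM i:I. x i^n / (PROD l:I - {i}. x i - x l)) = fps_nth (csym x I) n" using assms
proof (induction "card I" arbitrary: I n rule: less_induct)
 case less
 let ?A = "%I n. SUM i:I. x i^n / (PROD l:I - {i}. x i - x l)"
 have step: "?A I (Suc n) = x j*?A I n + ?A (I - {j}) n" if j: "j : I" for j n
 proof -
  have "?A I (Suc n) - x j*?A I n = (SUM i:I. x i^n*(x i - x j) / (PROD l:I - {i}. x i - x l))"
   unfolding sum_distrib_left sum_subtractf[symmetric] by (intro sum.cong) (auto simp: algebra_simps diff_divide_distrib)
  also have "... = (SUM i:I - {j}. x i^n*(x i - x j) / (PROD l:I - {i}. x i - x l))" using less.prems j by (subst sum.remove[of _ j]) auto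
  also have "... = ?A (I - {j}) n"
  proof (rule sum.cong[OF refl])
   fix i assume i: "i : I - {j}"
   have ij: "x i - x j ~= 0" using i j less.prems(3) by (auto dest: inj_onD)
   have "(PROD l:I - {i}. x i - x l) = (x i - x j)*(PROD l:I - {i}-{j}. x i - x l)" using less.prems(1) i j by (intro prod.remove) auto
   also have "I - {i}-{j} = I - {j}-{i}" by auto
   finally show "x i^n*(x i - x j) / (PROD l:I - {i}. x i - x l) = x i^n / (PROD l:I - {j}-{i}. x i - x l)" using ij by simp
  qed
  finally show ?thesis by (simp add: algebra_simps)
 qed
 obtain j where j: "j : I" using less.prems(2) by blast
 show ?case
 proof (cases "I = {j}")
  case True
  thus ?thesis by (simp add: csym_def geo_nth)
 next
  case False
  then obtain j' where j': "j' : I" "j' ~= j" using j by blast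
  have IH: "?A (I - {l}) n = fps_nth (csym x (I - {l})) n" if "l : I" "l' : I" "l ~= l'" for l l' n
   using less.prems that by (intro less.hyps card_Diff1_less) (auto intro: inj_on_diff)
  have nz: "I - {j} ~= {}" "I - {j'} ~= {}" using j j' by auto
  have I: "insert j (I - {j}) = I" using j by auto
  have "card (I - {j}) = card (I - {j'})" using j j' less.prems(1) by simp
  moreover have "fps_nth (PROD i:J. geo (x i)) 0 = 1" if "finite J" for J using that by (induction J rule: finite_induct) (simp_all add: geo_nth)
  ultimately have "?A (I - {j}) 0 = ?A (I - {j'}) 0" using IH[OF j j'(1) j'(2)[symmetric], of 0] IH[OF j'(1) j j'(2), of 0] less.prems(1) by (simp add: csym_def)
  hence "(x j - x j')*?A I 0 = 0" using step[OF j, of 0] step[OF j'(1), of 0] by (simp add: left_diff_distrib)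
  hence A0: "?A I 0 = 0" using j j' less.prems(3) by (auto dest: inj_onD)
  show ?thesis
  proof (induction n)
   case 0
   show ?case using A0 csym_nth_0[of "I - {j}" j x] nz less.prems(1) unfolding I by simp
  next
   case (Suc n)
   show ?case using step[OF j, of n] Suc IH[OF j j'(1) j'(2)[symmetric], of n] csym_nth_Suc[of "I - {j}" j x n] nz less.prems(1) unfolding I by simp
  qed
 qed
qed

text \<open>For one factor, geo^2 = geo + X geo', and the product follows by the Leibniz rule. In
  terms of coefficients this is the identity between the sum of the p_j N_j and k V.\<close>

lemma sum_geo_mult:
 assumes "finite I"
 shows "(SUM j:I. geo (x j)*(PROD i:I. geo (x i))) = of_nat (card I)*(PROD i:I. geo (x i)) + fps_X*fps_deriv (PROD i:I. geo (x i))" using assms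
proof (induction I rule: finite_induct)
 case (insert j I)
 let ?G = "PROD i:I. geo (x i)" and ?g = "geo (x j)"
 have g2: "?g*?g = ?g + fps_X*fps_deriv ?g"
 proof (rule fps_ext)
  fix n
  have "fps_nth (?g*?g) n = (SUM i=0..n. x j^n)" unfolding fps_mult_nth geo_nth by (intro sum.cong) (simp_all add: power_add[symmetric])
  thus "fps_nth (?g*?g) n = fps_nth (?g + fps_X*fps_deriv ?g) n" by (cases n) (simp_all add: geo_nth algebra_simps)
 qed
 have "(SUM l:insert j I. geo (x l)*(PROD i:insert j I. geo (x i))) = ?g*?g*?G + ?g*(SUM l:I. geo (x l)*?G)"
  using insert.hyps by (simp add: sum_distrib_left mult_ac)
 also have "... = of_nat (card (insert j I))*(PROD i:insert j I. geo (x i)) + fps_X*fps_deriv (PROD i:insert j I. geo (x i))"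
  unfolding g2 insert.IH using insert.hyps by (simp add: algebra_simps)
 finally show ?case .
qed simp

lemma sum_geo_mult_nth: "finite I ==> (SUM j:I. fps_nth (geo (x j)*(PROD i:I. geo (x i))) m) = of_nat (card I + m)*fps_nth (PROD i:I. geo (x i)) m"
 unfolding fps_sum_nth[symmetric] sum_geo_mult by (cases m) (simp_all add: algebra_simps fps_of_nat[symmetric])

text \<open>Divided by the product of the degrees in places 2 and up, the recursion of
  \<open>codim_bound\<close> becomes that of \<open>csym\<close>. The pencil is the case of two
  equal variables: k + 1 equal terms in the coefficient of degree k.\<close>

lemma codim_bound_eq:
 assumes "q 0 = q 1" "!!i. 0 < q i"
 shows "(of_nat (codim_bound 2 q k (Suc (Suc n)))::rat) = (PROD i:{2..<Suc (Suc n)}. of_nat (q i))*fps_nth (csym (%i. of_nat (q i)-1) {..<Suc (Suc n)}) k"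
proof (induction k arbitrary: n)
 case 0
 have I: "{..<Suc (Suc n)} = insert (Suc n) {..<Suc n}" by auto
 have Z: "fps_nth (csym (%i. of_nat (q i)-1::rat) {..<Suc (Suc n)}) 0 = 0" unfolding I by (rule csym_nth_0) auto
 show ?case unfolding Z by simp
next
 case (Suc k)
 have qs: "of_nat (q i - Suc 0) = (of_nat (q i)-1::rat)" for i using assms(2)[of i] by (simp add: of_nat_diff Suc_leI)
 have I: "{..<Suc (Suc n)} = insert (Suc n) {..<Suc n}" for n by auto
 show ?case
 proof (cases n)
  case 0
  have "{..<Suc (Suc 0)} = {0,1::nat}" by auto
  hence "fps_nth (csym (%i. of_nat (q i)-1::rat) {..<Suc (Suc 0)}) (Suc k) = fps_nth (geo (of_nat (q 1)-1)*geo (of_nat (q 1)-1)) k"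
   by (simp add: csym_def assms(1))
  also have "... = (SUM i=0..k. (of_nat (q 1)-1)^k)" unfolding fps_mult_nth geo_nth by (intro sum.cong) (simp_all add: power_add[symmetric])
  finally show ?thesis using 0 assms(1) qs[of 1] by (simp add: distrib_right)
 next
  case (Suc n')
  have P: "(PROD i:{2..<Suc (Suc (Suc n'))}. of_nat (q i)::rat) = (PROD i:{2..<Suc (Suc n')}. of_nat (q i))*of_nat (q (Suc (Suc n')))"
   by (simp add: prod.atLeastLessThan_Suc)
  have A: "(of_nat (codim_bound 2 q (Suc k) (Suc (Suc (Suc n'))))::rat) =
    (of_nat (q (Suc (Suc n')))-1)*of_nat (codim_bound 2 q k (Suc (Suc (Suc n')))) + of_nat (q (Suc (Suc n')))*of_nat (codim_bound 2 q k (Suc (Suc n')))"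
   by (simp add: qs)
  have R: "fps_nth (csym (%i. of_nat (q i)-1::rat) {..<Suc (Suc (Suc n'))}) (Suc k) =
    (of_nat (q (Suc (Suc n')))-1)*fps_nth (csym (%i. of_nat (q i)-1) {..<Suc (Suc (Suc n'))}) k + fps_nth (csym (%i. of_nat (q i)-1) {..<Suc (Suc n')}) k"
   unfolding I[of "Suc n'"] by (rule csym_nth_Suc) auto
  show ?thesis unfolding Suc A Suc.IH R P by (simp add: algebra_simps del: lessThan_Suc prod.op_ivl_Suc)
 qed
qed

text \<open>The same recursion of \<open>csym\<close>, with critical points of the new polynomial
  contributing the factor \<open>p s - 1\<close> and its roots the factor
  \<open>p s\<close>.\<close>

lemma crit_count_eq:
 assumes "!!i. 0 < p i"
 shows "(of_nat (crit_count p n s)::rat) = (PROD i:{1..s}. of_nat (p i))*fps_nth (csym (%i. of_nat (p i)-1) {..s}) n"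
proof (induction n arbitrary: s)
 case 0
 show ?case
 proof (cases s)
  case (Suc s')
  thus ?thesis using csym_nth_0[of "{..s'}" "Suc s'" "%i. of_nat (p i)-1::rat"] by (simp add: atMost_Suc)
 qed (simp add: csym_def geo_nth)
next
 case (Suc n)
 have ps: "of_nat (p i - Suc 0) = (of_nat (p i)-1::rat)" for i using assms[of i] by (simp add: of_nat_diff Suc_leI)
 show ?case
 proof (cases s)
  case 0
  thus ?thesis by (simp add: Suc.IH ps csym_def geo_nth)
 next
  case (Suc s')
  have A: "(of_nat (crit_count p (Suc n) (Suc s'))::rat) =
    (of_nat (p (Suc s'))-1)*of_nat (crit_count p n (Suc s')) + of_nat (p (Suc s'))*of_nat (crit_count p n s')" by (simp add: ps)
  moreover have R: "fps_nth (csym (%i. of_nat (p i)-1::rat) {..Suc s'}) (Suc n) =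
    (of_nat (p (Suc s'))-1)*fps_nth (csym (%i. of_nat (p i)-1) {..Suc s'}) n + fps_nth (csym (%i. of_nat (p i)-1) {..s'}) n"
   unfolding atMost_Suc by (rule csym_nth_Suc) auto
  ultimately show ?thesis unfolding Suc A Suc.IH R by (simp add: algebra_simps del: atMost_Suc)
 qed
qed

text \<open>The polynomial behind the formula: the other degrees times the complete symmetric
  polynomial of degree k - r in the numbers q_i - 1, with q_j - 1 taken twice.\<close>

definition form_degree::"nat => nat => nat => (nat => rat) => rat" where
 "form_degree k r j q = (PROD i:{..<r}-{j}. q i)*fps_nth (geo (q j-1)*(PROD i<r. geo (q i-1))) (k-r)"

definition var_degree::"nat => nat => (nat => rat) => rat" where "var_degree k r q = (PROD i<r. q i)*fps_nth (PROD i<r. geo (q i-1)) (k-r)"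

lemma sum_form_degree:
 assumes "r <= k"
 shows "(SUM j<r. q j*form_degree k r j q) = of_nat k*var_degree k r q"
proof -
 have "(SUM j<r. q j*form_degree k r j q) = (PROD i<r. q i)*(SUM j<r. fps_nth (geo (q j-1)*(PROD i<r. geo (q i-1))) (k-r))"
  unfolding sum_distrib_left by (intro sum.cong refl) (simp add: form_degree_def prod.remove[of "{..<r}"])
 thus ?thesis using sum_geo_mult_nth[of "{..<r}" "%i. q i-1" "k-r"] assms by (simp add: var_degree_def)
qed

section \<open>The rational formulas as polynomials\<close>

lemma pfun_fps_mult:
 assumes "!!m. pfun V (%s. fps_nth (F s) m)" "!!m. pfun V (%s. fps_nth (G s) m)"
 shows "pfun V (%s. fps_nth (F s*G s) m)" unfolding fps_mult_nth by (intro pfunI assms)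

lemma pfun_geo: "i : V ==> pfun V (%s. fps_nth (geo (s i-1)) m)" unfolding geo_nth by (intro pfunI)

lemma pfun_prod_geo: "finite I ==> I <= V ==> pfun V (%s. fps_nth (PROD i:I. geo (s i-1)) m)"
proof (induction I arbitrary: m rule: finite_induct)
 case empty
 show ?case by (simp add: fps_one_nth pfunI)
next
 case (insert i I)
 thus ?case by (simp add: pfun_fps_mult pfun_geo)
qed

lemma polynomial_valueI:
 assumes "pfun {..<r} f" "!!s. inj_on s {..<r} ==> (!!j. j < r ==> s j ~= 0) ==> f s = R s" "f q = v"
 shows "polynomial_value r R q v"
proof -
 obtain E where "mv_in {..<r} E" "ALL a. mv_eval a E = f a" using pfun_imp_mvpoly[OF assms(1)] by blast
 thus ?thesis unfolding polynomial_value_def using assms(2,3) by (intro exI[of _ E]) auto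
qed

lemma weights_prod: "(PROD l:{..<r}-{i}. (q i-1)-(q l-1)) = (PROD l:{..<r}-{i}. q i - q l::rat)" by (intro prod.cong) auto

lemma variable_degree_formula_eq:
 assumes "0 < r" "r <= k" "inj_on q {..<r}"
 shows "variable_degree_formula k r q = var_degree k r q"
proof -
 have "(SUM j<r. (q j-1)^(k-1) / (PROD l:{..<r}-{j}. q j - q l)) = fps_nth (csym (%i. q i-1) {..<r}) (k-1)"
  unfolding weights_prod[symmetric] using assms by (intro divided_difference) (auto simp: inj_on_def)
 thus ?thesis using csym_shift[of "{..<r}" k "%i. q i-1"] assms by (simp add: variable_degree_formula_def var_degree_def)
qed

text \<open>The difference quotient of the powers is a sum of mixed powers of x_j and x_i, with the
  stated convention covering \<open>i = j\<close>. Summed over i it becomes a convolution of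
  \<open>csym\<close> with powers of x_j, that is, a product with \<open>geo\<close>.\<close>

lemma form_degree_formula_eq:
 assumes "r <= k" "inj_on q {..<r}" and j: "j < r" "q j ~= 0"
 shows "form_degree_formula k r j q = form_degree k r j q"
proof -
 let ?x = "%i. q i-1"
 let ?w = "%i. 1 / (PROD l:{..<r}-{i}. q i - q l)"
 have S: "(if i = j then of_nat k*?x j^(k-1) else (?x j^k - ?x i^k) / (q j - q i)) = (SUM a<k. ?x j^(k - Suc a)*?x i^a)" if i: "i < r" for i
 proof (cases "i = j")
  case True
  have "(SUM a<k. ?x j^(k - Suc a)*?x j^a) = (SUM a<k. ?x j^(k-1))" by (intro sum.cong refl) (simp add: power_add[symmetric])
  thus ?thesis using True by simp
 next
  case False
  hence "q j - q i ~= 0" using assms(2) i j by (auto dest: inj_onD)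
  thus ?thesis using False power_diff_sumr2[of "?x i" k "?x j"] by (simp add: divide_eq_eq) (simp add: algebra_simps)
 qed
 have "(SUM i<r. (if i = j then of_nat k*?x j^(k-1) else (?x j^k - ?x i^k) / (q j - q i))*?w i) =
   (SUM a<k. ?x j^(k - Suc a)*(SUM i<r. ?x i^a / (PROD l:{..<r}-{i}. ?x i - ?x l)))"
  unfolding weights_prod sum_distrib_left by (subst sum.swap) (simp add: S sum_divide_distrib)
 also have "... = (SUM a<k. ?x j^(k - Suc a)*fps_nth (csym ?x {..<r}) a)"
 proof -
  have "(SUM i<r. ?x i^a / (PROD l:{..<r}-{i}. ?x i - ?x l)) = fps_nth (csym ?x {..<r}) a" for a using assms by (intro divided_difference) (auto simp: inj_on_def)
  thus ?thesis by simp
 qed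
 also have "... = fps_nth (csym ?x {..<r}*geo (?x j)) (k-1)" unfolding fps_mult_nth geo_nth using assms(1) j by (intro sum.cong) (auto simp: mult.commute)
 also have "... = fps_nth (fps_X^(r-1)*(geo (?x j)*(PROD i<r. geo (?x i)))) (k-1)" by (simp add: csym_def mult_ac)
 also have "... = fps_nth (geo (?x j)*(PROD i<r. geo (?x i))) (k-r)" using assms(1) j by (simp add: fps_X_power_mult_nth)
 finally have "form_degree_formula k r j q = (PROD i<r. q i) / q j*fps_nth (geo (?x j)*(PROD i<r. geo (?x i))) (k-r)" unfolding form_degree_formula_def by simp
 also have "(PROD i<r. q i) / q j = (PROD i:{..<r}-{j}. q i)" using j by (subst prod.remove[of _ j]) auto
 finally show ?thesis by (simp add: form_degree_def)
qed

context discriminant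
begin

abbreviation (input) "pr == %i. of_nat (p i)::rat"

lemma degvar_ge_value: "var_degree k r pr <= of_nat degvar"
proof -
 define q where "q = (%i. if i < r then p i else 1)"
 have I: "{..r-1} = {..<r}" "{..<r} = insert 0 {1..r-1}" using r by auto
 have "of_nat (p 0)*of_nat (crit_count q (k-1) (r-1)) = (of_nat (q 0)*(PROD i:{1..r-1}. of_nat (q i)))*fps_nth (csym (%i. of_nat (q i)-1::rat) {..<r}) (k-1)"
 proof -
  have "0 < q i" for i using p by (simp add: q_def)
  from crit_count_eq[of q "k-1" "r-1", OF this] show ?thesis using r unfolding I(1) by (simp add: q_def)
 qed
 also have "of_nat (q 0)*(PROD i:{1..r-1}. of_nat (q i)) = (PROD i<r. of_nat (q i)::rat)" unfolding I(2) by (subst prod.insert) auto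
 also have "fps_nth (csym (%i. of_nat (q i)-1::rat) {..<r}) (k-1) = fps_nth (PROD i<r. geo (of_nat (q i)-1)) (k-r)"
  using csym_shift[of "{..<r}" k "%i. of_nat (q i)-1::rat"] r by simp
 also have "(PROD i<r. of_nat (q i))*fps_nth (PROD i<r. geo (of_nat (q i)-1)) (k-r) = var_degree k r pr" by (simp add: var_degree_def q_def)
 finally have "of_nat (p 0*crit_count q (k-1) (r-1)) = var_degree k r pr" by simp
 moreover have "of_nat (p 0*crit_count q (k-1) (r-1)) <= (of_nat degvar::rat)" using degvar_ge unfolding q_def of_nat_le_iff .
 ultimately show ?thesis by simp
qed

lemma deg_le_value:
 assumes j: "j < r"
 shows "of_nat (deg j) <= form_degree k r j pr"
proof -
 \<comment> \<open>The transposition used in \<open>deg_le_codim_bound\<close>. In \<open>q\<close>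
   the degree \<open>p j\<close> stands at 0 and 1, once for each member of the pencil, and values
   beyond \<open>r\<close> get the positive default 1.\<close>
 define ta where "ta = (%i. if i = 0 then j else if i = j then 0 else i)"
 define q where "q = (%i. if i <= r then p (ta (i-1)) else 1)"
 have ta: "bij_betw ta {..<r} {..<r}" "bij_betw ta {1..<r} ({..<r}-{j})"
  by (rule bij_betw_byWitness[where f' = ta]; use j r in "auto simp: ta_def split: if_splits")
   (rule bij_betw_byWitness[where f' = ta]; use j r in "auto simp: ta_def split: if_splits")
 have cong: "codim_bound 2 f k n = codim_bound 2 g k n" if "!!i. i < n ==> f i = g i" "0 < n" for f g k n using that
 proof (induction k arbitrary: n)
  case (Suc k)
  thus ?case using Suc.IH[of n] Suc.IH[of "n-1"] by simp
 qed simp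
 have "codim_bound 2 (%i. p (if i-1 = 0 then j else if i-1 = j then 0 else i-1)) k (Suc r) = codim_bound 2 q k (Suc r)" by (rule cong) (auto simp: q_def ta_def)
 hence "deg j <= codim_bound 2 q k (Suc r)" using deg_le_codim_bound[OF j] by simp
 hence "of_nat (deg j) <= (of_nat (codim_bound 2 q k (Suc r))::rat)" by simp
 also have "of_nat (codim_bound 2 q k (Suc r)) = (PROD i:{2..<Suc r}. of_nat (q i))*fps_nth (csym (%i. of_nat (q i)-1::rat) {..<Suc r}) k"
 proof -
  obtain n where n: "r = Suc n" using r by (cases r) auto
  have "q 0 = q 1" "!!i. 0 < q i" using r j p by (auto simp: q_def ta_def)
  thus ?thesis unfolding n by (rule codim_bound_eq)
 qed
 also have "(PROD i:{2..<Suc r}. of_nat (q i)) = (PROD i:{1..<r}. of_nat (p (ta i))::rat)"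
  using prod.shift_bounds_Suc_ivl[of "%i. of_nat (q i)::rat" 1 r] by (auto simp: q_def numeral_2_eq_2 intro!: prod.cong)
 also have "... = (PROD i:{..<r}-{j}. pr i)" by (rule prod.reindex_bij_betw[OF ta(2)])
 also have "csym (%i. of_nat (q i)-1::rat) {..<Suc r} = fps_X^r*(geo (pr j-1)*(PROD i<r. geo (pr (ta i)-1)))"
  unfolding csym_def by (subst prod.lessThan_Suc_shift) (auto simp: q_def ta_def intro!: prod.cong)
 also have "(PROD i<r. geo (pr (ta i)-1)) = (PROD i<r. geo (pr i-1))" by (rule prod.reindex_bij_betw[OF ta(1)])
 finally show ?thesis using r by (simp add: form_degree_def fps_X_power_mult_nth)
qed

lemma degvar_eq: "of_nat degvar = var_degree k r pr"
 and deg_eq: "j < r ==> of_nat (deg j) = form_degree k r j pr"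
proof -
 have le: "pr j*of_nat (deg j) <= pr j*form_degree k r j pr" if "j : {..<r}" for j using deg_le_value[of j] that by (simp add: mult_left_mono)
 have "(SUM j<r. pr j*of_nat (deg j)) = of_nat (SUM j<r. p j*deg j)" by simp
 hence eq: "(SUM j<r. pr j*of_nat (deg j)) = of_nat k*of_nat degvar" unfolding weighted_sum_deg by simp
 have sum: "(SUM j<r. pr j*form_degree k r j pr) = of_nat k*var_degree k r pr" using r by (simp add: sum_form_degree)
 have "of_nat k*(of_nat degvar::rat) <= of_nat k*var_degree k r pr" unfolding eq[symmetric] sum[symmetric] by (rule sum_mono[OF le])
 hence "of_nat degvar <= var_degree k r pr" using r by simp
 thus v: "of_nat degvar = var_degree k r pr" using degvar_ge_value by simp
 show "of_nat (deg j) = form_degree k r j pr" if j: "j < r"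
 proof (rule ccontr)
  assume "of_nat (deg j) ~= form_degree k r j pr"
  hence "pr j*of_nat (deg j) < pr j*form_degree k r j pr" using deg_le_value[OF j] p[OF j] by simp
  hence "(SUM j<r. pr j*of_nat (deg j)) < (SUM j<r. pr j*form_degree k r j pr)" using j le by (intro sum_strict_mono_ex1) auto
  thus False unfolding eq sum v by simp
 qed
qed

end

theorem theorem3p2:
  fixes k r degvar :: nat
    and p deg :: "nat \<Rightarrow> nat"
    and D :: "(nat \<times> nat list, 'a::{alg_closed_field, field_char_0}) mvpoly"
  assumes "0 < r" and "r < k"
    and "\<forall>j<r. 0 < p j"
    and "is_discriminant k r p D"
    and "has_form_degrees r D deg"
    and "has_variable_degree k D degvar"
  shows "(\<forall>j<r. polynomial_value r (form_degree_formula k r j) (\<lambda>i. of_nat (p i)) (of_nat (deg j)))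
    \<and> of_nat degvar = 1 / of_nat k * (\<Sum>j<r. of_nat (p j) * of_nat (deg j) :: rat)
    \<and> polynomial_value r (variable_degree_formula k r) (\<lambda>i. of_nat (p i)) (of_nat degvar)"
proof -
 interpret discriminant k r degvar p deg D using assms by unfold_locales auto
 have "polynomial_value r (form_degree_formula k r j) (%i. of_nat (p i)) (of_nat (deg j))" if j: "j < r" for j
 proof (rule polynomial_valueI)
  show "pfun {..<r} (form_degree k r j)" unfolding form_degree_def[abs_def] using j by (intro pfunI pfun_fps_mult pfun_geo pfun_prod_geo) auto
  show "form_degree k r j s = form_degree_formula k r j s" if "inj_on s {..<r}" "!!i. i < r ==> s i ~= 0" for s using form_degree_formula_eq[of r k s j] that j r by simp
  show "form_degree k r j (%i. of_nat (p i)) = of_nat (deg j)" by (rule deg_eq[OF j, symmetric])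
 qed
 moreover have "of_nat k*of_nat degvar = (SUM j<r. of_nat (p j)*of_nat (deg j)::rat)" using arg_cong[OF weighted_sum_deg, of "of_nat::nat => rat"] by simp
 hence "of_nat degvar = 1 / of_nat k*(SUM j<r. of_nat (p j)*of_nat (deg j)::rat)" using r by (simp add: field_simps)
 moreover have "polynomial_value r (variable_degree_formula k r) (%i. of_nat (p i)) (of_nat degvar)"
 proof (rule polynomial_valueI)
  show "pfun {..<r} (var_degree k r)" unfolding var_degree_def[abs_def] by (intro pfunI pfun_prod_geo) auto
  show "var_degree k r s = variable_degree_formula k r s" if "inj_on s {..<r}" for s using variable_degree_formula_eq[of r k s] that r by simp
  show "var_degree k r (%i. of_nat (p i)) = of_nat degvar" by (rule degvar_eq[symmetric])
 qed
 ultimately show ?thesis by blast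
qed

end
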